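(* Let $n\ge3$, let $A=k\langle a_1,\ldots,a_n\rangle$ be the free associative algebra on $n$ odd variables of weight one, let $\omega=\sum_{i,j}c_{ij}a_ia_j$ with $c_{ij}=c_{ji}\in k$ be a generic symmetric quadratic form, and let $B=A/(\omega)$ be the quotient by the two-sided ideal generated by $\omega$. Then, as identities of series in $z,y$, $$\overline{\mathrm{HC}}_0(B)=z^2+\mathrm{hcfree}(nzy-z^2),\qquad \overline{\mathrm{HC}}_1(B)=yz^2,\qquad \overline{\mathrm{HC}}_m(B)=0\ \text{ for } m>1.$$ Here "generic" means: the assertion holds whenever the $\binom{n+1}{2}$ coefficients $c_{ij}$, $i\le j$, are algebraically independent over $\mathbb Q$, and it also holds for all $(c_{ij})_{i\le j}$ in some non-empty Zariski-open subset of $k^{\binom{n+1}{2}}$.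
   Context: $k$ is a field of characteristic zero. Algebras are $\mathbb N\times\mathbb Z_2$-graded connected $k$-algebras $A=k\oplus I$, $I=\bigoplus_{q\ge1,\epsilon\in\mathbb Z_2}I_{q,\epsilon}$ with finite-dimensional components; $q$ is the weight and $\epsilon$ (written $|a|$) the sign degree; odd means sign degree $1$. The series of a bigraded space $W$ is $W(z,y)=\sum_{q,\epsilon}\dim_k(W_{q,\epsilon})z^qy^\epsilon\in\mathbb Z[[z]][y]/(y^2-1)$; the same notation is used for a space and its series. Reduced cyclic homology: on $I^{\otimes (n+1)}$ put $t(a_0,\ldots,a_n)=(-1)^{\eta}(a_n,a_0,\ldots,a_{n-1})$, $\eta=(|a_n|+1)\sum_{r=0}^{n-1}(|a_r|+1)$, and $b(a_0,\ldots,a_n)=\sum_{i=0}^{n-1}(-1)^{\epsilon(i)}(a_0,\ldots,a_ia_{i+1},\ldots,a_n)+(-1)^{\epsilon}(a_na_0,a_1,\ldots,a_{n-1})$, where $\epsilon(i)=i+\sum_{r=0}^i|a_r|$ and $\epsilon=|a_n|+(|a_n|+1)\sum_{r=0}^{n-1}(|a_r|+1)$. Then $\overline{\mathrm{HC}}_n(A)$, $n\ge0$, is the homology in degree $n$ of the complex with $I^{\otimes(n+1)}/\mathrm{im}(1-t)$ in degree $n$ and differential induced by $b$. The class of $(a_0,\ldots,a_n)$ has weight the sum of the weights of the $a_i$ and sign degree $n+\sum_i|a_i|$. For a series $X\in\mathbb Z[[z]][y]/(y^2-1)$ without constant term, $\mathrm{hcfree}(X)=-\sum_{m\ge1}\frac{\phi(m)}{m}\log(1-X(z^m,(-1)^{m+1}y^m))$,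 where $\phi$ is Euler's function and $\log(Y)=-\sum_{j\ge1}(1-Y)^j/j$. *)

theory Defs
  imports
    "HOL-Algebra.QuotRing"
    "HOL-Algebra.Module"
    "HOL-Computational_Algebra.Formal_Power_Series"
    "HOL-Library.FuncSet"
    "HOL-Library.Poly_Mapping"
    "HOL-Library.Z2"
    "HOL-Number_Theory.Totient"
begin

section \<open>Free vector spaces\<close>

text \<open>\<open>'x \<Rightarrow>\<^sub>0 'k\<close> is the vector space with basis \<open>'x\<close>; the basis vector of \<open>x\<close> is
  \<open>Poly_Mapping.single x 1\<close>.\<close>

definition pscale :: "'k::field \<Rightarrow> ('x \<Rightarrow>\<^sub>0 'k) \<Rightarrow> ('x \<Rightarrow>\<^sub>0 'k)"
  where "pscale c p = Poly_Mapping.map ((*) c) p"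

lemma lookup_pscale [simp]: "Poly_Mapping.lookup (pscale c p) x = c * Poly_Mapping.lookup p x"
  by (simp add: pscale_def Poly_Mapping.map.rep_eq when_def)

global_interpretation pm: vector_space "pscale :: 'k::field \<Rightarrow> ('x \<Rightarrow>\<^sub>0 'k) \<Rightarrow> ('x \<Rightarrow>\<^sub>0 'k)"
  by standard (auto intro!: poly_mapping_eqI simp: lookup_add algebra_simps)

definition lin_ext :: "('x \<Rightarrow> 'y \<Rightarrow>\<^sub>0 'k::field) \<Rightarrow> ('x \<Rightarrow>\<^sub>0 'k) \<Rightarrow> ('y \<Rightarrow>\<^sub>0 'k)"
  where "lin_ext f p = (\<Sum>x\<in>Poly_Mapping.keys p. pscale (Poly_Mapping.lookup p x) (f x))"

text \<open>The image of the subspace \<open>U\<close> in the quotient by the subspace \<open>V\<close> has dimension \<open>d\<close>;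
  \<open>S\<close> represents a basis of \<open>(U + V) / V\<close>.\<close>

definition has_dim_modulo :: "('x \<Rightarrow>\<^sub>0 'k::field) set \<Rightarrow> ('x \<Rightarrow>\<^sub>0 'k) set \<Rightarrow> nat \<Rightarrow> bool"
  where "has_dim_modulo V U d \<longleftrightarrow>
    (\<exists>S. finite S \<and> card S = d \<and> S \<subseteq> U \<and>
      (\<forall>f. (\<Sum>s\<in>S. pscale (f s) s) \<in> V \<longrightarrow> (\<forall>s\<in>S. f s = 0)) \<and>
      U \<subseteq> pm.span (S \<union> V))"


section \<open>Bigraded algebras and reduced cyclic homology\<close>

text \<open>The scalars are a type \<open>'k::field\<close>; \<open>component A q \<epsilon>\<close> is the part of weight \<open>q\<close> and sign
  degree \<open>\<epsilon>\<close>. The augmentation ideal is the sum of the components with \<open>q \<ge> 1\<close>.\<close>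

record ('k, 'a) bigraded_algebra = "('k, 'a) module" +
  component :: "nat \<Rightarrow> bit \<Rightarrow> 'a set"

text \<open>Elementary tensors of homogeneous elements are lists of triples (weight, sign degree,
  element). The degrees are recorded explicitly because the zero element is homogeneous of
  every degree.\<close>

type_synonym 'a tagged = "nat \<times> bit \<times> 'a"

definition wt :: "'a tagged \<Rightarrow> nat" where "wt x = fst x"
definition sdeg :: "'a tagged \<Rightarrow> bit" where "sdeg x = fst (snd x)"

definition tagged_mult :: "('k, 'a) bigraded_algebra \<Rightarrow> 'a tagged \<Rightarrow> 'a tagged \<Rightarrow> 'a tagged"
  where "tagged_mult A x y = (wt x + wt y, sdeg x + sdeg y, snd (snd x) \<otimes>\<^bsub>A\<^esub> snd (snd y))"

definition tensors :: "('k, 'a) bigraded_algebra \<Rightarrow> nat \<Rightarrow> 'a tagged list set"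
  where "tensors A m = {w. length w = m + 1 \<and> (\<forall>(q, \<epsilon>, a)\<in>set w. q \<ge> 1 \<and> a \<in> component A q \<epsilon>)}"

definition chains :: "('k::field, 'a) bigraded_algebra \<Rightarrow> nat \<Rightarrow> ('a tagged list \<Rightarrow>\<^sub>0 'k) set"
  where "chains A m = {x. Poly_Mapping.keys x \<subseteq> tensors A m}"

text \<open>\<open>chains A m\<close> modulo the span of these relations is \<open>I\<^bsup>\<otimes>(m+1)\<^esup>\<close>, the direct sum of the tensor
  products of the homogeneous components of \<open>I\<close>.\<close>

definition multilinear_rels ::
    "('k::field, 'a) bigraded_algebra \<Rightarrow> nat \<Rightarrow> ('a tagged list \<Rightarrow>\<^sub>0 'k) set"
  where "multilinear_rels A m =
    {Poly_Mapping.single (u @ (q, \<epsilon>, a \<oplus>\<^bsub>A\<^esub> a') # v) 1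
       - Poly_Mapping.single (u @ (q, \<epsilon>, a) # v) 1
       - Poly_Mapping.single (u @ (q, \<epsilon>, a') # v) 1 | u q \<epsilon> a a' v.
       u @ (q, \<epsilon>, a) # v \<in> tensors A m \<and> u @ (q, \<epsilon>, a') # v \<in> tensors A m} \<union>
    {Poly_Mapping.single (u @ (q, \<epsilon>, r \<odot>\<^bsub>A\<^esub> a) # v) 1
       - Poly_Mapping.single (u @ (q, \<epsilon>, a) # v) r | u q \<epsilon> r a v.
       u @ (q, \<epsilon>, a) # v \<in> tensors A m}"

definition ksign :: "bit \<Rightarrow> 'k::field"
  where "ksign e = (if e = 0 then 1 else - 1)"

definition cyc_t :: "'a tagged list \<Rightarrow> ('a tagged list \<Rightarrow>\<^sub>0 'k::field)"
  where "cyc_t w = (let n = length w - 1 in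
    Poly_Mapping.single (last w # butlast w)
      (ksign ((sdeg (w ! n) + 1) * (\<Sum>r<n. sdeg (w ! r) + 1))))"

text \<open>Only used for lists of length at least two; the differential on degree \<open>0\<close> is zero.\<close>

definition cyc_b :: "('k::field, 'a) bigraded_algebra \<Rightarrow> 'a tagged list \<Rightarrow> ('a tagged list \<Rightarrow>\<^sub>0 'k)"
  where "cyc_b A w = (let n = length w - 1 in
    (\<Sum>i<n. Poly_Mapping.single
        (take i w @ tagged_mult A (w ! i) (w ! (i + 1)) # drop (i + 2) w)
        (ksign (of_nat i + (\<Sum>r\<le>i. sdeg (w ! r)))))
    + Poly_Mapping.single
        (tagged_mult A (w ! n) (w ! 0) # butlast (tl w))
        (ksign (sdeg (w ! n) + (sdeg (w ! n) + 1) * (\<Sum>r<n. sdeg (w ! r) + 1))))"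

text \<open>\<open>chains A m\<close> modulo \<open>cyc_rels A m\<close> is \<open>I\<^bsup>\<otimes>(m+1)\<^esup> / im (1 - t)\<close>. In this complex,
  \<open>HC_cycles\<close> and \<open>HC_bounds\<close> are the preimages in \<open>chains A m\<close> of the cycles and of the boundaries,
  so that the homology in degree \<open>m\<close> is \<open>HC_cycles A m / HC_bounds A m\<close>.\<close>

definition cyc_rels :: "('k::field, 'a) bigraded_algebra \<Rightarrow> nat \<Rightarrow> ('a tagged list \<Rightarrow>\<^sub>0 'k) set"
  where "cyc_rels A m =
    pm.span (multilinear_rels A m \<union> (\<lambda>x. x - lin_ext cyc_t x) ` chains A m)"

definition HC_cycles :: "('k::field, 'a) bigraded_algebra \<Rightarrow> nat \<Rightarrow> ('a tagged list \<Rightarrow>\<^sub>0 'k) set"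
  where "HC_cycles A m =
    {x \<in> chains A m. m = 0 \<or> lin_ext (cyc_b A) x \<in> cyc_rels A (m - 1)}"

definition HC_bounds :: "('k::field, 'a) bigraded_algebra \<Rightarrow> nat \<Rightarrow> ('a tagged list \<Rightarrow>\<^sub>0 'k) set"
  where "HC_bounds A m =
    pm.span (cyc_rels A m \<union> lin_ext (cyc_b A) ` chains A (m + 1))"

text \<open>In degree \<open>m\<close> the sign degree of a tensor is shifted by \<open>m\<close>.\<close>

definition homogeneous_chain :: "nat \<Rightarrow> nat \<Rightarrow> bit \<Rightarrow> ('a tagged list \<Rightarrow>\<^sub>0 'k::field) \<Rightarrow> bool"
  where "homogeneous_chain m q \<epsilon> x \<longleftrightarrow>
    (\<forall>w\<in>Poly_Mapping.keys x. sum_list (map wt w) = q \<and> of_nat m + sum_list (map sdeg w) = \<epsilon>)"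

definition HC_component_has_dim ::
    "('k::field, 'a) bigraded_algebra \<Rightarrow> nat \<Rightarrow> nat \<Rightarrow> bit \<Rightarrow> nat \<Rightarrow> bool"
  where "HC_component_has_dim A m q \<epsilon> d \<longleftrightarrow>
    has_dim_modulo (HC_bounds A m) {x \<in> HC_cycles A m. homogeneous_chain m q \<epsilon> x} d"


section \<open>Series in two variables\<close>

text \<open>\<open>bit \<Rightarrow>\<^sub>0 rat\<close> is the group algebra of \<open>\<int>/2\<close>, that is \<open>\<rat>[y]/(y\<^sup>2 - 1)\<close>; its power series ring in
  \<open>z = fps_X\<close> is \<open>\<rat>[[z]][y]/(y\<^sup>2 - 1)\<close>. Rational coefficients are needed for the logarithm.\<close>

type_synonym zy_series = "(bit \<Rightarrow>\<^sub>0 rat) fps"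

definition zvar :: zy_series where "zvar = fps_X"
definition yvar :: zy_series where "yvar = fps_const (Poly_Mapping.single 1 1)"
definition rconst :: "rat \<Rightarrow> zy_series" where "rconst r = fps_const (Poly_Mapping.single 0 r)"

text \<open>\<open>HC\<^sub>m(A)\<close> has finite-dimensional components, and \<open>X\<close> is its series.\<close>

definition HC_has_series :: "('k::field, 'a) bigraded_algebra \<Rightarrow> nat \<Rightarrow> zy_series \<Rightarrow> bool"
  where "HC_has_series A m X \<longleftrightarrow>
    (\<forall>q \<epsilon>. \<exists>d. HC_component_has_dim A m q \<epsilon> d \<and>
      Poly_Mapping.lookup (fps_nth X q) \<epsilon> = of_nat d)"

text \<open>\<open>X(z\<^sup>m, (-1)\<^sup>m\<^sup>+\<^sup>1 y\<^sup>m)\<close> for \<open>m \<ge> 1\<close>, where \<open>y\<^sup>m\<close> is the group element \<open>of_nat m\<close> of \<open>\<int>/2\<close>.\<close>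

definition series_subst :: "nat \<Rightarrow> zy_series \<Rightarrow> zy_series"
  where "series_subst m X =
    Abs_fps (\<lambda>q. Poly_Mapping.single 0 (Poly_Mapping.lookup (fps_nth X q) 0)
      + Poly_Mapping.single (of_nat m) ((- 1) ^ (m + 1) * Poly_Mapping.lookup (fps_nth X q) 1))
    oo fps_X ^ m"

text \<open>\<open>log Y = - \<Sum>\<^sub>j\<^sub>\<ge>\<^sub>1 (1 - Y)\<^sup>j / j\<close>, for \<open>Y\<close> with constant term \<open>1\<close>.\<close>

definition series_log :: "zy_series \<Rightarrow> zy_series"
  where "series_log Y =
    - (Abs_fps (\<lambda>j. if j = 0 then 0 else Poly_Mapping.single 0 (1 / of_nat j)) oo (1 - Y))"

text \<open>The \<open>m\<close>-th summand is divisible by \<open>z\<^sup>m\<close>, so only \<open>m \<le> N\<close> contributes to the coefficient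
  of \<open>z\<^sup>N\<close>.\<close>

definition hcfree :: "zy_series \<Rightarrow> zy_series"
  where "hcfree X = - Abs_fps (\<lambda>N. \<Sum>m=1..N.
    fps_nth (rconst (of_nat (totient m) / of_nat m) * series_log (1 - series_subst m X)) N)"


section \<open>The free algebra on odd variables and the quadric quotient\<close>

text \<open>The free monoid, written additively, so that \<open>nc_word \<Rightarrow>\<^sub>0 'k\<close> with the convolution product
  of \<open>Poly_Mapping\<close> is the free associative algebra on the variables \<open>a\<^sub>0, a\<^sub>1, \<dots>\<close>.\<close>

datatype nc_word = NCWord (letters: "nat list")

instantiation nc_word :: monoid_add
begin
definition zero_nc_word :: nc_word where "0 = NCWord []"
definition plus_nc_word :: "nc_word \<Rightarrow> nc_word \<Rightarrow> nc_word"
  where "u + v = NCWord (letters u @ letters v)"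
instance
  by standard (simp_all add: zero_nc_word_def plus_nc_word_def)
end

definition nc_var :: "nat \<Rightarrow> (nc_word \<Rightarrow>\<^sub>0 'k::field)"
  where "nc_var i = Poly_Mapping.single (NCWord [i]) 1"

text \<open>The variables \<open>a\<^sub>i\<close>, \<open>i < n\<close>, are odd of weight one, so a word of length \<open>l\<close> has weight \<open>l\<close>
  and sign degree \<open>l mod 2\<close>.\<close>

definition free_carrier :: "nat \<Rightarrow> (nc_word \<Rightarrow>\<^sub>0 'k::field) set"
  where "free_carrier n = {p. \<forall>w\<in>Poly_Mapping.keys p. set (letters w) \<subseteq> {..<n}}"

definition free_odd_algebra :: "nat \<Rightarrow> ('k::field, nc_word \<Rightarrow>\<^sub>0 'k) bigraded_algebra"
  where "free_odd_algebra n =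
    \<lparr>carrier = free_carrier n, monoid.mult = (*), one = 1, zero = 0, add = (+), smult = pscale,
     component = (\<lambda>q \<epsilon>. {p \<in> free_carrier n. \<forall>w\<in>Poly_Mapping.keys p.
       length (letters w) = q \<and> of_nat (length (letters w)) = \<epsilon>})\<rparr>"

lemma free_carrier_mult:
  assumes "p \<in> free_carrier n" "q \<in> free_carrier n"
  shows "p * q \<in> free_carrier n"
  using assms keys_mult[of p q] by (fastforce simp: free_carrier_def plus_nc_word_def)

lemma free_carrier_add:
  assumes "p \<in> free_carrier n" "q \<in> free_carrier n"
  shows "p + q \<in> free_carrier n"
  using assms Poly_Mapping.keys_add[of p q] by (fastforce simp: free_carrier_def)

lemma ring_free_odd_algebra: "ring (free_odd_algebra n)"
proof (rule ringI)
  show "abelian_group (free_odd_algebra n :: ('k::field, nc_word \<Rightarrow>\<^sub>0 'k) bigraded_algebra)"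
  proof (rule abelian_groupI)
    fix x :: "nc_word \<Rightarrow>\<^sub>0 'k"
    assume "x \<in> carrier (free_odd_algebra n)"
    then have "- x \<in> carrier (free_odd_algebra n)"
      by (simp add: free_odd_algebra_def free_carrier_def)
    then show "\<exists>y\<in>carrier (free_odd_algebra n).
        y \<oplus>\<^bsub>free_odd_algebra n\<^esub> x = \<zero>\<^bsub>free_odd_algebra n\<^esub>"
      by (intro bexI[of _ "- x"]) (simp_all add: free_odd_algebra_def)
  qed (auto simp: free_odd_algebra_def free_carrier_add algebra_simps, simp add: free_carrier_def)
  show "monoid (free_odd_algebra n :: ('k::field, nc_word \<Rightarrow>\<^sub>0 'k) bigraded_algebra)"
    by (rule monoidI) (auto simp: free_odd_algebra_def free_carrier_mult algebra_simps,
        simp add: free_carrier_def zero_nc_word_def)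
qed (auto simp: free_odd_algebra_def algebra_simps)

text \<open>Quotient of a bigraded algebra by a two-sided ideal \<open>J\<close>, with the induced structure; it is
  meaningful when \<open>J\<close> is generated by homogeneous elements.\<close>

definition quotient_algebra ::
    "('k, 'a) bigraded_algebra \<Rightarrow> 'a set \<Rightarrow> ('k, 'a set) bigraded_algebra"
  where "quotient_algebra A J =
    \<lparr>carrier = carrier (A Quot J), monoid.mult = monoid.mult (A Quot J), one = one (A Quot J),
     zero = zero (A Quot J), add = add (A Quot J),
     smult = (\<lambda>r X. \<Union>x\<in>X. J +>\<^bsub>A\<^esub> (r \<odot>\<^bsub>A\<^esub> x)),
     component = (\<lambda>q \<epsilon>. (\<lambda>x. J +>\<^bsub>A\<^esub> x) ` component A q \<epsilon>)\<rparr>"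

text \<open>The free coefficients are \<open>c\<^sub>i\<^sub>j\<close> with \<open>i \<le> j\<close>, and \<open>c\<^sub>j\<^sub>i = c\<^sub>i\<^sub>j\<close>.\<close>

definition coeff_index :: "nat \<Rightarrow> (nat \<times> nat) set"
  where "coeff_index n = {(i, j). i \<le> j \<and> j < n}"

definition sym_form :: "nat \<Rightarrow> (nat \<times> nat \<Rightarrow> 'k::field) \<Rightarrow> (nc_word \<Rightarrow>\<^sub>0 'k)"
  where "sym_form n c =
    (\<Sum>i<n. \<Sum>j<n. pscale (c (min i j, max i j)) (nc_var i * nc_var j))"

definition quadric_algebra ::
    "nat \<Rightarrow> (nat \<times> nat \<Rightarrow> 'k::field) \<Rightarrow> ('k, (nc_word \<Rightarrow>\<^sub>0 'k) set) bigraded_algebra"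
  where "quadric_algebra n c =
    quotient_algebra (free_odd_algebra n) (genideal (free_odd_algebra n) {sym_form n c})"


section \<open>Generic coefficients\<close>

definition polys_in :: "'v set \<Rightarrow> (('v \<Rightarrow>\<^sub>0 nat) \<Rightarrow>\<^sub>0 'r::zero) set"
  where "polys_in V = {P. \<forall>u\<in>Poly_Mapping.keys P. Poly_Mapping.keys u \<subseteq> V}"

definition poly_eval ::
    "('r::zero \<Rightarrow> 'k::comm_ring_1) \<Rightarrow> ('v \<Rightarrow> 'k) \<Rightarrow> (('v \<Rightarrow>\<^sub>0 nat) \<Rightarrow>\<^sub>0 'r) \<Rightarrow> 'k"
  where "poly_eval h c P = (\<Sum>u\<in>Poly_Mapping.keys P. h (Poly_Mapping.lookup P u) *
    (\<Prod>v\<in>Poly_Mapping.keys u. c v ^ Poly_Mapping.lookup u v))"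

definition affine_space :: "'v set \<Rightarrow> ('v \<Rightarrow> 'k) set"
  where "affine_space V = V \<rightarrow>\<^sub>E UNIV"

definition alg_indep_over_rat :: "'v set \<Rightarrow> ('v \<Rightarrow> 'k::field_char_0) \<Rightarrow> bool"
  where "alg_indep_over_rat V c \<longleftrightarrow> (\<forall>P\<in>polys_in V. P \<noteq> 0 \<longrightarrow> poly_eval of_rat c P \<noteq> 0)"

definition zariski_open :: "'v set \<Rightarrow> ('v \<Rightarrow> 'k::field) set \<Rightarrow> bool"
  where "zariski_open V U \<longleftrightarrow>
    (\<exists>T. T \<subseteq> polys_in V \<and> U = {c \<in> affine_space V. \<exists>P\<in>T. poly_eval id c P \<noteq> 0})"

definition holds_generically :: "'v set \<Rightarrow> (('v \<Rightarrow> 'k::field_char_0) \<Rightarrow> bool) \<Rightarrow> bool"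
  where "holds_generically V Q \<longleftrightarrow>
    (\<forall>c\<in>affine_space V. alg_indep_over_rat V c \<longrightarrow> Q c) \<and>
    (\<exists>U. zariski_open V U \<and> U \<noteq> {} \<and> (\<forall>c\<in>U. Q c))"

end

theory Submission
  imports Defs "Jordan_Normal_Form.Determinant"
begin

text \<open>The only genericity used is that the matrix of the form is nondegenerate.

  A cyclic tensor of words is a cyclic word with bars between the tensor factors, and the differential
  removes bars. A tensor over \<open>B\<close> is obtained by killing \<open>\<omega>\<close> between neighbouring letters without a bar.
  For a cyclic word of length \<open>q \<ge> 3\<close>, the sets of bars thus index a cube of quotients of
  \<open>V\<^bsup>\<otimes>q\<^esup>\<close>, whose exactness away from the empty set of bars reduces to two facts: a nonzero linear
  form is left regular on \<open>B\<close>, and, since there are at least three variables, no nonzero element of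
  positive degree of \<open>B\<close> commutes with all variables up to a fixed sign. Averaging over rotations preserves the
  exactness. So in weights \<open>q \<ge> 3\<close> only \<open>HC\<^sub>0\<close> survives, and its dimension is an Euler characteristic;
  in weight two \<open>\<omega>\<close> itself gives the extra class in degree one.

  \<open>B\<close> has Hilbert series \<open>1 / (1 - n z + z\<^sup>2)\<close>. The dimension of the coinvariants of the cyclic group
  is the trace of the averaging projection on tuples of normal words, which is a sum over divisors
  weighted by Euler's function; the alternating sum over the lengths of the tuples turns powers of \<open>I\<close>
  into \<open>log (1 + I) = - log (1 - (n z - z\<^sup>2))\<close>.\<close>

section \<open>Linear maps of free vector spaces\<close>

text \<open>The obstacle is the gap that closes the circle. With one gap barred, a cyclic word is a
  linear one, and left regularity controls the intersection of neighbouring relation spaces. With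
  all gaps killed except the two around one letter, the two ways of placing \<open>\<omega>\<close>
  across that letter give y a = a z in B for every letter a; only here must twisted central elements
  be excluded. Adding gaps one at a time, with a cube viewed as the cone of a map between two faces,
  reduces the whole cube to these two kinds of squares. Weight two is exceptional because its two
  gaps carry the same relation, \<open>\<omega>\<close> being symmetric. The vertex without bars is
  no tensor; dropping it from the acyclic cube leaves homology in degree zero. All computations take
  place in the free algebra with spans of explicit generators, so tensor products and quotients are
  never formed; the actual complex, whose tensors have arbitrary cosets as entries, is compared with
  this model by maps that are inverse up to relations. Characteristic zero enters in the averaging,
  in a factor 2 in weight two, and in reading dimensions off traces.\<close>

abbreviation plinear :: "(('x \<Rightarrow>\<^sub>0 'k::field) \<Rightarrow> ('y \<Rightarrow>\<^sub>0 'k)) \<Rightarrow> bool"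
  where "plinear \<equiv> Vector_Spaces.linear pscale pscale"

global_interpretation pmp: vector_space_pair
  "pscale :: 'k::field \<Rightarrow> ('x \<Rightarrow>\<^sub>0 'k) \<Rightarrow> ('x \<Rightarrow>\<^sub>0 'k)" "pscale :: 'k::field \<Rightarrow> ('y \<Rightarrow>\<^sub>0 'k) \<Rightarrow> ('y \<Rightarrow>\<^sub>0 'k)"
  by unfold_locales

lemma plinearI:
  assumes "\<And>x y. f (x + y) = f x + f y" "\<And>c x. f (pscale c x) = pscale c (f x)"
  shows "plinear f"
  using assms by (simp add: Vector_Spaces.linear_iff pm.vector_space_axioms)

lemma plinear_comp: "plinear f \<Longrightarrow> plinear g \<Longrightarrow> plinear (\<lambda>x. f (g x))"
  by (rule plinearI) (simp_all add: pmp.linear_add pmp.linear_scale)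

lemma plinear_id: "plinear (\<lambda>x. x)"
  by (rule plinearI) simp_all

lemma plinear_zero: "plinear (\<lambda>x. 0)"
  by (rule plinearI) simp_all

lemma plinear_minus: "plinear f \<Longrightarrow> plinear g \<Longrightarrow> plinear (\<lambda>x. f x - g x)"
  by (rule plinearI) (simp_all add: pmp.linear_add pmp.linear_scale pm.scale_right_diff_distrib)

lemma plinear_add: "plinear f \<Longrightarrow> plinear g \<Longrightarrow> plinear (\<lambda>x. f x + g x)"
  by (rule plinearI) (simp_all add: pmp.linear_add pmp.linear_scale pm.scale_right_distrib)

lemma plinear_scale: "plinear f \<Longrightarrow> plinear (\<lambda>x. pscale c (f x))"
  by (rule plinearI) (simp_all add: pmp.linear_add pmp.linear_scale pm.scale_right_distrib mult.commute)

lemma plinear_sum: "(\<And>i. i \<in> I \<Longrightarrow> plinear (f i)) \<Longrightarrow> plinear (\<lambda>x. \<Sum>i\<in>I. f i x)"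
  by (induction I rule: infinite_finite_induct) (auto intro: plinear_zero plinear_add)

lemma pscale_single [simp]: "pscale c (Poly_Mapping.single x a) = Poly_Mapping.single x (c * a)"
  by (rule poly_mapping_eqI) (simp add: lookup_single when_def)

lemma expand_single: "x = (\<Sum>k\<in>Poly_Mapping.keys x. pscale (Poly_Mapping.lookup x k) (Poly_Mapping.single k 1))"
proof (rule poly_mapping_eqI)
  fix k
  show "Poly_Mapping.lookup x k = Poly_Mapping.lookup
    (\<Sum>k\<in>Poly_Mapping.keys x. pscale (Poly_Mapping.lookup x k) (Poly_Mapping.single k 1)) k"
    by (cases "k \<in> Poly_Mapping.keys x")
      (auto simp: lookup_sum lookup_single when_def sum.delta' in_keys_iff)
qed

lemma keys_pscale_subset: "Poly_Mapping.keys (pscale c x) \<subseteq> Poly_Mapping.keys x"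
  by (rule subsetI) (metis in_keys_iff lookup_pscale mult_zero_right)

text \<open>Summing over a superset of the support lets several arguments share one index set, as
  the proof of additivity requires.\<close>

lemma lin_ext_superset:
  assumes "finite K" "Poly_Mapping.keys p \<subseteq> K"
  shows "lin_ext f p = (\<Sum>x\<in>K. pscale (Poly_Mapping.lookup p x) (f x))"
  unfolding lin_ext_def using assms
  by (intro sum.mono_neutral_left) (auto simp: in_keys_iff)

lemma lin_ext_linear [intro]:
  fixes f :: "'x \<Rightarrow> 'y \<Rightarrow>\<^sub>0 'k::field"
  shows "plinear (lin_ext f)"
proof (rule plinearI)
  fix x y :: "'x \<Rightarrow>\<^sub>0 'k" and c
  let ?K = "Poly_Mapping.keys x \<union> Poly_Mapping.keys y"
  have k: "Poly_Mapping.keys (x + y) \<subseteq> ?K" by (rule Poly_Mapping.keys_add)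
  show "lin_ext f (x + y) = lin_ext f x + lin_ext f y"
    by (simp add: lin_ext_superset[of ?K] k lookup_add pm.scale_left_distrib sum.distrib)
  have "Poly_Mapping.keys (pscale c x) \<subseteq> Poly_Mapping.keys x"
    by (rule keys_pscale_subset)
  then show "lin_ext f (pscale c x) = pscale c (lin_ext f x)"
    by (simp add: lin_ext_superset[of "Poly_Mapping.keys x"] pm.scale_sum_right)
qed

lemma lin_ext_single [simp]: "lin_ext f (Poly_Mapping.single x c) = pscale c (f x)"
  by (cases "c = 0") (simp_all add: lin_ext_def)

lemma lin_ext_simps [simp]:
  "lin_ext f 0 = 0" "lin_ext f (x + y) = lin_ext f x + lin_ext f y"
  "lin_ext f (x - y) = lin_ext f x - lin_ext f y" "lin_ext f (- x) = - lin_ext f x"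
  "lin_ext f (pscale c x) = pscale c (lin_ext f x)"
  "lin_ext f (sum g A) = (\<Sum>a\<in>A. lin_ext f (g a))"
  by (rule pmp.linear_0[OF lin_ext_linear] pmp.linear_add[OF lin_ext_linear]
    pmp.linear_diff[OF lin_ext_linear] pmp.linear_neg[OF lin_ext_linear]
    pmp.linear_scale[OF lin_ext_linear] pmp.linear_sum[OF lin_ext_linear])+

definition supp_in :: "'x set \<Rightarrow> ('x \<Rightarrow>\<^sub>0 'k::field) set"
  where "supp_in A = {x. Poly_Mapping.keys x \<subseteq> A}"

lemma subspace_supp_in [intro, simp]:
  fixes A :: "'x set"
  shows "pm.subspace (supp_in A :: ('x \<Rightarrow>\<^sub>0 'k::field) set)"
  unfolding pm.subspace_def supp_in_def
proof (intro conjI ballI allI)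
  fix x y :: "'x \<Rightarrow>\<^sub>0 'k" and c
  assume x: "x \<in> {x. Poly_Mapping.keys x \<subseteq> A}"
  then show "pscale c x \<in> {x. Poly_Mapping.keys x \<subseteq> A}"
    using keys_pscale_subset[of c x] by blast
  assume y: "y \<in> {x. Poly_Mapping.keys x \<subseteq> A}"
  show "x + y \<in> {x. Poly_Mapping.keys x \<subseteq> A}"
    using x y Poly_Mapping.keys_add[of x y] by blast
qed simp

lemma single_in_supp_in [simp]: "x \<in> A \<Longrightarrow> Poly_Mapping.single x c \<in> supp_in A"
  by (auto simp: supp_in_def)

lemma supp_in_eq_span:
  fixes A :: "'x set"
  shows "(supp_in A :: ('x \<Rightarrow>\<^sub>0 'k::field) set) = pm.span ((\<lambda>x. Poly_Mapping.single x 1) ` A)"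
proof
  show "(supp_in A :: ('x \<Rightarrow>\<^sub>0 'k) set) \<subseteq> pm.span ((\<lambda>x. Poly_Mapping.single x 1) ` A)"
  proof
    fix x :: "'x \<Rightarrow>\<^sub>0 'k"
    assume x: "x \<in> supp_in A"
    show "x \<in> pm.span ((\<lambda>x. Poly_Mapping.single x 1) ` A)"
      by (subst expand_single[of x], intro pm.span_sum pm.span_scale pm.span_base)
        (use x in \<open>auto simp: supp_in_def\<close>)
  qed
  show "pm.span ((\<lambda>x. Poly_Mapping.single x 1) ` A) \<subseteq> supp_in A"
    by (rule pm.span_minimal) auto
qed

lemma supp_in_mono: "A \<subseteq> B \<Longrightarrow> supp_in A \<subseteq> supp_in B"
  by (auto simp: supp_in_def)

lemma plinear_eq_on_supp:
  assumes "plinear f" "plinear g" "x \<in> supp_in A"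
    and "\<And>w. w \<in> A \<Longrightarrow> f (Poly_Mapping.single w 1) = g (Poly_Mapping.single w 1)"
  shows "f x = g x"
  by (rule pmp.linear_eq_on[OF assms(1,2), of _ "(\<lambda>x. Poly_Mapping.single x 1) ` A"])
    (use assms(3,4) in \<open>auto simp: supp_in_eq_span\<close>)

lemma plinear_eqI:
  assumes "plinear f" "plinear g" "\<And>w. f (Poly_Mapping.single w 1) = g (Poly_Mapping.single w 1)"
  shows "f x = g x"
  by (rule plinear_eq_on_supp[OF assms(1,2), of _ UNIV]) (use assms(3) in \<open>auto simp: supp_in_def\<close>)

text \<open>Nearly all inclusions below are linear in an element of a span; this reduces them to
  generators.\<close>

lemma plinear_span_subset:
  assumes "plinear f" "\<And>g. g \<in> G \<Longrightarrow> f g \<in> V" "pm.subspace V" "x \<in> pm.span G"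
  shows "f x \<in> V"
proof -
  have "f ` pm.span G = pm.span (f ` G)" using pmp.linear_span_image[OF assms(1)] by blast
  also have "\<dots> \<subseteq> V" using assms(2,3) by (intro pm.span_minimal) auto
  finally show ?thesis using assms(4) by auto
qed

lemma plinear_supp_subset:
  assumes "plinear f" "\<And>w. w \<in> A \<Longrightarrow> f (Poly_Mapping.single w 1) \<in> V" "pm.subspace V" "x \<in> supp_in A"
  shows "f x \<in> V"
  using plinear_span_subset[OF assms(1) _ assms(3), of "(\<lambda>x. Poly_Mapping.single x 1) ` A"]
    assms(2,4) by (auto simp: supp_in_eq_span)

lemma subspace_vimage: "plinear f \<Longrightarrow> pm.subspace V \<Longrightarrow> pm.subspace {x. f x \<in> V}"
  by (simp add: pm.subspace_def pmp.linear_add pmp.linear_scale pmp.linear_0)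


lemma times_eq_sum:
  fixes x y :: "'a::monoid_add \<Rightarrow>\<^sub>0 'k::field"
  shows "x * y = (\<Sum>k\<in>Poly_Mapping.keys x. \<Sum>l\<in>Poly_Mapping.keys y.
    Poly_Mapping.single (k + l) (Poly_Mapping.lookup x k * Poly_Mapping.lookup y l))"
  by (subst (1) expand_single[of x], subst (1) expand_single[of y])
    (simp add: sum_distrib_left sum_distrib_right mult_single sum.swap[of _ "Poly_Mapping.keys x"])

lemma single_conv_lin_ext:
  "Poly_Mapping.single u c * y = lin_ext (\<lambda>w. Poly_Mapping.single (u + w) (c :: 'k::field)) y"
  unfolding times_eq_sum lin_ext_def by (auto simp: mult.commute)

lemma pscale_eq_times: "pscale c x = Poly_Mapping.single 0 c * (x :: 'a::monoid_add \<Rightarrow>\<^sub>0 'k::field)"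
  unfolding single_conv_lin_ext
  by (rule plinear_eqI) (auto intro: plinear_scale plinear_id simp: mult.commute)

lemma times_pscale_left: "pscale c x * y = pscale c (x * (y :: 'a::monoid_add \<Rightarrow>\<^sub>0 'k::field))"
  by (simp add: pscale_eq_times mult.assoc)

lemma plinear_times_right: "plinear (\<lambda>x. x * (y :: 'a::monoid_add \<Rightarrow>\<^sub>0 'k::field))"
  by (rule plinearI) (simp_all add: distrib_right times_pscale_left)

text \<open>Scalars sit at the unit of the word monoid, so they are central although words do not
  commute. This yields linearity of the product in its right factor.\<close>

lemma single0_commute: "Poly_Mapping.single 0 c * x = x * Poly_Mapping.single 0 (c :: 'k::field)"
proof -
  have "pscale c x = x * Poly_Mapping.single 0 c"
    by (rule plinear_eqI) (auto intro!: plinear_scale plinear_id plinear_times_right simp: mult_single)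
  then show ?thesis by (simp add: pscale_eq_times)
qed

lemma times_pscale_right: "x * pscale c y = pscale c (x * (y :: 'a::monoid_add \<Rightarrow>\<^sub>0 'k::field))"
  unfolding pscale_eq_times
  by (simp only: mult.assoc[symmetric] single0_commute[of c x])

lemma plinear_times_left: "plinear (\<lambda>x. y * (x :: 'a::monoid_add \<Rightarrow>\<^sub>0 'k::field))"
  by (rule plinearI) (simp_all add: distrib_left times_pscale_right)

section \<open>The relations in the free algebra\<close>

definition wmono :: "nat list \<Rightarrow> (nc_word \<Rightarrow>\<^sub>0 'k::field)"
  where "wmono w = Poly_Mapping.single (NCWord w) 1"

lemma wmono_mult: "wmono u * wmono v = wmono (u @ v)"
  by (simp add: wmono_def mult_single plus_nc_word_def)

lemma wmono_Nil: "wmono [] = 1"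
  by (simp add: wmono_def flip: zero_nc_word_def)

definition words :: "nat \<Rightarrow> nat \<Rightarrow> nat list set"
  where "words n p = {w. length w = p \<and> set w \<subseteq> {..<n}}"

lemma finite_words [simp]: "finite (words n p)"
  using finite_lists_length_eq[of "{..<n}" p] by (simp add: words_def conj_commute)

definition T :: "nat \<Rightarrow> nat \<Rightarrow> (nc_word \<Rightarrow>\<^sub>0 'k::field) set"
  where "T n p = supp_in (NCWord ` words n p)"

lemma T_eq_span: "T n p = pm.span (wmono ` words n p)"
  by (simp add: T_def supp_in_eq_span wmono_def image_image)

lemma subspace_T [simp, intro]: "pm.subspace (T n p)"
  by (simp add: T_def)

lemma wmono_in_T: "w \<in> words n p \<Longrightarrow> wmono w \<in> T n p"
  by (simp add: T_def wmono_def)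

lemma T_linear_eq:
  assumes "plinear f" "plinear g" "x \<in> T n p" "\<And>w. w \<in> words n p \<Longrightarrow> f (wmono w) = g (wmono w)"
  shows "f x = g x"
  by (rule plinear_eq_on_supp[OF assms(1,2) assms(3)[unfolded T_def]]) (use assms(4) in \<open>auto simp: wmono_def\<close>)

lemma T_linear_subset:
  assumes "plinear f" "\<And>w. w \<in> words n p \<Longrightarrow> f (wmono w) \<in> V" "pm.subspace V" "x \<in> T n p"
  shows "f x \<in> V"
  by (rule plinear_supp_subset[OF assms(1) _ assms(3) assms(4)[unfolded T_def]])
    (use assms(2) in \<open>auto simp: wmono_def\<close>)

lemma words_append: "u \<in> words n p \<Longrightarrow> v \<in> words n q \<Longrightarrow> u @ v \<in> words n (p + q)"
  by (auto simp: words_def)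

lemma T_mult:
  assumes "x \<in> T n p" "y \<in> T n q"
  shows "x * y \<in> T n (p + q)"
proof (rule T_linear_subset[OF plinear_times_right _ _ assms(1)])
  fix w assume w: "w \<in> words n p"
  show "wmono w * y \<in> T n (p + q)"
    by (rule T_linear_subset[OF plinear_times_left _ _ assms(2)])
      (auto simp: wmono_mult intro: wmono_in_T words_append w)
qed simp

lemma T_mult_mono: "k < n \<Longrightarrow> x \<in> T n p \<Longrightarrow> wmono [k] * x \<in> T n (Suc p)"
  using T_mult[of "wmono [k]" n 1 x p] by (simp add: wmono_in_T words_def)

section \<open>Linear forms and left derivatives\<close>

definition linf :: "nat \<Rightarrow> (nat \<Rightarrow> 'k::field) \<Rightarrow> (nc_word \<Rightarrow>\<^sub>0 'k)"
  where "linf n \<mu> = (\<Sum>l<n. pscale (\<mu> l) (wmono [l]))"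

lemma linf_T [simp]: "linf n \<mu> \<in> T n (Suc 0)"
  unfolding linf_def by (intro pm.subspace_sum subspace_T pm.subspace_scale wmono_in_T) (auto simp: words_def)

text \<open>The left derivative by the letter \<open>k\<close>: it strips a leading \<open>k\<close>
  and kills all other words. An element of positive degree is determined by its derivatives, so
  membership can be tested letter by letter.\<close>

definition dec :: "nat \<Rightarrow> (nc_word \<Rightarrow>\<^sub>0 'k::field) \<Rightarrow> (nc_word \<Rightarrow>\<^sub>0 'k)"
  where "dec k = lin_ext (\<lambda>w. case letters w of [] \<Rightarrow> 0 | l # u \<Rightarrow> if l = k then wmono u else 0)"

lemma plinear_dec [intro, simp]: "plinear (dec k)"
  unfolding dec_def by (rule lin_ext_linear)

lemmas dec_simps [simp] = pmp.linear_0[OF plinear_dec] pmp.linear_add[OF plinear_dec]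
  pmp.linear_diff[OF plinear_dec] pmp.linear_scale[OF plinear_dec] pmp.linear_sum[OF plinear_dec]

lemma dec_wmono_Cons [simp]: "dec k (wmono (l # u)) = (if l = k then wmono u else 0)"
  by (simp add: dec_def wmono_def)

lemma dec_wmono_Nil [simp]: "dec k (wmono []) = 0"
  by (simp add: dec_def wmono_def)

lemma dec_letter_mult [simp]:
  fixes y :: "nc_word \<Rightarrow>\<^sub>0 'k::field"
  shows "dec k (wmono [l] * y) = (if l = k then y else 0)"
proof -
  have "dec k (wmono [l] * y) = (if l = k then pscale 1 y else 0)"
  proof (rule plinear_eqI[where f = "\<lambda>y. dec k (wmono [l] * y)" and g = "\<lambda>y. if l = k then pscale 1 y else 0"])
    show "plinear (\<lambda>y. dec k (wmono [l] * y))"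
      by (rule plinear_comp[OF plinear_dec plinear_times_left])
    show "plinear (\<lambda>y. if l = k then pscale 1 y else (0 :: nc_word \<Rightarrow>\<^sub>0 'k))"
      by (rule plinearI) (auto simp: pm.scale_right_distrib)
    fix w
    have "Poly_Mapping.single w 1 = (wmono (letters w) :: nc_word \<Rightarrow>\<^sub>0 'k)"
      by (cases w) (simp add: wmono_def)
    then show "dec k (wmono [l] * Poly_Mapping.single w 1) = (if l = k then pscale 1 (Poly_Mapping.single w (1::'k)) else 0)"
      by (simp add: wmono_mult)
  qed
  then show ?thesis by simp
qed

lemma dec_T: "x \<in> T n (Suc p) \<Longrightarrow> dec k x \<in> T n p"
proof (rule T_linear_subset[OF plinear_dec, of n "Suc p"])
  fix w assume "w \<in> words n (Suc p)"
  then show "dec k (wmono w) \<in> (T n p :: (nc_word \<Rightarrow>\<^sub>0 'a) set)"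
    by (cases w) (auto simp: words_def intro: wmono_in_T pm.subspace_0)
qed auto

lemma T_Suc_expand: "x \<in> T n (Suc p) \<Longrightarrow> x = (\<Sum>k<n. wmono [k] * dec k x)"
proof (rule T_linear_eq[of "\<lambda>x. x" "\<lambda>x. \<Sum>k<n. wmono [k] * dec k x"])
  fix w assume "w \<in> words n (Suc p)"
  then show "wmono w = (\<Sum>k<n. wmono [k] * dec k (wmono w) :: nc_word \<Rightarrow>\<^sub>0 'a)"
    by (cases w) (auto simp: words_def wmono_mult if_distrib[of "(*) _"] cong: if_cong)
qed (auto intro!: plinear_id plinear_sum plinear_comp[OF plinear_times_left])

lemma T_0: "x \<in> T n 0 \<longleftrightarrow> (\<exists>c. x = pscale c 1)"
proof
  assume "x \<in> T n 0"
  then have "x \<in> pm.span {1}" by (simp add: T_eq_span words_def wmono_Nil cong: conj_cong)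
  then show "\<exists>c. x = pscale c 1" by (auto simp: pm.span_singleton)
next
  assume "\<exists>c. x = pscale c 1"
  moreover have "1 \<in> (T n 0 :: (nc_word \<Rightarrow>\<^sub>0 'a) set)" using wmono_in_T[of "[]" n 0] by (simp add: words_def wmono_Nil)
  ultimately show "x \<in> T n 0" by (auto intro: pm.subspace_scale)
qed

lemma linf_zero_iff: "linf n \<mu> = 0 \<longleftrightarrow> (\<forall>l<n. \<mu> l = 0)"
proof
  assume "linf n \<mu> = 0"
  then have "dec l (linf n \<mu>) = 0" for l by simp
  then have "(if l < n then pscale (\<mu> l) (1 :: nc_word \<Rightarrow>\<^sub>0 'a) else 0) = 0" for l
    by (simp add: linf_def if_distrib[of "pscale _"] wmono_Nil cong: if_cong)
  then show "\<forall>l<n. \<mu> l = 0" by (metis pm.scale_eq_0_iff zero_neq_one)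
qed (simp add: linf_def)

lemma linf_mult: "linf n \<mu> * x = (\<Sum>l<n. pscale (\<mu> l) (wmono [l] * x))"
  by (simp add: linf_def sum_distrib_right times_pscale_left)

lemma dec_linf_mult [simp]: "k < n \<Longrightarrow> dec k (linf n \<mu> * x) = pscale (\<mu> k) x"
  by (simp add: linf_mult if_distrib[of "pscale _"] cong: if_cong)

lemma linf_comb:
  "(\<Sum>k<n. pscale (\<mu> k) (linf n (\<lambda>l. M k l))) = linf n (\<lambda>l. \<Sum>k<n. \<mu> k * M k l)"
  unfolding linf_def
  by (simp add: pm.scale_sum_right pm.scale_sum_left) (rule sum.swap)

section \<open>Relation spaces of a nondegenerate quadric\<close>

locale quadric =
  fixes n :: nat and c :: "nat \<times> nat \<Rightarrow> 'k::field_char_0"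
  assumes n3: "n \<ge> 3"
    and nondegenerate: "\<And>\<mu>. (\<And>k. k < n \<Longrightarrow> (\<Sum>l<n. c (min k l, max k l) * \<mu> l) = 0) \<Longrightarrow> (\<And>l. l < n \<Longrightarrow> \<mu> l = 0)"
begin

definition M :: "nat \<Rightarrow> nat \<Rightarrow> 'k" where "M k l = c (min k l, max k l)"

lemma M_sym: "M k l = M l k"
  by (simp add: M_def min.commute max.commute)

text \<open>These linear forms are the left derivatives of \<open>\<omega>\<close> and, the matrix
  being symmetric, also its right derivatives.\<close>

definition row :: "nat \<Rightarrow> (nc_word \<Rightarrow>\<^sub>0 'k)" where "row k = linf n (M k)"

definition \<omega> :: "nc_word \<Rightarrow>\<^sub>0 'k" where "\<omega> = sym_form n c"

lemma omega_pairs: "\<omega> = (\<Sum>k<n. \<Sum>l<n. pscale (M k l) (wmono [k, l]))"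
  by (simp add: \<omega>_def sym_form_def M_def nc_var_def mult_single plus_nc_word_def wmono_def)

lemma omega_row: "\<omega> = (\<Sum>k<n. wmono [k] * row k)"
  by (simp add: omega_pairs row_def linf_def sum_distrib_left times_pscale_right wmono_mult)

lemma omega_T: "\<omega> \<in> T n 2"
  unfolding omega_pairs
  by (intro pm.subspace_sum subspace_T pm.subspace_scale wmono_in_T) (auto simp: words_def)

lemma row_comb: "(\<Sum>k<n. pscale (\<mu> k) (row k)) = linf n (\<lambda>l. \<Sum>k<n. M l k * \<mu> k)"
  unfolding row_def linf_comb by (simp add: M_sym mult.commute)

text \<open>By symmetry, combining the rows with coefficients \<open>\<mu>\<close> gives the form
  with coefficient vector M \<open>\<mu>\<close>; nondegeneracy keeps it nonzero for
  \<open>\<mu>\<close> nonzero.\<close>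

lemma row_comb_nonzero:
  assumes "l < n" "\<mu> l \<noteq> 0"
  shows "\<exists>j<n. (\<Sum>k<n. M j k * \<mu> k) \<noteq> 0"
  using nondegenerate[of \<mu> l] assms by (auto simp: M_def)

lemma dec_omega_mult [simp]: "k < n \<Longrightarrow> dec k (\<omega> * z) = row k * z"
  by (simp add: omega_row sum_distrib_right mult.assoc)

definition rel_gens :: "nat set \<Rightarrow> nat \<Rightarrow> (nc_word \<Rightarrow>\<^sub>0 'k) set"
  where "rel_gens U p = {wmono u * \<omega> * wmono v | u v. length u \<in> U \<and> length u + 2 + length v = p
    \<and> set u \<subseteq> {..<n} \<and> set v \<subseteq> {..<n}}"

text \<open>A position counts the letters in front of \<open>\<omega>\<close>. For
  \<open>U = UNIV\<close> this is the degree \<open>p\<close> part of the ideal; in general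
  \<open>T n p\<close> modulo \<open>RS U p\<close> is a tensor product of components of B, a word
  being cut wherever the position is missing from \<open>U\<close>. Removing the first letter turns
  \<open>U\<close> into \<open>{i. Suc i \<in> U}\<close>.\<close>

definition RS :: "nat set \<Rightarrow> nat \<Rightarrow> (nc_word \<Rightarrow>\<^sub>0 'k) set"
  where "RS U p = pm.span (rel_gens U p)"

lemma subspace_RS [simp, intro]: "pm.subspace (RS U p)"
  by (simp add: RS_def)

lemma RS_gen: "length u \<in> U \<Longrightarrow> length u + 2 + length v = p \<Longrightarrow> set u \<subseteq> {..<n} \<Longrightarrow> set v \<subseteq> {..<n} \<Longrightarrow>
    wmono u * \<omega> * wmono v \<in> RS U p"
  unfolding RS_def rel_gens_def by (rule pm.span_base) auto

lemma RS_gen_T: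
  assumes "x \<in> T n i" "y \<in> T n j" "i \<in> U" "i + 2 + j = p"
  shows "x * \<omega> * y \<in> RS U p"
proof -
  have 1: "x * \<omega> * wmono v \<in> RS U p" if v: "v \<in> words n j" for v
  proof (rule T_linear_subset[OF _ _ _ assms(1), of "\<lambda>x. x * \<omega> * wmono v"])
    show "plinear (\<lambda>x. x * \<omega> * wmono v)" by (intro plinear_comp[OF plinear_times_right] plinear_times_right)
  qed (use v assms in \<open>auto simp: words_def intro!: RS_gen\<close>)
  show ?thesis
    by (rule T_linear_subset[OF plinear_times_left _ _ assms(2)]) (auto intro: 1)
qed

lemma RS_mono: "U \<subseteq> U' \<Longrightarrow> RS U p \<subseteq> RS U' p"
  unfolding RS_def by (rule pm.span_mono) (auto simp: rel_gens_def)

lemma RS_T: "RS U p \<subseteq> T n p"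
  unfolding RS_def
proof (rule pm.span_minimal)
  show "rel_gens U p \<subseteq> T n p"
  proof
    fix x assume "x \<in> rel_gens U p"
    then obtain u v where x: "x = wmono u * \<omega> * wmono v" "length u + 2 + length v = p" "set u \<subseteq> {..<n}" "set v \<subseteq> {..<n}"
      by (auto simp: rel_gens_def)
    have "x \<in> T n (length u + 2 + length v)"
      unfolding x(1) using x(3,4) by (intro T_mult omega_T wmono_in_T) (auto simp: words_def)
    then show "x \<in> T n p" using x(2) by simp
  qed
qed simp

lemma RS_small: "p < 2 \<Longrightarrow> RS U p = {0}"
  by (auto simp: RS_def rel_gens_def)

lemma RS_letter_mult:
  assumes "e \<in> RS {i. Suc i \<in> U} p" "k < n"
  shows "wmono [k] * e \<in> RS U (Suc p)"
proof (rule plinear_span_subset[OF plinear_times_left _ _ assms(1)[unfolded RS_def]])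
  fix g assume "g \<in> rel_gens {i. Suc i \<in> U} p"
  then obtain u v where g: "g = wmono u * \<omega> * wmono v" "Suc (length u) \<in> U" "length u + 2 + length v = p"
     "set u \<subseteq> {..<n}" "set v \<subseteq> {..<n}"
    by (auto simp: rel_gens_def)
  have "wmono [k] * g = wmono (k # u) * \<omega> * wmono v"
    unfolding g(1) by (simp add: wmono_mult flip: mult.assoc)
  also have "\<dots> \<in> RS U (Suc p)" using g assms(2) by (intro RS_gen) auto
  finally show "wmono [k] * g \<in> RS U (Suc p)" .
qed simp

lemma RS_linf_mult:
  assumes "e \<in> RS {i. Suc i \<in> U} p"
  shows "linf n \<mu> * e \<in> RS U (Suc p)"
  unfolding linf_mult by (intro pm.subspace_sum pm.subspace_scale subspace_RS RS_letter_mult assms) auto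

lemma RS_row_mult: "e \<in> RS {i. Suc i \<in> U} p \<Longrightarrow> row k * e \<in> RS U (Suc p)"
  unfolding row_def by (rule RS_linf_mult)

text \<open>A relation is \<open>\<omega> * z\<close> plus letters times relations that start later.
  The point is that one and the same \<open>z\<close> serves all derivatives, and that it vanishes
  when position 0 is not killed.\<close>

lemma dec_RS:
  assumes "e \<in> RS U (Suc p)"
  shows "\<exists>z\<in>T n (p - 1). (0 \<notin> U \<longrightarrow> z = 0) \<and> (\<forall>k<n. dec k e - row k * z \<in> RS {i. Suc i \<in> U} p)"
proof -
  let ?U = "{i. Suc i \<in> U}"
  define V where "V = {e. \<exists>z\<in>T n (p - 1). (0 \<notin> U \<longrightarrow> z = 0) \<and> (\<forall>k<n. dec k e - row k * z \<in> RS ?U p)}"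
  have "pm.span (rel_gens U (Suc p)) \<subseteq> V"
  proof (rule pm.span_minimal)
    show "rel_gens U (Suc p) \<subseteq> V"
    proof
      fix g assume "g \<in> rel_gens U (Suc p)"
      then obtain u v where g: "g = wmono u * \<omega> * wmono v" "length u \<in> U" "length u + 2 + length v = Suc p"
         "set u \<subseteq> {..<n}" "set v \<subseteq> {..<n}"
        by (auto simp: rel_gens_def)
      show "g \<in> V"
      proof (cases u)
        case Nil
        have "wmono v \<in> T n (p - 1)" using g Nil by (intro wmono_in_T) (auto simp: words_def)
        moreover have "dec k g - row k * wmono v = 0" if "k < n" for k
          using that by (simp add: g(1) Nil wmono_Nil)
        ultimately show ?thesis
          unfolding V_def using g(2) Nil by (auto intro!: bexI[of _ "wmono v"] pm.subspace_0)
      next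
        case (Cons a u')
        have "g = wmono [a] * (wmono u' * \<omega> * wmono v)"
          unfolding g(1) Cons by (simp add: wmono_mult flip: mult.assoc)
        then have "dec k g \<in> RS ?U p" for k
          using g Cons by (auto intro!: RS_gen pm.subspace_0)
        then show ?thesis unfolding V_def by (auto intro!: bexI[of _ 0] pm.subspace_0)
      qed
    qed
    show "pm.subspace V"
      unfolding pm.subspace_def
    proof (intro conjI ballI allI)
      show "0 \<in> V" unfolding V_def by (auto intro!: bexI[of _ 0] pm.subspace_0)
    next
      fix x y assume "x \<in> V" "y \<in> V"
      then obtain a b where a: "a \<in> T n (p-1)" "0 \<notin> U \<longrightarrow> a = 0" "\<And>k. k < n \<Longrightarrow> dec k x - row k * a \<in> RS ?U p"
        and b: "b \<in> T n (p-1)" "0 \<notin> U \<longrightarrow> b = 0" "\<And>k. k < n \<Longrightarrow> dec k y - row k * b \<in> RS ?U p"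
        unfolding V_def by blast
      have "dec k (x + y) - row k * (a + b) \<in> RS ?U p" if "k < n" for k
        using pm.subspace_add[OF subspace_RS a(3)[OF that] b(3)[OF that]] by (simp add: algebra_simps)
      then show "x + y \<in> V" unfolding V_def
        by (intro CollectI bexI[of _ "a + b"] conjI) (use a(1,2) b(1,2) in \<open>auto intro: pm.subspace_add[OF subspace_T]\<close>)
    next
      fix r x assume "x \<in> V"
      then obtain a where a: "a \<in> T n (p-1)" "0 \<notin> U \<longrightarrow> a = 0" "\<And>k. k < n \<Longrightarrow> dec k x - row k * a \<in> RS ?U p"
        unfolding V_def by blast
      have "dec k (pscale r x) - row k * (pscale r a) \<in> RS ?U p" if "k < n" for k
        using pm.subspace_scale[OF subspace_RS a(3)[OF that], of r] by (simp add: times_pscale_right pm.scale_right_diff_distrib)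
      then show "pscale r x \<in> V" unfolding V_def
        by (intro CollectI bexI[of _ "pscale r a"] conjI) (use a(1,2) in \<open>auto intro: pm.subspace_scale[OF subspace_T]\<close>)
    qed
  qed
  then show ?thesis using assms unfolding RS_def V_def by blast
qed

text \<open>Three coordinates suffice for a nonzero vector orthogonal to two given ones; this is one
  of the places where at least three variables are needed.\<close>

lemma exists_orthogonal:
  fixes f :: "nat \<Rightarrow> 'k"
  shows "\<exists>\<mu>. (\<exists>k<n. \<mu> k \<noteq> 0) \<and> (\<Sum>k<n. \<mu> k * f k) = 0 \<and> (\<Sum>k<n. \<mu> k * g k) = 0"
proof -
  have sub: "{..<n} \<inter> {0,1,2} = {0,1,2::nat}" using n3 by auto
  have s: "(\<Sum>k<n. (if k = 0 then x else if k = 1 then y else if k = 2 then z else 0) * h k)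
     = x * h 0 + y * h 1 + z * h 2" for x y z :: 'k and h
  proof -
    have "(\<Sum>k<n. (if k = 0 then x else if k = 1 then y else if k = 2 then z else 0) * h k)
      = (\<Sum>k\<in>{..<n} \<inter> {0,1,2}. (if k = 0 then x else if k = 1 then y else if k = 2 then z else 0) * h k)"
      by (rule sum.mono_neutral_right) auto
    then show ?thesis unfolding sub by simp
  qed
  have w: ?thesis if "x \<noteq> 0 \<or> y \<noteq> 0 \<or> z \<noteq> 0" "x * f 0 + y * f 1 + z * f 2 = 0" "x * g 0 + y * g 1 + z * g 2 = 0" for x y z
  proof -
    define \<mu> :: "nat \<Rightarrow> 'k" where "\<mu> = (\<lambda>k. if k = 0 then x else if k = 1 then y else if k = 2 then z else 0)"
    have "\<mu> 0 = x" "\<mu> 1 = y" "\<mu> 2 = z" by (simp_all add: \<mu>_def)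
    moreover have "0 < n" "1 < n" "2 < n" using n3 by auto
    ultimately have "\<exists>k<n. \<mu> k \<noteq> 0" using that(1) by blast
    moreover have "(\<Sum>k<n. \<mu> k * f k) = 0" "(\<Sum>k<n. \<mu> k * g k) = 0"
      unfolding \<mu>_def s using that by simp_all
    ultimately show ?thesis by blast
  qed
  \<comment> \<open>The cross product of the vectors truncated to their first three
    coordinates.\<close>
  let ?x = "f 1 * g 2 - f 2 * g 1" and ?y = "f 2 * g 0 - f 0 * g 2" and ?z = "f 0 * g 1 - f 1 * g 0"
  show ?thesis
  proof (cases "?x \<noteq> 0 \<or> ?y \<noteq> 0 \<or> ?z \<noteq> 0")
    case True
    show ?thesis by (rule w[OF True]) (simp_all add: algebra_simps)
  next
    case False
    then have z: "?x = 0" "?y = 0" "?z = 0" by auto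
    \<comment> \<open>With vanishing cross product the truncated vectors are proportional, so a
      vector orthogonal to a nonzero one of them is orthogonal to both.\<close>
    then have z': "f 1 * g 2 = f 2 * g 1" "f 2 * g 0 = f 0 * g 2" "f 0 * g 1 = f 1 * g 0" by simp_all
    consider "f 0 \<noteq> 0" | "f 1 \<noteq> 0" | "f 0 = 0" "f 1 = 0" "g 0 \<noteq> 0" | "f 0 = 0" "f 1 = 0" "g 0 = 0" by blast
    then show ?thesis
    proof cases
      case 1 show ?thesis by (rule w[of "f 1" "- f 0" 0]) (use 1 z' in \<open>simp_all\<close>)
    next
      case 2 show ?thesis by (rule w[of "f 1" "- f 0" 0]) (use 2 z' in \<open>simp_all\<close>)
    next
      case 3 show ?thesis by (rule w[of "g 1" "- g 0" 0]) (use 3 z' in \<open>simp_all\<close>)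
    next
      case 4 show ?thesis by (rule w[of 1 0 0]) (use 4 in \<open>simp_all\<close>)
    qed
  qed
qed

lemma T_letters_RS:
  assumes "x \<in> T n (Suc p)" "\<And>k. k < n \<Longrightarrow> dec k x \<in> RS {i. Suc i \<in> U} p"
  shows "x \<in> RS U (Suc p)"
  by (subst T_Suc_expand[OF assms(1)], intro pm.subspace_sum subspace_RS RS_letter_mult assms(2)) auto

text \<open>Left multiplication by a nonzero linear form is injective on \<open>B\<close>. The set \<open>U\<close> of positions
  at which \<open>\<omega>\<close> is killed is arbitrary, so this covers all tensor products of components of \<open>B\<close>.\<close>

lemma linf_mult_cancel:
  assumes "x \<in> T n p" "linf n \<nu> * x \<in> RS U (Suc p)" "k < n" "\<nu> k \<noteq> 0"
  shows "x \<in> RS {i. Suc i \<in> U} p"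
  using assms
proof (induction p arbitrary: x \<nu> k U rule: less_induct)
  case (less p)
  let ?U = "{i. Suc i \<in> U}"
  obtain z where z: "z \<in> T n (p - 1)" "\<And>k. k < n \<Longrightarrow> pscale (\<nu> k) x - row k * z \<in> RS ?U p"
    using dec_RS[OF less.prems(2)] by auto
  have cancel: "x \<in> RS ?U p" if "row k * z \<in> RS ?U p"
  proof -
    have "pscale (\<nu> k) x \<in> RS ?U p"
      using pm.subspace_add[OF subspace_RS z(2)[OF less.prems(3)] that] by simp
    then have "pscale (1 / \<nu> k) (pscale (\<nu> k) x) \<in> RS ?U p" by (rule pm.subspace_scale[OF subspace_RS])
    then show ?thesis using less.prems(4) by simp
  qed
  show ?case
  proof (cases p)
    case 0
    have "linf n \<nu> * x = 0" using less.prems(2) RS_small[of "Suc p"] 0 by auto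
    then have "pscale (\<nu> k) x = 0" using dec_linf_mult[OF less.prems(3), of \<nu> x] by simp
    then show ?thesis using less.prems(4) by (auto intro: pm.subspace_0)
  next
    case (Suc p')
    \<comment> \<open>Modulo relations, \<open>pscale (\<nu> k) x\<close> equals
      \<open>row k * z\<close> for every \<open>k\<close>. Weighting these equations by
      \<open>\<mu>\<close> orthogonal to \<open>\<nu>\<close> eliminates \<open>x\<close> and leaves
      a nonzero linear form times \<open>z\<close>, to which induction applies since
      \<open>z\<close> has smaller degree.\<close>
    obtain \<mu> j where \<mu>: "j < n" "\<mu> j \<noteq> 0" "(\<Sum>k<n. \<mu> k * \<nu> k) = 0" using exists_orthogonal[of \<nu> \<nu>] by auto
    obtain i where i: "i < n" "(\<Sum>k<n. M i k * \<mu> k) \<noteq> 0" using row_comb_nonzero[of j \<mu>] \<mu> by auto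
    have "(\<Sum>k<n. pscale (\<mu> k) (pscale (\<nu> k) x - row k * z)) \<in> RS ?U p"
      by (intro pm.subspace_sum pm.subspace_scale subspace_RS z(2)) auto
    also have "(\<Sum>k<n. pscale (\<mu> k) (pscale (\<nu> k) x - row k * z))
      = pscale (\<Sum>k<n. \<mu> k * \<nu> k) x - (\<Sum>k<n. pscale (\<mu> k) (row k)) * z"
      by (simp add: pm.scale_right_diff_distrib sum_subtractf pm.scale_sum_left sum_distrib_right times_pscale_left)
    also have "\<dots> = - (linf n (\<lambda>l. \<Sum>k<n. M l k * \<mu> k) * z)" by (simp add: \<mu>(3) row_comb)
    finally have "linf n (\<lambda>l. \<Sum>k<n. M l k * \<mu> k) * z \<in> RS ?U (Suc p')"
      using pm.subspace_neg[OF subspace_RS] Suc by fastforce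
    then have "z \<in> RS {i. Suc i \<in> ?U} p'"
      using less.IH[of p' z "\<lambda>l. \<Sum>k<n. M l k * \<mu> k" ?U i] z(1) i Suc by auto
    then have "row k * z \<in> RS ?U p" using RS_row_mult[of z ?U p' k] Suc by simp
    then show ?thesis by (rule cancel)
  qed
qed

lemma row_nonzero: "\<exists>j<n. M k j \<noteq> 0" if "k < n"
  using row_comb_nonzero[of k "\<lambda>i. if i = k then 1 else 0"] that
  by (auto simp: if_distrib M_sym[of _ k] cong: if_cong)

lemma row_mult_cancel:
  assumes "x \<in> T n p" "row k * x \<in> RS U (Suc p)" "k < n"
  shows "x \<in> RS {i. Suc i \<in> U} p"
  using row_nonzero[OF assms(3)] linf_mult_cancel[of x p "M k" U] assms unfolding row_def by blast

lemma omega_mult_RS: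
  assumes "z \<in> RS {i. Suc (Suc i) \<in> U} p"
  shows "\<omega> * z \<in> RS U (Suc (Suc p))"
  unfolding omega_row sum_distrib_right mult.assoc
  by (intro pm.subspace_sum subspace_RS RS_letter_mult RS_row_mult) (use assms in auto)

lemma RS_insert: "e \<in> RS (insert i U) p \<Longrightarrow> \<exists>a b. e = a + b \<and> a \<in> RS {i} p \<and> b \<in> RS U p"
proof -
  have "rel_gens (insert i U) p = rel_gens {i} p \<union> rel_gens U p" by (auto simp: rel_gens_def)
  then show "e \<in> RS (insert i U) p \<Longrightarrow> \<exists>a b. e = a + b \<and> a \<in> RS {i} p \<and> b \<in> RS U p"
    unfolding RS_def by (auto simp: pm.span_Un)
qed

lemma RS_single_0: "a \<in> RS {0} p \<Longrightarrow> p \<ge> 2 \<Longrightarrow> \<exists>z\<in>T n (p - 2). a = \<omega> * z"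
proof -
  assume a: "a \<in> RS {0} p" and p: "p \<ge> 2"
  have "rel_gens {0} p = (\<lambda>z. \<omega> * z) ` (wmono ` words n (p - 2))"
    using p by (auto simp: rel_gens_def words_def wmono_Nil image_iff)
  then have "RS {0} p = (\<lambda>z. \<omega> * z) ` T n (p - 2)"
    unfolding RS_def T_eq_span using pmp.linear_span_image[OF plinear_times_left, of \<omega>] by simp
  then show ?thesis using a by auto
qed

text \<open>Left regularity gives this instance of distributivity for two overlapping positions: an
  \<open>\<omega> * z\<close> that is a relation without using position 0 forces \<open>z\<close>
  itself to be a relation, so it can be rewritten with positions in \<open>U\<close> alone.\<close>

lemma RS_adjacent_inter:
  assumes "x \<in> RS (insert 0 U) p" "x \<in> RS (insert 1 U) p" "0 \<notin> U" "1 \<notin> U" "p \<ge> 2"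
  shows "x \<in> RS U p"
proof -
  obtain p' where p: "p = Suc (Suc p')" using assms(5) by (auto simp: le_iff_add)
  obtain z e where x: "x = \<omega> * z + e" "z \<in> T n (p - 2)" "e \<in> RS U p"
    using RS_insert[OF assms(1)] RS_single_0[OF _ assms(5)] by metis
  have "\<omega> * z \<in> RS (insert 1 U) p"
    using pm.subspace_diff[OF subspace_RS assms(2), of e] subsetD[OF RS_mono x(3), of "insert 1 U"]
    by (simp add: x(1) subset_insertI)
  then obtain w where w: "0 \<notin> insert 1 U \<longrightarrow> w = 0"
      "\<forall>k<n. dec k (\<omega> * z) - row k * w \<in> RS {i. Suc i \<in> insert 1 U} (Suc p')"
    using dec_RS[of "\<omega> * z" "insert 1 U" "Suc p'"] unfolding p by blast
  \<comment> \<open>Position 0 is not among those killed, so the common quotient vanishes and the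
    derivatives \<open>row k * z\<close> are relations themselves.\<close>
  have "w = 0" using w(1) assms(3) by simp
  then have "row 0 * z \<in> RS {i. Suc i \<in> insert 1 U} (Suc p')" using w(2) n3 by auto
  then have "z \<in> RS {i. Suc i \<in> {i. Suc i \<in> insert 1 U}} p'"
    by (intro row_mult_cancel[of z p' 0]) (use x(2) p n3 in auto)
  also have "{i. Suc i \<in> {i. Suc i \<in> insert 1 U}} = {i. Suc (Suc i) \<in> U}" by auto
  finally have "z \<in> RS {i. Suc (Suc i) \<in> U} p'" .
  then have "\<omega> * z \<in> RS U p" using omega_mult_RS[of z U p'] p by simp
  then show ?thesis unfolding x(1) using x(3) by (rule pm.subspace_add[OF subspace_RS])
qed

end

section \<open>Reversal, right ideals and twisted central elements\<close>

definition rv :: "(nc_word \<Rightarrow>\<^sub>0 'k::field) \<Rightarrow> (nc_word \<Rightarrow>\<^sub>0 'k)"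
  where "rv = lin_ext (\<lambda>w. wmono (rev (letters w)))"

lemma plinear_rv: "plinear rv" unfolding rv_def by (rule lin_ext_linear)

lemma rv_wmono [simp]: "rv (wmono w) = wmono (rev w)"
  by (simp add: rv_def wmono_def)

lemma plinear_wmono_eqI:
  assumes "plinear f" "plinear g" "\<And>w. f (wmono w) = g (wmono w)"
  shows "f x = g x"
proof (rule plinear_eqI[OF assms(1,2)])
  fix w show "f (Poly_Mapping.single w 1) = g (Poly_Mapping.single w 1)"
    using assms(3)[of "letters w"] by (simp add: wmono_def)
qed

lemma rv_times: "rv (x * y) = rv y * rv x"
proof (rule plinear_wmono_eqI[of "\<lambda>x. rv (x * y)" "\<lambda>x. rv y * rv x" x])
  fix u
  show "rv (wmono u * y) = rv y * rv (wmono u)"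
    by (rule plinear_wmono_eqI[of "\<lambda>y. rv (wmono u * y)" "\<lambda>y. rv y * rv (wmono u)" y])
      (auto intro!: plinear_comp[OF plinear_rv] plinear_times_left plinear_comp[OF plinear_times_right] plinear_rv
        simp: wmono_mult)
qed (auto intro!: plinear_comp[OF plinear_rv] plinear_times_right plinear_comp[OF plinear_times_left] plinear_rv)

lemma rv_rv: "rv (rv x) = x"
  by (rule plinear_wmono_eqI[of "\<lambda>x. rv (rv x)" "\<lambda>x. x"]) (auto intro: plinear_comp plinear_rv plinear_id)

context quadric begin

text \<open>Symmetry of the coefficients makes reversal preserve the relations, so that statements
  about right multiplication follow from those about left multiplication.\<close>

lemma rv_omega: "rv \<omega> = \<omega>"
  unfolding omega_pairs
  by (simp add: pmp.linear_sum[OF plinear_rv] pmp.linear_scale[OF plinear_rv])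
    (subst sum.swap, simp add: M_sym)

lemma rv_RS: "x \<in> RS UNIV p \<Longrightarrow> rv x \<in> RS UNIV p"
  unfolding RS_def[of UNIV p]
proof (rule plinear_span_subset[OF plinear_rv])
  fix g assume "g \<in> rel_gens UNIV p"
  then obtain u v where g: "g = wmono u * \<omega> * wmono v" "length u + 2 + length v = p"
     "set u \<subseteq> {..<n}" "set v \<subseteq> {..<n}"
    by (auto simp: rel_gens_def)
  have "rv g = wmono (rev v) * \<omega> * wmono (rev u)"
    by (simp add: g(1) rv_times rv_omega mult.assoc)
  then show "rv g \<in> pm.span (rel_gens UNIV p)" using g RS_gen[of "rev v" UNIV "rev u" p] by (simp add: RS_def)
qed auto

text \<open>The preimage in degree \<open>p\<close> of the left ideal of B generated by the letter
  \<open>j\<close>.\<close>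

definition RA :: "nat \<Rightarrow> nat \<Rightarrow> (nc_word \<Rightarrow>\<^sub>0 'k) set"
  where "RA j p = pm.span (rel_gens UNIV p \<union> {wmono (w @ [j]) | w. w \<in> words n (p - 1) \<and> p > 0})"

lemma subspace_RA [simp, intro]: "pm.subspace (RA j p)"
  by (simp add: RA_def)

lemma RS_RA: "RS UNIV p \<subseteq> RA j p"
  unfolding RS_def RA_def by (rule pm.span_mono) auto

lemma RA_split: "e \<in> RA j p \<Longrightarrow> p > 0 \<Longrightarrow> \<exists>a\<in>RS UNIV p. \<exists>t\<in>T n (p - 1). e = a + t * wmono [j]"
proof -
  assume e: "e \<in> RA j p" and p: "p > 0"
  let ?m = "\<lambda>t :: nc_word \<Rightarrow>\<^sub>0 'k. t * wmono [j]"
  have 1: "{wmono (w @ [j]) | w. w \<in> words n (p - 1) \<and> p > 0} = ?m ` (wmono ` words n (p - 1))"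
    using p by (auto simp: image_image wmono_mult)
  have 2: "pm.span (?m ` (wmono ` words n (p - 1))) = ?m ` T n (p - 1)"
    using pmp.linear_span_image[OF plinear_times_right[of "wmono [j]"]] by (simp add: T_eq_span)
  have "pm.span (rel_gens UNIV p \<union> {wmono (w @ [j]) | w. w \<in> words n (p - 1) \<and> p > 0})
    = {x + y | x y. x \<in> RS UNIV p \<and> y \<in> ?m ` T n (p - 1)}"
    unfolding 1 pm.span_Un 2 RS_def by simp
  then show ?thesis using e unfolding RA_def by auto
qed

lemma RA_mult: "t \<in> T n p \<Longrightarrow> t * wmono [j] \<in> RA j (Suc p)"
  by (rule T_linear_subset[OF plinear_times_right, of n p]) (auto simp: wmono_mult RA_def intro: pm.span_base)

lemma RA_letter_mult:
  assumes "e \<in> RA j p" "k < n"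
  shows "wmono [k] * e \<in> RA j (Suc p)"
proof (rule plinear_span_subset[OF plinear_times_left _ _ assms(1)[unfolded RA_def]])
  fix g assume "g \<in> rel_gens UNIV p \<union> {wmono (w @ [j]) |w. w \<in> words n (p - 1) \<and> p > 0}"
  then show "wmono [k] * g \<in> RA j (Suc p)"
  proof
    assume "g \<in> rel_gens UNIV p"
    then have "g \<in> RS {i. Suc i \<in> UNIV} p" by (simp add: RS_def pm.span_base)
    then show ?thesis using RS_letter_mult[of g UNIV p k] assms(2) RS_RA by auto
  next
    assume "g \<in> {wmono (w @ [j]) |w. w \<in> words n (p - 1) \<and> p > 0}"
    then obtain w where "g = wmono (w @ [j])" "w \<in> words n (p - 1)" "p > 0" by auto
    then show ?thesis using assms(2) unfolding RA_def
      by (intro pm.span_base UnI2 CollectI exI[of _ "k # w"]) (auto simp: wmono_mult words_def)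
  qed
qed simp

lemma RA_linf_mult: "e \<in> RA j p \<Longrightarrow> linf n \<mu> * e \<in> RA j (Suc p)"
  unfolding linf_mult by (intro pm.subspace_sum pm.subspace_scale subspace_RA RA_letter_mult) auto

text \<open>As for \<open>RS\<close>; the degree is at least two, so that the cofactor
  \<open>t\<close> of a term \<open>t * wmono [j]\<close> has positive degree and the derivative
  acts on \<open>t\<close> only.\<close>

lemma dec_RA:
  assumes "e \<in> RA j (Suc (Suc p))"
  shows "\<exists>z\<in>T n p. \<forall>k<n. dec k e - row k * z \<in> RA j (Suc p)"
proof -
  obtain a t where e: "a \<in> RS UNIV (Suc (Suc p))" "t \<in> T n (Suc p)" "e = a + t * wmono [j]"
    using RA_split[OF assms] by auto
  obtain z where z: "z \<in> T n p" "\<forall>k<n. dec k a - row k * z \<in> RS {i. Suc i \<in> UNIV} (Suc p)"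
    using dec_RS[OF e(1)] by auto
  have "dec k e - row k * z \<in> RA j (Suc p)" if "k < n" for k
  proof -
    have "dec k (t * wmono [j]) = dec k t * wmono [j]"
    proof (rule T_linear_eq[OF _ _ e(2), of "\<lambda>t. dec k (t * wmono [j])" "\<lambda>t. dec k t * wmono [j]"])
      fix w assume "w \<in> words n (Suc p)"
      then show "dec k (wmono w * wmono [j]) = dec k (wmono w) * (wmono [j] :: nc_word \<Rightarrow>\<^sub>0 'k)"
        by (cases w) (auto simp: words_def wmono_mult)
    qed (auto intro!: plinear_comp[OF plinear_dec] plinear_times_right plinear_comp[OF plinear_times_right] plinear_dec)
    then have "dec k (t * wmono [j]) \<in> RA j (Suc p)" using RA_mult[OF dec_T[OF e(2)]] by simp
    moreover have "dec k a - row k * z \<in> RA j (Suc p)" using z that RS_RA by auto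
    ultimately have "(dec k a - row k * z) + dec k (t * wmono [j]) \<in> RA j (Suc p)" by (intro pm.subspace_add) auto
    then show ?thesis by (simp add: e(3) algebra_simps)
  qed
  then show ?thesis using z(1) by blast
qed

lemma dec_RA_1: "e \<in> RA j 1 \<Longrightarrow> i \<noteq> j \<Longrightarrow> dec i e = 0"
  using RA_split[of e j 1] RS_small[of 1] by (auto simp: T_0 times_pscale_left)

text \<open>In positive degrees, left multiplication by a nonzero linear form is injective on \<open>B / B a\<^sub>j\<close>.\<close>

lemma linf_mult_cancel_RA:
  assumes "j < n" "x \<in> T n (Suc p)" "linf n \<nu> * x \<in> RA j (Suc (Suc p))" "k < n" "\<nu> k \<noteq> 0"
  shows "x \<in> RA j (Suc p)"
  using assms(2-)
proof (induction p arbitrary: x \<nu> k)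
  case (0 x \<nu> k)
  then show ?case
  proof -
    obtain z where z: "z \<in> T n 0" "\<And>k. k < n \<Longrightarrow> pscale (\<nu> k) x - row k * z \<in> RA j 1"
      using dec_RA[OF "0.prems"(2)] by auto
    obtain \<zeta> where \<zeta>: "z = pscale \<zeta> 1" using z(1) T_0 by blast
    \<comment> \<open>In degree zero B modulo B \<open>wmono [j]\<close> is spanned by 1, which
      multiples of the letter \<open>j\<close> annihilate. So \<open>\<mu>\<close> is also made
      orthogonal to the row of \<open>j\<close>: the resulting form then has no coefficient at
      \<open>j\<close> and does not kill the scalar \<open>z\<close>.\<close>
    obtain \<mu> i where \<mu>: "i < n" "\<mu> i \<noteq> 0" "(\<Sum>k<n. \<mu> k * \<nu> k) = 0" "(\<Sum>k<n. \<mu> k * M j k) = 0"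
      using exists_orthogonal[of \<nu> "M j"] by auto
    obtain i where i: "i < n" "(\<Sum>k<n. M i k * \<mu> k) \<noteq> 0" using row_comb_nonzero[of i \<mu>] \<mu> by auto
    have ij: "i \<noteq> j" using i \<mu>(4) by (auto simp: mult.commute)
    have "(\<Sum>k<n. pscale (\<mu> k) (pscale (\<nu> k) x - row k * z)) \<in> RA j 1"
      by (intro pm.subspace_sum pm.subspace_scale subspace_RA z(2)) auto
    also have "(\<Sum>k<n. pscale (\<mu> k) (pscale (\<nu> k) x - row k * z))
      = pscale (\<Sum>k<n. \<mu> k * \<nu> k) x - (\<Sum>k<n. pscale (\<mu> k) (row k)) * z"
      by (simp add: pm.scale_right_diff_distrib sum_subtractf pm.scale_sum_left sum_distrib_right times_pscale_left)
    also have "\<dots> = - (linf n (\<lambda>l. \<Sum>k<n. M l k * \<mu> k) * z)" by (simp add: \<mu>(3) row_comb)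
    finally have "linf n (\<lambda>l. \<Sum>k<n. M l k * \<mu> k) * z \<in> RA j 1"
      using pm.subspace_neg[OF subspace_RA] by fastforce
    from dec_RA_1[OF this ij] have "pscale (\<Sum>k<n. M i k * \<mu> k) z = 0" using i(1) by simp
    then have "z = 0" using i(2) pm.scale_eq_0_iff by blast
    then have "pscale (\<nu> k) x \<in> RA j (Suc 0)" using z(2)[OF "0.prems"(3)] by simp
    then have "pscale (1 / \<nu> k) (pscale (\<nu> k) x) \<in> RA j (Suc 0)"
      by (rule pm.subspace_scale[OF subspace_RA])
    moreover have "pscale (1 / \<nu> k) (pscale (\<nu> k) x) = x" using "0.prems"(4) by simp
    ultimately show ?thesis by (simp only:)
  qed
next
  case (Suc p x \<nu> k)
  obtain z where z: "z \<in> T n (Suc p)" "\<And>k. k < n \<Longrightarrow> pscale (\<nu> k) x - row k * z \<in> RA j (Suc (Suc p))"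
    using dec_RA[OF Suc.prems(2)] by auto
  obtain \<mu> i where \<mu>: "i < n" "\<mu> i \<noteq> 0" "(\<Sum>k<n. \<mu> k * \<nu> k) = 0"
    using exists_orthogonal[of \<nu> \<nu>] by auto
  obtain i where i: "i < n" "(\<Sum>k<n. M i k * \<mu> k) \<noteq> 0" using row_comb_nonzero[of i \<mu>] \<mu> by auto
  have "(\<Sum>k<n. pscale (\<mu> k) (pscale (\<nu> k) x - row k * z)) \<in> RA j (Suc (Suc p))"
    by (intro pm.subspace_sum pm.subspace_scale subspace_RA z(2)) auto
  also have "(\<Sum>k<n. pscale (\<mu> k) (pscale (\<nu> k) x - row k * z))
    = pscale (\<Sum>k<n. \<mu> k * \<nu> k) x - (\<Sum>k<n. pscale (\<mu> k) (row k)) * z"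
    by (simp add: pm.scale_right_diff_distrib sum_subtractf pm.scale_sum_left sum_distrib_right times_pscale_left)
  also have "\<dots> = - (linf n (\<lambda>l. \<Sum>k<n. M l k * \<mu> k) * z)" by (simp add: \<mu>(3) row_comb)
  finally have "linf n (\<lambda>l. \<Sum>k<n. M l k * \<mu> k) * z \<in> RA j (Suc (Suc p))"
    using pm.subspace_neg[OF subspace_RA] by fastforce
  then have "z \<in> RA j (Suc p)" using Suc.IH[OF z(1) _ i(1)] i(2) by simp
  then have "row k * z \<in> RA j (Suc (Suc p))" unfolding row_def by (rule RA_linf_mult)
  then have "pscale (\<nu> k) x \<in> RA j (Suc (Suc p))"
    using pm.subspace_add[OF subspace_RA z(2)[OF Suc.prems(3)]] by fastforce
  then have "pscale (1 / \<nu> k) (pscale (\<nu> k) x) \<in> RA j (Suc (Suc p))" by (rule pm.subspace_scale[OF subspace_RA])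
  then show ?case using Suc.prems(4) by simp
qed

text \<open>If \<open>a\<^sub>l y' = s y a\<^sub>l\<close> in \<open>B\<close>, then \<open>a\<^sub>l y'\<close> vanishes in \<open>B / B a\<^sub>l\<close>, so \<open>y' \<in> B a\<^sub>l\<close>; and
  \<open>B a\<^sub>0 \<inter> B a\<^sub>1 = 0\<close> because there is a third variable.\<close>

lemma twisted_central:
  assumes y: "y \<in> T n (Suc p)" "y' \<in> T n (Suc p)"
    and comm: "\<And>l. l < n \<Longrightarrow> wmono [l] * y' - pscale s (y * wmono [l]) \<in> RS UNIV (Suc (Suc p))"
  shows "y' \<in> RS UNIV (Suc p)"
proof -
  have RA: "y' \<in> RA l (Suc p)" if l: "l < n" for l
  proof -
    have "wmono [l] * y' - pscale s (y * wmono [l]) \<in> RA l (Suc (Suc p))" using comm[OF l] RS_RA by auto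
    moreover have "pscale s (y * wmono [l]) \<in> RA l (Suc (Suc p))"
      by (intro pm.subspace_scale RA_mult y subspace_RA)
    ultimately have "wmono [l] * y' \<in> RA l (Suc (Suc p))"
      using pm.subspace_add[OF subspace_RA] by fastforce
    moreover have "(wmono [l] :: nc_word \<Rightarrow>\<^sub>0 'k) = linf n (\<lambda>i. if i = l then 1 else 0)"
      using l by (simp add: linf_def if_distrib[of "\<lambda>x. pscale x _"] cong: if_cong)
    ultimately have "linf n (\<lambda>i. if i = l then 1 else 0) * y' \<in> RA l (Suc (Suc p))" by simp
    then show ?thesis by (rule linf_mult_cancel_RA[OF l y(2) _ l]) simp
  qed
  have n: "0 < n" "1 < n" "2 < n" using n3 by auto
  obtain a t where a: "a \<in> RS UNIV (Suc p)" "t \<in> T n p" "y' = a + t * wmono [0]"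
    using RA_split[OF RA[OF n(1)]] by auto
  obtain b u where b: "b \<in> RS UNIV (Suc p)" "u \<in> T n p" "y' = b + u * wmono [1]"
    using RA_split[OF RA[OF n(2)]] by auto
  \<comment> \<open>After reversal the two expressions of \<open>y'\<close> start with the letters 0
    and 1, where left derivatives apply.\<close>
  have ra: "rv y' = rv a + wmono [0] * rv t"
    by (simp add: a(3) pmp.linear_add[OF plinear_rv] rv_times)
  have rb: "rv y' = rv b + wmono [1] * rv u"
    by (simp add: b(3) pmp.linear_add[OF plinear_rv] rv_times)
  have "wmono [0] * rv t - wmono [1] * rv u = rv b - rv a" using ra rb by (simp add: algebra_simps)
  then have "wmono [0] * rv t - wmono [1] * rv u \<in> RS UNIV (Suc p)"
    using pm.subspace_diff[OF subspace_RS rv_RS[OF b(1)] rv_RS[OF a(1)]] by simp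
  then obtain z where z: "z \<in> T n (p - 1)"
    "\<And>k. k < n \<Longrightarrow> dec k (wmono [0] * rv t - wmono [1] * rv u) - row k * z \<in> RS UNIV p"
    using dec_RS[of "wmono [0] * rv t - wmono [1] * rv u" UNIV p] by (auto simp del: dec_simps)
  \<comment> \<open>The letter 2 starts neither term, so its derivative consists of
    \<open>row 2 * z\<close> alone; cancelling the row shows that \<open>z\<close> is a relation,
    and then the derivative by 0 shows that \<open>rv t\<close> is one.\<close>
  have "row 2 * z \<in> RS UNIV p" using z(2)[OF n(3)] pm.subspace_neg[OF subspace_RS] by fastforce
  have "row 0 * z \<in> RS UNIV p"
  proof (cases p)
    case 0
    have "row 2 * z = 0" using \<open>row 2 * z \<in> RS UNIV p\<close> RS_small[of p UNIV] 0 by auto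
    then have "dec k (row 2 * z) = 0" for k by simp
    then have "pscale (M 2 k) z = 0" if "k < n" for k using dec_linf_mult[OF that] unfolding row_def by metis
    then have "z = 0" using row_nonzero[OF n(3)] pm.scale_eq_0_iff by blast
    then show ?thesis by (simp add: pm.subspace_0)
  next
    case (Suc p')
    then have "z \<in> RS UNIV p'"
      using row_mult_cancel[of z p' 2 UNIV] \<open>row 2 * z \<in> RS UNIV p\<close> z(1) n by auto
    then show ?thesis using RS_row_mult[of z UNIV p' 0] Suc by simp
  qed
  then have "rv t \<in> RS UNIV p" using pm.subspace_add[OF subspace_RS z(2)[OF n(1)]] n by fastforce
  then have "rv y' \<in> RS UNIV (Suc p)"
    unfolding ra using RS_letter_mult[of "rv t" UNIV p 0] n
    by (intro pm.subspace_add subspace_RS rv_RS a(1)) simp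
  then show ?thesis using rv_RS rv_rv by metis
qed

end

section \<open>Exactness of cubes of quotients\<close>

definition WG :: "(nat \<Rightarrow> ('x \<Rightarrow>\<^sub>0 'k::field) set) \<Rightarrow> nat set \<Rightarrow> ('x \<Rightarrow>\<^sub>0 'k) set"
  where "WG G U = pm.span (\<Union>i\<in>U. G i)"

lemma subspace_WG [simp, intro]: "pm.subspace (WG G U)"
  by (simp add: WG_def)

lemma WG_mono: "U \<subseteq> V \<Longrightarrow> WG G U \<subseteq> WG G V"
  unfolding WG_def by (rule pm.span_mono) auto

lemma WG_insert: "x \<in> WG G (insert i U) \<Longrightarrow> \<exists>a b. x = a + b \<and> a \<in> pm.span (G i) \<and> b \<in> WG G U"
proof -
  assume "x \<in> WG G (insert i U)"
  then have "x \<in> pm.span (G i \<union> (\<Union>j\<in>U. G j))" by (simp only: WG_def UN_insert)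
  then show "\<exists>a b. x = a + b \<and> a \<in> pm.span (G i) \<and> b \<in> WG G U"
    unfolding pm.span_Un WG_def by blast
qed

text \<open>\<open>S\<close> is a set of bars; removing the bar \<open>i\<close> from \<open>insert i S\<close> contributes to the \<open>S\<close>-component
  of the differential. The sign is arbitrary up to the anticommutativity that gives \<open>d \<circ> d = 0\<close>.\<close>

definition cube_sign :: "(nat set \<Rightarrow> nat \<Rightarrow> 'k::field) \<Rightarrow> nat set \<Rightarrow> bool"
  where "cube_sign \<sigma> J \<longleftrightarrow> (\<forall>S\<subseteq>J. \<forall>i\<in>J - S. \<sigma> S i * \<sigma> S i = 1 \<and>
    (\<forall>j\<in>J - S. i \<noteq> j \<longrightarrow> \<sigma> S i * \<sigma> (insert i S) j = - (\<sigma> S j * \<sigma> (insert j S) i)))"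

lemma cube_sign_square: "cube_sign \<sigma> J \<Longrightarrow> S \<subseteq> J \<Longrightarrow> i \<in> J \<Longrightarrow> i \<notin> S \<Longrightarrow> \<sigma> S i * \<sigma> S i = 1"
  unfolding cube_sign_def by simp

lemma cube_sign_anti:
  assumes "cube_sign \<sigma> J" "S \<subseteq> J" "i \<in> J" "i \<notin> S" "j \<in> J" "j \<notin> S" "i \<noteq> j"
  shows "\<sigma> S i * \<sigma> (insert i S) j = - (\<sigma> S j * \<sigma> (insert j S) i)"
proof -
  have "i \<in> J - S" "j \<in> J - S" using assms by auto
  with assms(1)[unfolded cube_sign_def, rule_format, OF assms(2)] assms(7) show ?thesis by blast
qed

definition cube_d :: "(nat set \<Rightarrow> nat \<Rightarrow> 'k::field) \<Rightarrow> nat set \<Rightarrow> (nat set \<Rightarrow> ('x \<Rightarrow>\<^sub>0 'k)) \<Rightarrow> nat set \<Rightarrow> ('x \<Rightarrow>\<^sub>0 'k)"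
  where "cube_d \<sigma> J x S = (\<Sum>i\<in>J - S. pscale (\<sigma> S i) (x (insert i S)))"

text \<open>Exactness of the cube of quotients \<open>S \<mapsto> X / WG (K \<union> (J - S))\<close>.\<close>

definition cube_exact :: "(nat \<Rightarrow> ('x \<Rightarrow>\<^sub>0 'k::field) set) \<Rightarrow> ('x \<Rightarrow>\<^sub>0 'k) set \<Rightarrow> nat set \<Rightarrow> nat set \<Rightarrow> bool"
  where "cube_exact G X J K \<longleftrightarrow> (\<forall>\<sigma> x. cube_sign \<sigma> J \<longrightarrow> (\<forall>S\<subseteq>J. x S \<in> X) \<longrightarrow>
    (\<forall>S\<subseteq>J. cube_d \<sigma> J x S \<in> WG G (K \<union> (J - S))) \<longrightarrow>
    (\<exists>y. (\<forall>S\<subseteq>J. y S \<in> X) \<and> (\<forall>S\<subseteq>J. x S - cube_d \<sigma> J y S \<in> WG G (K \<union> (J - S)))))"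

lemma cube_exactD:
  assumes "cube_exact G X J K" "cube_sign \<sigma> J" "\<And>S. S \<subseteq> J \<Longrightarrow> x S \<in> X"
    "\<And>S. S \<subseteq> J \<Longrightarrow> cube_d \<sigma> J x S \<in> WG G (K \<union> (J - S))"
  obtains y where "\<And>S. S \<subseteq> J \<Longrightarrow> y S \<in> X" "\<And>S. S \<subseteq> J \<Longrightarrow> x S - cube_d \<sigma> J y S \<in> WG G (K \<union> (J - S))"
proof -
  have "\<forall>S\<subseteq>J. x S \<in> X" "\<forall>S\<subseteq>J. cube_d \<sigma> J x S \<in> WG G (K \<union> (J - S))"
    using assms(3,4) by simp_all
  with assms(1)[unfolded cube_exact_def, rule_format, OF assms(2), of x] that show ?thesis by blast
qed

text \<open>The summand is antisymmetric in the two removed bars, so the double sum equals its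
  negative and vanishes since 2 is invertible.\<close>

lemma cube_dd:
  fixes y :: "nat set \<Rightarrow> ('x \<Rightarrow>\<^sub>0 'k::field_char_0)"
  assumes "cube_sign \<sigma> J" "finite J" "S \<subseteq> J"
  shows "cube_d \<sigma> J (cube_d \<sigma> J y) S = 0"
proof -
  define f where "f i j = pscale (\<sigma> S i * \<sigma> (insert i S) j) (y (insert j (insert i S)))" for i j
  let ?A = "J - S"
  have "cube_d \<sigma> J (cube_d \<sigma> J y) S = (\<Sum>i\<in>?A. \<Sum>j\<in>J - insert i S. f i j)"
    by (simp add: cube_d_def f_def pm.scale_sum_right)
  also have "\<dots> = (\<Sum>i\<in>?A. \<Sum>j\<in>?A. if i = j then 0 else f i j)" (is "_ = ?s")
  proof (rule sum.cong[OF refl])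
    fix i assume "i \<in> ?A"
    show "(\<Sum>j\<in>J - insert i S. f i j) = (\<Sum>j\<in>?A. if i = j then 0 else f i j)"
      by (rule sum.mono_neutral_cong_left) (use assms(2) in auto)
  qed
  finally have s: "cube_d \<sigma> J (cube_d \<sigma> J y) S = ?s" .
  have "?s = (\<Sum>i\<in>?A. \<Sum>j\<in>?A. - (if j = i then 0 else f j i))"
  proof (intro sum.cong refl)
    fix i j assume ij: "i \<in> ?A" "j \<in> ?A"
    show "(if i = j then 0 else f i j) = - (if j = i then 0 else f j i)"
    proof (cases "i = j")
      case False
      then have "\<sigma> S i * \<sigma> (insert i S) j = - (\<sigma> S j * \<sigma> (insert j S) i)"
        using assms(1,3) ij unfolding cube_sign_def by blast
      then show ?thesis using False by (simp add: f_def insert_commute)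
    qed simp
  qed
  also have "\<dots> = - ?s" by (subst sum.swap) (simp add: sum_negf)
  finally have "?s + ?s = 0" by (rule iffD1[OF eq_neg_iff_add_eq_0])
  then have "pscale (1 + 1) ?s = 0" by (simp only: pm.scale_left_distrib pm.scale_one)
  then show ?thesis unfolding s pm.scale_eq_0_iff by simp
qed

text \<open>The cube is the cone of the map between its faces with and without a bar at
  \<open>k\<close>. Solve first on the face with the bar, correct \<open>x\<close>, and observe that
  the rest is a cycle on the other face, where \<open>k\<close> has become a killed gap. Exactness
  is quantified over all signs because the faces carry induced ones.\<close>

lemma cube_exact_insert:
  fixes G :: "nat \<Rightarrow> ('x \<Rightarrow>\<^sub>0 'k::field_char_0) set"
  assumes X: "pm.subspace X" and J: "finite J" "k \<notin> J"
    and ex1: "cube_exact G X J K" and ex0: "cube_exact G X J (insert k K)"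
  shows "cube_exact G X (insert k J) K"
  unfolding cube_exact_def
proof (intro allI impI)
  fix \<sigma> :: "nat set \<Rightarrow> nat \<Rightarrow> 'k" and x :: "nat set \<Rightarrow> ('x \<Rightarrow>\<^sub>0 'k)"
  let ?J = "insert k J"
  assume sg: "cube_sign \<sigma> ?J" and xX: "\<forall>S\<subseteq>?J. x S \<in> X"
    and dx: "\<forall>S\<subseteq>?J. cube_d \<sigma> ?J x S \<in> WG G (K \<union> (?J - S))"
  define \<sigma>1 where "\<sigma>1 S i = \<sigma> (insert k S) i" for S i
  have sg1: "cube_sign \<sigma>1 J"
    unfolding cube_sign_def \<sigma>1_def
  proof (intro allI impI ballI conjI)
    fix S i assume "S \<subseteq> J" "i \<in> J - S"
    then have 1: "insert k S \<subseteq> ?J" "i \<in> ?J - insert k S" using J(2) by auto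
    show "\<sigma> (insert k S) i * \<sigma> (insert k S) i = 1" using sg 1 unfolding cube_sign_def by blast
    fix j assume "j \<in> J - S" and ij: "i \<noteq> j"
    then have "j \<in> ?J - insert k S" using J(2) by auto
    then have "\<sigma> (insert k S) i * \<sigma> (insert i (insert k S)) j = - (\<sigma> (insert k S) j * \<sigma> (insert j (insert k S)) i)"
      using sg 1 ij unfolding cube_sign_def by blast
    then show "\<sigma> (insert k S) i * \<sigma> (insert k (insert i S)) j = - (\<sigma> (insert k S) j * \<sigma> (insert k (insert j S)) i)"
      by (simp add: insert_commute)
  qed
  have sg0: "cube_sign \<sigma> J" using sg unfolding cube_sign_def by blast
  have d1: "cube_d \<sigma> ?J z (insert k S) = cube_d \<sigma>1 J (\<lambda>S. z (insert k S)) S" if "S \<subseteq> J" for S and z :: "nat set \<Rightarrow> ('x \<Rightarrow>\<^sub>0 'k)"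
  proof -
    have "?J - insert k S = J - S" using that J(2) by auto
    then show ?thesis by (simp add: cube_d_def \<sigma>1_def insert_commute)
  qed
  have d0: "cube_d \<sigma> ?J z S = cube_d \<sigma> J z S + pscale (\<sigma> S k) (z (insert k S))" if "S \<subseteq> J" for S and z :: "nat set \<Rightarrow> ('x \<Rightarrow>\<^sub>0 'k)"
  proof -
    have "?J - S = insert k (J - S)" using that J(2) by auto
    then show ?thesis using J by (simp add: cube_d_def)
  qed
  have W1: "K \<union> (?J - insert k S) = K \<union> (J - S)" and W0: "K \<union> (?J - S) = insert k K \<union> (J - S)" if "S \<subseteq> J" for S
    using that J(2) by auto
  obtain y1 where y1: "\<And>S. S \<subseteq> J \<Longrightarrow> y1 S \<in> X"
    "\<And>S. S \<subseteq> J \<Longrightarrow> x (insert k S) - cube_d \<sigma>1 J y1 S \<in> WG G (K \<union> (J - S))"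
  proof (rule cube_exactD[OF ex1 sg1, of "\<lambda>S. x (insert k S)"])
    fix S assume S: "S \<subseteq> J"
    then have k: "insert k S \<subseteq> ?J" by auto
    show "x (insert k S) \<in> X" using xX k by simp
    show "cube_d \<sigma>1 J (\<lambda>S. x (insert k S)) S \<in> WG G (K \<union> (J - S))"
      using dx[rule_format, OF k] unfolding d1[OF S] W1[OF S] .
  qed (rule that)
  \<comment> \<open>The solution on the face with a bar at \<open>k\<close>, extended by zero to the
    other face.\<close>
  define z where "z S = (if k \<in> S then y1 (S - {k}) else 0)" for S
  define x' where "x' S = x S - cube_d \<sigma> ?J z S" for S
  have minus_k: "insert k S - {k} = S" if "S \<subseteq> J" for S using that J(2) by auto
  have z1: "z (insert k S) = y1 S" if "S \<subseteq> J" for S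
    by (simp add: z_def minus_k[OF that])
  have dz1: "cube_d \<sigma> ?J z (insert k S) = cube_d \<sigma>1 J y1 S" if "S \<subseteq> J" for S
    by (rule trans[OF d1[OF that]]) (use that z1 in \<open>auto simp: cube_d_def intro!: sum.cong\<close>)
  have z0: "z S = 0" if "S \<subseteq> J" for S using that J(2) by (auto simp: z_def)
  have dz0: "cube_d \<sigma> ?J z S = pscale (\<sigma> S k) (y1 S)" if "S \<subseteq> J" for S
  proof -
    have "cube_d \<sigma> J z S = 0" unfolding cube_d_def using that z0 by (intro sum.neutral) auto
    then show ?thesis using d0[OF that] z1[OF that] by simp
  qed
  have x'X: "x' S \<in> X" if "S \<subseteq> J" for S
    unfolding x'_def dz0[OF that] using xX y1(1) that
    by (intro pm.subspace_diff[OF X] pm.subspace_scale[OF X]) auto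
  have dx': "cube_d \<sigma> J x' S \<in> WG G (insert k K \<union> (J - S))" if S: "S \<subseteq> J" for S
  proof -
    have "cube_d \<sigma> ?J x' S = cube_d \<sigma> ?J x S - cube_d \<sigma> ?J (cube_d \<sigma> ?J z) S"
      by (simp add: cube_d_def[of \<sigma> ?J] x'_def pm.scale_right_diff_distrib sum_subtractf)
    also have "cube_d \<sigma> ?J (cube_d \<sigma> ?J z) S = 0" using cube_dd[OF sg] J S by auto
    finally have "cube_d \<sigma> ?J x' S = cube_d \<sigma> ?J x S" by simp
    moreover have "S \<subseteq> ?J" using S by auto
    ultimately have "cube_d \<sigma> ?J x' S \<in> WG G (insert k K \<union> (J - S))"
      using dx[rule_format, of S] unfolding W0[OF S] by simp
    moreover have "pscale (\<sigma> S k) (x' (insert k S)) \<in> WG G (insert k K \<union> (J - S))"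
    proof (rule pm.subspace_scale[OF subspace_WG])
      have "x' (insert k S) \<in> WG G (K \<union> (J - S))" using y1(2)[OF S] by (simp add: x'_def dz1[OF S])
      then show "x' (insert k S) \<in> WG G (insert k K \<union> (J - S))" using WG_mono[of "K \<union> (J - S)" "insert k K \<union> (J - S)" G] by auto
    qed
    ultimately have "cube_d \<sigma> ?J x' S - pscale (\<sigma> S k) (x' (insert k S)) \<in> WG G (insert k K \<union> (J - S))"
      by (rule pm.subspace_diff[OF subspace_WG])
    then show ?thesis by (simp add: d0[OF S])
  qed
  obtain y0 where y0: "\<And>S. S \<subseteq> J \<Longrightarrow> y0 S \<in> X"
    "\<And>S. S \<subseteq> J \<Longrightarrow> x' S - cube_d \<sigma> J y0 S \<in> WG G (insert k K \<union> (J - S))"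
    by (rule cube_exactD[OF ex0 sg0, of x'])(use x'X dx' in auto)
  define y where "y S = (if k \<in> S then y1 (S - {k}) else y0 S)" for S
  have yk: "y (insert k S) = y1 S" if "S \<subseteq> J" for S
    by (simp add: y_def minus_k[OF that])
  have yn: "y S = y0 S" if "S \<subseteq> J" for S using that J(2) by (auto simp: y_def)
  have goal1: "y (insert k S) \<in> X \<and> x (insert k S) - cube_d \<sigma> ?J y (insert k S) \<in> WG G (K \<union> (?J - insert k S))"
    if S: "S \<subseteq> J" for S
  proof -
    have "cube_d \<sigma> ?J y (insert k S) = cube_d \<sigma>1 J y1 S"
      by (rule trans[OF d1[OF S]]) (use S yk in \<open>auto simp: cube_d_def intro!: sum.cong\<close>)
    then show ?thesis using y1 S W1[OF S] yk[OF S] by simp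
  qed
  have goal0: "y S \<in> X \<and> x S - cube_d \<sigma> ?J y S \<in> WG G (K \<union> (?J - S))" if S: "S \<subseteq> J" for S
  proof -
    have "cube_d \<sigma> J y S = cube_d \<sigma> J y0 S"
      using S yn unfolding cube_d_def by (intro sum.cong) auto
    then have "x S - cube_d \<sigma> ?J y S = x' S - cube_d \<sigma> J y0 S"
      using yk[OF S] by (simp add: d0[OF S, of y] x'_def dz0[OF S])
    then show ?thesis using y0 S W0[OF S] yn[OF S] by simp
  qed
  have "y S \<in> X \<and> x S - cube_d \<sigma> ?J y S \<in> WG G (K \<union> (?J - S))" if "S \<subseteq> ?J" for S
  proof (cases "k \<in> S")
    case True
    then have "S = insert k (S - {k})" "S - {k} \<subseteq> J" using that by auto
    then show ?thesis using goal1[of "S - {k}"] by metis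
  next
    case False
    then show ?thesis using goal0[of S] that by auto
  qed
  then show "\<exists>y. (\<forall>S\<subseteq>?J. y S \<in> X) \<and> (\<forall>S\<subseteq>?J. x S - cube_d \<sigma> ?J y S \<in> WG G (K \<union> (?J - S)))"
    by blast
qed

text \<open>For a square, injectivity at the top vertex is the hypothesis on intersections,
  exactness in the middle holds because the relation space at the bottom is the sum of the two side
  ones, and surjectivity onto the bottom is clear.\<close>

lemma cube_exact_pair:
  fixes G :: "nat \<Rightarrow> ('x \<Rightarrow>\<^sub>0 'k::field) set"
  assumes X: "pm.subspace X" and GX: "G j \<subseteq> X" and ij: "i \<noteq> j"
    and inter: "\<And>e. e \<in> WG G (insert i K) \<Longrightarrow> e \<in> WG G (insert j K) \<Longrightarrow> e \<in> WG G K"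
  shows "cube_exact G X {i, j} K"
  unfolding cube_exact_def
proof (intro allI impI)
  fix \<sigma> :: "nat set \<Rightarrow> nat \<Rightarrow> 'k" and x :: "nat set \<Rightarrow> ('x \<Rightarrow>\<^sub>0 'k)"
  assume sg: "cube_sign \<sigma> {i, j}" and xX: "\<forall>S\<subseteq>{i, j}. x S \<in> X"
    and dx: "\<forall>S\<subseteq>{i, j}. cube_d \<sigma> {i, j} x S \<in> WG G (K \<union> ({i, j} - S))"
  define a b s t where "a = \<sigma> {} i" and "b = \<sigma> {} j" and "s = \<sigma> {i} j" and "t = \<sigma> {j} i"
  have sq: "a * a = 1" "b * b = 1" "s * s = 1" "t * t = 1"
    using cube_sign_square[OF sg, of "{}" i] cube_sign_square[OF sg, of "{}" j]
      cube_sign_square[OF sg, of "{i}" j] cube_sign_square[OF sg, of "{j}" i] ij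
    by (simp_all add: a_def b_def s_def t_def)
  have anti: "a * s = - (b * t)"
    using cube_sign_anti[OF sg, of "{}" i j] ij by (simp add: a_def b_def s_def t_def)
  have diffs: "{i, j} - {} = {i, j}" "{i, j} - {i} = {j}" "{i, j} - {j} = {i}" "{i, j} - {i, j} = {}" using ij by auto
  have ins: "{j, i} = {i, j}" by auto
  have d: "cube_d \<sigma> {i, j} z {} = pscale a (z {i}) + pscale b (z {j})" "cube_d \<sigma> {i, j} z {i} = pscale s (z {i, j})"
    "cube_d \<sigma> {i, j} z {j} = pscale t (z {i, j})" "cube_d \<sigma> {i, j} z {i, j} = 0" for z :: "nat set \<Rightarrow> ('x \<Rightarrow>\<^sub>0 'k)"
    using ij by (auto simp: cube_d_def diffs ins a_def b_def s_def t_def)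
  have K: "K \<union> {i, j} = insert i (insert j K)" "K \<union> {j} = insert j K" "K \<union> {i} = insert i K" by auto
  have dx0: "pscale a (x {i}) + pscale b (x {j}) \<in> WG G (insert i (insert j K))"
    using dx[rule_format, of "{}"] unfolding d diffs K by simp
  have "pscale s (x {i, j}) \<in> WG G (insert j K)" using dx[rule_format, of "{i}"] unfolding d diffs K by simp
  then have "pscale s (pscale s (x {i, j})) \<in> WG G (insert j K)" by (rule pm.subspace_scale[OF subspace_WG])
  then have 1: "x {i, j} \<in> WG G (insert j K)" by (simp add: sq)
  have "pscale t (x {i, j}) \<in> WG G (insert i K)" using dx[rule_format, of "{j}"] unfolding d diffs K by simp
  then have "pscale t (pscale t (x {i, j})) \<in> WG G (insert i K)" by (rule pm.subspace_scale[OF subspace_WG])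
  then have 2: "x {i, j} \<in> WG G (insert i K)" by (simp add: sq)
  have xij: "x {i, j} \<in> WG G K" by (rule inter[OF 2 1])
  obtain r w where rw: "pscale a (x {i}) + pscale b (x {j}) = r + w" "r \<in> pm.span (G j)" "w \<in> WG G (insert i K)"
    using WG_insert[OF dx0[unfolded insert_commute[of i j K]]] by metis
  have rX: "r \<in> X" using rw(2) pm.span_minimal[OF GX X] by auto
  have rW: "r \<in> WG G (insert j K)" using rw(2) subsetD[OF pm.span_mono[of "G j" "\<Union>i\<in>insert j K. G i"]]
    unfolding WG_def by blast
  \<comment> \<open>Chosen so that the component at \<open>{i}\<close> is hit up to a multiple of
    \<open>r\<close>, which is a relation there; the anticommutation of the signs then turns the
    error at \<open>{j}\<close> into a multiple of \<open>w\<close>.\<close>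
  define y0 where "y0 = pscale s (x {i} - pscale a r)"
  define y where "y S = (if S = {i, j} then y0 else if S = {i} then pscale a (x {}) else 0)" for S
  have nij: "{i} \<noteq> {i, j}" "{j} \<noteq> {i, j}" "{} \<noteq> {i, j}" "{i} \<noteq> {j}" using ij by auto
  have yX: "\<forall>S\<subseteq>{i, j}. y S \<in> X"
  proof (intro allI impI)
    fix S
    have "x {i} \<in> X" "x {} \<in> X" using xX by auto
    then have "y0 \<in> X" "pscale a (x {}) \<in> X"
      unfolding y0_def by (auto intro: pm.subspace_scale[OF X] pm.subspace_diff[OF X] rX simp del: pm.scale_right_diff_distrib)
    then show "y S \<in> X" by (simp add: y_def pm.subspace_0[OF X])
  qed
  have e0: "x {} - cube_d \<sigma> {i, j} y {} = 0" using nij by (simp add: d y_def sq)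
  have e1: "x {i} - cube_d \<sigma> {i, j} y {i} = pscale a r" by (simp add: d y_def y0_def sq)
  have "t * s = (b * b) * (t * s)" by (simp add: sq)
  also have "\<dots> = b * s * (b * t)" by (simp add: algebra_simps)
  also have "\<dots> = b * s * - (a * s)" using anti by simp
  also have "\<dots> = - (a * b * (s * s))" by (simp add: algebra_simps)
  finally have ts: "t * s = - (a * b)" by (simp add: sq)
  have bb: "x {j} = pscale b (pscale b (x {j}))" by (simp add: sq)
  have "x {j} - cube_d \<sigma> {i, j} y {j} = x {j} - pscale (t * s) (x {i} - pscale a r)"
    by (simp add: d y_def y0_def)
  also have "\<dots> = x {j} + pscale b (pscale a (x {i} - pscale a r))"
    by (simp only: ts pm.scale_minus_left diff_minus_eq_add pm.scale_scale mult.commute[of b a])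
  also have "pscale a (x {i} - pscale a r) = pscale a (x {i}) - r"
    by (simp add: pm.scale_right_diff_distrib sq)
  also have "x {j} + pscale b (pscale a (x {i}) - r) = pscale b (pscale a (x {i}) + pscale b (x {j}) - r)"
    by (subst (1) bb) (simp add: pm.scale_right_distrib pm.scale_right_diff_distrib del: pm.scale_scale)
  also have "\<dots> = pscale b w" using rw(1) by simp
  finally have e2: "x {j} - cube_d \<sigma> {i, j} y {j} = pscale b w" .
  have e3: "x {i, j} - cube_d \<sigma> {i, j} y {i, j} = x {i, j}" by (simp add: d)
  have e: "x S - cube_d \<sigma> {i, j} y S \<in> WG G (K \<union> ({i, j} - S))" if S: "S \<subseteq> {i, j}" for S
  proof -
    consider "S = {}" | "S = {i}" | "S = {j}" | "S = {i, j}" using S by blast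
    then show ?thesis
    proof cases
      case 1 show ?thesis unfolding 1 e0 by (rule pm.subspace_0[OF subspace_WG])
    next
      case 2 show ?thesis unfolding 2 e1 diffs K by (rule pm.subspace_scale[OF subspace_WG rW])
    next
      case 3 show ?thesis unfolding 3 e2 diffs K by (rule pm.subspace_scale[OF subspace_WG rw(3)])
    next
      case 4 show ?thesis unfolding 4 e3 diffs using xij by simp
    qed
  qed
  show "\<exists>y. (\<forall>S\<subseteq>{i, j}. y S \<in> X) \<and> (\<forall>S\<subseteq>{i, j}. x S - cube_d \<sigma> {i, j} y S \<in> WG G (K \<union> ({i, j} - S)))"
    by (rule exI[of _ y], rule conjI, rule yX, intro allI impI, rule e)
qed

section \<open>The cube of cyclic words\<close>

lemma plinear_funpow:
  fixes f :: "('x \<Rightarrow>\<^sub>0 'k::field) \<Rightarrow> ('x \<Rightarrow>\<^sub>0 'k)"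
  shows "plinear f \<Longrightarrow> plinear (f ^^ k)"
proof (induction k)
  case 0 show ?case using plinear_id by (simp only: funpow.simps id_def)
next
  case (Suc k)
  then show ?case using plinear_comp[of f "f ^^ k"] by (simp only: funpow.simps comp_def)
qed

definition rotl :: "(nc_word \<Rightarrow>\<^sub>0 'k::field) \<Rightarrow> (nc_word \<Rightarrow>\<^sub>0 'k)"
  where "rotl = lin_ext (\<lambda>w. wmono (rotate1 (letters w)))"

lemma plinear_rotl: "plinear rotl" unfolding rotl_def by (rule lin_ext_linear)

lemma rotl_wmono [simp]: "rotl (wmono w) = wmono (rotate1 w)"
  by (simp add: rotl_def wmono_def)

lemma rotl_letter_mult: "rotl (wmono [a] * x) = x * wmono [a]"
  by (rule plinear_wmono_eqI[of "\<lambda>x. rotl (wmono [a] * x)" "\<lambda>x. x * wmono [a]"])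
    (auto intro!: plinear_comp[OF plinear_rotl] plinear_times_left plinear_times_right simp: wmono_mult)

lemma rotl_T: "x \<in> T n p \<Longrightarrow> rotl x \<in> T n p"
  by (rule T_linear_subset[OF plinear_rotl, of n p]) (auto intro!: wmono_in_T simp: words_def)

lemma rotl_power_wmono: "(rotl ^^ k) (wmono w) = wmono (rotate k w)"
  by (induction k) (simp_all add: rotate_def)

lemma rotl_power_id: "x \<in> T n q \<Longrightarrow> (rotl ^^ q) x = x"
proof (rule T_linear_eq[of "rotl ^^ q" "\<lambda>x. x" x n q])
  fix w assume "w \<in> words n q"
  then show "(rotl ^^ q) (wmono w) = (wmono w :: nc_word \<Rightarrow>\<^sub>0 'a)"
    using rotate_id[where xs = w] by (simp add: rotl_power_wmono words_def)
qed (auto intro: plinear_funpow plinear_rotl plinear_id)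

text \<open>The right derivative by the letter \<open>l\<close>: it strips a final
  \<open>l\<close>.\<close>

definition decl :: "nat \<Rightarrow> (nc_word \<Rightarrow>\<^sub>0 'k::field) \<Rightarrow> (nc_word \<Rightarrow>\<^sub>0 'k)"
  where "decl l x = rv (dec l (rv x))"

lemma plinear_decl: "plinear (decl l)"
  unfolding decl_def by (intro plinear_comp[OF plinear_rv] plinear_comp[OF plinear_dec] plinear_rv)

lemma decl_mult_letter: "decl l (x * wmono [k]) = (if k = l then x else 0)"
  by (simp add: decl_def rv_times rv_rv pmp.linear_0[OF plinear_rv])

context quadric begin

text \<open>The letter relations, in the word of length \<open>q\<close> written around a circle, between the
  letters \<open>j - 1\<close> and \<open>j\<close>.\<close>

definition cyc_gens :: "nat \<Rightarrow> nat \<Rightarrow> (nc_word \<Rightarrow>\<^sub>0 'k) set"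
  where "cyc_gens q j = (if j = 0 then rotl ` rel_gens {0} q else rel_gens {j - 1} q)"

lemma omega_row': "\<omega> = (\<Sum>l<n. row l * wmono [l])"
  unfolding omega_pairs row_def linf_def
  by (subst sum.swap) (simp add: sum_distrib_right times_pscale_left wmono_mult M_sym)

lemma rotl_omega_mult: "rotl (\<omega> * z) = (\<Sum>k<n. row k * z * wmono [k])"
  by (simp add: omega_row sum_distrib_right mult.assoc pmp.linear_sum[OF plinear_rotl] rotl_letter_mult)

lemma rotl_rotl_omega_mult: "rotl (rotl (\<omega> * z)) = z * \<omega>"
proof -
  have "rotl (rotl (\<omega> * z)) = (\<Sum>k<n. \<Sum>l<n. pscale (M k l) (z * wmono [k] * wmono [l]))"
    by (simp add: rotl_omega_mult row_def linf_mult sum_distrib_right times_pscale_left mult.assoc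
        pmp.linear_sum[OF plinear_rotl] pmp.linear_scale[OF plinear_rotl] rotl_letter_mult)
  also have "\<dots> = z * \<omega>"
    by (simp add: omega_pairs sum_distrib_left times_pscale_right mult.assoc wmono_mult)
  finally show ?thesis .
qed

lemma rel_gensI: "x = wmono u * \<omega> * wmono v \<Longrightarrow> length u \<in> U \<Longrightarrow> length u + 2 + length v = p \<Longrightarrow>
    set u \<subseteq> {..<n} \<Longrightarrow> set v \<subseteq> {..<n} \<Longrightarrow> x \<in> rel_gens U p"
  unfolding rel_gens_def by blast

lemma rel_gens_T: "rel_gens U p \<subseteq> T n p"
  using RS_T[of U p] pm.span_superset[of "rel_gens U p"] by (auto simp: RS_def)

lemma cyc_gens_T: "cyc_gens q j \<subseteq> T n q"
  by (auto simp: cyc_gens_def intro!: rotl_T intro: subsetD[OF rel_gens_T])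

text \<open>Rotation lowers the number of every gap by one modulo \<open>q\<close>. For the gap
  across the ends this means that two rotations carry a leading \<open>\<omega>\<close> to the end
  of the word.\<close>

lemma rotl_cyc_gens:
  assumes "x \<in> cyc_gens q (Suc j mod q)" "j < q" "q \<ge> 2"
  shows "rotl x \<in> cyc_gens q j"
proof (cases "Suc j = q")
  case True
  then obtain y v where y: "x = rotl y" "y = wmono [] * \<omega> * wmono v" "2 + length v = q" "set v \<subseteq> {..<n}"
    using assms(1) by (auto simp: cyc_gens_def rel_gens_def)
  have "rotl x = wmono v * \<omega> * wmono []"
    using rotl_rotl_omega_mult[of "wmono v"] y by (simp add: wmono_Nil)
  then show ?thesis using y(3,4) True assms(3)
    by (auto simp: cyc_gens_def intro!: rel_gensI[of _ v "[]"])
next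
  case False
  then have x: "x \<in> rel_gens {j} q" using assms by (simp add: cyc_gens_def)
  show ?thesis
  proof (cases j)
    case 0 then show ?thesis using x by (simp add: cyc_gens_def)
  next
    case (Suc i)
    then obtain a u v where uv: "x = wmono (a # u) * \<omega> * wmono v" "length u = i" "Suc i + 2 + length v = q"
      "set (a # u) \<subseteq> {..<n}" "set v \<subseteq> {..<n}"
      using x by (auto simp: rel_gens_def length_Suc_conv)
    have "x = wmono [a] * (wmono u * \<omega> * wmono v)"
      unfolding uv(1) by (simp add: wmono_mult flip: mult.assoc)
    then have "rotl x = wmono u * \<omega> * wmono (v @ [a])" by (simp add: rotl_letter_mult mult.assoc wmono_mult)
    then show ?thesis using uv Suc
      by (auto simp: cyc_gens_def intro!: rel_gensI[of _ u "v @ [a]"])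
  qed
qed

lemma rotl_power_cyc_gens:
  assumes "x \<in> cyc_gens q ((j + k) mod q)" "q \<ge> 2"
  shows "(rotl ^^ k) x \<in> cyc_gens q (j mod q)"
  using assms(1)
proof (induction k arbitrary: x)
  case (Suc k)
  have "x \<in> cyc_gens q (Suc ((j + k) mod q) mod q)" using Suc.prems by (simp add: mod_Suc_eq)
  then have "rotl x \<in> cyc_gens q ((j + k) mod q)" by (rule rotl_cyc_gens) (use assms(2) in auto)
  then show ?case using Suc.IH by (simp add: funpow_swap1)
qed simp

lemma rotl_power_WG:
  assumes "x \<in> WG (cyc_gens q) K" "q \<ge> 2" "K \<subseteq> {..<q}" "\<And>i. i \<in> K \<Longrightarrow> \<exists>j\<in>K'. j < q \<and> i = (j + k) mod q"
  shows "(rotl ^^ k) x \<in> WG (cyc_gens q) K'"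
proof (rule plinear_span_subset[OF plinear_funpow[OF plinear_rotl] _ subspace_WG assms(1)[unfolded WG_def]])
  fix g assume "g \<in> (\<Union>i\<in>K. cyc_gens q i)"
  then obtain i where i: "i \<in> K" "g \<in> cyc_gens q i" by auto
  then obtain j where j: "j \<in> K'" "j < q" "i = (j + k) mod q" using assms(4) by blast
  then have "(rotl ^^ k) g \<in> cyc_gens q j" using rotl_power_cyc_gens[of g q j k] i assms(2) by simp
  then show "(rotl ^^ k) g \<in> WG (cyc_gens q) K'" unfolding WG_def using j(1) by (intro pm.span_base) auto
qed

text \<open>If the gap across the ends is not killed, the circle may be cut there; gap
  \<open>Suc i\<close> is position \<open>i\<close> of the linear word.\<close>

lemma WG_linear: "0 \<notin> K \<Longrightarrow> WG (cyc_gens q) K = RS {i. Suc i \<in> K} q"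
proof -
  assume K: "0 \<notin> K"
  have "(\<Union>j\<in>K. cyc_gens q j) = rel_gens {i. Suc i \<in> K} q"
  proof (intro equalityI subsetI)
    fix x assume "x \<in> (\<Union>j\<in>K. cyc_gens q j)"
    then obtain j where "j \<in> K" "x \<in> cyc_gens q j" by auto
    then show "x \<in> rel_gens {i. Suc i \<in> K} q" using K by (cases j) (auto simp: cyc_gens_def rel_gens_def)
  next
    fix x assume "x \<in> rel_gens {i. Suc i \<in> K} q"
    then obtain u v where "x = wmono u * \<omega> * wmono v" "Suc (length u) \<in> K" "length u + 2 + length v = q"
      "set u \<subseteq> {..<n}" "set v \<subseteq> {..<n}" by (auto simp: rel_gens_def)
    then have "x \<in> cyc_gens q (Suc (length u))" by (auto simp: cyc_gens_def rel_gens_def)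
    then show "x \<in> (\<Union>j\<in>K. cyc_gens q j)" using \<open>Suc (length u) \<in> K\<close> by blast
  qed
  then show ?thesis by (simp add: WG_def RS_def)
qed

lemma WG_T: "WG (cyc_gens q) K \<subseteq> T n q"
  unfolding WG_def by (rule pm.span_minimal) (use cyc_gens_T in auto)

text \<open>Rotate the open gap \<open>f\<close> to the ends of the word. The next two gaps become
  the positions 0 and 1 of a linear word, where \<open>RS_adjacent_inter\<close> applies.\<close>

lemma WG_adjacent_inter:
  assumes q: "q \<ge> 3" and f: "f < q" and K: "K \<subseteq> {..<q}" "f \<notin> K" "(f + 1) mod q \<notin> K" "(f + 2) mod q \<notin> K"
    and x: "x \<in> WG (cyc_gens q) (insert ((f + 1) mod q) K)" "x \<in> WG (cyc_gens q) (insert ((f + 2) mod q) K)"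
  shows "x \<in> WG (cyc_gens q) K"
proof -
  define K' where "K' = {j. j < q \<and> (j + f) mod q \<in> K}"
  define y where "y = (rotl ^^ f) x"
  have rot: "\<exists>j<q. i = (j + f) mod q" if "i < q" for i
  proof (cases "f \<le> i")
    case True then show ?thesis using that by (intro exI[of _ "i - f"]) auto
  next
    case False then show ?thesis using that f by (intro exI[of _ "i + q - f"]) (auto simp: mod_if)
  qed
  have KK': "\<exists>j\<in>K'. j < q \<and> i = (j + f) mod q" if "i \<in> K" for i
    using rot[of i] that K(1) by (auto simp: K'_def)
  have n0: "0 \<notin> K'" "1 \<notin> K'" "2 \<notin> K'" using K f by (auto simp: K'_def add.commute)
  have y1: "y \<in> WG (cyc_gens q) (insert 1 K')"
    unfolding y_def
  proof (rule rotl_power_WG[OF x(1)])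
    fix i assume "i \<in> insert ((f + 1) mod q) K"
    then show "\<exists>j\<in>insert 1 K'. j < q \<and> i = (j + f) mod q" using KK'[of i] q by (auto simp: add.commute)
  qed (use q K in auto)
  have y2: "y \<in> WG (cyc_gens q) (insert 2 K')"
    unfolding y_def
  proof (rule rotl_power_WG[OF x(2)])
    fix i assume "i \<in> insert ((f + 2) mod q) K"
    then show "\<exists>j\<in>insert 2 K'. j < q \<and> i = (j + f) mod q" using KK'[of i] q by (auto simp: add.commute)
  qed (use q K in auto)
  have "{i. Suc i \<in> insert 1 K'} = insert 0 {i. Suc i \<in> K'}" "{i. Suc i \<in> insert 2 K'} = insert 1 {i. Suc i \<in> K'}"
    by auto
  then have "y \<in> RS (insert 0 {i. Suc i \<in> K'}) q" "y \<in> RS (insert 1 {i. Suc i \<in> K'}) q"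
    using y1 y2 WG_linear[of "insert 1 K'" q] WG_linear[of "insert 2 K'" q] n0 by auto
  then have "y \<in> RS {i. Suc i \<in> K'} q"
    by (rule RS_adjacent_inter) (use n0 q in \<open>auto simp: numeral_2_eq_2\<close>)
  then have y: "y \<in> WG (cyc_gens q) K'" using WG_linear[of K' q] n0 by simp
  \<comment> \<open>Rotating on to a full turn, which is the identity in degree \<open>q\<close>,
    returns the conclusion to \<open>x\<close>.\<close>
  have "(rotl ^^ (q - f)) y \<in> WG (cyc_gens q) K"
  proof (rule rotl_power_WG[OF y])
    fix i assume i: "i \<in> K'"
    show "\<exists>j\<in>K. j < q \<and> i = (j + (q - f)) mod q"
    proof (intro bexI conjI)
      show "(i + f) mod q \<in> K" using i by (simp add: K'_def)
      show "(i + f) mod q < q" using q by simp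
      have "((i + f) mod q + (q - f)) mod q = (i + f + (q - f)) mod q" by (simp add: mod_add_left_eq)
      also have "\<dots> = i" using f i by (simp add: K'_def)
      finally show "i = ((i + f) mod q + (q - f)) mod q" ..
    qed
  qed (use q in \<open>auto simp: K'_def\<close>)
  moreover have "(rotl ^^ (q - f)) y = (rotl ^^ q) x"
  proof -
    have "rotl ^^ q = (rotl ^^ (q - f)) \<circ> (rotl ^^ f :: (nc_word \<Rightarrow>\<^sub>0 'k) \<Rightarrow> _)" using f by (simp flip: funpow_add)
    then show ?thesis by (simp add: y_def)
  qed
  moreover have "(rotl ^^ q) x = x" using x(1) WG_T by (intro rotl_power_id) auto
  ultimately show ?thesis by simp
qed

text \<open>Nondegeneracy makes the \<open>n\<close> rows independent inside the span of the
  \<open>n\<close> letters, hence spanning. This converts identities involving rows into identities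
  involving letters.\<close>

lemma letter_in_span_rows: "i < n \<Longrightarrow> wmono [i] \<in> pm.span (row ` {..<n})"
proof -
  assume i: "i < n"
  let ?L = "(\<lambda>i. wmono [i] :: nc_word \<Rightarrow>\<^sub>0 'k) ` {..<n}"
  have inj: "inj_on row {..<n}"
  proof (rule inj_onI, rule ccontr)
    fix k l assume kl: "k \<in> {..<n}" "l \<in> {..<n}" "row k = row l" "k \<noteq> l"
    define \<mu> :: "nat \<Rightarrow> 'k" where "\<mu> = (\<lambda>i. (if i = k then 1 else 0) - (if i = l then 1 else 0))"
    have "M j k = M j l" if "j < n" for j
    proof -
      have "dec j (row k * 1) = dec j (row l * 1)" using kl(3) by simp
      then have "pscale (M k j) 1 = pscale (M l j) (1 :: nc_word \<Rightarrow>\<^sub>0 'k)"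
        unfolding row_def dec_linf_mult[OF that] .
      then show ?thesis by (simp add: M_sym)
    qed
    then have "(\<Sum>i<n. M j i * \<mu> i) = 0" if "j < n" for j
      using that kl(1,2) by (simp add: \<mu>_def right_diff_distrib sum_subtractf if_distrib[of "(*) _"] cong: if_cong)
    then have "\<mu> k = 0" using nondegenerate[of \<mu> k] kl(1) unfolding M_def by blast
    then show False using kl(4) by (simp add: \<mu>_def)
  qed
  have ind: "pm.independent (row ` {..<n})"
  proof (rule pm.independent_if_scalars_zero)
    fix f :: "(nc_word \<Rightarrow>\<^sub>0 'k) \<Rightarrow> 'k" and x
    assume s: "(\<Sum>x\<in>row ` {..<n}. pscale (f x) x) = 0" and x: "x \<in> row ` {..<n}"
    then obtain k where k: "k < n" "x = row k" by auto
    have "(\<Sum>k<n. pscale (f (row k)) (row k)) = 0" using s by (simp add: sum.reindex[OF inj])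
    then have "\<forall>l<n. (\<Sum>k<n. M l k * f (row k)) = 0" unfolding row_comb linf_zero_iff .
    then show "f x = 0" using nondegenerate[of "\<lambda>k. f (row k)" k] k unfolding M_def by blast
  qed simp
  have "row k \<in> pm.span ?L" for k
    unfolding row_def linf_def by (intro pm.span_sum pm.span_scale, rule pm.span_base) auto
  then have "row ` {..<n} \<subseteq> pm.span ?L" by auto
  show ?thesis
  proof (rule ccontr)
    assume "wmono [i] \<notin> pm.span (row ` {..<n})"
    then have ind': "pm.independent (insert (wmono [i]) (row ` {..<n}))" and "wmono [i] \<notin> row ` {..<n}"
      using ind by (auto simp: pm.independent_insert intro: pm.span_base)
    have "insert (wmono [i]) (row ` {..<n}) \<subseteq> pm.span ?L"
      using \<open>row ` {..<n} \<subseteq> pm.span ?L\<close> i by (auto intro: pm.span_base)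
    then have "card (insert (wmono [i]) (row ` {..<n})) \<le> card ?L"
      using pm.independent_span_bound[OF _ ind', of ?L] by auto
    also have "\<dots> \<le> n" using card_image_le[of "{..<n}"] by simp
    finally show False using \<open>wmono [i] \<notin> row ` {..<n}\<close> inj by (simp add: card_image)
  qed
qed

text \<open>Positions below \<open>q - 2\<close> do not touch the last letter, so it can be
  stripped.\<close>

lemma decl_RS:
  assumes "e \<in> RS {..<q - 2} q"
  shows "decl l e \<in> RS UNIV (q - 1)"
proof (rule plinear_span_subset[OF plinear_decl _ subspace_RS assms[unfolded RS_def]])
  fix g assume "g \<in> rel_gens {..<q - 2} q"
  then obtain u v where uv: "g = wmono u * \<omega> * wmono v" "length u < q - 2" "length u + 2 + length v = q"
    "set u \<subseteq> {..<n}" "set v \<subseteq> {..<n}" by (auto simp: rel_gens_def)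
  then have "v \<noteq> []" by auto
  then obtain v' b where v: "v = v' @ [b]" by (metis rev_exhaust)
  have "g = wmono u * \<omega> * wmono v' * wmono [b]" unfolding uv(1) v by (simp add: wmono_mult mult.assoc)
  then show "decl l g \<in> RS UNIV (q - 1)"
    using uv(2-) v by (auto simp: decl_mult_letter intro!: RS_gen pm.subspace_0)
qed

lemma RS_mult_letter:
  assumes "e \<in> RS UNIV p" "k < n"
  shows "e * wmono [k] \<in> RS {..<p - 1} (Suc p)"
proof (rule plinear_span_subset[OF plinear_times_right _ subspace_RS assms(1)[unfolded RS_def]])
  fix g assume "g \<in> rel_gens UNIV p"
  then obtain u v where uv: "g = wmono u * \<omega> * wmono v" "length u + 2 + length v = p"
    "set u \<subseteq> {..<n}" "set v \<subseteq> {..<n}" by (auto simp: rel_gens_def)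
  have "g * wmono [k] = wmono u * \<omega> * wmono (v @ [k])" unfolding uv(1) by (simp add: wmono_mult mult.assoc)
  then show "g * wmono [k] \<in> RS {..<p - 1} (Suc p)" using uv assms(2) by (auto intro!: RS_gen)
qed

text \<open>With the gaps \<open>1..q - 2\<close> killed, the first \<open>q - 1\<close> letters
  form an element of B and the last letter stands alone. An element of both spaces is
  \<open>y * \<omega>\<close> and also \<open>rotl (\<omega> * z)\<close>; comparing the
  coefficients of the last letter makes \<open>y\<close> and \<open>z\<close> intertwined by all
  rows, hence by all letters, and \<open>twisted_central\<close> gives \<open>z = 0\<close> in
  B.\<close>

lemma WG_wrap_inter:
  assumes q: "q \<ge> 3" and x: "x \<in> WG (cyc_gens q) (insert 0 {1..q - 2})" "x \<in> WG (cyc_gens q) (insert (q - 1) {1..q - 2})"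
  shows "x \<in> WG (cyc_gens q) {1..q - 2}"
proof -
  let ?U = "{..<q - 2}"
  obtain p where p: "q = Suc (Suc (Suc p))" using q by (intro that[of "q - 3"]) simp
  have U: "{i. Suc i \<in> {1..q - 2}} = ?U" using q by auto
  have RSU: "WG (cyc_gens q) {1..q - 2} = RS ?U q" using WG_linear[of "{1..q-2}" q] unfolding U by simp
  obtain a e where a: "x = a + e" "a \<in> pm.span (cyc_gens q 0)" "e \<in> RS ?U q"
    using WG_insert[OF x(1), unfolded RSU] by blast
  obtain b e' where b: "x = b + e'" "b \<in> pm.span (cyc_gens q (q - 1))" "e' \<in> RS ?U q"
    using WG_insert[OF x(2), unfolded RSU] by blast
  have g0: "rel_gens {0} q = (\<lambda>z. \<omega> * z) ` (wmono ` words n (q - 2))"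
    using q by (auto simp: rel_gens_def words_def wmono_Nil image_iff)
  have "pm.span (cyc_gens q 0) = rotl ` (\<lambda>z. \<omega> * z) ` T n (q - 2)"
    unfolding T_eq_span cyc_gens_def if_P[OF refl] g0
    by (simp only: pmp.linear_span_image[OF plinear_times_left, of \<omega>] pmp.linear_span_image[OF plinear_rotl])
  then obtain z where z: "z \<in> T n (q - 2)" "a = rotl (\<omega> * z)" using a(2) by auto
  have "rel_gens {q - 2} q = (\<lambda>z. z * \<omega>) ` (wmono ` words n (q - 2))"
  proof (intro equalityI subsetI)
    fix x assume "x \<in> rel_gens {q - 2} q"
    then obtain u v where "x = wmono u * \<omega> * wmono v" "length u = q - 2" "length u + 2 + length v = q" "set u \<subseteq> {..<n}"
      by (auto simp: rel_gens_def)
    moreover from this have "length v = 0" using q by linarith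
    ultimately show "x \<in> (\<lambda>z. z * \<omega>) ` (wmono ` words n (q - 2))" by (auto simp: words_def wmono_Nil)
  next
    fix x assume "x \<in> (\<lambda>z. z * \<omega>) ` (wmono ` words n (q - 2))"
    then obtain u where "x = wmono u * \<omega>" "u \<in> words n (q - 2)" by auto
    then show "x \<in> rel_gens {q - 2} q" using q by (intro rel_gensI[of _ u "[]"]) (auto simp: words_def wmono_Nil)
  qed
  then have "pm.span (cyc_gens q (q - 1)) = (\<lambda>z. z * \<omega>) ` T n (q - 2)"
    unfolding T_eq_span cyc_gens_def
    using q pmp.linear_span_image[OF plinear_times_right, of \<omega>] by (simp add: diff_diff_left numeral_2_eq_2)
  then obtain y where y: "y \<in> T n (q - 2)" "b = y * \<omega>" using b(2) by auto
  have "y * \<omega> - rotl (\<omega> * z) = e - e'" using a(1) b(1) z(2) y(2) by (simp add: algebra_simps)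
  then have D: "y * \<omega> - rotl (\<omega> * z) \<in> RS ?U q" using pm.subspace_diff[OF subspace_RS a(3) b(3)] by simp
  \<comment> \<open>The right derivative by \<open>l\<close> picks the coefficient
    \<open>y * row l\<close> of \<open>y * \<omega>\<close> and \<open>row l * z\<close> of the
    rotated relation.\<close>
  have rows: "y * row l - row l * z \<in> RS UNIV (q - 1)" if "l < n" for l
  proof -
    have "decl l (y * \<omega> - rotl (\<omega> * z)) = y * row l - row l * z"
    proof -
      have "y * \<omega> = (\<Sum>l<n. y * row l * wmono [l])" unfolding omega_row' by (simp add: sum_distrib_left mult.assoc)
      then show ?thesis unfolding rotl_omega_mult
        using that by (simp add: pmp.linear_diff[OF plinear_decl] pmp.linear_sum[OF plinear_decl] decl_mult_letter)
    qed
    then show ?thesis using decl_RS[OF D, of l] by simp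
  qed
  have "pm.span (row ` {..<n}) \<subseteq> {v. y * v - v * z \<in> RS UNIV (q - 1)}"
    by (rule pm.span_minimal) (use rows in \<open>auto intro!: subspace_vimage plinear_minus plinear_times_left plinear_times_right\<close>)
  then have letters: "y * wmono [l] - wmono [l] * z \<in> RS UNIV (q - 1)" if "l < n" for l
    using letter_in_span_rows[OF that] by auto
  \<comment> \<open>Here \<open>q \<ge> 3\<close> matters: it gives \<open>z\<close> positive
    degree. Scalars do commute with all letters, and they are responsible for the extra class in
    weight two.\<close>
  have "z \<in> RS UNIV (Suc p)"
  proof (rule twisted_central[of y p z 1])
    fix l assume "l < n"
    from pm.subspace_neg[OF subspace_RS letters[OF this]]
    show "wmono [l] * z - pscale 1 (y * wmono [l]) \<in> RS UNIV (Suc (Suc p))" using p by simp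
  qed (use y z p in auto)
  then have "row k * z \<in> RS UNIV (Suc (Suc p))" for k using RS_row_mult[of z UNIV "Suc p" k] by simp
  then have "a \<in> RS ?U q"
    unfolding z(2) rotl_omega_mult using RS_mult_letter[of _ "Suc (Suc p)"] p
    by (intro pm.subspace_sum subspace_RS) auto
  then show ?thesis unfolding RSU a(1) using a(3) by (intro pm.subspace_add) auto
qed

text \<open>The gap \<open>f\<close> lies neither in \<open>J\<close> nor in \<open>K\<close>, so it
  carries a bar throughout. The two gaps after it form an exact square for every choice of the
  killed gaps, and the remaining gaps are added one at a time, each time barred on one face and
  killed on the other.\<close>

lemma cyc_exact_free:
  assumes q: "q \<ge> 3" and f: "f < q" and fin: "finite J"
    and J: "J \<inter> {f, (f + 1) mod q, (f + 2) mod q} = {}" "K \<inter> {f, (f + 1) mod q, (f + 2) mod q} = {}"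
    and "J \<inter> K = {}" "J \<subseteq> {..<q}" "K \<subseteq> {..<q}"
  shows "cube_exact (cyc_gens q) (T n q) (J \<union> {(f + 1) mod q, (f + 2) mod q}) K"
  using fin J assms(6-)
proof (induction J arbitrary: K rule: finite_induct)
  case empty
  have ne: "(f + 1) mod q \<noteq> (f + 2) mod q"
  proof -
    consider "f + 2 < q" | "f + 2 = q" | "f + 1 = q" using f by linarith
    then show ?thesis
    proof cases
      case 3
      then have "(f + 1) mod q = 0" "(f + 2) mod q = 1 mod q" using mod_add_self1[of q 1] by auto
      then show ?thesis using q by simp
    qed auto
  qed
  have "cube_exact (cyc_gens q) (T n q) {(f + 1) mod q, (f + 2) mod q} K"
  proof (rule cube_exact_pair)
    show "pm.subspace (T n q)" "cyc_gens q ((f + 2) mod q) \<subseteq> T n q" by (rule subspace_T, rule cyc_gens_T)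
    show "(f + 1) mod q \<noteq> (f + 2) mod q" by (rule ne)
    have K: "K \<subseteq> {..<q}" "f \<notin> K" "(f + 1) mod q \<notin> K" "(f + 2) mod q \<notin> K"
      using empty.prems by simp_all
    show "e \<in> WG (cyc_gens q) K" if "e \<in> WG (cyc_gens q) (insert ((f + 1) mod q) K)"
      "e \<in> WG (cyc_gens q) (insert ((f + 2) mod q) K)" for e
      by (rule WG_adjacent_inter[OF q f K that])
  qed
  then show ?case by (simp only: Un_empty_left)
next
  case (insert k J)
  let ?J = "J \<union> {(f + 1) mod q, (f + 2) mod q}"
  have "cube_exact (cyc_gens q) (T n q) (insert k ?J) K"
  proof (rule cube_exact_insert)
    show "cube_exact (cyc_gens q) (T n q) ?J K" 
      using insert.prems by (intro insert.IH) simp_all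
    show "cube_exact (cyc_gens q) (T n q) ?J (insert k K)" 
      using insert.prems insert.hyps by (intro insert.IH) simp_all
    show "finite ?J" using insert.hyps by simp
    show "k \<notin> ?J" using insert.hyps insert.prems by simp
  qed (rule subspace_T)
  then show ?case by (simp only: Un_insert_left)
qed

text \<open>Descending induction on the number of killed gaps. Adding gap \<open>j + 1\<close> needs
  the face where it is barred, covered by \<open>cyc_exact_free\<close> with
  \<open>f = j + 1\<close>, and the face where it is killed, which is the induction hypothesis. The
  base is the wrapped square on the gaps \<open>q - 1\<close> and 0.\<close>

lemma cyc_exact_partial:
  assumes q: "q \<ge> 3" and j: "j \<le> q - 2"
  shows "cube_exact (cyc_gens q) (T n q) (insert 0 {j + 1..<q}) {1..j}"
  using j
proof (induction rule: inc_induct)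
  case base
  have "insert 0 {q - 2 + 1..<q} = {0, q - 1}" using q by auto
  then show ?case
    using cube_exact_pair[of "T n q" "cyc_gens q" "q - 1" 0 "{1..q - 2}"] WG_wrap_inter[OF q] cyc_gens_T q by auto
next
  case (step j)
  have J: "insert 0 {j + 1..<q} = insert (j + 1) (insert 0 {Suc j + 1..<q})" using step by auto
  show ?case
    unfolding J
  proof (rule cube_exact_insert)
    have K: "insert (j + 1) {1..j} = {1..Suc j}" by auto
    show "cube_exact (cyc_gens q) (T n q) (insert 0 {Suc j + 1..<q}) (insert (j + 1) {1..j})"
      unfolding K by (rule step.IH)
    let ?f = "j + 1"
    have j3: "j + 3 \<le> q" using step q by auto
    have f1: "(?f + 1) mod q = j + 2" using j3 by simp
    have f2: "(?f + 2) mod q = (if j + 3 = q then 0 else j + 3)"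
    proof (cases "j + 3 = q")
      case True
      then have "?f + 2 = q" by simp
      then show ?thesis using True by (simp only: mod_self if_True refl)
    qed (use j3 in simp)
    note f = f1 f2
    \<comment> \<open>The two gaps following \<open>?f\<close> are split off as
      \<open>cyc_exact_free\<close> expects; the second of them is gap 0 when
      \<open>j + 3 = q\<close>.\<close>
    let ?J = "insert 0 {Suc j + 1..<q} - {(?f + 1) mod q, (?f + 2) mod q}"
    have "cube_exact (cyc_gens q) (T n q) (?J \<union> {(?f + 1) mod q, (?f + 2) mod q}) {1..j}"
    proof (rule cyc_exact_free[OF q])
      show "?J \<inter> {?f, (?f + 1) mod q, (?f + 2) mod q} = {}" by auto
      show "{1..j} \<inter> {?f, (?f + 1) mod q, (?f + 2) mod q} = {}" unfolding f by auto
      show "?J \<subseteq> {..<q}" using q by auto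
      show "{1..j} \<subseteq> {..<q}" using j3 by auto
      show "?J \<inter> {1..j} = {}" by auto
    qed (use j3 in auto)
    moreover have "?J \<union> {(?f + 1) mod q, (?f + 2) mod q} = insert 0 {Suc j + 1..<q}"
      unfolding f using j3 by auto
    ultimately show "cube_exact (cyc_gens q) (T n q) (insert 0 {Suc j + 1..<q}) {1..j}" by simp
  qed auto
qed

lemma cyc_exact: "q \<ge> 3 \<Longrightarrow> cube_exact (cyc_gens q) (T n q) {..<q} {}"
proof -
  assume q: "q \<ge> 3"
  have "insert 0 {0 + 1..<q} = {..<q}" using q by auto
  then show ?thesis using cyc_exact_partial[OF q, of 0] by simp
qed

end

section \<open>Cyclic words with bars\<close>

text \<open>A flag marks a letter with a bar in front of it. Bars start the factors of a tensor of words, and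
  cyclic words with bars encode cyclic tensors.\<close>

type_synonym flagged = "(bool \<times> nat) list"

definition flags :: "flagged \<Rightarrow> nat set"
  where "flags xs = {i. i < length xs \<and> fst (xs ! i)}"

definition flag_sign :: "bool \<times> nat \<Rightarrow> 'k::field"
  where "flag_sign x = (if fst x then 1 else - 1)"

definition lapp :: "'a list \<Rightarrow> ('a list \<Rightarrow>\<^sub>0 'k::field) \<Rightarrow> ('a list \<Rightarrow>\<^sub>0 'k)"
  where "lapp us = lin_ext (\<lambda>xs. Poly_Mapping.single (us @ xs) 1)"

definition rapp :: "'a list \<Rightarrow> ('a list \<Rightarrow>\<^sub>0 'k::field) \<Rightarrow> ('a list \<Rightarrow>\<^sub>0 'k)"
  where "rapp us = lin_ext (\<lambda>xs. Poly_Mapping.single (xs @ us) 1)"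

lemma lapp_single [simp]: "lapp us (Poly_Mapping.single xs c) = Poly_Mapping.single (us @ xs) c"
  and rapp_single [simp]: "rapp us (Poly_Mapping.single xs c) = Poly_Mapping.single (xs @ us) c"
  by (simp_all add: lapp_def rapp_def)

lemma plinear_lapp: "plinear (lapp us)" and plinear_rapp: "plinear (rapp us)"
  by (simp_all add: lapp_def rapp_def lin_ext_linear)

lemmas lapp_simps [simp] = pmp.linear_0[OF plinear_lapp] pmp.linear_add[OF plinear_lapp]
  pmp.linear_scale[OF plinear_lapp] pmp.linear_sum[OF plinear_lapp] pmp.linear_diff[OF plinear_lapp] pmp.linear_neg[OF plinear_lapp]
lemmas rapp_simps [simp] = pmp.linear_0[OF plinear_rapp] pmp.linear_add[OF plinear_rapp]
  pmp.linear_scale[OF plinear_rapp] pmp.linear_sum[OF plinear_rapp] pmp.linear_diff[OF plinear_rapp] pmp.linear_neg[OF plinear_rapp]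

lemma lapp_lapp: "lapp us (lapp vs x) = lapp (us @ vs) x"
  by (rule plinear_eqI[of "\<lambda>x. lapp us (lapp vs x)"]) (auto intro: plinear_comp plinear_lapp)

lemma lapp_rapp: "lapp us (rapp vs x) = rapp vs (lapp us x)"
  by (rule plinear_eqI[of "\<lambda>x. lapp us (rapp vs x)"]) (auto intro: plinear_comp plinear_lapp plinear_rapp)

lemma lapp_Nil [simp]: "lapp [] x = x"
  by (rule plinear_eqI[of "lapp []" "\<lambda>x. x"]) (auto intro: plinear_id plinear_lapp)

lemma rapp_Nil [simp]: "rapp [] x = x"
  by (rule plinear_eqI[of "rapp []" "\<lambda>x. x"]) (auto intro: plinear_id plinear_rapp)

text \<open>The differential removes bars. Letters and bars are both odd, so that a letter with a bar
  in front of it is even.\<close>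

primrec bar_d :: "flagged \<Rightarrow> (flagged \<Rightarrow>\<^sub>0 'k::field)"
  where "bar_d [] = 0"
  | "bar_d (x # xs) = (if fst x then Poly_Mapping.single ((False, snd x) # xs) 1 else 0)
      + pscale (flag_sign x) (lapp [x] (bar_d xs))"

lemma bar_d_append: "bar_d (us @ vs) = rapp vs (bar_d us) + pscale (prod_list (map flag_sign us)) (lapp us (bar_d vs))"
proof (induction us)
  case (Cons x us)
  then show ?case by (simp add: lapp_lapp lapp_rapp pm.scale_right_distrib)
qed simp

lemma bar_d_sum: "bar_d xs = (\<Sum>i<length xs. if fst (xs ! i)
    then Poly_Mapping.single (xs[i := (False, snd (xs ! i))]) (\<Prod>j<i. flag_sign (xs ! j)) else 0)"
proof (induction xs)
  case (Cons x xs)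
  have "(\<Sum>i<length (x # xs). if fst ((x # xs) ! i)
    then Poly_Mapping.single ((x # xs)[i := (False, snd ((x # xs) ! i))]) (\<Prod>j<i. flag_sign ((x # xs) ! j)) else 0)
    = (if fst x then Poly_Mapping.single ((False, snd x) # xs) 1 else 0) +
      (\<Sum>i<length xs. if fst (xs ! i)
    then Poly_Mapping.single (x # xs[i := (False, snd (xs ! i))]) (flag_sign x * (\<Prod>j<i. flag_sign (xs ! j))) else (0 :: flagged \<Rightarrow>\<^sub>0 'a))"
    by (simp add: sum.lessThan_Suc_shift prod.lessThan_Suc_shift del: sum.lessThan_Suc prod.lessThan_Suc cong: if_cong)
  also have "(\<Sum>i<length xs. if fst (xs ! i)
    then Poly_Mapping.single (x # xs[i := (False, snd (xs ! i))]) (flag_sign x * (\<Prod>j<i. flag_sign (xs ! j))) else (0 :: flagged \<Rightarrow>\<^sub>0 'a))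
    = pscale (flag_sign x) (lapp [x] (bar_d xs))"
    unfolding Cons by (simp add: pm.scale_sum_right if_distrib[of "lapp _"] if_distrib[of "pscale _"] cong: if_cong)
  finally show ?case by simp
qed simp

text \<open>A letter with its bar is even and moves to the end without a sign; a bare letter is odd
  and picks up the factor \<open>e\<close>, which depends on the parity of what it passes.\<close>

definition bar_rot :: "'k::field \<Rightarrow> flagged \<Rightarrow> (flagged \<Rightarrow>\<^sub>0 'k)"
  where "bar_rot e xs = Poly_Mapping.single (rotate1 xs) (if xs \<noteq> [] \<and> \<not> fst (hd xs) then e else 1)"

definition Rot :: "'k::field \<Rightarrow> (flagged \<Rightarrow>\<^sub>0 'k) \<Rightarrow> (flagged \<Rightarrow>\<^sub>0 'k)"
  where "Rot e = lin_ext (bar_rot e)"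

lemma plinear_Rot: "plinear (Rot e)" by (simp add: Rot_def lin_ext_linear)

lemmas Rot_simps [simp] = pmp.linear_0[OF plinear_Rot] pmp.linear_add[OF plinear_Rot] pmp.linear_diff[OF plinear_Rot]
  pmp.linear_scale[OF plinear_Rot] pmp.linear_sum[OF plinear_Rot] pmp.linear_neg[OF plinear_Rot]

lemma Rot_single_Cons: "Rot e (Poly_Mapping.single (x # xs) 1) = pscale (if fst x then 1 else e) (Poly_Mapping.single (xs @ [x]) 1)"
  by (simp add: Rot_def bar_rot_def)

lemma plinear_Rot_power: "plinear (Rot e ^^ k)" by (rule plinear_funpow[OF plinear_Rot])

lemma Rot_power_single: "(Rot e ^^ length us) (Poly_Mapping.single (us @ vs) 1)
    = pscale (e ^ length (filter (Not \<circ> fst) us)) (Poly_Mapping.single (vs @ us) 1)"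
proof (induction us arbitrary: vs)
  case (Cons x us)
  have "(Rot e ^^ length (x # us)) (Poly_Mapping.single ((x # us) @ vs) 1)
    = (Rot e ^^ length us) (Rot e (Poly_Mapping.single (x # (us @ vs)) 1))"
    by (simp add: funpow_swap1)
  also have "\<dots> = pscale (if fst x then 1 else e) ((Rot e ^^ length us) (Poly_Mapping.single (us @ (vs @ [x])) 1))"
    by (simp only: Rot_single_Cons pmp.linear_scale[OF plinear_Rot_power] append_assoc)
  also have "\<dots> = pscale (e ^ length (filter (Not \<circ> fst) (x # us))) (Poly_Mapping.single (vs @ x # us) 1)"
    unfolding Cons by simp
  finally show ?case .
qed simp

section \<open>Signed rotation of words with bars\<close>

context quadric begin

definition Dset :: "nat \<Rightarrow> nat \<Rightarrow> flagged set"
  where "Dset f q = {xs. length xs = q \<and> snd ` set xs \<subseteq> {..<n} \<and> length (filter fst xs) = f}"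

definition D :: "nat \<Rightarrow> nat \<Rightarrow> (flagged \<Rightarrow>\<^sub>0 'k) set" where "D f q = supp_in (Dset f q)"

lemma subspace_D [simp, intro]: "pm.subspace (D f q)" by (simp add: D_def)

lemma D_linear_eq:
  assumes "plinear g" "plinear h" "x \<in> D f q" "\<And>xs. xs \<in> Dset f q \<Longrightarrow> g (Poly_Mapping.single xs 1) = h (Poly_Mapping.single xs 1)"
  shows "g x = h x"
  by (rule plinear_eq_on_supp[OF assms(1,2) assms(3)[unfolded D_def] assms(4)])

lemma D_linear_subset:
  assumes "plinear g" "\<And>xs. xs \<in> Dset f q \<Longrightarrow> g (Poly_Mapping.single xs 1) \<in> V" "pm.subspace V" "x \<in> D f q"
  shows "g x \<in> V"
  by (rule plinear_supp_subset[OF assms(1) _ assms(3) assms(4)[unfolded D_def]]) (rule assms(2))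

text \<open>The Koszul sign of moving one odd symbol past the remaining \<open>q + f - 1\<close>
  among \<open>q\<close> letters and \<open>f\<close> bars.\<close>

definition sg :: "nat \<Rightarrow> nat \<Rightarrow> 'k" where "sg f q = (- 1) ^ (q + f + 1)"

lemma sg_Suc [simp]: "sg (Suc f) q = - sg f q" by (simp add: sg_def)

lemma sg_square [simp]: "sg f q * sg f q = 1"
  by (simp add: sg_def flip: power_add)

lemma Dset_filter: "xs \<in> Dset f q \<Longrightarrow> length (filter (Not \<circ> fst) xs) = q - f"
  using sum_length_filter_compl[of fst xs] by (simp add: Dset_def comp_def) 

lemma Dset_le: "xs \<in> Dset f q \<Longrightarrow> f \<le> q"
  by (auto simp: Dset_def)

text \<open>A full turn moves \<open>q - f\<close> bare letters, and \<open>q + f + 1\<close> and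
  \<open>q - f\<close> have opposite parity. Hence the signed rotation has order dividing
  \<open>q\<close>, as averaging requires.\<close>

lemma sg_power: "f \<le> q \<Longrightarrow> sg f q ^ (q - f) = 1"
proof -
  assume "f \<le> q"
  then obtain r where r: "q = f + r" using le_Suc_ex by blast
  have "even ((q + f + 1) * (q - f))" by (cases "even f"; cases "even r"; simp add: r)
  moreover have "sg f q ^ (q - f) = (- 1) ^ ((q + f + 1) * (q - f))" by (simp only: sg_def power_mult)
  ultimately show ?thesis by (simp only: minus_one_power_iff if_True)
qed

lemma rotate1_Dset: "xs \<in> Dset f q \<Longrightarrow> rotate1 xs \<in> Dset f q"
  by (cases xs) (auto simp: Dset_def)

lemma Rot_D: "x \<in> D f q \<Longrightarrow> Rot e x \<in> D f q"
  by (rule D_linear_subset[OF plinear_Rot, of f q]) (auto simp: Rot_def bar_rot_def D_def rotate1_Dset)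

lemma Rot_power_D: "x \<in> D f q \<Longrightarrow> (Rot e ^^ k) x \<in> D f q"
  by (induction k) (simp_all add: Rot_D)

lemma Rot_power_id: "x \<in> D f q \<Longrightarrow> (Rot (sg f q) ^^ q) x = x"
proof (rule D_linear_eq[OF plinear_Rot_power plinear_id])
  fix xs assume xs: "xs \<in> Dset f q"
  then have "length xs = q" by (simp add: Dset_def)
  then show "(Rot (sg f q) ^^ q) (Poly_Mapping.single xs 1) = Poly_Mapping.single xs 1"
    using Rot_power_single[where us = xs and vs = "[]" and e = "sg f q"] Dset_filter[OF xs] sg_power[OF Dset_le[OF xs]] by simp
qed

lemma bar_d_D: "xs \<in> Dset (Suc f) q \<Longrightarrow> bar_d xs \<in> D f q"
proof (induction xs arbitrary: f q)
  case (Cons x xs)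
  obtain q' where q: "q = Suc q'" using Cons.prems by (auto simp: Dset_def)
  have lapp: "lapp [x] y \<in> D f q" if "y \<in> D (if fst x then f - 1 else f) q'" "fst x \<Longrightarrow> f > 0" for y
    by (rule D_linear_subset[OF plinear_lapp _ subspace_D that(1)])
      (use Cons.prems that(2) q in \<open>auto simp: D_def Dset_def split: if_splits\<close>)
  show ?case
  proof (cases "fst x")
    case True
    have 1: "Poly_Mapping.single ((False, snd x) # xs) 1 \<in> D f q"
      using Cons.prems True by (auto simp: D_def Dset_def)
    show ?thesis
    proof (cases f)
      case 0
      then have "\<forall>y\<in>set xs. \<not> fst y" using Cons.prems True by (auto simp: Dset_def filter_empty_conv)
      then have "bar_d xs = (0 :: flagged \<Rightarrow>\<^sub>0 'k)" by (induction xs) auto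
      then show ?thesis using 1 True by simp
    next
      case (Suc f')
      have "bar_d xs \<in> D f' q'" using Cons.prems True Suc q by (intro Cons.IH) (auto simp: Dset_def)
      then have "lapp [x] (bar_d xs) \<in> D f q" using True Suc by (intro lapp) auto
      then show ?thesis using 1 True by (auto intro!: pm.subspace_add pm.subspace_scale)
    qed
  next
    case False
    have "bar_d xs \<in> D f q'" using Cons.prems False q by (intro Cons.IH) (auto simp: Dset_def)
    then have "lapp [x] (bar_d xs) \<in> D f q" using False by (intro lapp) auto
    then show ?thesis using False by (auto intro!: pm.subspace_scale)
  qed
qed (simp add: Dset_def)

lemma lin_bar_d_D: "x \<in> D (Suc f) q \<Longrightarrow> lin_ext bar_d x \<in> D f q"
  by (rule D_linear_subset[OF lin_ext_linear, of "Suc f" q]) (auto simp: bar_d_D)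

lemma Rot_lapp: "Rot e (lapp [x] y) = pscale (if fst x then 1 else e) (rapp [x] y)"
  by (rule plinear_eqI[of "\<lambda>y. Rot e (lapp [x] y)"])
    (simp_all add: plinear_comp[OF plinear_Rot plinear_lapp] plinear_scale[OF plinear_rapp] plinear_rapp Rot_single_Cons)

lemma flag_sign_prod: "prod_list (map flag_sign xs) = ((- 1) ^ length (filter (Not \<circ> fst) xs) :: 'k)"
  by (induction xs) (auto simp: flag_sign_def)

text \<open>Removing a bar changes the parity seen by a rotated letter. This compensates the sign of
  the differential passing a bare first letter; for a barred first letter it matches the sign of
  reaching its bar at the far end.\<close>

lemma bar_d_Rot:
  assumes "z \<in> D (Suc f) q"
  shows "lin_ext bar_d (Rot (sg (Suc f) q) z) = Rot (sg f q) (lin_ext bar_d z)"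
proof (rule D_linear_eq[OF _ _ assms])
  fix xs assume xs: "xs \<in> Dset (Suc f) q"
  then obtain x ys where x: "xs = x # ys" by (cases xs) (auto simp: Dset_def)
  let ?e = "sg f q"
  have e1: "sg (Suc f) q = - ?e" by simp
  have l: "lin_ext bar_d (Rot (- ?e) (Poly_Mapping.single xs 1))
      = pscale (if fst x then 1 else - ?e) (rapp [x] (bar_d ys) + pscale (prod_list (map flag_sign ys)) (lapp ys (bar_d [x])))"
    unfolding x Rot_single_Cons by (simp only: lin_ext_simps lin_ext_single bar_d_append pm.scale_one)
  show "lin_ext bar_d (Rot (sg (Suc f) q) (Poly_Mapping.single xs 1)) = Rot (sg f q) (lin_ext bar_d (Poly_Mapping.single xs 1))"
  proof (cases "fst x")
    case True
    have "length (filter (Not \<circ> fst) ys) = q - Suc f" using Dset_filter[OF xs] True x by simp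
    moreover have "(- 1) ^ (q - Suc f) = ?e"
    proof -
      obtain r where r: "q = Suc f + r" using Dset_le[OF xs] le_Suc_ex by blast
      show ?thesis unfolding sg_def r by (cases "even f"; cases "even r"; simp add: minus_one_power_iff)
    qed
    ultimately have p: "prod_list (map flag_sign ys) = ?e" by (simp add: flag_sign_prod)
    show ?thesis unfolding e1 l using True p
      by (simp add: x Rot_lapp Rot_single_Cons flag_sign_def add.commute)
  next
    case False
    show ?thesis unfolding e1 l using False
      by (simp add: x Rot_lapp flag_sign_def)
  qed
qed (auto intro!: plinear_comp[OF lin_ext_linear] plinear_comp[OF plinear_Rot] plinear_Rot lin_ext_linear)

section \<open>Decomposition by the set of bars, and averaging\<close>

definition slice :: "nat set \<Rightarrow> (flagged \<Rightarrow>\<^sub>0 'k) \<Rightarrow> (nc_word \<Rightarrow>\<^sub>0 'k)"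
  where "slice S = lin_ext (\<lambda>xs. if flags xs = S then wmono (map snd xs) else 0)"

definition flagl :: "nat set \<Rightarrow> nat list \<Rightarrow> flagged"
  where "flagl S w = map (\<lambda>i. (i \<in> S, w ! i)) [0..<length w]"

definition unslice :: "nat set \<Rightarrow> (nc_word \<Rightarrow>\<^sub>0 'k) \<Rightarrow> (flagged \<Rightarrow>\<^sub>0 'k)"
  where "unslice S = lin_ext (\<lambda>w. Poly_Mapping.single (flagl S (letters w)) 1)"

lemma plinear_slice: "plinear (slice S)" and plinear_unslice: "plinear (unslice S)"
  by (simp_all add: slice_def unslice_def lin_ext_linear)

lemmas slice_simps [simp] = pmp.linear_0[OF plinear_slice] pmp.linear_add[OF plinear_slice]
  pmp.linear_diff[OF plinear_slice] pmp.linear_scale[OF plinear_slice] pmp.linear_sum[OF plinear_slice]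

lemma slice_single: "slice S (Poly_Mapping.single xs r) = (if flags xs = S then pscale r (wmono (map snd xs)) else 0)"
  by (simp add: slice_def)

lemma unslice_wmono [simp]: "unslice S (wmono w) = Poly_Mapping.single (flagl S w) 1"
  by (simp add: unslice_def wmono_def)

lemma length_flagl [simp]: "length (flagl S w) = length w" by (simp add: flagl_def)

lemma flags_flagl: "S \<subseteq> {..<length w} \<Longrightarrow> flags (flagl S w) = S"
  by (auto simp: flags_def flagl_def)

lemma map_snd_flagl [simp]: "map snd (flagl S w) = w"
  by (simp add: flagl_def comp_def map_nth)

lemma flagl_flags: "flagl (flags xs) (map snd xs) = xs"
  by (rule nth_equalityI) (auto simp: flagl_def flags_def)

lemma card_flags: "card (flags xs) = length (filter fst xs)"
  by (simp add: flags_def length_filter_conv_card)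

lemma flags_subset: "flags xs \<subseteq> {..<length xs}" by (auto simp: flags_def)

lemma flagl_Dset: "w \<in> words n q \<Longrightarrow> S \<subseteq> {..<q} \<Longrightarrow> flagl S w \<in> Dset (card S) q"
  using card_flags[of "flagl S w"] flags_flagl[of S w] map_snd_flagl[of S w]
  by (auto simp: Dset_def words_def simp del: map_snd_flagl) (metis imageI image_set lessThan_iff map_snd_flagl snd_conv subsetD)

lemma unslice_D: "x \<in> T n q \<Longrightarrow> S \<subseteq> {..<q} \<Longrightarrow> unslice S x \<in> D (card S) q"
  by (rule T_linear_subset[OF plinear_unslice, of n q]) (auto simp: D_def flagl_Dset)

lemma slice_unslice: "x \<in> T n q \<Longrightarrow> S \<subseteq> {..<q} \<Longrightarrow> slice S' (unslice S x) = (if S' = S then x else 0)"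
  by (cases "S' = S"; rule T_linear_eq[of "\<lambda>x. slice S' (unslice S x)" "\<lambda>x. if S' = S then x else 0" x n q])
    (auto intro!: plinear_comp[OF plinear_slice] plinear_unslice plinear_zero plinear_id simp: slice_single flags_flagl words_def
      split: if_split)

lemma slice_T: "x \<in> D f q \<Longrightarrow> slice S x \<in> T n q"
  by (rule D_linear_subset[OF plinear_slice, of f q])
    (auto simp: slice_single Dset_def words_def intro!: wmono_in_T pm.subspace_0)

lemma slice_D_zero: "x \<in> D f q \<Longrightarrow> card S \<noteq> f \<Longrightarrow> slice S x = 0"
  by (rule D_linear_eq[OF plinear_slice plinear_zero, of x f q]) (auto simp: slice_single Dset_def card_flags)

lemma unslice_slice: "x \<in> D f q \<Longrightarrow> x = (\<Sum>S\<in>Pow {..<q}. unslice S (slice S x))"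
proof (rule D_linear_eq[OF plinear_id, of "\<lambda>x. \<Sum>S\<in>Pow {..<q}. unslice S (slice S x)" x f q])
  fix xs assume "xs \<in> Dset f q"
  then have "flags xs \<in> Pow {..<q}" using flags_subset by (auto simp: Dset_def)
  then show "Poly_Mapping.single xs 1 = (\<Sum>S\<in>Pow {..<q}. unslice S (slice S (Poly_Mapping.single xs (1::'k))))"
    using pmp.linear_0[OF plinear_unslice]
    by (simp add: slice_single if_distrib[of "unslice _"] flagl_flags cong: if_cong)
qed (auto intro!: plinear_sum plinear_comp[OF plinear_unslice] plinear_slice)

text \<open>The sign with which \<open>bar_d\<close> removes the bar at \<open>i\<close>: one factor
  -1 for each bare letter before it.\<close>

definition \<sigma>D :: "nat set \<Rightarrow> nat \<Rightarrow> 'k" where "\<sigma>D S i = (\<Prod>j<i. if j \<in> S then 1 else - 1)"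

lemma sigmaD_insert: "\<sigma>D (insert i S) j = (if i < j \<and> i \<notin> S then - \<sigma>D S j else \<sigma>D S j)"
proof (cases "i < j \<and> i \<notin> S")
  case True
  have s: "(\<Prod>k<j. g k) = g i * (\<Prod>k\<in>{..<j} - {i}. g k)" for g :: "nat \<Rightarrow> 'k"
    using True by (intro prod.remove) auto
  have "(\<Prod>k\<in>{..<j} - {i}. if k \<in> insert i S then 1 else - 1) = (\<Prod>k\<in>{..<j} - {i}. if k \<in> S then 1 else - 1 :: 'k)"
    by (rule prod.cong) auto
  then show ?thesis unfolding \<sigma>D_def s using True by simp
next
  case False
  then show ?thesis unfolding \<sigma>D_def by (auto intro!: prod.cong)
qed

lemma cube_sign_sigmaD: "cube_sign \<sigma>D J"
  unfolding cube_sign_def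
proof (intro allI impI ballI conjI)
  fix S i assume "i \<in> J - S"
  have "\<sigma>D S i * \<sigma>D S i = (\<Prod>j<i. (if j \<in> S then 1 else - 1) * (if j \<in> S then 1 else - 1))"
    by (simp add: \<sigma>D_def prod.distrib)
  also have "\<dots> = 1" by (rule prod.neutral) auto
  finally show "\<sigma>D S i * \<sigma>D S i = 1" .
next
  fix S i j assume "i \<in> J - S" "j \<in> J - S" "i \<noteq> j"
  then show "\<sigma>D S i * \<sigma>D (insert i S) j = - (\<sigma>D S j * \<sigma>D (insert j S) i)"
    by (cases "i < j") (auto simp: sigmaD_insert)
qed

text \<open>A word contributes to the slice \<open>S\<close> exactly when its bars are
  \<open>insert i S\<close> and the bar at \<open>i\<close> is removed; this identifies
  \<open>bar_d\<close> with the differential of the cube.\<close>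

lemma slice_bar_d:
  assumes "z \<in> D f q" "S \<subseteq> {..<q}"
  shows "slice S (lin_ext bar_d z) = cube_d \<sigma>D {..<q} (\<lambda>S. slice S z) S"
proof (rule D_linear_eq[OF _ _ assms(1)])
  fix xs assume "xs \<in> Dset f q"
  then have len: "length xs = q" by (simp add: Dset_def)
  have fl: "flags (xs[i := (False, snd (xs ! i))]) = S \<longleftrightarrow> i \<notin> S \<and> flags xs = insert i S"
    if "i < q" "fst (xs ! i)" for i
  proof -
    have "flags (xs[i := (False, snd (xs ! i))]) = flags xs - {i}"
      using that len by (auto simp: flags_def nth_list_update split: if_splits)
    moreover have "i \<in> flags xs" using that len by (simp add: flags_def)
    ultimately show ?thesis by blast
  qed
  have "slice S (lin_ext bar_d (Poly_Mapping.single xs 1)) = (\<Sum>i<q. if fst (xs ! i) then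
      slice S (Poly_Mapping.single (xs[i := (False, snd (xs ! i))]) (\<Prod>j<i. flag_sign (xs ! j))) else 0)"
    by (simp add: bar_d_sum len if_distrib[of "slice S"] cong: if_cong)
  also have "\<dots> = (\<Sum>i<q. if i \<notin> S \<and> flags xs = insert i S then pscale (\<sigma>D S i) (wmono (map snd xs)) else 0)"
  proof (intro sum.cong refl)
    fix i assume i: "i \<in> {..<q}"
    show "(if fst (xs ! i) then slice S (Poly_Mapping.single (xs[i := (False, snd (xs ! i))]) (\<Prod>j<i. flag_sign (xs ! j))) else 0)
      = (if i \<notin> S \<and> flags xs = insert i S then pscale (\<sigma>D S i) (wmono (map snd xs)) else (0 :: nc_word \<Rightarrow>\<^sub>0 'k))"
    proof (cases "fst (xs ! i) \<and> i \<notin> S \<and> flags xs = insert i S")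
      case True
      have "(\<Prod>j<i. flag_sign (xs ! j)) = \<sigma>D S i"
        unfolding \<sigma>D_def
      proof (rule prod.cong[OF refl])
        fix j assume "j \<in> {..<i}"
        then have "j < q" "j \<noteq> i" using i by auto
        moreover from this have "fst (xs ! j) \<longleftrightarrow> j \<in> flags xs" using len by (simp add: flags_def)
        ultimately have "fst (xs ! j) \<longleftrightarrow> j \<in> S" using True by simp
        then show "flag_sign (xs ! j) = (if j \<in> S then 1 else - 1 :: 'k)" by (simp add: flag_sign_def)
      qed
      moreover have "map snd (xs[i := (False, snd (xs ! i))]) = map snd xs"
        by (simp add: map_update) (metis list_update_id map_update snd_conv)
      ultimately show ?thesis using True i by (simp add: slice_single fl)
    next
      case False
      have "i \<in> flags xs \<longleftrightarrow> fst (xs ! i)" using i len by (simp add: flags_def)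
      then show ?thesis using False i by (auto simp: slice_single fl)
    qed
  qed
  also have "\<dots> = cube_d \<sigma>D {..<q} (\<lambda>S. slice S (Poly_Mapping.single xs 1)) S"
    unfolding cube_d_def
    by (rule sum.mono_neutral_cong_right) (auto simp: slice_single)
  finally show "slice S (lin_ext bar_d (Poly_Mapping.single xs 1)) = cube_d \<sigma>D {..<q} (\<lambda>S. slice S (Poly_Mapping.single xs 1)) S" .
qed (auto intro!: plinear_comp[OF plinear_slice] lin_ext_linear plinear_sum plinear_scale plinear_slice simp: cube_d_def)

text \<open>The relations of the tensor products over B: on the slice \<open>S\<close>,
  \<open>\<omega>\<close> vanishes at every gap without a bar.\<close>

definition WD :: "nat \<Rightarrow> nat \<Rightarrow> (flagged \<Rightarrow>\<^sub>0 'k) set"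
  where "WD f q = {z \<in> D f q. \<forall>S\<subseteq>{..<q}. slice S z \<in> WG (cyc_gens q) ({..<q} - S)}"

lemma subspace_WD [simp, intro]: "pm.subspace (WD f q)"
proof (rule pm.subspaceI)
  show "0 \<in> WD f q" by (simp add: WD_def pm.subspace_0)
next
  fix x y assume "x \<in> WD f q" "y \<in> WD f q"
  then show "x + y \<in> WD f q" by (simp add: WD_def pm.subspace_add)
next
  fix r x assume "x \<in> WD f q"
  then show "pscale r x \<in> WD f q" by (simp add: WD_def pm.subspace_scale)
qed

lemma WD_D: "WD f q \<subseteq> D f q" by (auto simp: WD_def)

text \<open>The effect of one rotation on the set of bars.\<close>

definition shift1 :: "nat \<Rightarrow> nat set \<Rightarrow> nat set" where "shift1 q S = {i. i < q \<and> Suc i mod q \<in> S}"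

lemma flags_rotate1: "xs \<noteq> [] \<Longrightarrow> flags (rotate1 xs) = shift1 (length xs) (flags xs)"
  by (auto simp: flags_def shift1_def nth_rotate1)

lemma Rot_unslice:
  assumes "x \<in> T n q" "S \<subseteq> {..<q}" "q > 0"
  shows "Rot e (unslice S x) = pscale (if 0 \<in> S then 1 else e) (unslice (shift1 q S) (rotl x))"
proof (rule T_linear_eq[OF _ _ assms(1)])
  fix w assume w: "w \<in> words n q"
  then have len: "length w = q" by (simp add: words_def)
  then have ne: "flagl S w \<noteq> []" using assms(3) by (auto simp: flagl_def)
  have f: "flags (flagl S w) = S" using flags_flagl assms(2) len by simp
  have "rotate1 (flagl S w) = flagl (flags (rotate1 (flagl S w))) (map snd (rotate1 (flagl S w)))"
    by (simp add: flagl_flags)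
  also have "\<dots> = flagl (shift1 q S) (rotate1 w)"
    using flags_rotate1[OF ne] f len by (simp add: rotate1_map[symmetric])
  finally have r: "rotate1 (flagl S w) = flagl (shift1 q S) (rotate1 w)" .
  have "hd (flagl S w) = (0 \<in> S, w ! 0)" using ne assms(3) len by (simp add: flagl_def hd_map upt_conv_Cons)
  then show "Rot e (unslice S (wmono w)) = pscale (if 0 \<in> S then 1 else e) (unslice (shift1 q S) (rotl (wmono w)))"
    using ne by (simp add: Rot_def bar_rot_def r)
qed (auto intro!: plinear_comp[OF plinear_Rot] plinear_unslice plinear_scale plinear_comp[OF plinear_unslice] plinear_rotl)

lemma rotl_WG:
  assumes "x \<in> WG (cyc_gens q) ({..<q} - S)" "q \<ge> 2"
  shows "rotl x \<in> WG (cyc_gens q) ({..<q} - shift1 q S)"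
proof -
  have "(rotl ^^ 1) x \<in> WG (cyc_gens q) ({..<q} - shift1 q S)"
  proof (rule rotl_power_WG[OF assms])
    fix i assume i: "i \<in> {..<q} - S"
    define j where "j = (if i = 0 then q - 1 else i - 1)"
    have "Suc j mod q = i" "j < q" using i by (auto simp: j_def)
    then show "\<exists>j\<in>{..<q} - shift1 q S. j < q \<and> i = (j + 1) mod q"
      using i by (intro bexI[of _ j]) (auto simp: shift1_def)
  qed auto
  then show ?thesis by simp
qed

lemma unslice_WD: 
  assumes "x \<in> WG (cyc_gens q) ({..<q} - S)" "S \<subseteq> {..<q}"
  shows "unslice S x \<in> WD (card S) q"
proof -
  have x: "x \<in> T n q" using assms(1) WG_T by auto
  show ?thesis unfolding WD_def
    using unslice_D[OF x assms(2)] slice_unslice[OF x assms(2)] assms(1) by (auto simp: pm.subspace_0)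
qed

lemma card_shift1: "S \<subseteq> {..<q} \<Longrightarrow> card (shift1 q S) = card S"
proof -
  assume S: "S \<subseteq> {..<q}"
  have "bij_betw (\<lambda>i. Suc i mod q) (shift1 q S) S"
  proof (rule bij_betwI[where g = "\<lambda>i. if i = 0 then q - 1 else i - 1"])
    show "(\<lambda>i. Suc i mod q) \<in> shift1 q S \<rightarrow> S" by (auto simp: shift1_def)
    show "(\<lambda>i. if i = 0 then q - 1 else i - 1) \<in> S \<rightarrow> shift1 q S"
    proof
      fix i assume i: "i \<in> S"
      then have "i < q" using S by auto
      then show "(if i = 0 then q - 1 else i - 1) \<in> shift1 q S" using i by (auto simp: shift1_def)
    qed
    show "(if Suc i mod q = 0 then q - 1 else Suc i mod q - 1) = i" if "i \<in> shift1 q S" for i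
      using that by (cases "Suc i = q") (auto simp: shift1_def)
    show "Suc (if i = 0 then q - 1 else i - 1) mod q = i" if "i \<in> S" for i using that S by auto
  qed
  then show ?thesis by (rule bij_betw_same_card)
qed

lemma Rot_WD:
  assumes "z \<in> WD f q" "q \<ge> 2"
  shows "Rot e z \<in> WD f q"
proof -
  have z: "z \<in> D f q" using assms(1) WD_D by auto
  have "Rot e z = (\<Sum>S\<in>Pow {..<q}. Rot e (unslice S (slice S z)))"
    by (subst unslice_slice[OF z]) simp
  also have "\<dots> \<in> WD f q"
  proof (rule pm.subspace_sum[OF subspace_WD])
    fix S assume S: "S \<in> Pow {..<q}"
    show "Rot e (unslice S (slice S z)) \<in> WD f q"
    proof (cases "card S = f")
      case False
      then show ?thesis using slice_D_zero[OF z] pmp.linear_0[OF plinear_unslice] by (simp add: pm.subspace_0)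
    next
      case True
      have s: "slice S z \<in> WG (cyc_gens q) ({..<q} - S)" using assms(1) S by (auto simp: WD_def)
      then have "unslice (shift1 q S) (rotl (slice S z)) \<in> WD (card (shift1 q S)) q"
        using assms(2) by (intro unslice_WD rotl_WG) (auto simp: shift1_def)
      then show ?thesis
        using Rot_unslice[OF slice_T[OF z]] S assms(2) card_shift1[of S q] True
        by (auto intro!: pm.subspace_scale)
    qed
  qed
  finally show ?thesis .
qed

lemma Rot_power_WD: "z \<in> WD f q \<Longrightarrow> q \<ge> 2 \<Longrightarrow> (Rot e ^^ k) z \<in> WD f q"
  by (induction k) (simp_all add: Rot_WD)

text \<open>The kernel of the passage from \<open>D f q\<close> to the cyclic coinvariants.\<close>

definition relD :: "nat \<Rightarrow> nat \<Rightarrow> (flagged \<Rightarrow>\<^sub>0 'k) set"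
  where "relD f q = {w + (u - Rot (sg f q) u) | w u. w \<in> WD f q \<and> u \<in> D f q}"

lemma relDI: "w \<in> WD f q \<Longrightarrow> u \<in> D f q \<Longrightarrow> x = w + (u - Rot (sg f q) u) \<Longrightarrow> x \<in> relD f q"
  by (auto simp: relD_def)

lemma subspace_relD [simp, intro]: "pm.subspace (relD f q)"
proof (rule pm.subspaceI)
  show "0 \<in> relD f q" by (rule relDI[of 0 _ _ 0]) (auto intro: pm.subspace_0)
next
  fix x y assume "x \<in> relD f q" "y \<in> relD f q"
  then obtain w u w' u' where "x = w + (u - Rot (sg f q) u)" "w \<in> WD f q" "u \<in> D f q"
    "y = w' + (u' - Rot (sg f q) u')" "w' \<in> WD f q" "u' \<in> D f q" by (auto simp: relD_def)
  then show "x + y \<in> relD f q" by (intro relDI[of "w + w'" _ _ "u + u'"]) (auto intro: pm.subspace_add)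
next
  fix r x assume "x \<in> relD f q"
  then obtain w u where "x = w + (u - Rot (sg f q) u)" "w \<in> WD f q" "u \<in> D f q" by (auto simp: relD_def)
  then show "pscale r x \<in> relD f q"
    by (intro relDI[of "pscale r w" _ _ "pscale r u"])
      (auto intro: pm.subspace_scale simp: pm.scale_right_distrib pm.scale_right_diff_distrib)
qed

lemma WD_relD: "WD f q \<subseteq> relD f q"
  using relDI[of _ f q 0] by (auto intro: pm.subspace_0)

lemma Rot_relD: "u \<in> D f q \<Longrightarrow> u - Rot (sg f q) u \<in> relD f q"
  by (rule relDI[of 0]) (auto intro: pm.subspace_0)

lemma Rot_power_relD: "u \<in> D f q \<Longrightarrow> u - (Rot (sg f q) ^^ k) u \<in> relD f q"
proof (induction k)
  case (Suc k)
  have "(u - (Rot (sg f q) ^^ k) u) + ((Rot (sg f q) ^^ k) u - Rot (sg f q) ((Rot (sg f q) ^^ k) u)) \<in> relD f q"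
    by (intro pm.subspace_add subspace_relD Suc Rot_relD Rot_power_D)
  then show ?case by simp
qed (simp add: pm.subspace_0)

lemma bar_d_relD:
  assumes "x \<in> relD (Suc f) q"
  shows "\<exists>w u. lin_ext bar_d x = lin_ext bar_d w + (u - Rot (sg f q) u) \<and> w \<in> WD (Suc f) q \<and> u \<in> D f q"
proof -
  obtain w u where wu: "x = w + (u - Rot (sg (Suc f) q) u)" "w \<in> WD (Suc f) q" "u \<in> D (Suc f) q"
    using assms by (auto simp: relD_def)
  then show ?thesis using lin_bar_d_D[OF wu(3)] bar_d_Rot[OF wu(3)] by auto
qed

text \<open>Removing a bar only enlarges the set of killed gaps, so relations stay
  relations.\<close>

lemma bar_d_WD:
  assumes "w \<in> WD (Suc f) q"
  shows "lin_ext bar_d w \<in> WD f q"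
  unfolding WD_def
proof (intro CollectI conjI allI impI)
  have w: "w \<in> D (Suc f) q" using assms WD_D by auto
  then show "lin_ext bar_d w \<in> D f q" by (rule lin_bar_d_D)
  fix S assume S: "S \<subseteq> {..<q}"
  have "slice (insert i S) w \<in> WG (cyc_gens q) ({..<q} - S)" if "i < q" for i
  proof -
    have "slice (insert i S) w \<in> WG (cyc_gens q) ({..<q} - insert i S)" using assms S that by (auto simp: WD_def)
    then show ?thesis using WG_mono[of "{..<q} - insert i S" "{..<q} - S" "cyc_gens q"] by auto
  qed
  then show "slice S (lin_ext bar_d w) \<in> WG (cyc_gens q) ({..<q} - S)"
    unfolding slice_bar_d[OF w S] cube_d_def
    by (auto intro!: pm.subspace_sum pm.subspace_scale)
qed

lemma bar_d_relD': "x \<in> relD (Suc f) q \<Longrightarrow> lin_ext bar_d x \<in> relD f q"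
  using bar_d_relD[of x f q] bar_d_WD relDI by blast

text \<open>Checked slice by slice, where it is the identity of the cube.\<close>

lemma bar_dd:
  assumes "z \<in> D (Suc (Suc f)) q"
  shows "lin_ext bar_d (lin_ext bar_d z) = 0"
proof -
  have d1: "lin_ext bar_d z \<in> D (Suc f) q" by (rule lin_bar_d_D[OF assms])
  have d2: "lin_ext bar_d (lin_ext bar_d z) \<in> D f q" by (rule lin_bar_d_D[OF d1])
  have "slice S (lin_ext bar_d (lin_ext bar_d z)) = 0" if S: "S \<subseteq> {..<q}" for S
  proof -
    have "slice S (lin_ext bar_d (lin_ext bar_d z)) = cube_d \<sigma>D {..<q} (\<lambda>S. slice S (lin_ext bar_d z)) S"
      by (rule slice_bar_d[OF d1 S])
    also have "\<dots> = cube_d \<sigma>D {..<q} (cube_d \<sigma>D {..<q} (\<lambda>S. slice S z)) S"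
      unfolding cube_d_def[of _ _ "\<lambda>S. slice S (lin_ext bar_d z)"] cube_d_def[of _ _ "cube_d \<sigma>D {..<q} (\<lambda>S. slice S z)"]
      by (intro sum.cong refl arg_cong[of _ _ "pscale _"] slice_bar_d[OF assms]) (use S in auto)
    also have "\<dots> = 0" by (rule cube_dd[OF cube_sign_sigmaD _ S]) simp
    finally show ?thesis .
  qed
  then show ?thesis
    by (subst unslice_slice[OF d2], intro sum.neutral) (auto simp: pmp.linear_0[OF plinear_unslice])
qed

text \<open>Coinvariants are exact in characteristic zero: replace the cycle by its norm, which is a
  cycle of the cube without any correction by rotations, solve there, and divide by
  \<open>q\<close>.\<close>

lemma D_exact:
  assumes q: "q \<ge> 3" and z: "z \<in> D (Suc f) q" and dz: "lin_ext bar_d z \<in> relD f q"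
  shows "\<exists>y\<in>D (Suc (Suc f)) q. z - lin_ext bar_d y \<in> relD (Suc f) q"
proof -
  let ?R = "Rot (sg (Suc f) q)" and ?R' = "Rot (sg f q)"
  \<comment> \<open>The boundary of \<open>z\<close> vanishes only up to relations and terms
    \<open>u - ?R' u\<close>; the norm eliminates the latter.\<close>
  define N where "N = (\<Sum>k<q. (?R ^^ k) z)"
  have ND: "N \<in> D (Suc f) q" unfolding N_def by (intro pm.subspace_sum subspace_D Rot_power_D z)
  obtain w u where wu: "lin_ext bar_d z = w + (u - ?R' u)" "w \<in> WD f q" "u \<in> D f q"
    using dz by (auto simp: relD_def)
  have dR: "lin_ext bar_d ((?R ^^ k) z) = (?R' ^^ k) (lin_ext bar_d z)" for k
  proof (induction k)
    case (Suc k)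
    have "lin_ext bar_d ((?R ^^ Suc k) z) = lin_ext bar_d (?R ((?R ^^ k) z))" by (simp only: funpow.simps comp_def)
    also have "\<dots> = ?R' (lin_ext bar_d ((?R ^^ k) z))" by (rule bar_d_Rot[OF Rot_power_D[OF z]])
    finally show ?case by (simp only: Suc funpow.simps comp_def)
  qed simp
  have "lin_ext bar_d N = (\<Sum>k<q. (?R' ^^ k) w) + (\<Sum>k<q. (?R' ^^ k) u - (?R' ^^ Suc k) u)"
  proof -
    have "(?R' ^^ k) (lin_ext bar_d z) = (?R' ^^ k) w + ((?R' ^^ k) u - (?R' ^^ Suc k) u)" for k
      unfolding wu(1) by (simp only: pmp.linear_add[OF plinear_Rot_power] pmp.linear_diff[OF plinear_Rot_power] funpow_Suc_right comp_def)
    then show ?thesis by (simp only: N_def lin_ext_simps dR sum.distrib)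
  qed
  \<comment> \<open>Telescoping, followed by the fact that a full signed turn is the
    identity.\<close>
  also have "(\<Sum>k<q. (?R' ^^ k) u - (?R' ^^ Suc k) u) = (?R' ^^ 0) u - (?R' ^^ q) u"
    by (rule sum_lessThan_telescope')
  also have "\<dots> = 0" using Rot_power_id[OF wu(3)] by simp
  finally have dN: "lin_ext bar_d N = (\<Sum>k<q. (?R' ^^ k) w)" by simp
  have dNW: "lin_ext bar_d N \<in> WD f q"
    unfolding dN using q by (intro pm.subspace_sum subspace_WD Rot_power_WD wu(2)) simp
  obtain y where y: "\<And>S. S \<subseteq> {..<q} \<Longrightarrow> y S \<in> T n q"
    "\<And>S. S \<subseteq> {..<q} \<Longrightarrow> slice S N - cube_d \<sigma>D {..<q} y S \<in> WG (cyc_gens q) ({} \<union> ({..<q} - S))"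
  proof (rule cube_exactD[OF cyc_exact[OF q] cube_sign_sigmaD, of "\<lambda>S. slice S N"])
    show "slice S N \<in> T n q" if "S \<subseteq> {..<q}" for S by (rule slice_T[OF ND])
    show "cube_d \<sigma>D {..<q} (\<lambda>S. slice S N) S \<in> WG (cyc_gens q) ({} \<union> ({..<q} - S))" if "S \<subseteq> {..<q}" for S
    proof -
      have "slice S (lin_ext bar_d N) \<in> WG (cyc_gens q) ({..<q} - S)" using dNW that by (simp add: WD_def)
      then show ?thesis unfolding slice_bar_d[OF ND that] by simp
    qed
  qed (rule that)
  \<comment> \<open>Exactness of the cube ignores the number of bars, so the solution is cut down to
    its components with \<open>Suc (Suc f)\<close> bars, the only ones that map to the degree of
    \<open>N\<close>.\<close>
  define Y where "Y = (\<Sum>S\<in>{S. S \<subseteq> {..<q} \<and> card S = Suc (Suc f)}. unslice S (y S))"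
  have fin: "finite {S. S \<subseteq> {..<q} \<and> card S = Suc (Suc f)}" by (rule finite_subset[of _ "Pow {..<q}"]) auto
  have YD: "Y \<in> D (Suc (Suc f)) q"
    unfolding Y_def
  proof (intro pm.subspace_sum subspace_D)
    fix S assume S: "S \<in> {S. S \<subseteq> {..<q} \<and> card S = Suc (Suc f)}"
    then show "unslice S (y S) \<in> D (Suc (Suc f)) q" using unslice_D[of "y S" q S] y(1)[of S] by simp
  qed
  have sY: "slice S Y = (if card S = Suc (Suc f) then y S else 0)" if S: "S \<subseteq> {..<q}" for S
  proof -
    have "slice S Y = (\<Sum>S'\<in>{S. S \<subseteq> {..<q} \<and> card S = Suc (Suc f)}. if S = S' then y S' else 0)"
      unfolding Y_def slice_simps by (intro sum.cong refl slice_unslice) (use y(1) in auto)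
    then show ?thesis using S fin by (simp add: sum.delta)
  qed
  have NY: "N - lin_ext bar_d Y \<in> WD (Suc f) q"
    unfolding WD_def
  proof (intro CollectI conjI allI impI)
    show "N - lin_ext bar_d Y \<in> D (Suc f) q" by (intro pm.subspace_diff subspace_D ND lin_bar_d_D YD)
    fix S assume S: "S \<subseteq> {..<q}"
    have sl: "slice S (N - lin_ext bar_d Y) = slice S N - cube_d \<sigma>D {..<q} (\<lambda>S. slice S Y) S"
      by (simp add: slice_bar_d[OF YD S])
    show "slice S (N - lin_ext bar_d Y) \<in> WG (cyc_gens q) ({..<q} - S)"
    proof (cases "card S = Suc f")
      case True
      have "finite S" using S finite_subset by blast
      have "cube_d \<sigma>D {..<q} (\<lambda>S. slice S Y) S = cube_d \<sigma>D {..<q} y S"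
        unfolding cube_d_def using S True \<open>finite S\<close> by (intro sum.cong refl) (auto simp: sY)
      then show ?thesis unfolding sl using y(2)[OF S] by simp
    next
      case False
      have "finite S" using S finite_subset by blast
      have "cube_d \<sigma>D {..<q} (\<lambda>S. slice S Y) S = 0"
        unfolding cube_d_def using S False \<open>finite S\<close> by (intro sum.neutral) (auto simp: sY)
      then show ?thesis unfolding sl using slice_D_zero[OF ND False] by (simp add: pm.subspace_0)
    qed
  qed
  \<comment> \<open>Since \<open>pscale (of_nat q) z - N\<close> consists of rotation terms,
    dividing by \<open>q\<close> transfers the solution for \<open>N\<close> to
    \<open>z\<close>.\<close>
  define c where "c = 1 / (of_nat q :: 'k)"
  have c: "c * of_nat q = 1" using q by (simp add: c_def)
  have "(\<Sum>k<q. z - (?R ^^ k) z) \<in> relD (Suc f) q"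
    by (intro pm.subspace_sum subspace_relD Rot_power_relD z)
  also have "(\<Sum>k<q. z - (?R ^^ k) z) = pscale (of_nat q) z - N"
  proof -
    have "(\<Sum>k<q. z) = pscale (\<Sum>k<q. 1) z" by (simp only: pm.scale_sum_left pm.scale_one)
    then show ?thesis by (simp add: N_def sum_subtractf)
  qed
  finally have "pscale (of_nat q) z - N \<in> relD (Suc f) q" .
  then have "(pscale (of_nat q) z - N) + (N - lin_ext bar_d Y) \<in> relD (Suc f) q"
    using NY WD_relD by (intro pm.subspace_add subspace_relD) auto
  then have "pscale c ((pscale (of_nat q) z - N) + (N - lin_ext bar_d Y)) \<in> relD (Suc f) q"
    by (rule pm.subspace_scale[OF subspace_relD])
  also have "pscale c ((pscale (of_nat q) z - N) + (N - lin_ext bar_d Y)) = z - lin_ext bar_d (pscale c Y)"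
    using c by (simp add: pm.scale_right_diff_distrib)
  finally show ?thesis using pm.subspace_scale[OF subspace_D YD, of c] by blast
qed

end

section \<open>Cyclic tensors of words\<close>

text \<open>The operators \<open>tE\<close> and \<open>bE\<close> are \<open>cyc_t\<close> and
  \<open>cyc_b\<close> on tensors of words, where the sign degree of a factor is the parity of its
  length.\<close>

definition tE :: "nat list list \<Rightarrow> (nat list list \<Rightarrow>\<^sub>0 'k::field)"
  where "tE ws = (let m = length ws - 1 in
    Poly_Mapping.single (last ws # butlast ws) ((- 1) ^ ((length (ws ! m) + 1) * (\<Sum>r<m. length (ws ! r) + 1))))"

definition bE' :: "nat list list \<Rightarrow> (nat list list \<Rightarrow>\<^sub>0 'k::field)"
  where "bE' ws = (\<Sum>i<length ws - 1. Poly_Mapping.single (take i ws @ (ws ! i @ ws ! (i + 1)) # drop (i + 2) ws)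
        ((- 1) ^ (i + (\<Sum>r\<le>i. length (ws ! r)))))"

definition bE :: "nat list list \<Rightarrow> (nat list list \<Rightarrow>\<^sub>0 'k::field)"
  where "bE ws = (let m = length ws - 1 in bE' ws +
    Poly_Mapping.single ((ws ! m @ ws ! 0) # butlast (tl ws))
      ((- 1) ^ (length (ws ! m) + (length (ws ! m) + 1) * (\<Sum>r<m. length (ws ! r) + 1))))"

text \<open>Splitting off the first factor puts the differential without its wrapping term into the
  recursive form of \<open>bar_d\<close>.\<close>

lemma bE'_rec: "bE' (w # v # ws) = Poly_Mapping.single ((w @ v) # ws) ((- 1) ^ length w)
    + pscale (- ((- 1) ^ length w)) (lapp [w] (bE' (v # ws)) :: nat list list \<Rightarrow>\<^sub>0 'k::field)"
proof -
  let ?t = "\<lambda>ws i. take i ws @ (ws ! i @ ws ! (i + 1)) # drop (i + 2) ws"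
  let ?c = "\<lambda>ws i. (- 1 :: 'k) ^ (i + (\<Sum>r\<le>i. length (ws ! r)))"
  have c: "?c (w # v # ws) (Suc i) = - ((- 1) ^ length w) * ?c (v # ws) i" for i
    by (simp add: sum.atMost_Suc_shift power_add del: sum.atMost_Suc)
  have t: "?t (w # v # ws) (Suc i) = w # ?t (v # ws) i" for i by simp
  have "bE' (w # v # ws) = (\<Sum>i<Suc (length ws). Poly_Mapping.single (?t (w # v # ws) i) (?c (w # v # ws) i))"
    by (simp add: bE'_def)
  also have "\<dots> = Poly_Mapping.single (?t (w # v # ws) 0) (?c (w # v # ws) 0) +
     (\<Sum>i<length ws. Poly_Mapping.single (?t (w # v # ws) (Suc i)) (?c (w # v # ws) (Suc i)))"
    by (rule sum.lessThan_Suc_shift)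
  also have "(\<Sum>i<length ws. Poly_Mapping.single (?t (w # v # ws) (Suc i)) (?c (w # v # ws) (Suc i)))
    = pscale (- ((- 1) ^ length w)) (lapp [w] (bE' (v # ws)))"
  proof -
    have "bE' (v # ws) = (\<Sum>i<length ws. Poly_Mapping.single (?t (v # ws) i) (?c (v # ws) i))" by (simp add: bE'_def)
    then show ?thesis unfolding c t by (simp only: lapp_simps lapp_single pm.scale_sum_right pscale_single append_Cons append_Nil)
  qed
  finally show ?thesis by simp
qed

lemma bE'_single [simp]: "bE' [w] = 0" by (simp add: bE'_def)

definition fl :: "nat list \<Rightarrow> flagged" where "fl w = (True, hd w) # map (Pair False) (tl w)"

definition enc :: "nat list list \<Rightarrow> flagged" where "enc ws = concat (map fl ws)"

definition Enc :: "(nat list list \<Rightarrow>\<^sub>0 'k::field) \<Rightarrow> (flagged \<Rightarrow>\<^sub>0 'k)"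
  where "Enc = lin_ext (\<lambda>ws. Poly_Mapping.single (enc ws) 1)"

lemma plinear_Enc: "plinear Enc" by (simp add: Enc_def lin_ext_linear)

lemmas Enc_simps [simp] = pmp.linear_0[OF plinear_Enc] pmp.linear_add[OF plinear_Enc] pmp.linear_diff[OF plinear_Enc]
  pmp.linear_scale[OF plinear_Enc] pmp.linear_sum[OF plinear_Enc] pmp.linear_neg[OF plinear_Enc]

lemma Enc_single [simp]: "Enc (Poly_Mapping.single ws r) = Poly_Mapping.single (enc ws) r"
  by (simp add: Enc_def)

lemma enc_simps [simp]: "enc [] = []" "enc (w # ws) = fl w @ enc ws" "enc (us @ vs) = enc us @ enc vs"
  by (simp_all add: enc_def)

lemma fl_append: "w \<noteq> [] \<Longrightarrow> fl w @ map (Pair False) v = fl (w @ v)"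
  by (cases w) (simp_all add: fl_def)

lemma enc_hd: "enc ws = [] \<or> fst (hd (enc ws))"
  by (cases ws) (simp_all add: fl_def)

lemma bar_d_unflagged [simp]: "bar_d (map (Pair False) u) = 0"
  by (induction u) simp_all

lemma bar_d_fl: "w \<noteq> [] \<Longrightarrow> bar_d (fl w) = Poly_Mapping.single (map (Pair False) w) 1"
  by (cases w) (simp_all add: fl_def)

lemma filter_unflagged [simp]: "filter (Not \<circ> fst) (map (Pair False) u) = map (Pair False) u"
  "filter fst (map (Pair False) u) = []"
  by (induction u) simp_all

lemma flag_sign_fl: "w \<noteq> [] \<Longrightarrow> prod_list (map flag_sign (fl w)) = (- ((- 1) ^ length w) :: 'k::field)"
proof -
  assume w: "w \<noteq> []"
  have "prod_list (map flag_sign (map (Pair False) u)) = ((- 1) ^ length u :: 'k)" for u :: "nat list"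
    by (induction u) (simp_all add: flag_sign_def)
  then show ?thesis using w by (cases w) (simp_all add: fl_def flag_sign_def del: map_map)
qed

lemma lapp_Enc: "lapp (fl w) (Enc y) = Enc (lapp [w] y)"
  by (rule plinear_eqI[of "\<lambda>y. lapp (fl w) (Enc y)"])
    (simp_all add: plinear_comp[OF plinear_lapp plinear_Enc] plinear_comp[OF plinear_Enc plinear_lapp])

text \<open>The inner bars give the merges of neighbouring factors. Removing the first bar leaves a
  word that starts with bare letters: on the circle, the first factor has been joined to the
  last.\<close>

lemma bar_d_enc: "w \<noteq> [] \<Longrightarrow> [] \<notin> set ws \<Longrightarrow>
    (bar_d (enc (w # ws)) :: flagged \<Rightarrow>\<^sub>0 'k::field) = Poly_Mapping.single (map (Pair False) w @ enc ws) 1 - Enc (bE' (w # ws))"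
proof (induction ws arbitrary: w)
  case Nil
  then show ?case by (simp add: bar_d_fl)
next
  case (Cons v ws)
  have v: "v \<noteq> []" "[] \<notin> set ws" using Cons.prems by auto
  have "(bar_d (enc (w # v # ws)) :: flagged \<Rightarrow>\<^sub>0 'k) = rapp (enc (v # ws)) (bar_d (fl w))
      + pscale (prod_list (map flag_sign (fl w))) (lapp (fl w) (bar_d (enc (v # ws))))"
    by (simp only: enc_simps(2)[of w] bar_d_append)
  also have "\<dots> = Poly_Mapping.single (map (Pair False) w @ enc (v # ws)) 1
      + pscale (- ((- 1) ^ length w)) (Poly_Mapping.single (fl (w @ v) @ enc ws) 1 - Enc (lapp [w] (bE' (v # ws))))"
    unfolding Cons.IH[OF v] flag_sign_fl[OF Cons.prems(1)]
    bar_d_fl[OF Cons.prems(1)] lapp_simps lapp_Enc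
    using Cons.prems(1) by (simp add: fl_append[symmetric])
  also have "\<dots> = Poly_Mapping.single (map (Pair False) w @ enc (v # ws)) 1 - Enc (bE' (w # v # ws))"
    unfolding bE'_rec by (simp add: pm.scale_right_diff_distrib algebra_simps) (simp add: single_uminus)
  finally show ?case .
qed

lemma sum_length_Suc: "(\<Sum>r<length us. length (us ! r) + 1) = sum_list (map length us) + length us"
  by (simp only: sum.distrib) (simp add: sum_list_sum_nth atLeast0LessThan)

text \<open>Cuts before each bar. The first entry always opens a block, whatever its flag, so this
  inverts \<open>enc\<close> only on words that start with a bar.\<close>

function blocks :: "flagged \<Rightarrow> nat list list"
  where "blocks [] = []"
  | "blocks (x # xs) = (snd x # map snd (takeWhile (Not \<circ> fst) xs)) # blocks (dropWhile (Not \<circ> fst) xs)"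
  by pat_completeness auto
termination by (relation "measure length") (auto simp: le_imp_less_Suc length_dropWhile_le)

lemma takeWhile_unflagged: "ys = [] \<or> fst (hd ys) \<Longrightarrow> takeWhile (Not \<circ> fst) (map (Pair False) u @ ys) = map (Pair False) u"
  "ys = [] \<or> fst (hd ys) \<Longrightarrow> dropWhile (Not \<circ> fst) (map (Pair False) u @ ys) = ys"
  by (induction u) (cases ys; auto)+

lemma blocks_enc: "[] \<notin> set ws \<Longrightarrow> blocks (enc ws) = ws"
proof (induction ws)
  case (Cons w ws)
  then show ?case
    using takeWhile_unflagged[OF enc_hd[of ws], of "tl w"]
    by (cases w) (simp_all add: fl_def, simp add: comp_def)
qed simp

lemma takeWhile_unflagged_eq: "map (Pair False) (map snd (takeWhile (Not \<circ> fst) xs)) = takeWhile (Not \<circ> fst) xs"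
  by (induction xs) auto

lemma takeWhile_unflagged_eq': "map (Pair False \<circ> snd) (takeWhile (Not \<circ> fst) xs) = takeWhile (Not \<circ> fst) xs"
  by (induction xs) auto

lemma enc_blocks: "xs = [] \<or> fst (hd xs) \<Longrightarrow> enc (blocks xs) = xs"
proof (induction xs rule: blocks.induct)
  case (2 x xs)
  have "dropWhile (Not \<circ> fst) xs = [] \<or> fst (hd (dropWhile (Not \<circ> fst) xs))"
    using hd_dropWhile[of "Not \<circ> fst" xs] by auto
  from "2.IH"[OF this] "2.prems" show ?case
    by (cases x) (simp add: fl_def takeWhile_unflagged_eq')
qed simp

lemma blocks_nonempty: "[] \<notin> set (blocks xs)"
  by (induction xs rule: blocks.induct) auto

context quadric begin

definition Eset :: "nat \<Rightarrow> nat \<Rightarrow> nat list list set"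
  where "Eset m q = {ws. length ws = Suc m \<and> (\<forall>w\<in>set ws. w \<noteq> [] \<and> set w \<subseteq> {..<n}) \<and> sum_list (map length ws) = q}"

definition E :: "nat \<Rightarrow> nat \<Rightarrow> (nat list list \<Rightarrow>\<^sub>0 'k) set" where "E m q = supp_in (Eset m q)"

lemma subspace_E [simp, intro]: "pm.subspace (E m q)" by (simp add: E_def)

lemma E_linear_subset:
  assumes "plinear g" "\<And>xs. xs \<in> Eset m q \<Longrightarrow> g (Poly_Mapping.single xs 1) \<in> V" "pm.subspace V" "x \<in> E m q"
  shows "g x \<in> V"
  by (rule plinear_supp_subset[OF assms(1) _ assms(3) assms(4)[unfolded E_def]]) (rule assms(2))

lemma Eset_nonempty: "ws \<in> Eset m q \<Longrightarrow> [] \<notin> set ws" by (auto simp: Eset_def)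

lemma single_E [simp]: "ws \<in> Eset m q \<Longrightarrow> Poly_Mapping.single ws r \<in> E m q" by (simp add: E_def)

lemma enc_Dset: "[] \<notin> set ws \<Longrightarrow> enc ws \<in> Dset f q \<longleftrightarrow>
    length ws = f \<and> (\<forall>w\<in>set ws. set w \<subseteq> {..<n}) \<and> sum_list (map length ws) = q"
proof -
  assume ne: "[] \<notin> set ws"
  have 1: "length (enc ws) = sum_list (map length ws)" using ne
  proof (induction ws)
    case (Cons w ws) then show ?case by (cases w) (auto simp: fl_def)
  qed simp
  have 2: "map snd (enc ws) = concat ws" using ne
  proof (induction ws)
    case (Cons w ws) then show ?case by (cases w) (auto simp: fl_def comp_def)
  qed simp
  have 3: "length (filter fst (enc ws)) = length ws"
    by (induction ws) (simp_all add: fl_def)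
  have "snd ` set (enc ws) = set (concat ws)" using 2 by (metis image_set)
  then show ?thesis using 1 3 by (auto simp: Dset_def)
qed

lemma enc_Eset: "[] \<notin> set ws \<Longrightarrow> enc ws \<in> Dset (Suc m) q \<longleftrightarrow> ws \<in> Eset m q"
  using enc_Dset[of ws "Suc m" q] by (auto simp: Eset_def)

lemma Enc_D: "z \<in> E m q \<Longrightarrow> Enc z \<in> D (Suc m) q"
  by (rule E_linear_subset[OF plinear_Enc, of m q]) (simp_all add: D_def enc_Eset Eset_nonempty)

text \<open>A parity computation: the sign in the definition of the cyclic operator is the sign of
  rotating the encoded factor, that is one factor \<open>sg\<close> for each of its letters except
  the barred one. The lemma on \<open>bE\<close> after it does the same for the wrapping
  term.\<close>

lemma tE_append: "us @ [w] \<in> Eset m q \<Longrightarrow> tE (us @ [w]) = Poly_Mapping.single (w # us) (sg (Suc m) q ^ (length w - 1))"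
proof -
  assume uw: "us @ [w] \<in> Eset m q"
  then have len: "length us = m" "q = sum_list (map length us) + length w" "w \<noteq> []" by (auto simp: Eset_def)
  define r p where "r = sum_list (map length us)" and "p = length w"
  have p: "p \<ge> 1" using len by (cases w) (simp_all add: p_def)
  have "(\<Sum>i<m. length ((us @ [w]) ! i) + 1) = (\<Sum>i<length us. length (us ! i) + 1)"
    using len by (intro sum.cong) (auto simp: nth_append)
  also have "\<dots> = r + m" using sum_length_Suc[of us] len by (simp add: r_def)
  finally have "(- 1 :: 'k) ^ ((length w + 1) * (\<Sum>i<m. length ((us @ [w]) ! i) + 1)) = (- 1) ^ ((p + 1) * (r + m))"
    by (simp only: p_def)
  also have "\<dots> = (- 1) ^ ((r + p + Suc m + 1) * (p - 1))"
  proof -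
    obtain p' where "p = Suc p'" using p by (cases p) auto
    then show ?thesis by (cases "even p'"; cases "even (r + m)") (auto simp: minus_one_power_iff)
  qed
  also have "\<dots> = sg (Suc m) q ^ (p - 1)" by (simp only: sg_def power_mult len(2) r_def p_def)
  finally show ?thesis using len by (simp add: tE_def Let_def nth_append p_def)
qed

lemma bE_append: "w # us @ [v] \<in> Eset (Suc m) q \<Longrightarrow>
    bE (w # us @ [v]) = bE' (w # us @ [v]) + Poly_Mapping.single ((v @ w) # us) (- (sg (Suc m) q ^ (length v - 1)))"
proof -
  assume uw: "w # us @ [v] \<in> Eset (Suc m) q"
  then have len: "length us = m" "q = sum_list (map length (w # us)) + length v" "v \<noteq> []" by (auto simp: Eset_def)
  define r p where "r = sum_list (map length (w # us))" and "p = length v"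
  have p: "p \<ge> 1" using len by (cases v) (simp_all add: p_def)
  have "(\<Sum>i<Suc m. length ((w # us @ [v]) ! i) + 1) = (\<Sum>i<length (w # us). length ((w # us) ! i) + 1)"
    using len by (intro sum.cong) (auto simp: nth_append simp flip: append_Cons)
  also have "\<dots> = r + Suc m"
    using sum_length_Suc[of "w # us"] len by (simp only: r_def list.size(4) Suc_eq_plus1)
  finally have "(- 1 :: 'k) ^ (length v + (length v + 1) * (\<Sum>i<Suc m. length ((w # us @ [v]) ! i) + 1)) = (- 1) ^ (p + (p + 1) * (r + Suc m))"
    by (simp only: p_def)
  also have "\<dots> = - ((- 1) ^ ((r + p + Suc m + 1) * (p - 1)))"
  proof -
    obtain p' where "p = Suc p'" using p by (cases p) auto
    then show ?thesis by (cases "even p'"; cases "even (r + m)") (auto simp: minus_one_power_iff)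
  qed
  also have "\<dots> = - (sg (Suc m) q ^ (p - 1))" by (simp only: sg_def power_mult len(2) r_def p_def)
  finally show ?thesis using len by (simp add: bE_def Let_def nth_append p_def butlast_append del: sum.lessThan_Suc)
qed

lemma Eset_Cons_snoc: "ws \<in> Eset (Suc m) q \<Longrightarrow> \<exists>w us v. ws = w # us @ [v]"
proof -
  assume "ws \<in> Eset (Suc m) q"
  then have "length ws = Suc (Suc m)" by (simp add: Eset_def)
  then obtain w ws' where ws: "ws = w # ws'" "length ws' = Suc m" by (cases ws) auto
  then obtain us v where "ws' = us @ [v]" by (cases ws' rule: rev_exhaust) auto
  then show ?thesis using ws by blast
qed

lemma Eset_rotate: "w # us \<in> Eset m q \<longleftrightarrow> us @ [w] \<in> Eset m q" by (auto simp: Eset_def)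

lemma sg_power_square: "sg f q ^ k * sg f q ^ k = 1"
  by (simp flip: power_mult_distrib)

lemma Rot_fl:
  assumes "w # us \<in> Eset m q"
  shows "(Rot (sg (Suc m) q) ^^ length w) (Poly_Mapping.single (enc (w # us)) 1)
    = pscale (sg (Suc m) q ^ (length w - 1)) (Poly_Mapping.single (enc (us @ [w])) 1)"
proof -
  have w: "w \<noteq> []" using assms by (auto simp: Eset_def)
  then have "length (fl w) = length w" "length (filter (Not \<circ> fst) (fl w)) = length w - 1"
    by (cases w; simp add: fl_def)+
  then show ?thesis using Rot_power_single[where us = "fl w" and vs = "enc us" and e = "sg (Suc m) q"] by simp
qed

lemma enc_rotate:
  assumes "w # us \<in> Eset m q"
  shows "Poly_Mapping.single (enc (w # us)) 1 - pscale (sg (Suc m) q ^ (length w - 1)) (Poly_Mapping.single (enc (us @ [w])) 1)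
    \<in> relD (Suc m) q"
proof -
  have "Poly_Mapping.single (enc (w # us)) 1 \<in> D (Suc m) q"
    using assms enc_Eset[OF Eset_nonempty[OF assms]] by (simp add: D_def)
  from Rot_power_relD[OF this, of "length w"] show ?thesis using Rot_fl[OF assms] by simp
qed

text \<open>Under the encoding \<open>bar_d\<close> corresponds to minus \<open>bE\<close>. Only the
  wrapping term needs the rotation relations: both versions of it are rotated to the same word, with
  the joined factor at the end.\<close>

lemma bar_d_Enc:
  assumes "z \<in> E (Suc m) q"
  shows "lin_ext bar_d (Enc z) + Enc (lin_ext bE z) \<in> relD (Suc m) q"
proof (rule E_linear_subset[OF _ _ subspace_relD assms])
  fix ws assume ws: "ws \<in> Eset (Suc m) q"
  then obtain w us v where wuv: "ws = w # us @ [v]" using Eset_Cons_snoc by blast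
  have ne: "w \<noteq> []" "v \<noteq> []" "[] \<notin> set us" "[] \<notin> set (us @ [v])" using ws wuv by (auto simp: Eset_def)
  let ?e = "sg (Suc m) q"
  have vw: "(v @ w) # us \<in> Eset m q" using ws wuv by (auto simp: Eset_def)
  have "lin_ext bar_d (Enc (Poly_Mapping.single ws 1)) + Enc (lin_ext bE (Poly_Mapping.single ws 1))
    = Poly_Mapping.single (map (Pair False) w @ enc (us @ [v])) 1 - pscale (?e ^ (length v - 1)) (Poly_Mapping.single (enc ((v @ w) # us)) 1)"
  proof -
    have "lin_ext bar_d (Enc (Poly_Mapping.single ws 1)) = bar_d (enc (w # us @ [v]))" by (simp only: Enc_single lin_ext_single wuv pm.scale_one)
    also have "\<dots> = Poly_Mapping.single (map (Pair False) w @ enc (us @ [v])) 1 - Enc (bE' (w # us @ [v]))"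
      by (rule bar_d_enc[OF ne(1,4)])
    finally have 1: "lin_ext bar_d (Enc (Poly_Mapping.single ws 1)) = \<dots>" .
    have "Enc (lin_ext bE (Poly_Mapping.single ws 1)) = Enc (bE' (w # us @ [v])) - pscale (?e ^ (length v - 1)) (Poly_Mapping.single (enc ((v @ w) # us)) 1)"
      using bE_append[of w us v m q] ws wuv by (simp add: single_uminus del: enc_simps)
    then show ?thesis unfolding 1 by simp
  qed
  also have "\<dots> \<in> relD (Suc m) q"
  proof -
    let ?x = "Poly_Mapping.single (map (Pair False) w @ enc (us @ [v])) (1::'k)"
    let ?y = "Poly_Mapping.single (enc (us @ [v @ w])) (1::'k)"
    let ?z = "Poly_Mapping.single (enc ((v @ w) # us)) (1::'k)"
    have xD: "?x \<in> D (Suc m) q"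
    proof -
      have "enc ((v @ w) # us) \<in> Dset (Suc m) q" using enc_Eset[OF Eset_nonempty[OF vw]] vw by simp
      then show ?thesis using ne(2)
        by (simp add: D_def Dset_def fl_append[OF ne(2), symmetric] image_Un)
    qed
    have "(Rot ?e ^^ length w) ?x = pscale (?e ^ length w) ?y"
      using Rot_power_single[where us = "map (Pair False) w" and vs = "enc (us @ [v])" and e = ?e] ne(2)
      by (simp add: fl_append)
    then have 1: "?x - pscale (?e ^ length w) ?y \<in> relD (Suc m) q" using Rot_power_relD[OF xD, of "length w"] by simp
    have 2: "?z - pscale (?e ^ (length (v @ w) - 1)) ?y \<in> relD (Suc m) q" by (rule enc_rotate[OF vw])
    have "?e ^ (length v - 1) * ?e ^ (length (v @ w) - 1) = ?e ^ length w"
    proof -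
      have "?e ^ (length (v @ w) - 1) = ?e ^ (length v - 1) * ?e ^ length w"
        using ne(2) by (cases v) (simp_all add: power_add)
      then show ?thesis using sg_power_square[of "Suc m" q "length v - 1"] by (simp add: mult.assoc[symmetric])
    qed
    then have eq: "?x - pscale (?e ^ (length v - 1)) ?z
      = (?x - pscale (?e ^ length w) ?y) - pscale (?e ^ (length v - 1)) (?z - pscale (?e ^ (length (v @ w) - 1)) ?y)"
      by (simp add: pm.scale_right_diff_distrib del: pscale_single)
    show ?thesis unfolding eq by (rule pm.subspace_diff[OF subspace_relD 1 pm.subspace_scale[OF subspace_relD 2]])
  qed
  finally show "lin_ext bar_d (Enc (Poly_Mapping.single ws 1)) + Enc (lin_ext bE (Poly_Mapping.single ws 1)) \<in> relD (Suc m) q" .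
qed (intro plinear_add plinear_comp[OF lin_ext_linear plinear_Enc] plinear_comp[OF plinear_Enc lin_ext_linear])

text \<open>The tensor with \<open>\<omega>\<close> inside one factor, between \<open>x\<close> and
  \<open>y\<close>. In \<open>omega_gens\<close> the letters \<open>[0, 0]\<close> merely stand for
  the two letters of \<open>\<omega>\<close> in order to state the lengths and the alphabet.\<close>

definition omega_gen :: "nat list list \<Rightarrow> nat list \<Rightarrow> nat list \<Rightarrow> nat list list \<Rightarrow> (nat list list \<Rightarrow>\<^sub>0 'k)"
  where "omega_gen us x y vs = (\<Sum>k<n. \<Sum>l<n. pscale (M k l) (Poly_Mapping.single (us @ (x @ [k, l] @ y) # vs) 1))"

definition omega_gens :: "nat \<Rightarrow> nat \<Rightarrow> (nat list list \<Rightarrow>\<^sub>0 'k) set"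
  where "omega_gens m q = {omega_gen us x y vs | us x y vs. us @ (x @ [0, 0] @ y) # vs \<in> Eset m q}"

text \<open>\<open>E m q\<close> modulo \<open>relE m q\<close> is the weight \<open>q\<close> part of \<open>I\<^bsup>\<otimes>(m+1)\<^esup> / im (1 - t)\<close>, where \<open>I\<close> is the
  augmentation ideal of the quadric algebra.\<close>

definition relE :: "nat \<Rightarrow> nat \<Rightarrow> (nat list list \<Rightarrow>\<^sub>0 'k) set"
  where "relE m q = pm.span (omega_gens m q \<union> (\<lambda>z. z - lin_ext tE z) ` E m q)"

lemma subspace_relE [simp, intro]: "pm.subspace (relE m q)" by (simp add: relE_def)

lemma omega_gen_relE: "us @ (x @ [0, 0] @ y) # vs \<in> Eset m q \<Longrightarrow> omega_gen us x y vs \<in> relE m q"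
  unfolding relE_def omega_gens_def by (intro pm.span_base) blast

lemma tE_relE: "z \<in> E m q \<Longrightarrow> z - lin_ext tE z \<in> relE m q"
  unfolding relE_def by (intro pm.span_base) blast

lemma Eset_letters: "us @ (x @ [0, 0] @ y) # vs \<in> Eset m q \<Longrightarrow> k < n \<Longrightarrow> l < n \<Longrightarrow> us @ (x @ [k, l] @ y) # vs \<in> Eset m q"
  by (auto simp: Eset_def)

lemma omega_gen_E: "us @ (x @ [0, 0] @ y) # vs \<in> Eset m q \<Longrightarrow> omega_gen us x y vs \<in> E m q"
  unfolding omega_gen_def
  by (intro pm.subspace_sum pm.subspace_scale subspace_E single_E) (simp add: Eset_letters[simplified])

lemma Eset_last: "ws \<in> Eset m q \<Longrightarrow> \<exists>us w. ws = us @ [w]"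
  by (cases ws rule: rev_exhaust) (auto simp: Eset_def)

lemma tE_E: "z \<in> E m q \<Longrightarrow> lin_ext tE z \<in> E m q"
proof (rule E_linear_subset[OF lin_ext_linear, of m q])
  fix ws assume ws: "ws \<in> Eset m q"
  then obtain us w where uw: "ws = us @ [w]" using Eset_last by blast
  then show "lin_ext tE (Poly_Mapping.single ws 1) \<in> E m q" using ws tE_append[of us w m q] by (simp add: Eset_rotate)
qed auto

lemma relE_E: "relE m q \<subseteq> E m q"
  unfolding relE_def omega_gens_def
  by (rule pm.span_minimal) (auto intro!: omega_gen_E pm.subspace_diff tE_E)

lemma map_fst_enc: "map fst (enc ws) = concat (map (\<lambda>w. True # replicate (length w - 1) False) ws)"
  by (induction ws) (simp_all add: fl_def comp_def map_replicate_const)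

lemma flags_cong: "map fst xs = map fst ys \<Longrightarrow> flags xs = flags ys"
proof -
  assume a: "map fst xs = map fst ys"
  then have "length xs = length ys" by (metis length_map)
  moreover have "fst (xs ! i) = fst (ys ! i)" if "i < length xs" for i
    using a that calculation by (metis nth_map)
  ultimately show ?thesis by (auto simp: flags_def)
qed

lemma unslice_omega: "unslice S (wmono A * \<omega> * wmono B) = (\<Sum>k<n. \<Sum>l<n. pscale (M k l) (Poly_Mapping.single (flagl S (A @ [k, l] @ B)) 1))"
  unfolding omega_pairs
  by (simp add: sum_distrib_left sum_distrib_right times_pscale_left times_pscale_right wmono_mult
      pmp.linear_sum[OF plinear_unslice] pmp.linear_scale[OF plinear_unslice] del: pscale_single)

lemma map_snd_enc: "[] \<notin> set ws \<Longrightarrow> map snd (enc ws) = concat ws"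
proof (induction ws)
  case (Cons w ws) then show ?case by (cases w) (auto simp: fl_def comp_def)
qed simp

text \<open>An \<open>\<omega>\<close> inside one factor sits at a gap without a bar, hence encodes
  to an element of \<open>WD\<close>; cyclic relations encode to powers of the signed
  rotation.\<close>

lemma Enc_relE: "x \<in> relE m q \<Longrightarrow> Enc x \<in> relD (Suc m) q"
  unfolding relE_def
proof (rule plinear_span_subset[OF plinear_Enc _ subspace_relD])
  fix g assume "g \<in> omega_gens m q \<union> (\<lambda>z. z - lin_ext tE z) ` E m q"
  then show "Enc g \<in> relD (Suc m) q"
  proof
    assume "g \<in> omega_gens m q"
    then obtain us x y vs where g: "g = omega_gen us x y vs" "us @ (x @ [0, 0] @ y) # vs \<in> Eset m q"
      by (auto simp: omega_gens_def)
    let ?ws = "\<lambda>k l. us @ (x @ [k, l] @ y) # vs"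
    define S where "S = flags (enc (?ws 0 0))"
    let ?A = "concat us @ x" and ?B = "y @ concat vs"
    have ne: "[] \<notin> set (?ws k l)" for k l using Eset_nonempty[OF g(2)] by auto
    have fl: "enc (?ws k l) = flagl S (?A @ [k, l] @ ?B)" for k l
    proof -
      have "flags (enc (?ws k l)) = S" unfolding S_def by (rule flags_cong) (simp add: map_fst_enc del: enc_simps)
      moreover have "map snd (enc (?ws k l)) = ?A @ [k, l] @ ?B" using map_snd_enc[OF ne] by simp
      ultimately show ?thesis using flagl_flags[of "enc (?ws k l)"] by simp
    qed
    have len: "length ?A + 2 + length ?B = q" using g(2) by (auto simp: Eset_def length_concat)
    have dD: "enc (?ws 0 0) \<in> Dset (Suc m) q" using enc_Eset[OF ne[of 0 0]] g(2) by blast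
    have Sq: "S \<subseteq> {..<q}"
    proof -
      have "length (enc (?ws 0 0)) = q" using dD unfolding Dset_def by blast
      then show ?thesis unfolding S_def using flags_subset[of "enc (?ws 0 0)"] by metis
    qed
    \<comment> \<open>The gap in question precedes the second letter of \<open>\<omega>\<close>,
      which never opens a factor.\<close>
    have nj: "Suc (length ?A) \<notin> S"
    proof
      assume "Suc (length ?A) \<in> S"
      then have "fst (enc (?ws 0 0) ! Suc (length ?A))" unfolding S_def flags_def by blast
      moreover have "enc (?ws 0 0) = (enc us @ fl (x @ [0])) @ (False, 0) # map (Pair False) y @ enc vs"
        using fl_append[of "x @ [0]" "0 # y"] by simp
      moreover have "length (enc us @ fl (x @ [0])) = Suc (length ?A)"
      proof -
        have "[] \<notin> set us" using ne[of 0 0] by simp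
        then have "length (enc us) = length (concat us)" using map_snd_enc[of us] length_map[of snd "enc us"] by simp
        then show ?thesis by (cases x) (simp_all add: fl_def)
      qed
      ultimately have "fst (((enc us @ fl (x @ [0])) @ (False, 0) # map (Pair False) y @ enc vs) ! length (enc us @ fl (x @ [0])))"
        by (simp only:)
      then show False unfolding nth_append_length by simp
    qed
    have "Enc g = unslice S (wmono ?A * \<omega> * wmono ?B)"
      unfolding unslice_omega fl[symmetric] g(1) omega_gen_def
      by (simp only: Enc_simps Enc_single)
    also have "\<dots> \<in> WD (card S) q"
    proof (rule unslice_WD[OF _ Sq])
      have sets: "set ?A \<subseteq> {..<n}" "set ?B \<subseteq> {..<n}" 
      proof -
        have "\<forall>w\<in>set (?ws 0 0). set w \<subseteq> {..<n}" using g(2) unfolding Eset_def by simp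
        then have "\<forall>w\<in>set us. set w \<subseteq> {..<n}" "\<forall>w\<in>set vs. set w \<subseteq> {..<n}" "set x \<subseteq> {..<n}" "set y \<subseteq> {..<n}"
          by simp_all
        then show "set ?A \<subseteq> {..<n}" "set ?B \<subseteq> {..<n}" by (simp_all add: UN_subset_iff)
      qed
      have "wmono ?A * \<omega> * wmono ?B \<in> rel_gens {length ?A} q"
        by (rule rel_gensI[OF refl _ len sets]) simp
      then have "wmono ?A * \<omega> * wmono ?B \<in> cyc_gens q (Suc (length ?A))" by (simp add: cyc_gens_def)
      moreover have "Suc (length ?A) \<in> {..<q} - S" using len nj by auto
      ultimately show "wmono ?A * \<omega> * wmono ?B \<in> WG (cyc_gens q) ({..<q} - S)"
        unfolding WG_def by (intro pm.span_base) blast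
    qed
    also have "card S = Suc m" unfolding S_def card_flags using dD unfolding Dset_def by blast
    finally show ?thesis using WD_relD by blast
  next
    assume "g \<in> (\<lambda>z. z - lin_ext tE z) ` E m q"
    then obtain z where z: "g = z - lin_ext tE z" "z \<in> E m q" by auto
    show ?thesis unfolding z(1)
    proof (rule E_linear_subset[OF _ _ subspace_relD z(2), of "\<lambda>z. Enc (z - lin_ext tE z)"])
      fix ws assume ws: "ws \<in> Eset m q"
      then obtain us w where uw: "ws = us @ [w]" using Eset_last by blast
      let ?c = "sg (Suc m) q ^ (length w - 1)"
      have "Enc (Poly_Mapping.single ws 1 - lin_ext tE (Poly_Mapping.single ws 1))
        = Poly_Mapping.single (enc (us @ [w])) 1 - pscale ?c (Poly_Mapping.single (enc (w # us)) 1)"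
        using tE_append[of us w m q] ws uw by (simp del: enc_simps)
      also have "\<dots> = - pscale ?c (Poly_Mapping.single (enc (w # us)) 1 - pscale ?c (Poly_Mapping.single (enc (us @ [w])) 1))"
        using sg_power_square[of "Suc m" q "length w - 1"] by (simp add: pm.scale_right_diff_distrib del: pscale_single enc_simps)
      also have "\<dots> \<in> relD (Suc m) q"
        using ws uw by (intro pm.subspace_neg pm.subspace_scale subspace_relD enc_rotate) (simp add: Eset_rotate)
      finally show "Enc (Poly_Mapping.single ws 1 - lin_ext tE (Poly_Mapping.single ws 1)) \<in> relD (Suc m) q" .
    qed (intro plinear_comp[OF plinear_Enc] plinear_minus plinear_id lin_ext_linear)
  qed
qed

text \<open>Decoding: the bare letters before the first bar belong to the last factor, so they are
  rotated to the end, with one sign for each, before cutting at the bars.\<close>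

definition alphaD :: "'k \<Rightarrow> flagged \<Rightarrow> (nat list list \<Rightarrow>\<^sub>0 'k)"
  where "alphaD e xs = Poly_Mapping.single (blocks (dropWhile (Not \<circ> fst) xs @ takeWhile (Not \<circ> fst) xs))
    (e ^ length (takeWhile (Not \<circ> fst) xs))"

definition AlphaD :: "nat \<Rightarrow> nat \<Rightarrow> (flagged \<Rightarrow>\<^sub>0 'k) \<Rightarrow> (nat list list \<Rightarrow>\<^sub>0 'k)"
  where "AlphaD m q = lin_ext (alphaD (sg (Suc m) q))"

lemma plinear_AlphaD: "plinear (AlphaD m q)" by (simp add: AlphaD_def lin_ext_linear)

lemmas AlphaD_simps [simp] = pmp.linear_0[OF plinear_AlphaD] pmp.linear_add[OF plinear_AlphaD] pmp.linear_diff[OF plinear_AlphaD]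
  pmp.linear_scale[OF plinear_AlphaD] pmp.linear_sum[OF plinear_AlphaD] pmp.linear_neg[OF plinear_AlphaD]

lemma AlphaD_single_enc:
  assumes "[] \<notin> set ws" "ws \<noteq> []"
  shows "AlphaD m q (Poly_Mapping.single (map (Pair False) u @ enc ws) 1)
    = Poly_Mapping.single (blocks (enc ws @ map (Pair False) u)) (sg (Suc m) q ^ length u)"
  using takeWhile_unflagged[OF enc_hd[of ws], of u] by (simp add: AlphaD_def alphaD_def)

lemma enc_unflagged_snoc: "w \<noteq> [] \<Longrightarrow> enc (us @ [w]) @ map (Pair False) u = enc (us @ [w @ u])"
  by (simp add: fl_append)

lemma Dset_decomp:
  assumes "xs \<in> Dset (Suc m) q"
  obtains u us w where "xs = map (Pair False) u @ enc (us @ [w])" "us @ [w @ u] \<in> Eset m q" "w \<noteq> []"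
proof -
  define u where "u = map snd (takeWhile (Not \<circ> fst) xs)"
  define ys where "ys = dropWhile (Not \<circ> fst) xs"
  have xs: "xs = map (Pair False) u @ ys" unfolding u_def ys_def takeWhile_unflagged_eq by simp
  have "ys \<noteq> []"
  proof
    assume "ys = []"
    then have "filter fst xs = []" using xs by simp
    then show False using assms by (simp add: Dset_def)
  qed
  then have "enc (blocks ys) = ys" using hd_dropWhile[of "Not \<circ> fst" xs] by (intro enc_blocks) (auto simp: ys_def)
  moreover from this have "blocks ys \<noteq> []" using \<open>ys \<noteq> []\<close> by auto
  then obtain us w where uw: "blocks ys = us @ [w]" by (metis rev_exhaust)
  ultimately have ys: "ys = enc (us @ [w])" by simp
  have ne: "[] \<notin> set (us @ [w])" using blocks_nonempty[of ys] uw by simp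
  then have w: "w \<noteq> []" by auto
  have "ys @ map (Pair False) u \<in> Dset (Suc m) q" using assms xs by (auto simp: Dset_def)
  then have "enc (us @ [w @ u]) \<in> Dset (Suc m) q" using ys enc_unflagged_snoc[OF w] by simp
  then have "us @ [w @ u] \<in> Eset m q" using enc_Eset[of "us @ [w @ u]"] ne by auto
  then show ?thesis using that xs ys w by blast
qed

lemma AlphaD_decomp:
  assumes "us @ [w @ u] \<in> Eset m q" "w \<noteq> []"
  shows "AlphaD m q (Poly_Mapping.single (map (Pair False) u @ enc (us @ [w])) 1)
    = Poly_Mapping.single (us @ [w @ u]) (sg (Suc m) q ^ length u)"
proof -
  have "[] \<notin> set (us @ [w])" "[] \<notin> set (us @ [w @ u])" using assms by (auto simp: Eset_def)
  then show ?thesis using AlphaD_single_enc[of "us @ [w]" m q u] blocks_enc[of "us @ [w @ u]"]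
    enc_unflagged_snoc[OF assms(2), of us u] by (simp del: enc_simps)
qed

lemma AlphaD_Enc: "z \<in> E m q \<Longrightarrow> AlphaD m q (Enc z) = z"
proof (rule plinear_eq_on_supp[of "\<lambda>z. AlphaD m q (Enc z)" "\<lambda>z. z" z "Eset m q"])
  fix ws assume ws: "ws \<in> Eset m q"
  then obtain us w where uw: "ws = us @ [w]" using Eset_last by blast
  then show "AlphaD m q (Enc (Poly_Mapping.single ws 1)) = Poly_Mapping.single ws 1"
    using AlphaD_decomp[of us w "[]" m q] ws by (simp add: Eset_def)
qed (auto simp: E_def intro: plinear_comp[OF plinear_AlphaD plinear_Enc] plinear_id)

lemma AlphaD_E: "z \<in> D (Suc m) q \<Longrightarrow> AlphaD m q z \<in> E m q"
proof (rule D_linear_subset[OF plinear_AlphaD, of "Suc m" q])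
  fix xs assume "xs \<in> Dset (Suc m) q"
  then obtain u us w where "xs = map (Pair False) u @ enc (us @ [w])" "us @ [w @ u] \<in> Eset m q" "w \<noteq> []"
    by (rule Dset_decomp)
  then show "AlphaD m q (Poly_Mapping.single xs 1) \<in> E m q" using AlphaD_decomp[of us w u m q] by simp
qed auto

lemma Enc_AlphaD: "z \<in> D (Suc m) q \<Longrightarrow> z - Enc (AlphaD m q z) \<in> relD (Suc m) q"
proof (rule D_linear_subset[of "\<lambda>z. z - Enc (AlphaD m q z)" "Suc m" q])
  fix xs assume xs: "xs \<in> Dset (Suc m) q"
  then obtain u us w where d: "xs = map (Pair False) u @ enc (us @ [w])" "us @ [w @ u] \<in> Eset m q" "w \<noteq> []"
    by (rule Dset_decomp)
  have "Poly_Mapping.single xs 1 \<in> D (Suc m) q" using xs by (simp add: D_def)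
  from Rot_power_relD[OF this, of "length u"]
  show "Poly_Mapping.single xs 1 - Enc (AlphaD m q (Poly_Mapping.single xs 1)) \<in> relD (Suc m) q"
    using Rot_power_single[where us = "map (Pair False) u" and vs = "enc (us @ [w])" and e = "sg (Suc m) q"]
      AlphaD_decomp[OF d(2,3)] enc_unflagged_snoc[OF d(3), of us u] d(1) by (simp del: enc_simps)
qed (auto intro: plinear_minus plinear_id plinear_comp[OF plinear_Enc plinear_AlphaD])

text \<open>If the first letter is bare, its rotation is part of the decoding and the difference
  vanishes. If it is barred, one rotation makes the rest of its factor a bare prefix, so decoding
  moves that whole factor to the end; this is an instance of the cyclic relation.\<close>

lemma AlphaD_Rot: "z \<in> D (Suc m) q \<Longrightarrow> AlphaD m q (z - Rot (sg (Suc m) q) z) \<in> relE m q"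
proof (rule D_linear_subset[of "\<lambda>z. AlphaD m q (z - Rot (sg (Suc m) q) z)" "Suc m" q])
  fix xs assume xs: "xs \<in> Dset (Suc m) q"
  then obtain u us w where d: "xs = map (Pair False) u @ enc (us @ [w])" "us @ [w @ u] \<in> Eset m q" "w \<noteq> []"
    by (rule Dset_decomp)
  let ?e = "sg (Suc m) q"
  show "AlphaD m q (Poly_Mapping.single xs 1 - Rot ?e (Poly_Mapping.single xs 1)) \<in> relE m q"
  proof (cases u)
    case (Cons a u')
    have "xs = (False, a) # map (Pair False) u' @ enc (us @ [w])" using d(1) Cons by simp
    moreover have "(map (Pair False) u' @ enc (us @ [w])) @ [(False, a)] = map (Pair False) u' @ enc (us @ [w @ [a]])"
      using enc_unflagged_snoc[OF d(3), of us "[a]"] by simp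
    ultimately have r1: "Rot ?e (Poly_Mapping.single xs 1) = pscale ?e (Poly_Mapping.single (map (Pair False) u' @ enc (us @ [w @ [a]])) 1)"
      using Rot_single_Cons[of ?e "(False, a)" "map (Pair False) u' @ enc (us @ [w])"] by (simp only: fst_conv if_False)
    have r2: "AlphaD m q (Poly_Mapping.single (map (Pair False) u' @ enc (us @ [w @ [a]])) 1)
      = Poly_Mapping.single (us @ [w @ u]) (?e ^ length u')"
      using AlphaD_decomp[of us "w @ [a]" u' m q] d(2) Cons by (simp del: enc_simps)
    have "AlphaD m q (Rot ?e (Poly_Mapping.single xs 1)) = Poly_Mapping.single (us @ [w @ u]) (?e ^ length u)"
      unfolding r1 AlphaD_simps r2 using Cons by simp
    then have "AlphaD m q (Poly_Mapping.single xs 1) = AlphaD m q (Rot ?e (Poly_Mapping.single xs 1))"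
      using AlphaD_decomp[OF d(2,3)] d(1) by (simp only:)
    then show ?thesis by (simp add: pm.subspace_0)
  next
    case Nil
    then have xsE: "xs = enc (us @ [w])" "us @ [w] \<in> Eset m q" using d by simp_all
    obtain v vs where v: "us @ [w] = v # vs" by (cases us) auto
    have vne: "v \<noteq> []" "[] \<notin> set vs" using xsE(2) v by (auto simp: Eset_def)
    obtain a t where at: "v = a # t" using vne by (cases v) auto
    have "Rot ?e (Poly_Mapping.single xs 1) = Poly_Mapping.single (map (Pair False) t @ enc (vs @ [[a]])) 1"
      using Rot_single_Cons[of ?e "(True, a)" "map (Pair False) t @ enc vs"] xsE(1) v at by (simp add: fl_def)
    moreover have "vs @ [[a] @ t] \<in> Eset m q" using xsE(2) v at Eset_rotate[of v vs] by simp
    then have "AlphaD m q (Poly_Mapping.single (map (Pair False) t @ enc (vs @ [[a]])) 1)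
      = Poly_Mapping.single (vs @ [v]) (?e ^ length t)"
      using AlphaD_decomp[of vs "[a]" t m q] at by simp
    moreover have "AlphaD m q (Poly_Mapping.single xs 1) = Poly_Mapping.single (v # vs) 1"
      using AlphaD_decomp[of us w "[]" m q] xsE d(3) v by simp
    ultimately have "AlphaD m q (Poly_Mapping.single xs 1 - Rot ?e (Poly_Mapping.single xs 1))
      = Poly_Mapping.single (v # vs) 1 - Poly_Mapping.single (vs @ [v]) (?e ^ length t)" by simp
    also have "\<dots> = - pscale (?e ^ length t) (Poly_Mapping.single (vs @ [v]) 1 - lin_ext tE (Poly_Mapping.single (vs @ [v]) 1))"
      using tE_append[of vs v m q] xsE(2) v Eset_rotate[of v vs] at sg_power_square[of "Suc m" q "length t"]
      by (simp add: pm.scale_right_diff_distrib)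
    also have "\<dots> \<in> relE m q"
      using xsE(2) v Eset_rotate[of v vs] by (intro pm.subspace_neg pm.subspace_scale subspace_relE tE_relE) simp
    finally show ?thesis .
  qed
qed (auto intro: plinear_comp[OF plinear_AlphaD plinear_minus[OF plinear_id plinear_Rot]] simp del: AlphaD_simps)

lemma unflagged_prefix: "\<exists>u vs. xs = map (Pair False) u @ enc vs \<and> [] \<notin> set vs"
proof (intro exI conjI)
  have "dropWhile (Not \<circ> fst) xs = [] \<or> fst (hd (dropWhile (Not \<circ> fst) xs))"
    using hd_dropWhile[of "Not \<circ> fst" xs] by auto
  then show "xs = map (Pair False) (map snd (takeWhile (Not \<circ> fst) xs)) @ enc (blocks (dropWhile (Not \<circ> fst) xs))"
    by (simp add: takeWhile_unflagged_eq' enc_blocks)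
qed (rule blocks_nonempty)

lemma nth_flagl: "i < length w \<Longrightarrow> flagl S w ! i = (i \<in> S, w ! i)"
  by (simp add: flagl_def)

text \<open>Induction on the position \<open>i\<close> of some bar: rotating brings a bar to
  position 0. Then the killed gap is not the one across the ends, so \<open>\<omega>\<close> lies
  inside a single factor and decodes to a generator of \<open>relE\<close>.\<close>

lemma AlphaD_cyc_gens:
  assumes "i \<in> S" "S \<subseteq> {..<q}" "card S = Suc m" "j < q" "j \<notin> S" "g \<in> cyc_gens q j" "q \<ge> 2"
  shows "AlphaD m q (unslice S g) \<in> relE m q"
  using assms
proof (induction i arbitrary: S j g)
  case 0
  then have "j \<noteq> 0" by (metis)
  then have "g \<in> rel_gens {j - 1} q" using "0.prems" by (simp add: cyc_gens_def)
  then obtain A B where AB: "g = wmono A * \<omega> * wmono B" "length A = j - 1" "length A + 2 + length B = q"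
    "set A \<subseteq> {..<n}" "set B \<subseteq> {..<n}" by (auto simp: rel_gens_def)
  have jA: "Suc (length A) \<notin> S" using AB(2) \<open>j \<noteq> 0\<close> "0.prems" by simp
  \<comment> \<open>Whether the first letter of \<open>\<omega>\<close> opens its factor; if so,
    nothing precedes \<open>\<omega>\<close> in that factor.\<close>
  let ?f = "length A \<in> S"
  define XA where "XA = map (\<lambda>i. (i \<in> S, A ! i)) [0..<length A]"
  define XB where "XB = map (\<lambda>i. (length A + 2 + i \<in> S, B ! i)) [0..<length B]"
  have flag: "flagl S (A @ [k, l] @ B) = XA @ [(?f, k), (False, l)] @ XB" for k l
  proof (rule nth_equalityI)
    fix i assume "i < length (flagl S (A @ [k, l] @ B))"
    then consider "i < length A" | "i = length A" | "i = Suc (length A)" | j where "i = length A + 2 + j" "j < length B"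
      by (force simp: flagl_def dest: less_imp_Suc_add intro: that(4)[of "i - (length A + 2)"])
    then show "flagl S (A @ [k, l] @ B) ! i = (XA @ [(?f, k), (False, l)] @ XB) ! i"
    proof cases
      case 4
      then have "(XA @ [(?f, k), (False, l)] @ XB) ! i = XB ! j" "(A @ [k, l] @ B) ! i = B ! j"
        by (simp_all add: XA_def nth_append)
      then show ?thesis using 4 by (simp add: nth_flagl XB_def)
    qed (use jA in \<open>simp_all add: nth_flagl XA_def nth_append\<close>)
  qed (simp add: XA_def XB_def)
  obtain y vs where XB: "XB = map (Pair False) y @ enc vs" "[] \<notin> set vs" using unflagged_prefix by blast
  have XAhd: "XA = [] \<or> fst (hd XA)" using "0.prems"(1) by (cases "A = []") (auto simp: XA_def hd_map upt_conv_Cons)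
  obtain us x where usx: "\<And>k. XA @ [(?f, k)] = enc us @ fl (x @ [k])" "[] \<notin> set us"
  proof (cases ?f)
    case True
    then show ?thesis using that[of "blocks XA" "[]"] enc_blocks[OF XAhd] blocks_nonempty[of XA] by (simp add: fl_def)
  next
    case False
    have "XA \<noteq> []" using False "0.prems"(1) by (cases A) (auto simp: XA_def)
    then have "blocks XA \<noteq> []" using enc_blocks[OF XAhd] by auto
    then obtain us x where ux: "blocks XA = us @ [x]" by (metis rev_exhaust)
    then have "[] \<notin> set (us @ [x])" using blocks_nonempty[of XA] by simp
    moreover have "XA = enc us @ fl x" using enc_blocks[OF XAhd] ux by simp
    ultimately show ?thesis using that[of us x] False fl_append[of x "[k]" for k] by auto
  qed
  have fl_enc: "flagl S (A @ [k, l] @ B) = enc (us @ (x @ [k, l] @ y) # vs)" for k l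
  proof -
    have "flagl S (A @ [k, l] @ B) = (XA @ [(?f, k)]) @ map (Pair False) (l # y) @ enc vs"
      unfolding flag XB(1) by simp
    also have "\<dots> = enc us @ (fl (x @ [k]) @ map (Pair False) (l # y)) @ enc vs" unfolding usx(1) by simp
    also have "\<dots> = enc (us @ (x @ [k, l] @ y) # vs)" by (subst fl_append) simp_all
    finally show ?thesis .
  qed
  have ne: "[] \<notin> set (us @ (x @ [k, l] @ y) # vs)" for k l using usx(2) XB(2) by simp
  have Es: "us @ (x @ [k, l] @ y) # vs \<in> Eset m q" if "k < n" "l < n" for k l
  proof -
    have "A @ [k, l] @ B \<in> words n q" using AB that by (auto simp: words_def)
    then have "flagl S (A @ [k, l] @ B) \<in> Dset (card S) q" using "0.prems"(2) by (rule flagl_Dset)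
    then show ?thesis unfolding fl_enc "0.prems"(3) enc_Eset[OF ne] .
  qed
  have "AlphaD m q (unslice S g) = (\<Sum>k<n. \<Sum>l<n. pscale (M k l) (AlphaD m q (Enc (Poly_Mapping.single (us @ (x @ [k, l] @ y) # vs) 1))))"
    unfolding AB(1) unslice_omega fl_enc by (simp del: enc_simps pscale_single)
  also have "\<dots> = omega_gen us x y vs"
    unfolding omega_gen_def by (intro sum.cong refl arg_cong[of _ _ "pscale _"] AlphaD_Enc single_E Es) auto
  also have "\<dots> \<in> relE m q" using Es[of 0 0] n3 by (intro omega_gen_relE) auto
  finally show ?case .
next
  case (Suc i)
  have q: "q \<ge> 2" and qp: "q > 0" using Suc.prems by auto
  have gT: "g \<in> T n q" using Suc.prems(6) cyc_gens_T by auto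
  have zD: "unslice S g \<in> D (Suc m) q" using unslice_D[OF gT Suc.prems(2)] Suc.prems(3) by simp
  define j' where "j' = (if j = 0 then q - 1 else j - 1)"
  have j': "Suc j' mod q = j" "j' < q" using Suc.prems(4) by (auto simp: j'_def)
  have rg: "rotl g \<in> cyc_gens q j'" using rotl_cyc_gens[of g q j'] Suc.prems(6) j' q by simp
  have iS: "i \<in> shift1 q S" using Suc.prems(1,2) by (auto simp: shift1_def)
  have IH: "AlphaD m q (unslice (shift1 q S) (rotl g)) \<in> relE m q"
    using Suc.prems j' rg iS q card_shift1[of S q] by (intro Suc.IH[of "shift1 q S" j']) (auto simp: shift1_def)
  let ?e = "sg (Suc m) q"
  have "AlphaD m q (Rot ?e (unslice S g)) \<in> relE m q"
    unfolding Rot_unslice[OF gT Suc.prems(2) qp] AlphaD_simps by (intro pm.subspace_scale subspace_relE IH)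
  then have "AlphaD m q (unslice S g - Rot ?e (unslice S g)) + AlphaD m q (Rot ?e (unslice S g)) \<in> relE m q"
    by (intro pm.subspace_add subspace_relE AlphaD_Rot[OF zD])
  then show ?case by simp
qed

lemma AlphaD_relD:
  assumes "x \<in> relD (Suc m) q" "q \<ge> 2"
  shows "AlphaD m q x \<in> relE m q"
proof -
  obtain w u where wu: "x = w + (u - Rot (sg (Suc m) q) u)" "w \<in> WD (Suc m) q" "u \<in> D (Suc m) q"
    using assms(1) by (auto simp: relD_def)
  have w: "w \<in> D (Suc m) q" using wu(2) WD_D by auto
  have "AlphaD m q w = (\<Sum>S\<in>Pow {..<q}. AlphaD m q (unslice S (slice S w)))"
    by (subst unslice_slice[OF w]) simp
  also have "\<dots> \<in> relE m q"
  proof (rule pm.subspace_sum[OF subspace_relE])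
    fix S assume S: "S \<in> Pow {..<q}"
    show "AlphaD m q (unslice S (slice S w)) \<in> relE m q"
    proof (cases "card S = Suc m")
      case False
      then show ?thesis using slice_D_zero[OF w] by (simp add: pmp.linear_0[OF plinear_unslice] pm.subspace_0)
    next
      case True
      then obtain i where i: "i \<in> S" by (metis card.empty equals0I nat.simps(3))
      have s: "slice S w \<in> pm.span (\<Union>j\<in>{..<q} - S. cyc_gens q j)" using wu(2) S by (auto simp: WD_def WG_def)
      show ?thesis
      proof (rule plinear_span_subset[OF plinear_comp[OF plinear_AlphaD plinear_unslice] _ subspace_relE s])
        fix g assume "g \<in> (\<Union>j\<in>{..<q} - S. cyc_gens q j)"
        then obtain j where "j < q" "j \<notin> S" "g \<in> cyc_gens q j" by auto
        then show "AlphaD m q (unslice S g) \<in> relE m q"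
          using AlphaD_cyc_gens[OF i _ True] S assms(2) by auto
      qed
    qed
  qed
  finally have "AlphaD m q w \<in> relE m q" .
  then show ?thesis using AlphaD_Rot[OF wu(3)] unfolding wu(1)
    unfolding pmp.linear_add[OF plinear_AlphaD] by (rule pm.subspace_add[OF subspace_relE])
qed

lemma Enc_relE_iff: "z \<in> E m q \<Longrightarrow> q \<ge> 2 \<Longrightarrow> Enc z \<in> relD (Suc m) q \<Longrightarrow> z \<in> relE m q"
  using AlphaD_relD[of "Enc z" m q] AlphaD_Enc[of z m q] by simp

lemma Eset_merge: "us @ a # b # vs \<in> Eset (Suc m) q \<Longrightarrow> us @ (a @ b) # vs \<in> Eset m q"
  by (auto simp: Eset_def)

lemma bE_E:
  assumes "z \<in> E (Suc m) q"
  shows "lin_ext bE z \<in> E m q"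
proof (rule E_linear_subset[OF lin_ext_linear _ subspace_E assms])
  fix ws assume ws: "ws \<in> Eset (Suc m) q"
  then obtain w us v where wuv: "ws = w # us @ [v]" using Eset_Cons_snoc by blast
  have 1: "bE' ws \<in> E m q"
    unfolding bE'_def
  proof (intro pm.subspace_sum subspace_E single_E)
    fix i assume i: "i \<in> {..<length ws - 1}"
    then have "drop i ws = ws ! i # ws ! (i + 1) # drop (i + 2) ws"
      using Cons_nth_drop_Suc[of i ws] Cons_nth_drop_Suc[of "Suc i" ws] by simp
    then have "ws = take i ws @ ws ! i # ws ! (i + 1) # drop (i + 2) ws" by (metis append_take_drop_id)
    then have "take i ws @ ws ! i # ws ! (i + 1) # drop (i + 2) ws \<in> Eset (Suc m) q" using ws by metis
    then show "take i ws @ (ws ! i @ ws ! (i + 1)) # drop (i + 2) ws \<in> Eset m q" by (rule Eset_merge)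
  qed
  have "(v @ w) # us \<in> Eset m q" using ws wuv by (auto simp: Eset_def)
  then show "lin_ext bE (Poly_Mapping.single ws 1) \<in> E m q"
    using bE_append[of w us v m q] ws wuv 1 by (auto intro!: pm.subspace_add)
qed

text \<open>This and the vanishing of the square of \<open>bE\<close> are inherited from
  \<open>bar_d\<close> through the encoding, which avoids a direct check with the cyclic
  signs.\<close>

lemma bE_relE:
  assumes "z \<in> relE (Suc m) q" "q \<ge> 2"
  shows "lin_ext bE z \<in> relE m q"
proof (rule Enc_relE_iff[OF _ assms(2)])
  have z: "z \<in> E (Suc m) q" using assms(1) relE_E by auto
  then show "lin_ext bE z \<in> E m q" by (rule bE_E)
  have "lin_ext bar_d (Enc z) \<in> relD (Suc m) q" by (rule bar_d_relD'[OF Enc_relE[OF assms(1)]])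
  from pm.subspace_diff[OF subspace_relD bar_d_Enc[OF z] this]
  show "Enc (lin_ext bE z) \<in> relD (Suc m) q" by simp
qed

lemma bE_bE:
  assumes "z \<in> E (Suc (Suc m)) q" "q \<ge> 2"
  shows "lin_ext bE (lin_ext bE z) \<in> relE m q"
proof (rule Enc_relE_iff[OF _ assms(2)])
  let ?y = "lin_ext bE z"
  have y: "?y \<in> E (Suc m) q" by (rule bE_E[OF assms(1)])
  then show "lin_ext bE ?y \<in> E m q" by (rule bE_E)
  have "lin_ext bar_d (lin_ext bar_d (Enc z) + Enc ?y) \<in> relD (Suc m) q"
    by (rule bar_d_relD'[OF bar_d_Enc[OF assms(1)]])
  then have "lin_ext bar_d (Enc ?y) \<in> relD (Suc m) q" using bar_dd[OF Enc_D[OF assms(1)]] by simp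
  from pm.subspace_diff[OF subspace_relD bar_d_Enc[OF y] this]
  show "Enc (lin_ext bE ?y) \<in> relD (Suc m) q" by simp
qed

text \<open>Encode, apply \<open>D_exact\<close>, decode the preimage. The sign in
  \<open>- v\<close> comes from \<open>bar_d\<close> corresponding to minus
  \<open>bE\<close>.\<close>

lemma E_exact:
  assumes q: "q \<ge> 3" and z: "z \<in> E (Suc m) q" and bz: "lin_ext bE z \<in> relE m q"
  shows "\<exists>y\<in>E (Suc (Suc m)) q. z - lin_ext bE y \<in> relE (Suc m) q"
proof -
  have zD: "Enc z \<in> D (Suc (Suc m)) q" by (rule Enc_D[OF z])
  have "lin_ext bar_d (Enc z) \<in> relD (Suc m) q"
    using pm.subspace_diff[OF subspace_relD bar_d_Enc[OF z] Enc_relE[OF bz]] by simp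
  then obtain y where y: "y \<in> D (Suc (Suc (Suc m))) q" "Enc z - lin_ext bar_d y \<in> relD (Suc (Suc m)) q"
    using D_exact[OF q zD] by blast
  define v where "v = AlphaD (Suc (Suc m)) q y"
  have v: "v \<in> E (Suc (Suc m)) q" unfolding v_def by (rule AlphaD_E[OF y(1)])
  have 1: "lin_ext bar_d y - lin_ext bar_d (Enc v) \<in> relD (Suc (Suc m)) q"
    using bar_d_relD'[OF Enc_AlphaD[OF y(1)]] by (simp add: v_def)
  have 2: "lin_ext bar_d (Enc v) + Enc (lin_ext bE v) \<in> relD (Suc (Suc m)) q" by (rule bar_d_Enc[OF v])
  have "(Enc z - lin_ext bar_d y) + (lin_ext bar_d y - lin_ext bar_d (Enc v)) + (lin_ext bar_d (Enc v) + Enc (lin_ext bE v))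
    \<in> relD (Suc (Suc m)) q"
    by (intro pm.subspace_add subspace_relD y(2) 1 2)
  then have "Enc (z - lin_ext bE (- v)) \<in> relD (Suc (Suc m)) q" by simp
  then have "z - lin_ext bE (- v) \<in> relE (Suc m) q"
    using q by (intro Enc_relE_iff pm.subspace_diff subspace_E z bE_E pm.subspace_neg v) auto
  then show ?thesis using pm.subspace_neg[OF subspace_E v] by blast
qed

end

section \<open>The quotient algebra\<close>

lemma ksign_add: "ksign (a + b) = (ksign a * ksign b :: 'k::field)"
  by (cases a; cases b) (auto simp: ksign_def)

lemma ksign_of_nat: "ksign (of_nat k) = ((- 1) ^ k :: 'k::field)"
proof (induction k)
  case (Suc k)
  have "ksign (of_nat (Suc k)) = (ksign 1 * ksign (of_nat k) :: 'k)" by (simp only: of_nat_Suc ksign_add)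
  then show ?case using Suc by (simp add: ksign_def)
qed (simp add: ksign_def)

context quadric begin

abbreviation FA :: "('k, nc_word \<Rightarrow>\<^sub>0 'k) bigraded_algebra" where "FA \<equiv> free_odd_algebra n"

definition J :: "(nc_word \<Rightarrow>\<^sub>0 'k) set" where "J = genideal FA {\<omega>}"

text \<open>The ideal as a linear span of explicit generators; unlike \<open>genideal\<close> it
  admits linear arguments on generators.\<close>

definition Jspan :: "(nc_word \<Rightarrow>\<^sub>0 'k) set"
  where "Jspan = pm.span {wmono u * \<omega> * wmono v | u v. set u \<subseteq> {..<n} \<and> set v \<subseteq> {..<n}}"

lemma FA_simps [simp]: "carrier FA = free_carrier n" "x \<otimes>\<^bsub>FA\<^esub> y = x * y" "x \<oplus>\<^bsub>FA\<^esub> y = x + y"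
  "\<zero>\<^bsub>FA\<^esub> = 0" "\<one>\<^bsub>FA\<^esub> = 1" "r \<odot>\<^bsub>FA\<^esub> x = pscale r x"
  by (simp_all add: free_odd_algebra_def)

lemma ring_FA: "ring FA" by (rule ring_free_odd_algebra)

lemma free_carrier_span: "free_carrier n = pm.span (wmono ` {w. set w \<subseteq> {..<n}})"
proof -
  have "free_carrier n = supp_in (NCWord ` {w. set w \<subseteq> {..<n}})"
    by (auto simp: free_carrier_def supp_in_def image_iff) (metis nc_word.collapse, fastforce)
  then show ?thesis by (simp add: supp_in_eq_span wmono_def image_image)
qed

lemma subspace_free_carrier [simp, intro]: "pm.subspace (free_carrier n)" by (simp add: free_carrier_span)

lemma T_carrier: "T n p \<subseteq> free_carrier n"
  unfolding T_eq_span free_carrier_span by (rule pm.span_mono) (auto simp: words_def)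

lemma wmono_carrier: "set w \<subseteq> {..<n} \<Longrightarrow> wmono w \<in> free_carrier n"
  unfolding free_carrier_span by (rule pm.span_base) auto

lemma Jspan_carrier: "Jspan \<subseteq> free_carrier n"
  unfolding Jspan_def
  by (rule pm.span_minimal) (use omega_T T_carrier in \<open>auto intro!: free_carrier_mult wmono_carrier\<close>)

lemma subspace_Jspan [simp, intro]: "pm.subspace Jspan" by (simp add: Jspan_def)

lemma Jspan_mult:
  assumes "x \<in> Jspan" "a \<in> free_carrier n"
  shows "a * x \<in> Jspan" "x * a \<in> Jspan"
proof -
  have l: "wmono w * x \<in> Jspan" if w: "set w \<subseteq> {..<n}" for w
  proof (rule plinear_span_subset[OF plinear_times_left _ subspace_Jspan assms(1)[unfolded Jspan_def]])
    fix g assume "g \<in> {wmono u * \<omega> * wmono v | u v. set u \<subseteq> {..<n} \<and> set v \<subseteq> {..<n}}"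
    then obtain u v where g: "g = wmono u * \<omega> * wmono v" "set u \<subseteq> {..<n}" "set v \<subseteq> {..<n}" by blast
    have "wmono w * g = wmono (w @ u) * \<omega> * wmono v" unfolding g(1) wmono_mult[symmetric] by (simp only: mult.assoc)
    moreover have "set (w @ u) \<subseteq> {..<n}" using g w by simp
    ultimately show "wmono w * g \<in> Jspan" unfolding Jspan_def using g(3) by (intro pm.span_base) blast
  qed
  have r: "x * wmono w \<in> Jspan" if w: "set w \<subseteq> {..<n}" for w
  proof (rule plinear_span_subset[OF plinear_times_right _ subspace_Jspan assms(1)[unfolded Jspan_def]])
    fix g assume "g \<in> {wmono u * \<omega> * wmono v | u v. set u \<subseteq> {..<n} \<and> set v \<subseteq> {..<n}}"
    then obtain u v where g: "g = wmono u * \<omega> * wmono v" "set u \<subseteq> {..<n}" "set v \<subseteq> {..<n}" by blast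
    have "g * wmono w = wmono u * \<omega> * wmono (v @ w)" unfolding g(1) wmono_mult[symmetric] by (simp only: mult.assoc)
    moreover have "set (v @ w) \<subseteq> {..<n}" using g w by simp
    ultimately show "g * wmono w \<in> Jspan" unfolding Jspan_def using g(2) by (intro pm.span_base) blast
  qed
  show "a * x \<in> Jspan"
    by (rule plinear_span_subset[OF plinear_times_right _ subspace_Jspan assms(2)[unfolded free_carrier_span]]) (use l in auto)
  show "x * a \<in> Jspan"
    by (rule plinear_span_subset[OF plinear_times_left _ subspace_Jspan assms(2)[unfolded free_carrier_span]]) (use r in auto)
qed

lemma ideal_Jspan: "ideal Jspan FA"
proof (rule idealI[OF ring_FA])
  show "subgroup Jspan (add_monoid FA)"
  proof
    fix x assume x: "x \<in> Jspan"
    interpret ring FA by (rule ring_FA)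
    have "\<ominus>\<^bsub>FA\<^esub> x = - x"
      by (rule minus_equality) (use x Jspan_carrier pm.subspace_neg[OF subspace_Jspan x] in auto)
    then have "inv\<^bsub>add_monoid FA\<^esub> x = - x" by (simp add: a_inv_def)
    then show "inv\<^bsub>add_monoid FA\<^esub> x \<in> Jspan" using pm.subspace_neg[OF subspace_Jspan x] by simp
  qed (use Jspan_carrier in \<open>auto intro: pm.subspace_add pm.subspace_0\<close>)
qed (auto intro: Jspan_mult)

lemma omega_Jspan: "\<omega> \<in> Jspan"
proof -
  have "\<omega> = wmono [] * \<omega> * wmono []" by (simp add: wmono_Nil)
  then show ?thesis unfolding Jspan_def by (intro pm.span_base) (auto intro!: exI[of _ "[]"])
qed

lemma omega_carrier: "\<omega> \<in> free_carrier n" using omega_T T_carrier by auto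

lemma J_eq: "J = Jspan"
proof
  show "J \<subseteq> Jspan"
    unfolding J_def using ring.genideal_minimal[OF ring_FA ideal_Jspan] omega_Jspan by blast
  have id: "ideal J FA" unfolding J_def by (rule ring.genideal_ideal[OF ring_FA]) (use omega_carrier in auto)
  interpret ideal J FA by (rule id)
  have \<omega>: "\<omega> \<in> J" unfolding J_def using ring.genideal_self[OF ring_FA, of "{\<omega>}"] omega_carrier by auto
  have sub: "pm.subspace J"
  proof (rule pm.subspaceI)
    show "0 \<in> J" using additive_subgroup.zero_closed[OF is_additive_subgroup] by simp
    show "x + y \<in> J" if "x \<in> J" "y \<in> J" for x y
      using additive_subgroup.a_closed[OF is_additive_subgroup that] by simp
    \<comment> \<open>An ideal of the ring is closed under scalars because these are ring elements,
      supported at the empty word.\<close>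
    show "pscale r x \<in> J" if "x \<in> J" for r x
    proof -
      have "Poly_Mapping.single 0 r \<in> free_carrier n" by (simp add: free_carrier_def zero_nc_word_def)
      then show ?thesis using I_l_closed[OF that, of "Poly_Mapping.single 0 r"] by (simp add: pscale_eq_times)
    qed
  qed
  show "Jspan \<subseteq> J"
    unfolding Jspan_def
  proof (rule pm.span_minimal[OF _ sub], rule subsetI)
    fix g assume "g \<in> {wmono u * \<omega> * wmono v | u v. set u \<subseteq> {..<n} \<and> set v \<subseteq> {..<n}}"
    then obtain u v where g: "g = wmono u * \<omega> * wmono v" "set u \<subseteq> {..<n}" "set v \<subseteq> {..<n}" by blast
    show "g \<in> J" unfolding g(1)
      using I_r_closed[OF I_l_closed[OF \<omega>, of "wmono u"], of "wmono v"] wmono_carrier[of u] wmono_carrier[of v] g(2,3) by simp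
  qed
qed

lemma subspace_J [simp, intro]: "pm.subspace J" by (simp add: J_eq)

lemma ideal_J: "ideal J FA" unfolding J_eq by (rule ideal_Jspan)

definition proj :: "nat \<Rightarrow> (nc_word \<Rightarrow>\<^sub>0 'k) \<Rightarrow> (nc_word \<Rightarrow>\<^sub>0 'k)"
  where "proj p = lin_ext (\<lambda>w. if length (letters w) = p then Poly_Mapping.single w 1 else 0)"

lemma plinear_proj: "plinear (proj p)" by (simp add: proj_def lin_ext_linear)

lemma proj_T: "x \<in> T n p' \<Longrightarrow> proj p x = (if p' = p then x else 0)"
proof (cases "p' = p")
  case True
  show "x \<in> T n p' \<Longrightarrow> ?thesis"
    using T_linear_eq[OF plinear_proj plinear_id, of x n p'] True by (simp add: proj_def wmono_def words_def)
next
  case False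
  show "x \<in> T n p' \<Longrightarrow> ?thesis"
    using T_linear_eq[OF plinear_proj plinear_zero, of x n p'] False by (simp add: proj_def wmono_def words_def)
qed

text \<open>The generators are homogeneous, so projecting a representation to degree
  \<open>p\<close> keeps only those of degree \<open>p\<close>.\<close>

lemma J_T_RS: "x \<in> J \<Longrightarrow> x \<in> T n p \<Longrightarrow> x \<in> RS UNIV p"
proof -
  assume x: "x \<in> J" "x \<in> T n p"
  have "proj p x \<in> RS UNIV p"
  proof (rule plinear_span_subset[OF plinear_proj _ subspace_RS x(1)[unfolded J_eq Jspan_def]])
    fix g assume "g \<in> {wmono u * \<omega> * wmono v | u v. set u \<subseteq> {..<n} \<and> set v \<subseteq> {..<n}}"
    then obtain u v where g: "g = wmono u * \<omega> * wmono v" "set u \<subseteq> {..<n}" "set v \<subseteq> {..<n}" by blast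
    let ?p = "length u + 2 + length v"
    have "g \<in> RS UNIV ?p" unfolding g(1) using g(2,3) by (intro RS_gen) auto
    moreover from this have "g \<in> T n ?p" using RS_T by blast
    ultimately show "proj p g \<in> RS UNIV p" using proj_T[of g ?p p] by (cases "?p = p") (auto intro: pm.subspace_0)
  qed
  then show ?thesis using proj_T[OF x(2), of p] by simp
qed

lemma RS_J: "RS UNIV p \<subseteq> J"
  unfolding RS_def J_eq Jspan_def by (rule pm.span_mono) (auto simp: rel_gens_def)

definition cls :: "(nc_word \<Rightarrow>\<^sub>0 'k) \<Rightarrow> (nc_word \<Rightarrow>\<^sub>0 'k) set" where "cls x = J +>\<^bsub>FA\<^esub> x"

lemma cls_set: "cls x = (\<lambda>j. j + x) ` J"
  by (auto simp: cls_def a_r_coset_def r_coset_def)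

lemma cls_eq: "cls x = cls y \<longleftrightarrow> x - y \<in> J"
proof
  assume "cls x = cls y"
  moreover have "x \<in> cls x" using pm.subspace_0[OF subspace_J] by (auto simp: cls_set image_iff)
  ultimately obtain j where "j \<in> J" "x = j + y" by (auto simp: cls_set)
  then show "x - y \<in> J" by simp
next
  have *: "cls x \<subseteq> cls y" if "x - y \<in> J" for x y
  proof
    fix z assume "z \<in> cls x"
    then obtain j where "j \<in> J" "z = j + x" by (auto simp: cls_set)
    then have "z = (j + (x - y)) + y" "j + (x - y) \<in> J" using that by (auto intro: pm.subspace_add)
    then show "z \<in> cls y" unfolding cls_set by (rule image_eqI)
  qed
  assume "x - y \<in> J"
  then show "cls x = cls y" using *[of x y] *[of y x] pm.subspace_neg[OF subspace_J, of "x - y"] by auto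
qed

abbreviation B :: "('k, (nc_word \<Rightarrow>\<^sub>0 'k) set) bigraded_algebra" where "B \<equiv> quadric_algebra n c"

lemma B_unfold: "B = quotient_algebra FA J" by (simp add: quadric_algebra_def J_def \<omega>_def)

lemma B_mult: "x \<in> free_carrier n \<Longrightarrow> y \<in> free_carrier n \<Longrightarrow> cls x \<otimes>\<^bsub>B\<^esub> cls y = cls (x * y)"
  using ideal.rcoset_mult_add[OF ideal_J, of x y]
  by (simp add: B_unfold quotient_algebra_def FactRing_def cls_def)

lemma B_add: "cls x \<oplus>\<^bsub>B\<^esub> cls y = cls (x + y)"
proof -
  have "cls x <+>\<^bsub>FA\<^esub> cls y = {z. \<exists>j\<in>J. \<exists>j'\<in>J. z = (j + x) + (j' + y)}"
    by (auto simp: set_add_def set_mult_def cls_set)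
  also have "\<dots> = cls (x + y)"
  proof (intro equalityI subsetI)
    fix z assume "z \<in> {z. \<exists>j\<in>J. \<exists>j'\<in>J. z = (j + x) + (j' + y)}"
    then obtain j j' where j: "j \<in> J" "j' \<in> J" "z = (j + x) + (j' + y)" by blast
    have "z = (j + j') + (x + y)" unfolding j(3) by (simp add: algebra_simps)
    then show "z \<in> cls (x + y)" unfolding cls_set using pm.subspace_add[OF subspace_J j(1,2)] by (rule image_eqI)
  next
    fix z assume "z \<in> cls (x + y)"
    then obtain j where "j \<in> J" "z = j + (x + y)" by (auto simp: cls_set)
    then have "z = (j + x) + (0 + y)" by (simp add: algebra_simps)
    then show "z \<in> {z. \<exists>j\<in>J. \<exists>j'\<in>J. z = (j + x) + (j' + y)}"
      using \<open>j \<in> J\<close> pm.subspace_0[OF subspace_J] by blast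
  qed
  finally show ?thesis by (simp add: B_unfold quotient_algebra_def FactRing_def)
qed

text \<open>The scalar action is defined as a union over all representatives; each of them yields
  the same coset because the ideal is closed under scalars.\<close>

lemma B_smult: "r \<odot>\<^bsub>B\<^esub> cls x = cls (pscale r x)"
proof -
  have "r \<odot>\<^bsub>B\<^esub> cls x = (\<Union>y\<in>cls x. cls (pscale r y))"
    by (simp add: B_unfold quotient_algebra_def cls_def)
  also have "\<dots> = (\<Union>y\<in>cls x. cls (pscale r x))"
  proof (rule SUP_cong[OF refl])
    fix y assume "y \<in> cls x"
    then obtain j where "j \<in> J" "y = j + x" by (auto simp: cls_set)
    then show "cls (pscale r y) = cls (pscale r x)"
      by (simp add: cls_eq pm.scale_right_distrib pm.subspace_scale)
  qed
  also have "\<dots> = cls (pscale r x)" using pm.subspace_0[OF subspace_J] by (auto simp: cls_set)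
  finally show ?thesis .
qed

lemma component_FA: "component FA p \<epsilon> = (if of_nat p = \<epsilon> then T n p else {0})"
proof (cases "of_nat p = \<epsilon>")
  case True
  have "x \<in> component FA p \<epsilon> \<longleftrightarrow> x \<in> T n p" for x
  proof
    assume x: "x \<in> component FA p \<epsilon>"
    show "x \<in> T n p" unfolding T_def supp_in_def
    proof (intro CollectI subsetI)
      fix w assume "w \<in> Poly_Mapping.keys x"
      then have "length (letters w) = p" "set (letters w) \<subseteq> {..<n}"
        using x by (auto simp: free_odd_algebra_def free_carrier_def)
      then show "w \<in> NCWord ` words n p" by (cases w) (auto simp: words_def)
    qed
  next
    assume "x \<in> T n p"
    then have sub: "Poly_Mapping.keys x \<subseteq> NCWord ` words n p" by (simp add: T_def supp_in_def)
    have "length (letters w) = p \<and> set (letters w) \<subseteq> {..<n}" if "w \<in> Poly_Mapping.keys x" for w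
      using subsetD[OF sub that] unfolding words_def by auto
    then show "x \<in> component FA p \<epsilon>" using True by (auto simp: free_odd_algebra_def free_carrier_def)
  qed
  then show ?thesis using True by auto
next
  case False
  have "x = 0" if "x \<in> component FA p \<epsilon>" for x
  proof -
    have "\<forall>w\<in>Poly_Mapping.keys x. length (letters w) = p \<and> of_nat (length (letters w)) = \<epsilon>"
      using that unfolding free_odd_algebra_def bigraded_algebra.select_convs by blast
    then have "w \<notin> Poly_Mapping.keys x" for w using False by metis
    then show ?thesis by (metis Poly_Mapping.keys_eq_empty equals0I)
  qed
  moreover have "0 \<in> component FA p \<epsilon>" by (simp add: free_odd_algebra_def free_carrier_def)
  ultimately show ?thesis using False by auto
qed

lemma component_B: "component B p \<epsilon> = cls ` component FA p \<epsilon>"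
  by (simp add: B_unfold quotient_algebra_def cls_def)

text \<open>A chosen homogeneous representative. When the sign degree is not the parity of the
  weight, the component is zero and so is the representative; tensors with such an entry thereby
  drop out.\<close>

definition rep :: "(nc_word \<Rightarrow>\<^sub>0 'k) set tagged \<Rightarrow> (nc_word \<Rightarrow>\<^sub>0 'k)"
  where "rep y = (if sdeg y = of_nat (wt y) then SOME x. x \<in> T n (wt y) \<and> cls x = snd (snd y) else 0)"

definition good_tag :: "(nc_word \<Rightarrow>\<^sub>0 'k) set tagged \<Rightarrow> bool"
  where "good_tag y \<longleftrightarrow> wt y \<ge> 1 \<and> snd (snd y) \<in> component B (wt y) (sdeg y)"

lemma tensors_iff: "L \<in> tensors B m \<longleftrightarrow> length L = m + 1 \<and> (\<forall>y\<in>set L. good_tag y)"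
  by (auto simp: tensors_def good_tag_def wt_def sdeg_def split: prod.splits)

lemma rep_props:
  assumes "good_tag y"
  shows "rep y \<in> T n (wt y)" "cls (rep y) = snd (snd y)"
proof -
  have "rep y \<in> T n (wt y) \<and> cls (rep y) = snd (snd y)"
  proof (cases "sdeg y = of_nat (wt y)")
    case True
    then have "snd (snd y) \<in> cls ` T n (wt y)" using assms by (simp add: good_tag_def component_B component_FA)
    then have "\<exists>x. x \<in> T n (wt y) \<and> cls x = snd (snd y)" by auto
    then show ?thesis using True by (simp add: rep_def) (rule someI_ex)
  next
    case False
    then show ?thesis using assms by (simp add: rep_def good_tag_def component_B component_FA pm.subspace_0)
  qed
  then show "rep y \<in> T n (wt y)" "cls (rep y) = snd (snd y)" by auto
qed

definition tag :: "nat list \<Rightarrow> (nc_word \<Rightarrow>\<^sub>0 'k) set tagged"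
  where "tag w = (length w, of_nat (length w), cls (wmono w))"

lemma tag_simps [simp]: "wt (tag w) = length w" "sdeg (tag w) = of_nat (length w)" "snd (snd (tag w)) = cls (wmono w)"
  by (simp_all add: tag_def wt_def sdeg_def)

lemma good_tag_tag: "w \<noteq> [] \<Longrightarrow> set w \<subseteq> {..<n} \<Longrightarrow> good_tag (tag w)"
  by (cases w) (auto simp: good_tag_def component_B component_FA words_def intro!: imageI wmono_in_T)

lemma good_tag_cls: "x \<in> T n p \<Longrightarrow> p \<ge> 1 \<Longrightarrow> good_tag (p, of_nat p, cls x)"
  by (auto simp: good_tag_def wt_def sdeg_def component_B component_FA)

lemma tagged_mult_tag: "set u \<subseteq> {..<n} \<Longrightarrow> set v \<subseteq> {..<n} \<Longrightarrow> tagged_mult B (tag u) (tag v) = tag (u @ v)"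
  by (simp add: tagged_mult_def B_mult wmono_carrier wmono_mult) (simp add: tag_def)

lemma good_tag_mult:
  assumes "good_tag x" "good_tag y"
  shows "good_tag (tagged_mult B x y)" "rep (tagged_mult B x y) - rep x * rep y \<in> RS UNIV (wt x + wt y)"
proof -
  note rx = rep_props[OF assms(1)] and ry = rep_props[OF assms(2)]
  have car: "rep x \<in> free_carrier n" "rep y \<in> free_carrier n" using rx ry T_carrier by auto
  have e: "snd (snd (tagged_mult B x y)) = cls (rep x * rep y)"
    by (simp add: tagged_mult_def rx(2)[symmetric] ry(2)[symmetric] B_mult car)
  have w: "wt (tagged_mult B x y) = wt x + wt y" "sdeg (tagged_mult B x y) = sdeg x + sdeg y"
    by (simp_all add: tagged_mult_def wt_def sdeg_def)
  have "rep x * rep y \<in> component FA (wt x + wt y) (sdeg x + sdeg y)"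
  proof (cases "of_nat (wt x + wt y) = sdeg x + sdeg y")
    case True show ?thesis unfolding component_FA if_P[OF True] by (rule T_mult[OF rx(1) ry(1)])
  next
    case False
    then have "sdeg x \<noteq> of_nat (wt x) \<or> sdeg y \<noteq> of_nat (wt y)" by auto
    then have "rep x * rep y = 0" by (auto simp: rep_def)
    then show ?thesis by (simp add: component_FA pm.subspace_0)
  qed
  then show g: "good_tag (tagged_mult B x y)" using assms by (auto simp: good_tag_def w e component_B)
  have "rep (tagged_mult B x y) - rep x * rep y \<in> J"
    unfolding cls_eq[symmetric] using rep_props(2)[OF g] e by simp
  then show "rep (tagged_mult B x y) - rep x * rep y \<in> RS UNIV (wt x + wt y)"
    using rep_props(1)[OF g] unfolding w(1)
    by (intro J_T_RS pm.subspace_diff[OF subspace_T] T_mult[OF rx(1) ry(1)])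
qed


end

section \<open>Comparison with the cyclic complex of the quotient algebra\<close>

fun splitl :: "nat list \<Rightarrow> 'a list \<Rightarrow> 'a list list"
  where "splitl [] w = []"
  | "splitl (p # ps) w = take p w # splitl ps (drop p w)"

lemma splitl_append: "length u = sum_list ps \<Longrightarrow> splitl (ps @ qs) (u @ v) = splitl ps u @ splitl qs v"
  by (induction ps arbitrary: u) auto

lemma splitl_block: "length x = p \<Longrightarrow> splitl (p # ps) (x @ v) = x # splitl ps v"
  by simp

lemma splitl_concat: "splitl (map length ws) (concat ws) = ws"
  by (induction ws) auto

lemma splitl_lengths: "length w = sum_list ps \<Longrightarrow> map length (splitl ps w) = ps"
  by (induction ps arbitrary: w) auto

lemma splitl_concat_id: "length w = sum_list ps \<Longrightarrow> concat (splitl ps w) = w"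
  by (induction ps arbitrary: w) auto

lemma length_splitl [simp]: "length (splitl ps w) = length ps"
  by (induction ps arbitrary: w) auto

definition mergel :: "nat \<Rightarrow> nat list \<Rightarrow> nat list"
  where "mergel i ps = take i ps @ (ps ! i + ps ! (i + 1)) # drop (i + 2) ps"

lemma nth_split2: "Suc i < length ws \<Longrightarrow> ws = take i ws @ ws ! i # ws ! (i + 1) # drop (i + 2) ws"
proof -
  assume "Suc i < length ws"
  then have "drop i ws = ws ! i # ws ! (i + 1) # drop (i + 2) ws"
    using Cons_nth_drop_Suc[of i ws] Cons_nth_drop_Suc[of "Suc i" ws] by simp
  then show ?thesis by (metis append_take_drop_id)
qed

lemma splitl_merge:
  assumes "length w = sum_list ps" "Suc i < length ps"
  shows "take i (splitl ps w) @ (splitl ps w ! i @ splitl ps w ! (i + 1)) # drop (i + 2) (splitl ps w) = splitl (mergel i ps) w"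
proof -
  let ?ws = "splitl ps w"
  let ?m = "take i ?ws @ (?ws ! i @ ?ws ! (i + 1)) # drop (i + 2) ?ws"
  have l: "map length ?ws = ps" by (rule splitl_lengths[OF assms(1)])
  have n: "length (?ws ! j) = ps ! j" if "j < length ps" for j using l that by (metis length_map nth_map)
  have "map length ?m = mergel i ps"
    using assms(2) n[of i] n[of "Suc i"] l by (simp add: mergel_def take_map[symmetric] drop_map[symmetric])
  moreover have "concat ?m = concat ?ws"
    using nth_split2[of i ?ws] assms(2) by (metis append.assoc concat.simps(2) concat_append length_splitl)
  ultimately show ?thesis using splitl_concat[of ?m] splitl_concat_id[OF assms(1)] by metis
qed

text \<open>Cuts a product at prescribed lengths. A multilinear map of the factors thus becomes a
  linear map of one element of \<open>T\<close>, and tensor products of subspaces are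
  avoided.\<close>

definition gam :: "nat list \<Rightarrow> (nc_word \<Rightarrow>\<^sub>0 'k::field) \<Rightarrow> (nat list list \<Rightarrow>\<^sub>0 'k)"
  where "gam ps = lin_ext (\<lambda>w. Poly_Mapping.single (splitl ps (letters w)) 1)"

lemma plinear_gam: "plinear (gam ps)" by (simp add: gam_def lin_ext_linear)

lemmas gam_simps [simp] = pmp.linear_0[OF plinear_gam] pmp.linear_add[OF plinear_gam] pmp.linear_diff[OF plinear_gam]
  pmp.linear_scale[OF plinear_gam] pmp.linear_sum[OF plinear_gam]

lemma gam_wmono [simp]: "gam ps (wmono w) = Poly_Mapping.single (splitl ps w) 1"
  by (simp add: gam_def wmono_def)

text \<open>Two elements with the same image would give a nontrivial combination equal to
  zero.\<close>

lemma independent_modulo_inj: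
  fixes f :: "'a \<Rightarrow> ('y \<Rightarrow>\<^sub>0 'k::field)"
  assumes S: "finite S" and V': "pm.subspace V'"
    and key: "\<And>h. (\<Sum>s\<in>S. pscale (h s) (f s)) \<in> V' \<Longrightarrow> \<forall>s\<in>S. h s = 0"
  shows "inj_on f S"
proof (rule inj_onI, rule ccontr)
  fix s t assume st: "s \<in> S" "t \<in> S" "f s = f t" "s \<noteq> t"
  define h :: "'a \<Rightarrow> 'k" where "h = (\<lambda>u. (if u = s then 1 else 0) - (if u = t then 1 else 0))"
  have "(\<Sum>u\<in>S. pscale (h u) (f u)) = (\<Sum>u\<in>S. if u = s then f u else 0) - (\<Sum>u\<in>S. if u = t then f u else 0)"
    unfolding h_def pm.scale_left_diff_distrib sum_subtractf
    by (intro arg_cong2[of _ _ _ _ "(-)"] sum.cong) auto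
  also have "\<dots> = 0" using st S by simp
  finally have "(\<Sum>u\<in>S. pscale (h u) (f u)) \<in> V'" using pm.subspace_0[OF V'] by simp
  from key[OF this] have "h s = 0" using st by blast
  then show False using st(4) by (simp add: h_def)
qed

text \<open>The maps need to be mutually inverse only modulo the two subspaces, which is how the
  word model and the complex of B are related.\<close>

lemma has_dim_modulo_transfer:
  fixes f :: "('x \<Rightarrow>\<^sub>0 'k::field) \<Rightarrow> ('y \<Rightarrow>\<^sub>0 'k)" and g :: "('y \<Rightarrow>\<^sub>0 'k) \<Rightarrow> ('x \<Rightarrow>\<^sub>0 'k)"
  assumes dim: "has_dim_modulo V U d" and f: "plinear f" and g: "plinear g"
    and V: "pm.subspace V" and V': "pm.subspace V'"
    and fU: "\<And>x. x \<in> U \<Longrightarrow> f x \<in> U'" and fV: "\<And>x. x \<in> V \<Longrightarrow> f x \<in> V'" and gV: "\<And>x. x \<in> V' \<Longrightarrow> g x \<in> V"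
    and gf: "\<And>x. x \<in> U \<Longrightarrow> g (f x) - x \<in> V" and gU: "\<And>x. x \<in> U' \<Longrightarrow> g x \<in> U"
    and fg: "\<And>x. x \<in> U' \<Longrightarrow> x - f (g x) \<in> V'"
  shows "has_dim_modulo V' U' d"
proof -
  obtain S where S: "finite S" "card S = d" "S \<subseteq> U"
    "\<And>h. (\<Sum>s\<in>S. pscale (h s) s) \<in> V \<Longrightarrow> (\<forall>s\<in>S. h s = 0)" "U \<subseteq> pm.span (S \<union> V)"
    using dim unfolding has_dim_modulo_def by blast
  have key: "\<forall>s\<in>S. h s = 0" if "(\<Sum>s\<in>S. pscale (h s) (f s)) \<in> V'" for h
  proof (rule S(4))
    have "g (\<Sum>s\<in>S. pscale (h s) (f s)) \<in> V" by (rule gV[OF that])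
    then have "(\<Sum>s\<in>S. pscale (h s) (g (f s))) \<in> V" by (simp add: pmp.linear_sum[OF g] pmp.linear_scale[OF g])
    moreover have "(\<Sum>s\<in>S. pscale (h s) (g (f s) - s)) \<in> V"
      using S(3) gf by (intro pm.subspace_sum[OF V] pm.subspace_scale[OF V]) auto
    ultimately have "(\<Sum>s\<in>S. pscale (h s) (g (f s))) - (\<Sum>s\<in>S. pscale (h s) (g (f s) - s)) \<in> V"
      by (rule pm.subspace_diff[OF V])
    then show "(\<Sum>s\<in>S. pscale (h s) s) \<in> V" by (simp add: pm.scale_right_diff_distrib sum_subtractf)
  qed
  have inj: "inj_on f S" by (rule independent_modulo_inj[OF S(1) V' key])
  show ?thesis
    unfolding has_dim_modulo_def
  proof (intro exI[of _ "f ` S"] conjI allI impI)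
    show "finite (f ` S)" "card (f ` S) = d" using S(1,2) inj by (simp_all add: card_image)
    show "f ` S \<subseteq> U'" using S(3) fU by auto
    fix h assume "(\<Sum>s\<in>f ` S. pscale (h s) s) \<in> V'"
    then have "(\<Sum>s\<in>S. pscale (h (f s)) (f s)) \<in> V'" by (simp add: sum.reindex[OF inj])
    then show "\<forall>s\<in>f ` S. h s = 0" using key[of "\<lambda>s. h (f s)"] by auto
  next
    show "U' \<subseteq> pm.span (f ` S \<union> V')"
    proof
      fix x assume x: "x \<in> U'"
      have "f y \<in> pm.span (f ` S \<union> V')" if "y \<in> pm.span (S \<union> V)" for y
        by (rule plinear_span_subset[OF f _ pm.subspace_span that]) (use fV in \<open>auto intro: pm.span_base\<close>)
      then have "f (g x) \<in> pm.span (f ` S \<union> V')" using gU[OF x] S(5) by auto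
      moreover have "x - f (g x) \<in> pm.span (f ` S \<union> V')" using fg[OF x] by (auto intro: pm.span_base)
      ultimately have "(x - f (g x)) + f (g x) \<in> pm.span (f ` S \<union> V')" by (intro pm.span_add)
      then show "x \<in> pm.span (f ` S \<union> V')" by simp
    qed
  qed
qed

context quadric begin

definition weights :: "nat \<Rightarrow> nat \<Rightarrow> nat list \<Rightarrow> bool"
  where "weights m q ps \<longleftrightarrow> length ps = Suc m \<and> (\<forall>p\<in>set ps. p \<ge> 1) \<and> sum_list ps = q"

lemma Eset_iff: "ws \<in> Eset m q \<longleftrightarrow> weights m q (map length ws) \<and> (\<forall>w\<in>set ws. set w \<subseteq> {..<n})"
  unfolding Eset_def weights_def by (auto simp: Suc_le_eq)

lemma splitl_Eset: "w \<in> words n q \<Longrightarrow> weights m q ps \<Longrightarrow> splitl ps w \<in> Eset m q"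
proof -
  assume w: "w \<in> words n q" "weights m q ps"
  then have l: "length w = sum_list ps" by (simp add: words_def weights_def)
  have "set (concat (splitl ps w)) \<subseteq> {..<n}" unfolding splitl_concat_id[OF l] using w by (simp add: words_def)
  then show ?thesis unfolding Eset_iff splitl_lengths[OF l] using w by auto
qed

lemma gam_E: "x \<in> T n q \<Longrightarrow> weights m q ps \<Longrightarrow> gam ps x \<in> E m q"
  by (rule T_linear_subset[OF plinear_gam _ subspace_E]) (auto intro!: single_E splitl_Eset)

text \<open>A relation of B in one factor, with arbitrary elements in the others, reduces by
  linearity in each place to a generator with words around it.\<close>

lemma gam_rel:
  assumes ps: "weights m q (ps1 @ p # ps2)" and a: "a \<in> T n (sum_list ps1)" and j: "j \<in> RS UNIV p" and b: "b \<in> T n (sum_list ps2)"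
  shows "gam (ps1 @ p # ps2) (a * j * b) \<in> relE m q"
proof -
  let ?g = "gam (ps1 @ p # ps2)"
  have "?g (wmono u * (wmono x * \<omega> * wmono y) * wmono v) \<in> relE m q"
    if "u \<in> words n (sum_list ps1)" "v \<in> words n (sum_list ps2)" "length x + 2 + length y = p" "set x \<subseteq> {..<n}" "set y \<subseteq> {..<n}" for u v x y
  proof -
    have s: "splitl (ps1 @ p # ps2) (u @ x @ [k, l] @ y @ v) = splitl ps1 u @ (x @ [k, l] @ y) # splitl ps2 v" for k l
      using splitl_append[of u ps1 "p # ps2" "(x @ [k, l] @ y) @ v"] splitl_block[of "x @ [k, l] @ y" p ps2 v] that
      by (simp add: words_def del: splitl.simps)
    have "?g (wmono u * (wmono x * \<omega> * wmono y) * wmono v) = omega_gen (splitl ps1 u) x y (splitl ps2 v)"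
      unfolding omega_pairs omega_gen_def s[symmetric]
      by (simp add: sum_distrib_left sum_distrib_right times_pscale_left times_pscale_right wmono_mult del: pscale_single)
    also have "\<dots> \<in> relE m q"
    proof (rule omega_gen_relE)
      have "u @ x @ [0, 0] @ y @ v \<in> words n q" using that ps n3 by (auto simp: words_def weights_def)
      from splitl_Eset[OF this ps] show "splitl ps1 u @ (x @ [0, 0] @ y) # splitl ps2 v \<in> Eset m q" unfolding s .
    qed
    finally show ?thesis .
  qed
  note mono = this
  have 1: "?g (wmono u * j * wmono v) \<in> relE m q" if "u \<in> words n (sum_list ps1)" "v \<in> words n (sum_list ps2)" for u v
    by (rule plinear_span_subset[OF plinear_comp[OF plinear_gam plinear_comp[OF plinear_times_right plinear_times_left]] _ subspace_relE j[unfolded RS_def]])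
      (use mono that in \<open>auto simp: rel_gens_def\<close>)
  have 2: "?g (wmono u * j * b) \<in> relE m q" if "u \<in> words n (sum_list ps1)" for u
    by (rule T_linear_subset[OF plinear_comp[OF plinear_gam plinear_times_left] _ subspace_relE b]) (use 1 that in auto)
  show ?thesis
    by (rule T_linear_subset[OF plinear_comp[OF plinear_gam plinear_comp[OF plinear_times_right plinear_times_right]] _ subspace_relE a])
      (use 2 in auto)
qed

definition prodr :: "(nc_word \<Rightarrow>\<^sub>0 'k) set tagged list \<Rightarrow> (nc_word \<Rightarrow>\<^sub>0 'k)"
  where "prodr L = prod_list (map rep L)"

lemma prodr_simps [simp]: "prodr [] = 1" "prodr (y # L) = rep y * prodr L" "prodr (L @ L') = prodr L * prodr L'"
  by (simp_all add: prodr_def)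

lemma prodr_T: "(\<And>y. y \<in> set L \<Longrightarrow> good_tag y) \<Longrightarrow> prodr L \<in> T n (sum_list (map wt L))"
proof (induction L)
  case Nil
  have "(1 :: nc_word \<Rightarrow>\<^sub>0 'k) \<in> T n 0" unfolding T_0 by (auto intro: exI[of _ 1])
  then show ?case by simp
next
  case (Cons y L)
  then show ?case using T_mult[OF rep_props(1)[of y] Cons.IH] by simp
qed

text \<open>Representatives of the tensor factors are multiplied, and the product is cut again at the weights
  of the factors.\<close>

definition beta :: "nat \<Rightarrow> (nc_word \<Rightarrow>\<^sub>0 'k) set tagged list \<Rightarrow> (nat list list \<Rightarrow>\<^sub>0 'k)"
  where "beta q L = (if sum_list (map wt L) = q then gam (map wt L) (prodr L) else 0)"

definition Alpha :: "(nat list list \<Rightarrow>\<^sub>0 'k) \<Rightarrow> ((nc_word \<Rightarrow>\<^sub>0 'k) set tagged list \<Rightarrow>\<^sub>0 'k)"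
  where "Alpha = lin_ext (\<lambda>ws. Poly_Mapping.single (map tag ws) 1)"

lemma plinear_Alpha: "plinear Alpha" by (simp add: Alpha_def lin_ext_linear)

lemmas Alpha_simps [simp] = pmp.linear_0[OF plinear_Alpha] pmp.linear_add[OF plinear_Alpha] pmp.linear_diff[OF plinear_Alpha]
  pmp.linear_scale[OF plinear_Alpha] pmp.linear_sum[OF plinear_Alpha]

lemma Alpha_single [simp]: "Alpha (Poly_Mapping.single ws r) = Poly_Mapping.single (map tag ws) r"
  by (simp add: Alpha_def)

abbreviation mlspan :: "nat \<Rightarrow> ((nc_word \<Rightarrow>\<^sub>0 'k) set tagged list \<Rightarrow>\<^sub>0 'k) set"
  where "mlspan m \<equiv> pm.span (multilinear_rels B m)"

lemma mlspan_cyc_rels: "mlspan m \<subseteq> cyc_rels B m"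
  unfolding cyc_rels_def by (rule pm.span_mono) auto

lemma tensors_ctx: "u @ y # v \<in> tensors B m \<longleftrightarrow> good_tag y \<and> (\<forall>x\<in>set u \<union> set v. good_tag x) \<and> length u + length v = m"
  by (auto simp: tensors_iff)

lemma mlspan_add:
  assumes "u @ (p, \<epsilon>, X) # v \<in> tensors B m" "u @ (p, \<epsilon>, Y) # v \<in> tensors B m"
  shows "Poly_Mapping.single (u @ (p, \<epsilon>, X \<oplus>\<^bsub>B\<^esub> Y) # v) 1 - Poly_Mapping.single (u @ (p, \<epsilon>, X) # v) 1
    - Poly_Mapping.single (u @ (p, \<epsilon>, Y) # v) 1 \<in> mlspan m"
  by (rule pm.span_base, unfold multilinear_rels_def, rule UnI1) (use assms in blast)

lemma mlspan_scale:
  assumes "u @ (p, \<epsilon>, X) # v \<in> tensors B m"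
  shows "Poly_Mapping.single (u @ (p, \<epsilon>, r \<odot>\<^bsub>B\<^esub> X) # v) 1 - Poly_Mapping.single (u @ (p, \<epsilon>, X) # v) r \<in> mlspan m"
  by (rule pm.span_base, unfold multilinear_rels_def, rule UnI2) (use assms in blast)

lemma mlspan_zero:
  assumes "u @ (p, \<epsilon>, cls 0) # v \<in> tensors B m"
  shows "Poly_Mapping.single (u @ (p, \<epsilon>, cls 0) # v) 1 \<in> mlspan m"
  using mlspan_scale[OF assms, of 0] by (simp add: B_smult)

text \<open>A basis tensor does not depend linearly on its entry; the multilinear relations say that
  it does modulo their span, so a factor can be expanded into words.\<close>

lemma mlspan_expand:
  assumes x: "x \<in> T n p" and p: "p \<ge> 1" and ctx: "\<forall>y\<in>set u \<union> set v. good_tag y" "length u + length v = m"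
  shows "Poly_Mapping.single (u @ (p, of_nat p, cls x) # v) 1
    - lin_ext (\<lambda>w. Poly_Mapping.single (u @ tag (letters w) # v) 1) x \<in> mlspan m"
proof -
  let ?h = "\<lambda>x. Poly_Mapping.single (u @ (p, of_nat p, cls x) # v) (1::'k)"
  let ?g = "lin_ext (\<lambda>w. Poly_Mapping.single (u @ tag (letters w) # v) (1::'k))"
  have ten: "u @ (p, of_nat p, cls x) # v \<in> tensors B m" if "x \<in> T n p" for x
    unfolding tensors_ctx using good_tag_cls[OF that p] ctx by auto
  have add: "?h (x + y) - ?h x - ?h y \<in> mlspan m" if "x \<in> T n p" "y \<in> T n p" for x y
    using mlspan_add[OF ten[OF that(1)] ten[OF that(2)]] by (simp add: B_add)
  have scale: "?h (pscale r x) - pscale r (?h x) \<in> mlspan m" if "x \<in> T n p" for r x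
    using mlspan_scale[OF ten[OF that], of r] by (simp add: B_smult)
  have "pm.subspace {x \<in> T n p. ?h x - ?g x \<in> mlspan m}"
  proof (rule pm.subspaceI)
    show "0 \<in> {x \<in> T n p. ?h x - ?g x \<in> mlspan m}" using scale[of 0 0] by (simp add: pm.subspace_0)
  next
    fix x y assume xy: "x \<in> {x \<in> T n p. ?h x - ?g x \<in> mlspan m}" "y \<in> {x \<in> T n p. ?h x - ?g x \<in> mlspan m}"
    have "(?h (x + y) - ?h x - ?h y) + (?h x - ?g x) + (?h y - ?g y) \<in> mlspan m"
      using xy add[of x y] by (intro pm.span_add) auto
    then show "x + y \<in> {x \<in> T n p. ?h x - ?g x \<in> mlspan m}" using xy by (simp add: pm.subspace_add algebra_simps)
  next
    fix r x assume xy: "x \<in> {x \<in> T n p. ?h x - ?g x \<in> mlspan m}"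
    have "(?h (pscale r x) - pscale r (?h x)) + pscale r (?h x - ?g x) \<in> mlspan m"
      using xy scale[of x r] by (intro pm.span_add pm.span_scale) auto
    then show "pscale r x \<in> {x \<in> T n p. ?h x - ?g x \<in> mlspan m}"
      using xy by (simp add: pm.subspace_scale pm.scale_right_diff_distrib del: pscale_single)
  qed
  moreover have "wmono ` words n p \<subseteq> {x \<in> T n p. ?h x - ?g x \<in> mlspan m}"
  proof
    fix x :: "nc_word \<Rightarrow>\<^sub>0 'k" assume "x \<in> wmono ` words n p"
    then obtain w where w: "x = wmono w" "w \<in> words n p" by auto
    then have "?h x = Poly_Mapping.single (u @ tag w # v) 1" by (simp add: tag_def words_def)
    moreover have "?g x = Poly_Mapping.single (u @ tag w # v) 1" by (simp add: w(1) wmono_def)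
    ultimately show "x \<in> {x \<in> T n p. ?h x - ?g x \<in> mlspan m}" using w by (simp add: wmono_in_T pm.span_zero)
  qed
  ultimately have "pm.span (wmono ` words n p) \<subseteq> {x \<in> T n p. ?h x - ?g x \<in> mlspan m}"
    by (rule pm.span_minimal[rotated])
  then show ?thesis using x unfolding T_eq_span[symmetric] by blast
qed

text \<open>Expand one factor after the other; the list \<open>u\<close> collects those already
  processed. A factor of the wrong sign degree is zero in B and makes both terms vanish modulo the
  relations.\<close>

lemma alpha_beta_ctx:
  assumes "\<forall>y\<in>set u \<union> set L. good_tag y" "length u + length L = Suc m"
  shows "Poly_Mapping.single (u @ L) 1
    - lin_ext (\<lambda>w. Poly_Mapping.single (u @ map tag (splitl (map wt L) (letters w))) 1) (prodr L) \<in> mlspan m"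
  using assms
proof (induction L arbitrary: u)
  case Nil
  have "lin_ext (\<lambda>w. Poly_Mapping.single u (1::'k)) (1 :: nc_word \<Rightarrow>\<^sub>0 'k) = Poly_Mapping.single u 1"
    by (simp flip: wmono_Nil add: wmono_def)
  then show ?case by (simp add: pm.span_zero)
next
  case (Cons y L)
  have gy: "good_tag y" using Cons.prems by simp
  obtain p \<epsilon> X where y: "y = (p, \<epsilon>, X)" by (cases y)
  let ?G = "lin_ext (\<lambda>w. Poly_Mapping.single (u @ map tag (splitl (map wt (y # L)) (letters w))) (1::'k))"
  show ?case
  proof (cases "\<epsilon> = of_nat p")
    case True
    have wt: "wt y = p" "p \<ge> 1" using gy y by (simp_all add: wt_def good_tag_def)
    have rT: "rep y \<in> T n p" and rX: "X = cls (rep y)" using rep_props[OF gy] y by (simp_all add: wt_def)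
    let ?g = "lin_ext (\<lambda>w. Poly_Mapping.single (u @ tag (letters w) # L) (1::'k))"
    have ctx: "\<forall>z\<in>set u \<union> set L. good_tag z" "length u + length L = m" using Cons.prems by auto
    have yr: "(p, of_nat p, cls (rep y)) = y" unfolding rX[symmetric] by (simp add: y True)
    have 1: "Poly_Mapping.single (u @ y # L) 1 - ?g (rep y) \<in> mlspan m"
      using mlspan_expand[OF rT wt(2) ctx] unfolding yr .
    have 2: "?g x - ?G (x * prodr L) \<in> mlspan m" if "x \<in> T n p" for x
    proof (rule T_linear_subset[OF _ _ pm.subspace_span that, of "\<lambda>x. ?g x - ?G (x * prodr L)"])
      show "plinear (\<lambda>x. ?g x - ?G (x * prodr L))"
        by (intro plinear_minus lin_ext_linear plinear_comp[OF lin_ext_linear plinear_times_right])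
      fix w assume w: "w \<in> words n p"
      have "?G (wmono w * z) = lin_ext (\<lambda>w'. Poly_Mapping.single ((u @ [tag w]) @ map tag (splitl (map wt L) (letters w'))) 1) z" for z
      proof (rule plinear_wmono_eqI[of "\<lambda>z. ?G (wmono w * z)"])
        fix v
        show "?G (wmono w * wmono v) = lin_ext (\<lambda>w'. Poly_Mapping.single ((u @ [tag w]) @ map tag (splitl (map wt L) (letters w'))) 1) (wmono v)"
          using w wt(1) by (simp add: wmono_mult) (simp add: wmono_def words_def)
      qed (intro lin_ext_linear plinear_comp[OF lin_ext_linear plinear_times_left])+
      moreover have "?g (wmono w) = Poly_Mapping.single ((u @ [tag w]) @ L) 1" by (simp add: wmono_def)
      moreover have "good_tag (tag w)" using w wt(2) by (intro good_tag_tag) (auto simp: words_def)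
      ultimately show "?g (wmono w) - ?G (wmono w * prodr L) \<in> mlspan m"
        using Cons.IH[of "u @ [tag w]"] Cons.prems by simp
    qed
    from pm.span_add[OF 1 2[OF rT]] show ?thesis by simp
  next
    case False
    then have "rep y = 0" using y by (simp add: rep_def wt_def sdeg_def)
    moreover have X: "X = cls 0" using gy y False by (auto simp: good_tag_def component_B component_FA wt_def sdeg_def)
    moreover have "u @ (p, \<epsilon>, cls 0) # L \<in> tensors B m" using Cons.prems y X by (auto simp: tensors_iff)
    ultimately show ?thesis using mlspan_zero[of u p \<epsilon> L m] y by simp
  qed
qed

lemma Alpha_gam: "Alpha (gam ps x) = lin_ext (\<lambda>w. Poly_Mapping.single (map tag (splitl ps (letters w))) 1) x"
  by (rule plinear_wmono_eqI[of "\<lambda>x. Alpha (gam ps x)"])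
    (simp_all add: plinear_comp[OF plinear_Alpha plinear_gam] lin_ext_linear, simp add: wmono_def)

lemma alpha_beta:
  assumes "L \<in> tensors B m" "sum_list (map wt L) = q"
  shows "Poly_Mapping.single L 1 - Alpha (beta q L) \<in> mlspan m"
  using alpha_beta_ctx[of "[]" L m] assms by (simp add: tensors_iff beta_def Alpha_gam)

lemma prodr_bad: "y \<in> set L \<Longrightarrow> sdeg y \<noteq> of_nat (wt y) \<Longrightarrow> prodr L = 0"
  by (induction L) (auto simp: rep_def)

lemma weights_tensors: "L \<in> tensors B m \<Longrightarrow> weights m (sum_list (map wt L)) (map wt L)"
  by (auto simp: tensors_iff weights_def good_tag_def)

lemma beta_E: "L \<in> tensors B m \<Longrightarrow> beta q L \<in> E m q"
  using gam_E[OF prodr_T weights_tensors] by (auto simp: beta_def tensors_iff pm.subspace_0)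

text \<open>The chosen representative of the class of a word differs from the word by a relation.
  The factors are replaced one at a time, with \<open>us\<close> already consisting of
  words.\<close>

lemma beta_alpha_ctx:
  assumes "us @ vs \<in> Eset m q"
  shows "gam (map length (us @ vs)) (wmono (concat us) * prodr (map tag vs)) - Poly_Mapping.single (us @ vs) 1 \<in> relE m q"
  using assms
proof (induction vs arbitrary: us)
  case Nil
  then show ?case by (simp add: splitl_concat pm.subspace_0)
next
  case (Cons v vs)
  have good: "good_tag (tag v)" "\<And>y. y \<in> set (map tag vs) \<Longrightarrow> good_tag y"
    using Cons.prems by (auto simp: Eset_def intro!: good_tag_tag)
  define j where "j = rep (tag v) - wmono v"
  have vw: "v \<in> words n (length v)" using Cons.prems by (auto simp: Eset_def words_def)
  have "cls (rep (tag v)) = cls (wmono v)" using rep_props(2)[OF good(1)] by simp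
  then have j: "j \<in> RS UNIV (length v)"
    unfolding j_def cls_eq using rep_props(1)[OF good(1)] wmono_in_T[OF vw] by (intro J_T_RS pm.subspace_diff[OF subspace_T]) auto
  have W: "weights m q (map length us @ length v # map length vs)" using Cons.prems unfolding Eset_iff by simp
  have "sum_list (map wt (map tag vs)) = sum_list (map length vs)" by (simp add: comp_def)
  moreover have "prodr (map tag vs) \<in> T n (sum_list (map wt (map tag vs)))" by (rule prodr_T) (rule good(2))
  ultimately have "prodr (map tag vs) \<in> T n (sum_list (map length vs))" by (simp only:)
  moreover have "wmono (concat us) \<in> T n (sum_list (map length us))"
    using Cons.prems by (intro wmono_in_T) (auto simp: Eset_def words_def length_concat)
  ultimately have 1: "gam (map length (us @ v # vs)) (wmono (concat us) * j * prodr (map tag vs)) \<in> relE m q"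
    using gam_rel[OF W _ j] by simp
  have 2: "gam (map length ((us @ [v]) @ vs)) (wmono (concat (us @ [v])) * prodr (map tag vs)) - Poly_Mapping.single ((us @ [v]) @ vs) 1 \<in> relE m q"
    using Cons.prems by (intro Cons.IH) simp
  have "wmono (concat us) * prodr (map tag (v # vs)) = wmono (concat us) * j * prodr (map tag vs) + wmono (concat (us @ [v])) * prodr (map tag vs)"
    by (simp add: j_def algebra_simps flip: wmono_mult)
  then have "gam (map length (us @ v # vs)) (wmono (concat us) * prodr (map tag (v # vs))) - Poly_Mapping.single (us @ v # vs) 1
    = gam (map length (us @ v # vs)) (wmono (concat us) * j * prodr (map tag vs))
     + (gam (map length ((us @ [v]) @ vs)) (wmono (concat (us @ [v])) * prodr (map tag vs)) - Poly_Mapping.single ((us @ [v]) @ vs) 1)"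
    by simp
  then show ?case using pm.subspace_add[OF subspace_relE 1 2] by (simp add: add_diff_eq)
qed

lemma beta_alpha: "ws \<in> Eset m q \<Longrightarrow> beta q (map tag ws) - Poly_Mapping.single ws 1 \<in> relE m q"
  using beta_alpha_ctx[of "[]" ws m q] by (simp add: beta_def Eset_def comp_def wmono_Nil)

definition Beta :: "nat \<Rightarrow> ((nc_word \<Rightarrow>\<^sub>0 'k) set tagged list \<Rightarrow>\<^sub>0 'k) \<Rightarrow> (nat list list \<Rightarrow>\<^sub>0 'k)"
  where "Beta q = lin_ext (beta q)"

lemma plinear_Beta: "plinear (Beta q)" by (simp add: Beta_def lin_ext_linear)

lemmas Beta_simps [simp] = pmp.linear_0[OF plinear_Beta] pmp.linear_add[OF plinear_Beta] pmp.linear_diff[OF plinear_Beta]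
  pmp.linear_scale[OF plinear_Beta] pmp.linear_sum[OF plinear_Beta]

lemma Beta_single [simp]: "Beta q (Poly_Mapping.single L r) = pscale r (beta q L)" by (simp add: Beta_def)

lemma rep_diff_RS:
  assumes "good_tag y" "x \<in> T n (wt y)" "snd (snd y) = cls x"
  shows "rep y - x \<in> RS UNIV (wt y)"
proof -
  have "cls (rep y) = cls x" using rep_props(2)[OF assms(1)] assms(3) by simp
  then show ?thesis unfolding cls_eq using rep_props(1)[OF assms(1)] assms(2) by (intro J_T_RS pm.subspace_diff[OF subspace_T])
qed

lemma beta_rel:
  assumes L: "u @ y # v \<in> tensors B m" and j: "j \<in> RS UNIV (wt y)" and q: "sum_list (map wt (u @ y # v)) = q"
  shows "gam (map wt (u @ y # v)) (prodr u * j * prodr v) \<in> relE m q"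
proof -
  have "weights m q (map wt u @ wt y # map wt v)" using weights_tensors[OF L] q by simp
  moreover have "prodr u \<in> T n (sum_list (map wt u))" "prodr v \<in> T n (sum_list (map wt v))"
    using L by (auto simp: tensors_ctx intro!: prodr_T)
  ultimately show ?thesis using gam_rel[OF _ _ j] by simp
qed

lemma good_tag_component: "good_tag (p, \<epsilon>, X) \<longleftrightarrow> p \<ge> 1 \<and> X \<in> cls ` component FA p \<epsilon>"
  by (simp add: good_tag_def wt_def sdeg_def component_B)

text \<open>Representatives were chosen without regard to linearity, so additivity and homogeneity
  fail by elements of the ideal, which \<open>beta_rel\<close> absorbs.\<close>

lemma Beta_multilinear:
  assumes "g \<in> multilinear_rels B m"
  shows "Beta q g \<in> relE m q"
  using assms unfolding multilinear_rels_def
proof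
  assume "g \<in> {Poly_Mapping.single (u @ (q, \<epsilon>, a \<oplus>\<^bsub>B\<^esub> a') # v) 1
       - Poly_Mapping.single (u @ (q, \<epsilon>, a) # v) 1
       - Poly_Mapping.single (u @ (q, \<epsilon>, a') # v) 1 | u q \<epsilon> a a' v.
       u @ (q, \<epsilon>, a) # v \<in> tensors B m \<and> u @ (q, \<epsilon>, a') # v \<in> tensors B m}"
  then obtain u p \<epsilon> a a' v where g: "g = Poly_Mapping.single (u @ (p, \<epsilon>, a \<oplus>\<^bsub>B\<^esub> a') # v) 1
       - Poly_Mapping.single (u @ (p, \<epsilon>, a) # v) 1 - Poly_Mapping.single (u @ (p, \<epsilon>, a') # v) 1"
    and t: "u @ (p, \<epsilon>, a) # v \<in> tensors B m" "u @ (p, \<epsilon>, a') # v \<in> tensors B m" by blast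
  let ?y = "(p, \<epsilon>, a \<oplus>\<^bsub>B\<^esub> a')" and ?r = "rep (p, \<epsilon>, a)" and ?r' = "rep (p, \<epsilon>, a')"
  have ga: "good_tag (p, \<epsilon>, a)" "good_tag (p, \<epsilon>, a')" using t by (auto simp: tensors_ctx)
  then obtain x x' where x: "a = cls x" "a' = cls x'" "x \<in> component FA p \<epsilon>" "x' \<in> component FA p \<epsilon>"
    by (auto simp: good_tag_component)
  then have "x + x' \<in> component FA p \<epsilon>" by (auto simp: component_FA pm.subspace_add split: if_splits)
  then have gy: "good_tag ?y" using ga x by (auto simp: good_tag_component B_add)
  then have ty: "u @ ?y # v \<in> tensors B m" using t by (auto simp: tensors_ctx)
  have wt: "wt ?y = p" "wt (p, \<epsilon>, a) = p" "wt (p, \<epsilon>, a') = p" by (simp_all add: wt_def)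
  have "a \<oplus>\<^bsub>B\<^esub> a' = cls (?r + ?r')" using rep_props(2)[OF ga(1)] rep_props(2)[OF ga(2)] by (metis B_add snd_conv)
  then have j: "rep ?y - (?r + ?r') \<in> RS UNIV (wt ?y)"
    using rep_props(1)[OF ga(1)] rep_props(1)[OF ga(2)] by (intro rep_diff_RS[OF gy]) (simp_all add: wt_def pm.subspace_add)
  show ?thesis
  proof (cases "sum_list (map wt (u @ ?y # v)) = q")
    case True
    from beta_rel[OF ty j True] show ?thesis
      using True unfolding g by (simp add: beta_def wt algebra_simps)
  next
    case False
    then show ?thesis unfolding g by (simp add: beta_def wt pm.subspace_0)
  qed
next
  assume "g \<in> {Poly_Mapping.single (u @ (q, \<epsilon>, r \<odot>\<^bsub>B\<^esub> a) # v) 1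
       - Poly_Mapping.single (u @ (q, \<epsilon>, a) # v) r | u q \<epsilon> r a v.
       u @ (q, \<epsilon>, a) # v \<in> tensors B m}"
  then obtain u p \<epsilon> r a v where g: "g = Poly_Mapping.single (u @ (p, \<epsilon>, r \<odot>\<^bsub>B\<^esub> a) # v) 1
       - Poly_Mapping.single (u @ (p, \<epsilon>, a) # v) r" and t: "u @ (p, \<epsilon>, a) # v \<in> tensors B m" by blast
  let ?y = "(p, \<epsilon>, r \<odot>\<^bsub>B\<^esub> a)" and ?r = "rep (p, \<epsilon>, a)"
  have ga: "good_tag (p, \<epsilon>, a)" using t by (auto simp: tensors_ctx)
  then obtain x where x: "a = cls x" "x \<in> component FA p \<epsilon>" by (auto simp: good_tag_component)
  then have "pscale r x \<in> component FA p \<epsilon>" by (auto simp: component_FA pm.subspace_scale split: if_splits)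
  then have gy: "good_tag ?y" using ga x by (auto simp: good_tag_component B_smult)
  then have ty: "u @ ?y # v \<in> tensors B m" using t by (auto simp: tensors_ctx)
  have wt: "wt ?y = p" "wt (p, \<epsilon>, a) = p" by (simp_all add: wt_def)
  have "r \<odot>\<^bsub>B\<^esub> a = cls (pscale r ?r)" using rep_props(2)[OF ga] by (metis B_smult snd_conv)
  then have j: "rep ?y - pscale r ?r \<in> RS UNIV (wt ?y)"
    using rep_props(1)[OF ga] by (intro rep_diff_RS[OF gy]) (simp_all add: wt_def pm.subspace_scale)
  show ?thesis
  proof (cases "sum_list (map wt (u @ ?y # v)) = q")
    case True
    from beta_rel[OF ty j True] show ?thesis
      using True unfolding g by (simp add: beta_def wt algebra_simps times_pscale_left times_pscale_right)
  next
    case False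
    then show ?thesis unfolding g by (simp add: beta_def wt pm.subspace_0)
  qed
qed

lemma sdeg_sum: "(\<forall>y\<in>set L. sdeg y = of_nat (wt y)) \<Longrightarrow> N \<le> length L \<Longrightarrow>
    (\<Sum>r<N. sdeg (L ! r) + 1) = of_nat (\<Sum>r<N. wt (L ! r) + 1)"
  by (simp only: of_nat_sum of_nat_add of_nat_1) (intro sum.cong, auto)

text \<open>The sign depends only on the lengths of the factors, so the formula on words extends
  linearly in both parts of the product.\<close>

lemma tE_gam:
  fixes x y :: "nc_word \<Rightarrow>\<^sub>0 'k"
  assumes "weights m q (ps @ [p])" "x \<in> T n (sum_list ps)" "y \<in> T n p"
  shows "lin_ext tE (gam (ps @ [p]) (x * y)) = pscale ((- 1) ^ ((p + 1) * (\<Sum>r<m. ps ! r + 1))) (gam (p # ps) (y * x))"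
proof -
  let ?c = "(- 1 :: 'k) ^ ((p + 1) * (\<Sum>r<m. ps ! r + 1))"
  have 1: "lin_ext tE (gam (ps @ [p]) (wmono u * wmono w)) = pscale ?c (gam (p # ps) (wmono w * wmono u))"
    if u: "u \<in> words n (sum_list ps)" and w: "w \<in> words n p" for u w
  proof -
    have l: "length u = sum_list ps" "length w = p" "length ps = m" using u w assms(1) by (auto simp: words_def weights_def)
    have s: "splitl (ps @ [p]) (u @ w) = splitl ps u @ [w]" using splitl_append[of u ps "[p]" w] l by simp
    have "length (splitl ps u ! r) = ps ! r" if "r < m" for r
      using splitl_lengths[OF l(1)] that l(3) by (metis length_map nth_map)
    then have "(\<Sum>r<m. length ((splitl ps u @ [w]) ! r) + 1) = (\<Sum>r<m. ps ! r + 1)"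
      using l(3) by (intro sum.cong) (auto simp: nth_append)
    moreover have "(splitl ps u @ [w]) ! m = w" using l(3) by (simp add: nth_append)
    moreover have "splitl (p # ps) (w @ u) = w # splitl ps u" using l by simp
    ultimately show ?thesis using l by (simp add: wmono_mult s tE_def Let_def del: splitl.simps)
  qed
  have 2: "lin_ext tE (gam (ps @ [p]) (wmono u * y)) = pscale ?c (gam (p # ps) (y * wmono u))"
    if u: "u \<in> words n (sum_list ps)" for u
    by (rule T_linear_eq[OF _ _ assms(3), where f = "\<lambda>y. lin_ext tE (gam (ps @ [p]) (wmono u * y))" and g = "\<lambda>y. pscale ?c (gam (p # ps) (y * wmono u))"])
      (intro 1[OF u] plinear_comp[OF lin_ext_linear] plinear_comp[OF plinear_gam plinear_times_left] plinear_scale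
        plinear_comp[OF plinear_gam plinear_times_right])+
  show ?thesis
    by (rule T_linear_eq[OF _ _ assms(2), where f = "\<lambda>x. lin_ext tE (gam (ps @ [p]) (x * y))" and g = "\<lambda>x. pscale ?c (gam (p # ps) (y * x))"])
      (intro 2 plinear_comp[OF lin_ext_linear] plinear_comp[OF plinear_gam plinear_times_left] plinear_scale
        plinear_comp[OF plinear_gam plinear_times_right])+
qed

text \<open>If every entry has the sign degree of its weight, the signs of \<open>cyc_t\<close> and
  \<open>tE\<close> agree; otherwise some representative is zero and both terms vanish.\<close>

lemma Beta_cyc_t:
  assumes L: "L \<in> tensors B m"
  shows "Beta q (Poly_Mapping.single L 1 - lin_ext cyc_t (Poly_Mapping.single L 1)) \<in> relE m q"
proof -
  obtain L0 y where Ly: "L = L0 @ [y]" using L by (cases L rule: rev_exhaust) (auto simp: tensors_iff)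
  have len: "length L0 = m" using L Ly by (simp add: tensors_iff)
  let ?s = "ksign ((sdeg y + 1) * (\<Sum>r<m. sdeg ((L0 @ [y]) ! r) + 1)) :: 'k"
  have ct: "cyc_t L = Poly_Mapping.single (y # L0) ?s" using len 
  proof -
    have e: "length (L0 @ [y]) - 1 = m" "last (L0 @ [y]) = y" "butlast (L0 @ [y]) = L0" "(L0 @ [y]) ! m = y" using len by (simp_all add: nth_append)
    show ?thesis unfolding cyc_t_def Let_def Ly e ..
  qed
  have B: "Beta q (Poly_Mapping.single L 1 - lin_ext cyc_t (Poly_Mapping.single L 1)) = beta q (L0 @ [y]) - pscale ?s (beta q (y # L0))"
    by (simp add: ct) (simp add: Ly)
  show ?thesis
  proof (cases "sum_list (map wt L) = q \<and> (\<forall>y\<in>set L. sdeg y = of_nat (wt y))")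
    case False
    then have "beta q (L0 @ [y]) = 0 \<and> beta q (y # L0) = 0"
    proof (cases "sum_list (map wt L) = q")
      case True
      then obtain z where z: "z \<in> set L" "sdeg z \<noteq> of_nat (wt z)" using False by blast
      then have "prodr (L0 @ [y]) = 0" "prodr (y # L0) = 0" using prodr_bad[of z] Ly by (auto simp del: prodr_simps)
      then show ?thesis by (simp add: beta_def del: prodr_simps)
    qed (simp add: beta_def Ly add.commute)
    then show ?thesis unfolding B by (simp add: pm.subspace_0)
  next
    case True
    have W: "weights m q (map wt L0 @ [wt y])" using weights_tensors[OF L] True Ly by simp
    have T: "prodr L0 \<in> T n (sum_list (map wt L0))" "rep y \<in> T n (wt y)"
      using L Ly by (auto simp: tensors_iff intro!: prodr_T rep_props)
    have "(\<Sum>r<m. sdeg ((L0 @ [y]) ! r) + 1) = of_nat (\<Sum>r<m. wt ((L0 @ [y]) ! r) + 1)"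
      using True Ly len by (intro sdeg_sum) auto
    moreover have "(\<Sum>r<m. wt ((L0 @ [y]) ! r) + 1) = (\<Sum>r<m. map wt L0 ! r + 1)"
      using len by (intro sum.cong) (auto simp: nth_append)
    moreover have "sdeg y + 1 = of_nat (wt y + 1)" using True Ly by simp
    ultimately have "?s = ksign (of_nat ((wt y + 1) * (\<Sum>r<m. map wt L0 ! r + 1)))" by (simp only: of_nat_mult)
    then have s: "?s = (- 1) ^ ((wt y + 1) * (\<Sum>r<m. map wt L0 ! r + 1))" by (simp only: ksign_of_nat)
    have "gam (map wt L0 @ [wt y]) (prodr L0 * rep y) - lin_ext tE (gam (map wt L0 @ [wt y]) (prodr L0 * rep y)) \<in> relE m q"
      using T_mult[OF T] W by (intro tE_relE gam_E[OF _ W]) (simp add: weights_def)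
    then show ?thesis
      unfolding B s using True Ly by (simp add: beta_def tE_gam[OF W T] add.commute)
  qed
qed

lemma chains_supp: "chains B m = supp_in (tensors B m)" by (simp add: chains_def supp_in_def)

lemma Beta_cyc_rels: "x \<in> cyc_rels B m \<Longrightarrow> Beta q x \<in> relE m q"
  unfolding cyc_rels_def
proof (rule plinear_span_subset[OF plinear_Beta _ subspace_relE])
  fix g assume "g \<in> multilinear_rels B m \<union> (\<lambda>x. x - lin_ext cyc_t x) ` chains B m"
  then show "Beta q g \<in> relE m q"
  proof
    assume "g \<in> (\<lambda>x. x - lin_ext cyc_t x) ` chains B m"
    then obtain x where x: "g = x - lin_ext cyc_t x" "x \<in> supp_in (tensors B m)" by (auto simp: chains_supp)
    show ?thesis unfolding x(1)
      by (rule plinear_supp_subset[OF plinear_comp[OF plinear_Beta plinear_minus[OF plinear_id lin_ext_linear]] _ subspace_relE x(2)])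
        (rule Beta_cyc_t)
  qed (rule Beta_multilinear)
qed

text \<open>The product is split into first, middle and last parts since the wrapping term moves the
  last factor in front of the first; each part is then extended linearly from words.\<close>

lemma bE_gam:
  fixes x y z :: "nc_word \<Rightarrow>\<^sub>0 'k"
  assumes W: "weights (Suc m) q (p # ps @ [p'])" and T: "x \<in> T n p" "y \<in> T n (sum_list ps)" "z \<in> T n p'"
  shows "lin_ext bE (gam (p # ps @ [p']) (x * y * z)) =
    (\<Sum>i<Suc m. pscale ((- 1) ^ (i + (\<Sum>r\<le>i. (p # ps @ [p']) ! r))) (gam (mergel i (p # ps @ [p'])) (x * y * z)))
    + pscale ((- 1) ^ (p' + (p' + 1) * (\<Sum>r<Suc m. (p # ps @ [p']) ! r + 1))) (gam ((p' + p) # ps) (z * x * y))"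
    (is "?l (x * y * z) = ?r x y z")
proof -
  let ?P = "p # ps @ [p']"
  have 1: "?l (wmono u * wmono v * wmono w) = ?r (wmono u) (wmono v) (wmono w)"
    if u: "u \<in> words n p" and v: "v \<in> words n (sum_list ps)" and w: "w \<in> words n p'" for u v w
  proof -
    have l: "length u = p" "length v = sum_list ps" "length w = p'" "length ps = m" using u v w W by (auto simp: words_def weights_def)
    let ?w = "u @ v @ w"
    have lw: "length ?w = sum_list ?P" using l by simp
    have s: "splitl ?P ?w = u # splitl ps v @ [w]" using splitl_append[of v ps "[p']" w] l by simp
    have len: "length (splitl ?P ?w ! r) = ?P ! r" if "r < Suc (Suc m)" for r
      using splitl_lengths[OF lw] that l(4) by (metis length_Cons length_append_singleton length_map nth_map)
    have "bE' (splitl ?P ?w) = (\<Sum>i<Suc m. Poly_Mapping.single (splitl (mergel i ?P) ?w) ((- 1 :: 'k) ^ (i + (\<Sum>r\<le>i. ?P ! r))))"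
      unfolding bE'_def
    proof (rule sum.cong)
      fix i assume i: "i \<in> {..<Suc m}"
      have "(\<Sum>r\<le>i. length (splitl ?P ?w ! r)) = (\<Sum>r\<le>i. ?P ! r)" using i len by (intro sum.cong refl) auto
      moreover have "take i (splitl ?P ?w) @ (splitl ?P ?w ! i @ splitl ?P ?w ! (i + 1)) # drop (i + 2) (splitl ?P ?w) = splitl (mergel i ?P) ?w"
        using i l by (intro splitl_merge lw) auto
      ultimately show "Poly_Mapping.single (take i (splitl ?P ?w) @ (splitl ?P ?w ! i @ splitl ?P ?w ! (i + 1)) # drop (i + 2) (splitl ?P ?w))
        ((- 1 :: 'k) ^ (i + (\<Sum>r\<le>i. length (splitl ?P ?w ! r)))) = Poly_Mapping.single (splitl (mergel i ?P) ?w) ((- 1) ^ (i + (\<Sum>r\<le>i. ?P ! r)))"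
        by (simp only:)
    qed (use l in simp)
    moreover have "(\<Sum>r<Suc m. length (splitl ?P ?w ! r) + 1) = (\<Sum>r<Suc m. ?P ! r + 1)" using len by (intro sum.cong refl) auto
    moreover have "splitl ?P ?w ! Suc m = w" "splitl ?P ?w ! 0 = u" "butlast (tl (splitl ?P ?w)) = splitl ps v" "length (splitl ?P ?w) = Suc (Suc m)"
      unfolding s using l by (simp_all add: nth_append)
    moreover have "splitl ((p' + p) # ps) (w @ u @ v) = (w @ u) # splitl ps v" using l by simp
    ultimately show ?thesis using l(3)
      by (simp add: wmono_mult bE_def Let_def del: sum.lessThan_Suc splitl.simps)
  qed
  have 2: "?l (wmono u * wmono v * z) = ?r (wmono u) (wmono v) z"
    if u: "u \<in> words n p" and v: "v \<in> words n (sum_list ps)" for u v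
    by (rule T_linear_eq[OF _ _ T(3), where f = "\<lambda>z. ?l (wmono u * wmono v * z)" and g = "\<lambda>z. ?r (wmono u) (wmono v) z"])
      (intro 1[OF u v] plinear_comp[OF lin_ext_linear] plinear_comp[OF plinear_gam plinear_times_left] plinear_add plinear_sum plinear_scale
        plinear_comp[OF plinear_gam plinear_comp[OF plinear_times_right plinear_times_right]])+
  have 3: "?l (wmono u * y * z) = ?r (wmono u) y z" if u: "u \<in> words n p" for u
    by (rule T_linear_eq[OF _ _ T(2), where f = "\<lambda>y. ?l (wmono u * y * z)" and g = "\<lambda>y. ?r (wmono u) y z"])
      (intro 2[OF u] plinear_comp[OF lin_ext_linear] plinear_comp[OF plinear_gam plinear_comp[OF plinear_times_right plinear_times_left]]
        plinear_add plinear_sum plinear_scale plinear_comp[OF plinear_gam plinear_times_left])+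
  show ?thesis
    by (rule T_linear_eq[OF _ _ T(1), where f = "\<lambda>x. ?l (x * y * z)" and g = "\<lambda>x. ?r x y z"])
      (intro 3 plinear_comp[OF lin_ext_linear] plinear_comp[OF plinear_gam plinear_comp[OF plinear_times_right plinear_times_right]]
        plinear_add plinear_sum plinear_scale plinear_comp[OF plinear_gam plinear_comp[OF plinear_times_right plinear_times_left]])+
qed

lemma wt_tagged_mult: "wt (tagged_mult B x y) = wt x + wt y"
  by (simp add: tagged_mult_def wt_def)

lemma beta_merge:
  assumes L: "L \<in> tensors B (Suc m)" and i: "Suc i < length L"
  shows "beta q (take i L @ tagged_mult B (L ! i) (L ! (i + 1)) # drop (i + 2) L)
    - (if sum_list (map wt L) = q then gam (mergel i (map wt L)) (prodr L) else 0) \<in> relE m q"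
proof -
  obtain u x y v where Lx: "L = u @ x # y # v" "u = take i L" "x = L ! i" "y = L ! (i + 1)" "v = drop (i + 2) L"
    using nth_split2[OF i] by blast
  have lu: "length u = i" using Lx(2) i by simp
  have g: "good_tag x" "good_tag y" "\<forall>z\<in>set u \<union> set v. good_tag z" using L Lx(1) by (auto simp: tensors_iff)
  let ?t = "tagged_mult B x y"
  have t: "u @ ?t # v \<in> tensors B m"
    unfolding tensors_ctx using g good_tag_mult(1)[OF g(1,2)] L Lx(1) by (auto simp: tensors_iff)
  have mg: "mergel i (map wt L) = map wt (u @ ?t # v)"
    unfolding mergel_def Lx(1) using lu by (simp add: wt_tagged_mult nth_append)
  have sum: "sum_list (map wt (u @ ?t # v)) = sum_list (map wt L)" unfolding Lx(1) by (simp add: wt_tagged_mult)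
  show ?thesis
  proof (cases "sum_list (map wt L) = q")
    case True
    have "gam (map wt (u @ ?t # v)) (prodr u * (rep ?t - rep x * rep y) * prodr v) \<in> relE m q"
      using good_tag_mult(2)[OF g(1,2)] sum True by (intro beta_rel[OF t]) (simp_all only: wt_tagged_mult)
    moreover have "prodr u * (rep ?t - rep x * rep y) * prodr v = prodr (u @ ?t # v) - prodr L"
      unfolding Lx(1) by (simp add: algebra_simps)
    ultimately show ?thesis using True sum unfolding mg Lx(2-5)[symmetric] by (simp add: beta_def del: prodr_simps map_append)
  next
    case False
    then show ?thesis using sum unfolding Lx(2-5)[symmetric] by (simp add: beta_def pm.subspace_0 del: map_append)
  qed
qed

lemma ksign_wt:
  assumes "\<forall>y\<in>set L. sdeg y = of_nat (wt y)" "length L = Suc (Suc m)"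
  shows "i \<le> Suc m \<Longrightarrow> ksign (of_nat i + (\<Sum>r\<le>i. sdeg (L ! r))) = ((- 1) ^ (i + (\<Sum>r\<le>i. map wt L ! r)) :: 'k)"
    and "ksign (sdeg (L ! Suc m) + (sdeg (L ! Suc m) + 1) * (\<Sum>r<Suc m. sdeg (L ! r) + 1))
      = ((- 1) ^ (map wt L ! Suc m + (map wt L ! Suc m + 1) * (\<Sum>r<Suc m. map wt L ! r + 1)) :: 'k)"
proof -
  have s: "sdeg (L ! r) = of_nat (map wt L ! r)" if "r \<le> Suc m" for r using assms that by simp
  show "ksign (of_nat i + (\<Sum>r\<le>i. sdeg (L ! r))) = ((- 1) ^ (i + (\<Sum>r\<le>i. map wt L ! r)) :: 'k)" if "i \<le> Suc m"
  proof -
    have "of_nat i + (\<Sum>r\<le>i. sdeg (L ! r)) = of_nat (i + (\<Sum>r\<le>i. map wt L ! r))"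
      unfolding of_nat_add of_nat_sum by (intro arg_cong2[of _ _ _ _ "(+)"] sum.cong refl s) (use that in auto)
    then show ?thesis by (simp only: ksign_of_nat)
  qed
  have "(\<Sum>r<Suc m. sdeg (L ! r) + 1) = of_nat (\<Sum>r<Suc m. map wt L ! r + 1)"
    unfolding of_nat_add of_nat_sum of_nat_1 by (intro sum.cong refl arg_cong2[of _ _ _ _ "(+)"] s) auto
  then have "sdeg (L ! Suc m) + (sdeg (L ! Suc m) + 1) * (\<Sum>r<Suc m. sdeg (L ! r) + 1)
    = of_nat (map wt L ! Suc m + (map wt L ! Suc m + 1) * (\<Sum>r<Suc m. map wt L ! r + 1))"
    by (simp only: s[OF order_refl] of_nat_add of_nat_mult of_nat_1)
  then show "ksign (sdeg (L ! Suc m) + (sdeg (L ! Suc m) + 1) * (\<Sum>r<Suc m. sdeg (L ! r) + 1))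
      = ((- 1) ^ (map wt L ! Suc m + (map wt L ! Suc m + 1) * (\<Sum>r<Suc m. map wt L ! r + 1)) :: 'k)"
    by (simp only: ksign_of_nat)
qed

text \<open>The representative of a product differs from the product of representatives by a
  relation, so each merge commutes with \<open>Beta\<close> modulo \<open>relE\<close>.\<close>

lemma Beta_cyc_b:
  assumes L: "L \<in> tensors B (Suc m)"
  shows "Beta q (cyc_b B L) - lin_ext bE (beta q L) \<in> relE m q"
proof -
  have len: "length L = Suc (Suc m)" using L by (simp add: tensors_iff)
  obtain x L1 y where Lxy: "L = x # L1 @ [y]"
  proof -
    obtain x L' where "L = x # L'" "length L' = Suc m" using len by (cases L) auto
    moreover then obtain L1 y where "L' = L1 @ [y]" by (cases L' rule: rev_exhaust) auto
    ultimately show ?thesis using that by blast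
  qed
  have l1: "length L1 = m" using len Lxy by simp
  let ?\<sigma> = "\<lambda>i. ksign (of_nat i + (\<Sum>r\<le>i. sdeg (L ! r))) :: 'k"
  let ?\<sigma>' = "ksign (sdeg (L ! Suc m) + (sdeg (L ! Suc m) + 1) * (\<Sum>r<Suc m. sdeg (L ! r) + 1)) :: 'k"
  let ?P = "map wt L"
  let ?\<tau> = "\<lambda>i. (- 1 :: 'k) ^ (i + (\<Sum>r\<le>i. ?P ! r))"
  let ?\<tau>' = "(- 1 :: 'k) ^ (?P ! Suc m + (?P ! Suc m + 1) * (\<Sum>r<Suc m. ?P ! r + 1))"
  let ?t = "tagged_mult B y x"
  let ?mg = "\<lambda>i. take i L @ tagged_mult B (L ! i) (L ! (i + 1)) # drop (i + 2) L"
  have ends: "L ! Suc m = y" "L ! 0 = x" "butlast (tl L) = L1" using Lxy l1 by (simp_all add: nth_append)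
  have cb: "cyc_b B L = (\<Sum>i<Suc m. Poly_Mapping.single (?mg i) (?\<sigma> i)) + Poly_Mapping.single (?t # L1) ?\<sigma>'"
    by (simp add: cyc_b_def Let_def len ends del: sum.lessThan_Suc sum.atMost_Suc)
  have g: "good_tag x" "good_tag y" "\<forall>z\<in>set L1. good_tag z" using L Lxy by (auto simp: tensors_iff)
  define G where "G i = (if sum_list ?P = q then gam (mergel i ?P) (prodr L) else 0)" for i
  define G' where "G' = (if sum_list ?P = q then gam ((wt y + wt x) # map wt L1) (rep y * rep x * prodr L1) else 0)"
  have 1: "beta q (?mg i) - G i \<in> relE m q" if "i < Suc m" for i
    unfolding G_def using that len by (intro beta_merge[OF L]) simp
  have 2: "beta q (?t # L1) - G' \<in> relE m q"
  proof -
    have t: "[] @ ?t # L1 \<in> tensors B m" unfolding tensors_ctx using g good_tag_mult(1)[OF g(2,1)] l1 by simp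
    have sum: "sum_list (map wt (?t # L1)) = sum_list ?P" unfolding Lxy by (simp add: wt_tagged_mult)
    show ?thesis
    proof (cases "sum_list ?P = q")
      case True
      have "gam (map wt ([] @ ?t # L1)) (prodr [] * (rep ?t - rep y * rep x) * prodr L1) \<in> relE m q"
        using good_tag_mult(2)[OF g(2,1)] sum True by (intro beta_rel[OF t]) (simp_all only: wt_tagged_mult append_Nil)
      then show ?thesis using True sum by (simp add: beta_def G'_def wt_tagged_mult algebra_simps)
    next
      case False
      then show ?thesis using sum by (simp add: beta_def G'_def pm.subspace_0)
    qed
  qed
  have bE: "lin_ext bE (beta q L) = (\<Sum>i<Suc m. pscale (?\<tau> i) (G i)) + pscale ?\<tau>' G'"
  proof (cases "sum_list ?P = q")
    case True
    have P: "?P = wt x # map wt L1 @ [wt y]" by (simp add: Lxy)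
    have W: "weights (Suc m) q (wt x # map wt L1 @ [wt y])" using weights_tensors[OF L] True P by simp
    have T: "rep x \<in> T n (wt x)" "prodr L1 \<in> T n (sum_list (map wt L1))" "rep y \<in> T n (wt y)"
      using g by (auto intro!: rep_props prodr_T)
    have "prodr L = rep x * prodr L1 * rep y" by (simp add: Lxy mult.assoc)
    moreover have "?P ! Suc m = wt y" using P l1 by (simp add: nth_append)
    ultimately show ?thesis using bE_gam[OF W T] True
      unfolding G_def G'_def beta_def if_P[OF True] P[symmetric] by (simp only:)
  next
    case False
    then show ?thesis by (simp add: beta_def G_def G'_def)
  qed
  \<comment> \<open>Signs computed from sign degrees and from weights may differ only when some
    entry has the wrong sign degree, and then the product of representatives is zero.\<close>
  have eq: "pscale (?\<sigma> i) (G i) = pscale (?\<tau> i) (G i)" if "i < Suc m" for i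
  proof (cases "\<forall>y\<in>set L. sdeg y = of_nat (wt y)")
    case True then show ?thesis using ksign_wt(1)[OF True len, of i] that by simp
  next
    case False then show ?thesis using prodr_bad[of _ L] by (auto simp: G_def)
  qed
  have eq': "pscale ?\<sigma>' G' = pscale ?\<tau>' G'"
  proof (cases "\<forall>y\<in>set L. sdeg y = of_nat (wt y)")
    case True then show ?thesis using ksign_wt(2)[OF True len] by (simp only:)
  next
    case False
    then obtain z where z: "z \<in> set (y # x # L1)" "sdeg z \<noteq> of_nat (wt z)"
      unfolding Lxy set_append list.set by blast
    have "prodr (y # x # L1) = 0" by (rule prodr_bad[OF z])
    then show ?thesis by (simp add: G'_def mult.assoc)
  qed
  have "Beta q (cyc_b B L) - lin_ext bE (beta q L)
    = (\<Sum>i<Suc m. pscale (?\<sigma> i) (beta q (?mg i) - G i)) + pscale ?\<sigma>' (beta q (?t # L1) - G')"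
  proof -
    have "Beta q (cyc_b B L) = (\<Sum>i<Suc m. pscale (?\<sigma> i) (beta q (?mg i))) + pscale ?\<sigma>' (beta q (?t # L1))"
      unfolding cb by (simp only: Beta_simps Beta_single)
    moreover have "lin_ext bE (beta q L) = (\<Sum>i<Suc m. pscale (?\<sigma> i) (G i)) + pscale ?\<sigma>' G'"
      unfolding bE eq'[symmetric] by (intro arg_cong2[of _ _ _ _ "(+)"] sum.cong refl eq[symmetric]) auto
    ultimately show ?thesis by (simp only: pm.scale_right_diff_distrib sum_subtractf) (simp add: algebra_simps del: sum.lessThan_Suc)
  qed
  also have "\<dots> \<in> relE m q"
    by (intro pm.subspace_add pm.subspace_sum pm.subspace_scale subspace_relE 1 2) auto
  finally show ?thesis .
qed


lemma cyc_t_tag: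
  assumes "ws \<in> Eset m q"
  shows "cyc_t (map tag ws) = Alpha (tE ws)"
proof -
  have l: "length ws = Suc m" using assms by (simp add: Eset_def)
  have s: "sdeg (map tag ws ! r) = of_nat (length (ws ! r))" if "r \<le> m" for r using that l by simp
  have "(\<Sum>r<m. sdeg (map tag ws ! r) + 1) = of_nat (\<Sum>r<m. length (ws ! r) + 1)"
    unfolding of_nat_add of_nat_sum of_nat_1 by (intro sum.cong refl arg_cong2[of _ _ _ _ "(+)"] s) auto
  then have "(sdeg (map tag ws ! m) + 1) * (\<Sum>r<m. sdeg (map tag ws ! r) + 1)
    = of_nat ((length (ws ! m) + 1) * (\<Sum>r<m. length (ws ! r) + 1))"
    by (simp only: s[OF order_refl] of_nat_add of_nat_mult of_nat_1)
  then have k: "ksign ((sdeg (map tag ws ! m) + 1) * (\<Sum>r<m. sdeg (map tag ws ! r) + 1))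
    = ((- 1) ^ ((length (ws ! m) + 1) * (\<Sum>r<m. length (ws ! r) + 1)) :: 'k)" by (simp only: ksign_of_nat)
  have "ws \<noteq> []" using l by auto
  then have e: "length (map tag ws) - 1 = m" "length ws - 1 = m" "last (map tag ws) = tag (last ws)"
    "butlast (map tag ws) = map tag (butlast ws)" using l by (simp_all add: last_map map_butlast)
  show ?thesis unfolding cyc_t_def tE_def Let_def e k Alpha_single list.map ..
qed

lemma cyc_b_tag:
  assumes "ws \<in> Eset (Suc m) q"
  shows "cyc_b B (map tag ws) = Alpha (bE ws)"
proof -
  have l: "length ws = Suc (Suc m)" using assms by (simp add: Eset_def)
  have le: "length (map tag ws) = Suc (Suc m)" using l by simp
  have sd: "\<forall>y\<in>set (map tag ws). sdeg y = of_nat (wt y)" by auto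
  have w: "map wt (map tag ws) ! r = length (ws ! r)" if "r \<le> Suc m" for r using that l by simp
  have W: "set (ws ! r) \<subseteq> {..<n}" if "r \<le> Suc m" for r using assms that l by (auto simp: Eset_def)
  have s1: "(\<Sum>r\<le>i. map wt (map tag ws) ! r) = (\<Sum>r\<le>i. length (ws ! r))" if "i \<le> Suc m" for i
    using that by (intro sum.cong refl w) auto
  have s2: "(\<Sum>r<Suc m. map wt (map tag ws) ! r + 1) = (\<Sum>r<Suc m. length (ws ! r) + 1)"
    by (intro sum.cong refl arg_cong2[of _ _ _ _ "(+)"] w) auto
  have 1: "Poly_Mapping.single (take i (map tag ws) @ tagged_mult B (map tag ws ! i) (map tag ws ! (i + 1)) # drop (i + 2) (map tag ws))
        (ksign (of_nat i + (\<Sum>r\<le>i. sdeg (map tag ws ! r))))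
    = Alpha (Poly_Mapping.single (take i ws @ (ws ! i @ ws ! (i + 1)) # drop (i + 2) ws) ((- 1) ^ (i + (\<Sum>r\<le>i. length (ws ! r)))))"
    if "i < Suc m" for i
  proof -
    have "tagged_mult B (map tag ws ! i) (map tag ws ! (i + 1)) = tag (ws ! i @ ws ! (i + 1))"
      using tagged_mult_tag[OF W W, of i "i + 1"] that l by simp
    then show ?thesis using ksign_wt(1)[OF sd le, of i] s1[of i] that by (simp add: take_map drop_map)
  qed
  have "tagged_mult B (map tag ws ! Suc m) (map tag ws ! 0) = tag (ws ! Suc m @ ws ! 0)"
    using tagged_mult_tag[OF W W, of "Suc m" 0] l by simp
  then have 2: "Poly_Mapping.single (tagged_mult B (map tag ws ! Suc m) (map tag ws ! 0) # butlast (tl (map tag ws)))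
        (ksign (sdeg (map tag ws ! Suc m) + (sdeg (map tag ws ! Suc m) + 1) * (\<Sum>r<Suc m. sdeg (map tag ws ! r) + 1)))
    = Alpha (Poly_Mapping.single ((ws ! Suc m @ ws ! 0) # butlast (tl ws))
       ((- 1) ^ (length (ws ! Suc m) + (length (ws ! Suc m) + 1) * (\<Sum>r<Suc m. length (ws ! r) + 1))))"
    unfolding ksign_wt(2)[OF sd le] s2 w[OF order_refl] by (simp add: map_butlast map_tl)
  have e: "length (map tag ws) - 1 = Suc m" "length ws - 1 = Suc m" using l by auto
  show ?thesis
    unfolding cyc_b_def bE_def bE'_def Let_def e 2 Alpha_simps
    by (intro arg_cong2[of _ _ _ _ "(+)"] sum.cong refl 1) simp
qed

lemma tag_tensors: "ws \<in> Eset m q \<Longrightarrow> map tag ws \<in> tensors B m"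
  by (auto simp: tensors_iff Eset_def intro!: good_tag_tag)

definition hom_tensors :: "nat \<Rightarrow> nat \<Rightarrow> bit \<Rightarrow> (nc_word \<Rightarrow>\<^sub>0 'k) set tagged list set"
  where "hom_tensors m q \<epsilon> = {L \<in> tensors B m. sum_list (map wt L) = q \<and> of_nat m + sum_list (map sdeg L) = \<epsilon>}"

lemma homogeneous_supp: "x \<in> chains B m \<and> homogeneous_chain m q \<epsilon> x \<longleftrightarrow> x \<in> supp_in (hom_tensors m q \<epsilon>)"
  unfolding chains_def homogeneous_chain_def supp_in_def hom_tensors_def by blast

lemma sum_list_sdeg: "(\<forall>y\<in>set L. sdeg y = of_nat (wt y)) \<Longrightarrow> sum_list (map sdeg L) = of_nat (sum_list (map wt L))"
  by (induction L) auto

lemma tag_hom_tensors: "ws \<in> Eset m q \<Longrightarrow> map tag ws \<in> hom_tensors m q (of_nat (m + q))"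
proof -
  assume ws: "ws \<in> Eset m q"
  have "sum_list (map wt (map tag ws)) = q" using ws by (simp add: Eset_def comp_def)
  moreover have "sum_list (map sdeg (map tag ws)) = of_nat (sum_list (map wt (map tag ws)))" by (rule sum_list_sdeg) auto
  ultimately show ?thesis unfolding hom_tensors_def using tag_tensors[OF ws] by (simp only: mem_Collect_eq of_nat_add)
qed

lemma Alpha_hom: "z \<in> E m q \<Longrightarrow> Alpha z \<in> supp_in (hom_tensors m q (of_nat (m + q)))"
  by (rule E_linear_subset[OF plinear_Alpha _ subspace_supp_in]) (use tag_hom_tensors in auto)

lemma Alpha_chains: "z \<in> E m q \<Longrightarrow> Alpha z \<in> chains B m"
  using Alpha_hom homogeneous_supp by blast

lemma Alpha_tE: "z \<in> E m q \<Longrightarrow> lin_ext cyc_t (Alpha z) = Alpha (lin_ext tE z)"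
  unfolding E_def
  by (rule plinear_eq_on_supp[of "\<lambda>z. lin_ext cyc_t (Alpha z)" "\<lambda>z. Alpha (lin_ext tE z)"])
    (auto intro: plinear_comp lin_ext_linear plinear_Alpha simp: cyc_t_tag)

lemma Alpha_bE: "z \<in> E (Suc m) q \<Longrightarrow> lin_ext (cyc_b B) (Alpha z) = Alpha (lin_ext bE z)"
  unfolding E_def
  by (rule plinear_eq_on_supp[of "\<lambda>z. lin_ext (cyc_b B) (Alpha z)" "\<lambda>z. Alpha (lin_ext bE z)"])
    (auto intro: plinear_comp lin_ext_linear plinear_Alpha simp: cyc_b_tag)

lemma subspace_cyc_rels [simp, intro]: "pm.subspace (cyc_rels B m)" by (simp add: cyc_rels_def)
lemma subspace_HC_bounds [simp, intro]: "pm.subspace (HC_bounds B m)" by (simp add: HC_bounds_def)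

lemma cyc_rels_bounds: "cyc_rels B m \<subseteq> HC_bounds B m"
  unfolding HC_bounds_def by (auto intro: pm.span_base)

lemma Alpha_omega_gen:
  assumes ws: "us @ (x @ [0, 0] @ y) # vs \<in> Eset m q"
  shows "Alpha (omega_gen us x y vs) \<in> mlspan m"
proof -
  let ?X = "wmono x * \<omega> * wmono y" and ?p = "length x + 2 + length y"
  let ?u = "map tag us" and ?v = "map tag vs"
  have X: "?X \<in> RS UNIV ?p" using ws by (intro RS_gen) (auto simp: Eset_def)
  have XT: "?X \<in> T n ?p" using X RS_T by auto
  have c0: "cls ?X = cls 0" using X RS_J by (auto simp: cls_eq)
  have ctx: "\<forall>y\<in>set ?u \<union> set ?v. good_tag y" "length ?u + length ?v = m"
    using ws by (auto simp: Eset_def intro!: good_tag_tag)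
  have "?u @ (?p, of_nat ?p, cls ?X) # ?v \<in> tensors B m"
    unfolding tensors_ctx using ctx good_tag_cls[OF XT] by auto
  then have 1: "Poly_Mapping.single (?u @ (?p, of_nat ?p, cls ?X) # ?v) 1 \<in> mlspan m" unfolding c0 by (rule mlspan_zero)
  have 2: "Poly_Mapping.single (?u @ (?p, of_nat ?p, cls ?X) # ?v) 1
    - lin_ext (\<lambda>w. Poly_Mapping.single (?u @ tag (letters w) # ?v) 1) ?X \<in> mlspan m"
    by (rule mlspan_expand[OF XT _ ctx]) simp
  have g: "lin_ext (\<lambda>w. Poly_Mapping.single (?u @ tag (letters w) # ?v) (1::'k)) (wmono w) = Poly_Mapping.single (?u @ tag w # ?v) 1" for w
    by (simp add: wmono_def)
  have "lin_ext (\<lambda>w. Poly_Mapping.single (?u @ tag (letters w) # ?v) 1) ?X = Alpha (omega_gen us x y vs)"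
    unfolding omega_pairs omega_gen_def
    by (simp add: sum_distrib_left sum_distrib_right times_pscale_left times_pscale_right wmono_mult g pmp.linear_sum[OF lin_ext_linear] del: pscale_single)
  then show ?thesis using pm.span_diff[OF 1 2] by simp
qed

lemma Alpha_relE: "z \<in> relE m q \<Longrightarrow> Alpha z \<in> cyc_rels B m"
  unfolding relE_def
proof (rule plinear_span_subset[OF plinear_Alpha _ subspace_cyc_rels])
  fix g :: "nat list list \<Rightarrow>\<^sub>0 'k"
  assume "g \<in> omega_gens m q \<union> (\<lambda>z. z - lin_ext tE z) ` E m q"
  then show "Alpha g \<in> cyc_rels B m"
  proof
    assume "g \<in> omega_gens m q"
    then obtain us x y vs where "g = omega_gen us x y vs" "us @ (x @ [0, 0] @ y) # vs \<in> Eset m q"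
      unfolding omega_gens_def by blast
    then show ?thesis using Alpha_omega_gen mlspan_cyc_rels by blast
  next
    assume "g \<in> (\<lambda>z. z - lin_ext tE z) ` E m q"
    then obtain z where z: "g = z - lin_ext tE z" "z \<in> E m q" by auto
    then have "Alpha g = Alpha z - lin_ext cyc_t (Alpha z)" by (simp add: Alpha_tE)
    then show ?thesis unfolding cyc_rels_def using Alpha_chains[OF z(2)] by (auto intro: pm.span_base)
  qed
qed

definition ZE :: "nat \<Rightarrow> nat \<Rightarrow> (nat list list \<Rightarrow>\<^sub>0 'k) set"
  where "ZE m q = {z \<in> E m q. m = 0 \<or> lin_ext bE z \<in> relE (m - 1) q}"

definition BE :: "nat \<Rightarrow> nat \<Rightarrow> (nat list list \<Rightarrow>\<^sub>0 'k) set"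
  where "BE m q = pm.span (relE m q \<union> lin_ext bE ` E (Suc m) q)"

lemma relE_BE: "relE m q \<subseteq> BE m q" unfolding BE_def by (auto intro: pm.span_base)

lemma subspace_BE [simp, intro]: "pm.subspace (BE m q)" by (simp add: BE_def)

lemma Beta_E: "x \<in> chains B m \<Longrightarrow> Beta q x \<in> E m q"
  unfolding chains_supp by (rule plinear_supp_subset[OF plinear_Beta _ subspace_E]) (auto intro: beta_E)

lemma Beta_b: "x \<in> chains B (Suc m) \<Longrightarrow> Beta q (lin_ext (cyc_b B) x) - lin_ext bE (Beta q x) \<in> relE m q"
  unfolding chains_supp
  by (rule plinear_supp_subset[of "\<lambda>x. Beta q (lin_ext (cyc_b B) x) - lin_ext bE (Beta q x)", OF _ _ subspace_relE])
    (auto intro: plinear_minus plinear_comp[OF plinear_Beta lin_ext_linear] plinear_comp[OF lin_ext_linear plinear_Beta] Beta_cyc_b)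

lemma Beta_bounds: "x \<in> HC_bounds B m \<Longrightarrow> Beta q x \<in> BE m q"
  unfolding HC_bounds_def
proof (rule plinear_span_subset[OF plinear_Beta _ subspace_BE])
  fix g assume "g \<in> cyc_rels B m \<union> lin_ext (cyc_b B) ` chains B (m + 1)"
  then show "Beta q g \<in> BE m q"
  proof
    assume "g \<in> cyc_rels B m"
    then show ?thesis using Beta_cyc_rels relE_BE by blast
  next
    assume "g \<in> lin_ext (cyc_b B) ` chains B (m + 1)"
    then obtain x where x: "g = lin_ext (cyc_b B) x" "x \<in> chains B (Suc m)" by auto
    have "Beta q g - lin_ext bE (Beta q x) \<in> BE m q" using Beta_b[OF x(2)] relE_BE x(1) by blast
    moreover have "lin_ext bE (Beta q x) \<in> BE m q" unfolding BE_def using Beta_E[OF x(2)] by (auto intro: pm.span_base)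
    ultimately have "(Beta q g - lin_ext bE (Beta q x)) + lin_ext bE (Beta q x) \<in> BE m q" by (rule pm.subspace_add[OF subspace_BE])
    then show ?thesis by simp
  qed
qed

lemma HC_cycles_hom: "{x \<in> HC_cycles B m. homogeneous_chain m q \<epsilon> x}
  = {x \<in> supp_in (hom_tensors m q \<epsilon>). m = 0 \<or> lin_ext (cyc_b B) x \<in> cyc_rels B (m - 1)}"
  unfolding HC_cycles_def using homogeneous_supp by blast

text \<open>\<open>Alpha\<close> and \<open>Beta\<close> are chain maps, inverse to each other
  modulo relations in weight \<open>q\<close>. The sign degree is \<open>m + q\<close> because
  letters are odd of weight one and degree \<open>m\<close> contributes a shift by
  \<open>m\<close>.\<close>

lemma HC_component_transfer:
  assumes "has_dim_modulo (BE m q) (ZE m q) d"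
  shows "HC_component_has_dim B m q (of_nat (m + q)) d"
  unfolding HC_component_has_dim_def HC_cycles_hom
proof (rule has_dim_modulo_transfer[OF assms plinear_Alpha plinear_Beta[of q] subspace_BE subspace_HC_bounds])
  fix x assume "x \<in> ZE m q"
  then have x: "x \<in> E m q" "m = 0 \<or> lin_ext bE x \<in> relE (m - 1) q" by (auto simp: ZE_def)
  have "m = 0 \<or> lin_ext (cyc_b B) (Alpha x) \<in> cyc_rels B (m - 1)"
  proof (cases m)
    case (Suc m') then show ?thesis using Alpha_bE[of x m' q] Alpha_relE[of _ m' q] x by simp
  qed simp
  then show "Alpha x \<in> {x \<in> supp_in (hom_tensors m q (of_nat (m + q))). m = 0 \<or> lin_ext (cyc_b B) x \<in> cyc_rels B (m - 1)}"
    using Alpha_hom[OF x(1)] by simp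
  have "Beta q (Alpha x) - x \<in> relE m q"
    by (rule E_linear_subset[of "\<lambda>x. Beta q (Alpha x) - x", OF _ _ subspace_relE x(1)])
      (auto intro: plinear_minus plinear_comp[OF plinear_Beta plinear_Alpha] plinear_id beta_alpha)
  then show "Beta q (Alpha x) - x \<in> BE m q" using relE_BE by blast
next
  fix x assume "x \<in> BE m q"
  then show "Alpha x \<in> HC_bounds B m"
    unfolding BE_def
  proof (rule plinear_span_subset[OF plinear_Alpha _ subspace_HC_bounds, rotated])
    fix g :: "nat list list \<Rightarrow>\<^sub>0 'k" assume "g \<in> relE m q \<union> lin_ext bE ` E (Suc m) q"
    then show "Alpha g \<in> HC_bounds B m"
    proof
      assume "g \<in> relE m q" then show ?thesis using Alpha_relE cyc_rels_bounds by blast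
    next
      assume "g \<in> lin_ext bE ` E (Suc m) q"
      then obtain y where y: "g = lin_ext bE y" "y \<in> E (Suc m) q" by auto
      then have "Alpha g = lin_ext (cyc_b B) (Alpha y)" by (simp add: Alpha_bE)
      then show ?thesis unfolding HC_bounds_def using Alpha_chains[OF y(2)] by (auto intro: pm.span_base)
    qed
  qed
next
  fix x assume "x \<in> HC_bounds B m"
  then show "Beta q x \<in> BE m q" by (rule Beta_bounds)
next
  fix x assume "x \<in> {x \<in> supp_in (hom_tensors m q (of_nat (m + q))). m = 0 \<or> lin_ext (cyc_b B) x \<in> cyc_rels B (m - 1)}"
  then have x: "x \<in> supp_in (hom_tensors m q (of_nat (m + q)))" "m = 0 \<or> lin_ext (cyc_b B) x \<in> cyc_rels B (m - 1)" by auto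
  have xc: "x \<in> chains B m" using x(1) homogeneous_supp by blast
  have "m = 0 \<or> lin_ext bE (Beta q x) \<in> relE (m - 1) q"
  proof (cases m)
    case (Suc m')
    have "Beta q (lin_ext (cyc_b B) x) \<in> relE m' q" using x(2) Suc by (intro Beta_cyc_rels) simp
    from pm.subspace_diff[OF subspace_relE this Beta_b[of x m' q]] xc Suc show ?thesis by simp
  qed simp
  then show "Beta q x \<in> ZE m q" using Beta_E[OF xc] by (simp add: ZE_def)
  have "x - Alpha (Beta q x) \<in> mlspan m"
    by (rule plinear_supp_subset[of "\<lambda>x. x - Alpha (Beta q x)", OF _ _ pm.subspace_span x(1)])
      (auto intro: plinear_minus plinear_comp[OF plinear_Alpha plinear_Beta] plinear_id alpha_beta simp: hom_tensors_def)
  then show "x - Alpha (Beta q x) \<in> HC_bounds B m" using mlspan_cyc_rels cyc_rels_bounds by blast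
qed

text \<open>Such a tensor has an entry whose sign degree is not the parity of its weight; that entry
  is zero in B, so the tensor vanishes by multilinearity.\<close>

lemma HC_component_other_sign:
  assumes "\<epsilon> \<noteq> of_nat (m + q)"
  shows "HC_component_has_dim B m q \<epsilon> 0"
proof -
  have "Poly_Mapping.single L 1 \<in> mlspan m" if L: "L \<in> hom_tensors m q \<epsilon>" for L
  proof -
    have t: "L \<in> tensors B m" and s: "sum_list (map wt L) = q" "of_nat m + sum_list (map sdeg L) = \<epsilon>" using L by (auto simp: hom_tensors_def)
    have "\<not> (\<forall>y\<in>set L. sdeg y = of_nat (wt y))"
    proof
      assume "\<forall>y\<in>set L. sdeg y = of_nat (wt y)"
      from sum_list_sdeg[OF this] have "sum_list (map sdeg L) = of_nat q" unfolding s(1) .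
      with s(2) have "\<epsilon> = of_nat m + of_nat q" by (simp only:)
      then show False using assms unfolding of_nat_add by blast
    qed
    then obtain y where "y \<in> set L" "sdeg y \<noteq> of_nat (wt y)" by blast
    then have "prodr L = 0" by (rule prodr_bad)
    then have "beta q L = 0" by (simp add: beta_def)
    then show ?thesis using alpha_beta[OF t s(1)] by simp
  qed
  then have "x \<in> mlspan m" if "x \<in> supp_in (hom_tensors m q \<epsilon>)" for x
    using plinear_supp_subset[OF plinear_id _ pm.subspace_span that] by blast
  then have "{x \<in> supp_in (hom_tensors m q \<epsilon>). m = 0 \<or> lin_ext (cyc_b B) x \<in> cyc_rels B (m - 1)} \<subseteq> HC_bounds B m"
    using mlspan_cyc_rels cyc_rels_bounds by blast
  then show ?thesis
    unfolding HC_component_has_dim_def HC_cycles_hom has_dim_modulo_def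
    by (intro exI[of _ "{}"]) (auto intro: pm.span_base)
qed

end

text \<open>The map induces an isomorphism of the quotients. No map back is required, which suits
  multiplication by a letter or by \<open>\<omega>\<close> and the differential.\<close>

lemma has_dim_modulo_cong:
  fixes f :: "('x \<Rightarrow>\<^sub>0 'k::field) \<Rightarrow> ('y \<Rightarrow>\<^sub>0 'k)"
  assumes dim: "has_dim_modulo V U d" and f: "plinear f" and U: "pm.subspace U" and V': "pm.subspace V'"
    and fU: "\<And>x. x \<in> U \<Longrightarrow> f x \<in> U'" and fV: "\<And>x. x \<in> U \<Longrightarrow> f x \<in> V' \<longleftrightarrow> x \<in> V"
    and onto: "\<And>y. y \<in> U' \<Longrightarrow> \<exists>x\<in>U. y - f x \<in> V'" and VU: "V \<subseteq> U"
  shows "has_dim_modulo V' U' d"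
proof -
  obtain S where S: "finite S" "card S = d" "S \<subseteq> U"
    "\<And>h. (\<Sum>s\<in>S. pscale (h s) s) \<in> V \<Longrightarrow> (\<forall>s\<in>S. h s = 0)" "U \<subseteq> pm.span (S \<union> V)"
    using dim unfolding has_dim_modulo_def by blast
  have key: "\<forall>s\<in>S. h s = 0" if "(\<Sum>s\<in>S. pscale (h s) (f s)) \<in> V'" for h
  proof (rule S(4))
    have SU: "(\<Sum>s\<in>S. pscale (h s) s) \<in> U" using S(3) by (intro pm.subspace_sum[OF U] pm.subspace_scale[OF U]) auto
    show "(\<Sum>s\<in>S. pscale (h s) s) \<in> V" using fV[OF SU] that by (simp add: pmp.linear_sum[OF f] pmp.linear_scale[OF f])
  qed
  have inj: "inj_on f S" by (rule independent_modulo_inj[OF S(1) V' key])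
  show ?thesis
    unfolding has_dim_modulo_def
  proof (intro exI[of _ "f ` S"] conjI allI impI)
    show "finite (f ` S)" "card (f ` S) = d" using S(1,2) inj by (simp_all add: card_image)
    show "f ` S \<subseteq> U'" using S(3) fU by auto
    fix h assume "(\<Sum>s\<in>f ` S. pscale (h s) s) \<in> V'"
    then have "(\<Sum>s\<in>S. pscale (h (f s)) (f s)) \<in> V'" by (simp add: sum.reindex[OF inj])
    then show "\<forall>s\<in>f ` S. h s = 0" using key[of "\<lambda>s. h (f s)"] by auto
  next
    show "U' \<subseteq> pm.span (f ` S \<union> V')"
    proof
      fix y assume "y \<in> U'"
      then obtain x where x: "x \<in> U" "y - f x \<in> V'" using onto by blast
      have xs: "x \<in> pm.span (S \<union> V)" using x(1) S(5) by blast
      have "f z \<in> pm.span (f ` S \<union> V')" if "z \<in> S \<union> V" for z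
        using that fV[of z] VU by (intro pm.span_base) blast
      then have 1: "f x \<in> pm.span (f ` S \<union> V')" by (rule plinear_span_subset[OF f _ pm.subspace_span xs])
      have 2: "y - f x \<in> pm.span (f ` S \<union> V')" using x(2) by (intro pm.span_base) simp
      have "(y - f x) + f x \<in> pm.span (f ` S \<union> V')" by (rule pm.span_add[OF 2 1])
      then show "y \<in> pm.span (f ` S \<union> V')" by simp
    qed
  qed
qed

section \<open>Dimensions and the Euler characteristic\<close>

definition fin_dim :: "('x \<Rightarrow>\<^sub>0 'k::field) set \<Rightarrow> bool"
  where "fin_dim U \<longleftrightarrow> pm.subspace U \<and> (\<exists>F. finite F \<and> U \<subseteq> pm.span F)"

lemma fin_dim_subset: "fin_dim U \<Longrightarrow> pm.subspace V \<Longrightarrow> V \<subseteq> U \<Longrightarrow> fin_dim V"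
  unfolding fin_dim_def by blast

lemma fin_dim_basis:
  assumes "fin_dim U" "pm.independent B" "B \<subseteq> U"
  shows "finite B"
  using assms pm.independent_span_bound unfolding fin_dim_def by (metis subset_trans)

text \<open>A basis modulo \<open>V\<close> together with a basis of \<open>V\<close> is a basis of
  \<open>U\<close>; relative dimensions thus become differences of dimensions.\<close>

lemma has_dim_modulo_dim:
  assumes V: "fin_dim V" and U: "pm.subspace U" "V \<subseteq> U" and d: "has_dim_modulo V U d"
  shows "pm.dim U = pm.dim V + d"
proof -
  obtain S where S: "finite S" "card S = d" "S \<subseteq> U"
    "\<And>h. (\<Sum>s\<in>S. pscale (h s) s) \<in> V \<Longrightarrow> (\<forall>s\<in>S. h s = 0)" "U \<subseteq> pm.span (S \<union> V)"
    using d unfolding has_dim_modulo_def by blast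
  have sV: "pm.subspace V" using V by (simp add: fin_dim_def)
  obtain C where C: "C \<subseteq> V" "pm.independent C" "V \<subseteq> pm.span C" "card C = pm.dim V" using pm.basis_exists by blast
  have fC: "finite C" by (rule fin_dim_basis[OF V C(2,1)])
  have CV: "pm.span C \<subseteq> V" by (rule pm.span_minimal[OF C(1) sV])
  have disj: "s \<notin> V" if "s \<in> S" for s
  proof
    assume "s \<in> V"
    have "(\<Sum>t\<in>S. pscale (if t = s then 1 else 0) t) = (\<Sum>t\<in>S. if t = s then t else 0)" by (rule sum.cong) auto
    also have "\<dots> = s" using that S(1) by simp
    finally have "(\<Sum>t\<in>S. pscale (if t = s then 1 else 0) t) \<in> V" using \<open>s \<in> V\<close> by simp
    from S(4)[OF this] that show False by auto
  qed
  have "pm.independent (S \<union> C)"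
  proof (rule pm.independent_if_scalars_zero)
    show "finite (S \<union> C)" using S(1) fC by simp
    fix f x assume eq: "(\<Sum>x\<in>S \<union> C. pscale (f x) x) = 0" and x: "x \<in> S \<union> C"
    have "(\<Sum>x\<in>S \<union> C. pscale (f x) x) = (\<Sum>x\<in>S. pscale (f x) x) + (\<Sum>x\<in>C. pscale (f x) x)"
      using S(1) fC disj C(1) by (intro sum.union_disjoint) auto
    then have s: "(\<Sum>x\<in>S. pscale (f x) x) = - (\<Sum>x\<in>C. pscale (f x) x)" using eq by (simp add: eq_neg_iff_add_eq_0)
    have "(\<Sum>x\<in>S. pscale (f x) x) \<in> V" unfolding s
      using C(1) by (intro pm.subspace_neg[OF sV] pm.subspace_sum[OF sV] pm.subspace_scale[OF sV]) auto
    from S(4)[OF this] have f0: "\<forall>x\<in>S. f x = 0" .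
    then have "(\<Sum>x\<in>C. pscale (f x) x) = 0" using s by simp
    then have "\<forall>x\<in>C. f x = 0" using pm.independentD[OF C(2) fC] by blast
    then show "f x = 0" using f0 x by blast
  qed
  moreover have "U \<subseteq> pm.span (S \<union> C)"
  proof -
    have "V \<subseteq> pm.span (S \<union> C)" using C(3) pm.span_mono[of C "S \<union> C"] by blast
    then have "S \<union> V \<subseteq> pm.span (S \<union> C)" by (auto intro: pm.span_base)
    then show ?thesis using S(5) pm.span_minimal[OF _ pm.subspace_span] by blast
  qed
  moreover have "S \<union> C \<subseteq> U" using S(3) C(1) U by blast
  ultimately have "pm.dim U = card (S \<union> C)" using pm.dim_unique by metis
  also have "\<dots> = d + pm.dim V" using S(1,2) fC disj C(1,4) by (subst card_Un_disjoint) auto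
  finally show ?thesis by simp
qed

text \<open>The basis is selected from a given spanning set. Applied to the words of a fixed length
  this produces normal words.\<close>

lemma basis_modulo_in_spanning_set:
  assumes G: "finite G" and V: "pm.subspace V"
  shows "\<exists>S\<subseteq>G. (\<forall>h. (\<Sum>s\<in>S. pscale (h s) s) \<in> V \<longrightarrow> (\<forall>s\<in>S. h s = 0)) \<and> G \<subseteq> pm.span (S \<union> V)"
  using G
proof (induction G rule: finite_induct)
  case empty
  then show ?case by auto
next
  case (insert g G)
  then obtain S where S: "S \<subseteq> G" "\<And>h. (\<Sum>s\<in>S. pscale (h s) s) \<in> V \<Longrightarrow> (\<forall>s\<in>S. h s = 0)" "G \<subseteq> pm.span (S \<union> V)" by blast
  have fS: "finite S" using S(1) insert.hyps finite_subset by blast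
  show ?case
  proof (cases "g \<in> pm.span (S \<union> V)")
    case True
    then show ?thesis using S by (intro exI[of _ S]) auto
  next
    case False
    have gS: "g \<notin> S" using False by (auto intro: pm.span_base)
    have "h s = 0" if h: "(\<Sum>s\<in>insert g S. pscale (h s) s) \<in> V" and s: "s \<in> insert g S" for h s
    proof -
      have e: "(\<Sum>s\<in>insert g S. pscale (h s) s) = pscale (h g) g + (\<Sum>s\<in>S. pscale (h s) s)" using gS fS by simp
      have g0: "h g = 0"
      proof (rule ccontr)
        assume h0: "h g \<noteq> 0"
        have "(\<Sum>s\<in>S. pscale (h s) s) \<in> pm.span (S \<union> V)" by (intro pm.span_sum pm.span_scale pm.span_base) auto
        moreover have "pscale (h g) g + (\<Sum>s\<in>S. pscale (h s) s) \<in> pm.span (S \<union> V)" using h e by (auto intro: pm.span_base)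
        ultimately have "pscale (h g) g + (\<Sum>s\<in>S. pscale (h s) s) - (\<Sum>s\<in>S. pscale (h s) s) \<in> pm.span (S \<union> V)" by (intro pm.span_diff)
        then have "pscale (inverse (h g)) (pscale (h g) g) \<in> pm.span (S \<union> V)" by (intro pm.span_scale[of "pscale (h g) g"]) (simp only: add_diff_cancel_right')
        moreover have "pscale (inverse (h g)) (pscale (h g) g) = g" using h0 by simp
        ultimately show False using False by (simp only:)
      qed
      then have "(\<Sum>s\<in>S. pscale (h s) s) \<in> V" using h e by simp
      then show ?thesis using S(2) g0 s by blast
    qed
    moreover have "pm.span (S \<union> V) \<subseteq> pm.span (insert g S \<union> V)" by (rule pm.span_mono) auto
    ultimately show ?thesis using S(1,3) by (intro exI[of _ "insert g S"]) (auto intro: pm.span_base)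
  qed
qed

lemma has_dim_modulo_exists:
  assumes U: "fin_dim U" and V: "pm.subspace V" "V \<subseteq> U"
  shows "has_dim_modulo V U (pm.dim U - pm.dim V)"
proof -
  obtain C where C: "C \<subseteq> U" "pm.independent C" "U \<subseteq> pm.span C" "card C = pm.dim U" by (rule pm.basis_exists)
  have "finite C" by (rule fin_dim_basis[OF U C(2,1)])
  from basis_modulo_in_spanning_set[OF this V(1)] obtain S where S: "S \<subseteq> C"
    "\<forall>h. (\<Sum>s\<in>S. pscale (h s) s) \<in> V \<longrightarrow> (\<forall>s\<in>S. h s = 0)" "C \<subseteq> pm.span (S \<union> V)" by (elim exE conjE)
  have "pm.span C \<subseteq> pm.span (S \<union> V)" using S(3) pm.span_minimal[OF _ pm.subspace_span] by blast
  then have d: "has_dim_modulo V U (card S)"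
    unfolding has_dim_modulo_def
  proof (intro exI[of _ S] conjI)
    show "finite S" using S(1) \<open>finite C\<close> by (rule finite_subset)
    show "S \<subseteq> U" using S(1) C(1) by (rule subset_trans)
    show "U \<subseteq> pm.span (S \<union> V)" using C(3) \<open>pm.span C \<subseteq> _\<close> by (rule subset_trans)
  qed (use S(2) in simp_all)
  have "pm.subspace U" using U by (simp add: fin_dim_def)
  from has_dim_modulo_dim[OF fin_dim_subset[OF U V] this V(2) d] d show ?thesis by simp
qed

context quadric begin

lemma finite_Eset: "finite (Eset m q)"
proof -
  have "Eset m q \<subseteq> {ws. set ws \<subseteq> (\<Union>p\<le>q. words n p) \<and> length ws = Suc m}"
  proof
    fix ws assume ws: "ws \<in> Eset m q"
    have "w \<in> (\<Union>p\<le>q. words n p)" if w: "w \<in> set ws" for w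
    proof -
      have "length w \<le> sum_list (map length ws)" using w by (intro member_le_sum_list) auto
      then show ?thesis using ws w by (auto simp: Eset_def words_def)
    qed
    then show "ws \<in> {ws. set ws \<subseteq> (\<Union>p\<le>q. words n p) \<and> length ws = Suc m}" using ws by (auto simp: Eset_def)
  qed
  then show ?thesis using finite_lists_length_eq[of "\<Union>p\<le>q. words n p" "Suc m"] by (auto intro: finite_subset)
qed

lemma fin_dim_E: "fin_dim (E m q)"
  unfolding fin_dim_def E_def supp_in_eq_span
  by (intro conjI pm.subspace_span exI[of _ "(\<lambda>x. Poly_Mapping.single x 1) ` Eset m q"]) (simp_all add: finite_Eset)

lemma Eset_empty: "q \<le> m \<Longrightarrow> Eset m q = {}"
proof (rule ccontr)
  assume q: "q \<le> m" and "Eset m q \<noteq> {}"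
  then obtain ws where ws: "ws \<in> Eset m q" by blast
  have "length ws \<le> sum_list (map length ws)" if "\<forall>w\<in>set ws. w \<noteq> []" for ws :: "nat list list"
    using that by (induction ws) (auto simp: Suc_le_eq add_le_mono simp flip: length_greater_0_conv)
  then show False using ws q by (fastforce simp: Eset_def)
qed

lemma E_zero: "q \<le> m \<Longrightarrow> E m q = {0}" by (simp add: E_def supp_in_eq_span Eset_empty)

lemma subspace_ZE: "pm.subspace (ZE m q)"
proof (cases m)
  case 0 then show ?thesis by (simp add: ZE_def)
next
  case (Suc m')
  then have "ZE m q = E m q \<inter> {z. lin_ext bE z \<in> relE m' q}" by (auto simp: ZE_def)
  then show ?thesis by (simp add: pm.subspace_inter subspace_vimage[OF lin_ext_linear])
qed

lemma BE_ZE: "BE m q \<subseteq> ZE m q"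
  unfolding BE_def
proof (rule pm.span_minimal[OF _ subspace_ZE])
  show "relE m q \<union> lin_ext bE ` E (Suc m) q \<subseteq> ZE m q"
  proof (cases m)
    case 0 then show ?thesis using relE_E bE_E by (auto simp: ZE_def)
  next
    case (Suc m')
    show ?thesis
    proof (cases "q \<ge> 2")
      case True
      then show ?thesis using Suc relE_E bE_E bE_relE bE_bE by (auto simp: ZE_def)
    next
      case False
      then have "E m q = {0}" "E (Suc m) q = {0}" using Suc E_zero by auto
      then show ?thesis using relE_E[of m q] by (auto simp: ZE_def pm.subspace_0)
    qed
  qed
qed

lemma ZE_E: "ZE m q \<subseteq> E m q" by (auto simp: ZE_def)

lemma HC_has_dim: "has_dim_modulo (BE m q) (ZE m q) (pm.dim (ZE m q) - pm.dim (BE m q))"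
  by (rule has_dim_modulo_exists[OF fin_dim_subset[OF fin_dim_E subspace_ZE ZE_E] subspace_BE BE_ZE])

text \<open>The dimension of the weight \<open>q\<close> part of the degree \<open>m\<close> term of
  the reduced cyclic complex.\<close>

definition coinv_dim :: "nat \<Rightarrow> nat \<Rightarrow> nat" where "coinv_dim m q = pm.dim (E m q) - pm.dim (relE m q)"

lemma dims:
  "pm.dim (relE m q) \<le> pm.dim (BE m q)" "pm.dim (BE m q) \<le> pm.dim (ZE m q)" "pm.dim (ZE m q) \<le> pm.dim (E m q)"
proof -
  have *: "pm.dim V \<le> pm.dim U" if "fin_dim U" "pm.subspace V" "V \<subseteq> U" for V U :: "(nat list list \<Rightarrow>\<^sub>0 'k) set"
    using has_dim_modulo_dim[OF fin_dim_subset[OF that] _ that(3) has_dim_modulo_exists[OF that]] that(1) by (simp add: fin_dim_def)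
  have Z: "fin_dim (ZE m q)" by (rule fin_dim_subset[OF fin_dim_E subspace_ZE ZE_E])
  have B: "fin_dim (BE m q)" by (rule fin_dim_subset[OF Z subspace_BE BE_ZE])
  show "pm.dim (relE m q) \<le> pm.dim (BE m q)" by (rule *[OF B subspace_relE relE_BE])
  show "pm.dim (BE m q) \<le> pm.dim (ZE m q)" by (rule *[OF Z subspace_BE BE_ZE])
  show "pm.dim (ZE m q) \<le> pm.dim (E m q)" by (rule *[OF fin_dim_E subspace_ZE ZE_E])
qed

text \<open>The differential identifies chains modulo cycles in degree \<open>Suc m\<close> with
  boundaries modulo relations in degree \<open>m\<close>.\<close>

lemma rank_nullity: "pm.dim (E (Suc m) q) + pm.dim (relE m q) = pm.dim (ZE (Suc m) q) + pm.dim (BE m q)"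
proof -
  have Z: "fin_dim (ZE (Suc m) q)" by (rule fin_dim_subset[OF fin_dim_E subspace_ZE ZE_E])
  have R: "fin_dim (relE m q)" by (rule fin_dim_subset[OF fin_dim_E subspace_relE relE_E])
  let ?d = "pm.dim (E (Suc m) q) - pm.dim (ZE (Suc m) q)"
  have "has_dim_modulo (relE m q) (BE m q) ?d"
  proof (rule has_dim_modulo_cong[OF has_dim_modulo_exists[OF fin_dim_E subspace_ZE ZE_E] lin_ext_linear[of bE] subspace_E subspace_relE])
    fix y assume "y \<in> BE m q"
    then show "\<exists>x\<in>E (Suc m) q. y - lin_ext bE x \<in> relE m q"
      unfolding BE_def pm.span_Un
    proof clarify
      fix a b assume a: "a \<in> pm.span (relE m q)" and b: "b \<in> pm.span (lin_ext bE ` E (Suc m) q)"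
      have "pm.span (lin_ext bE ` E (Suc m) q) = lin_ext bE ` E (Suc m) q"
        using pmp.linear_subspace_image[OF lin_ext_linear subspace_E] pm.span_eq_iff by blast
      then obtain x where x: "x \<in> E (Suc m) q" "b = lin_ext bE x" using b by (auto simp only:)
      have "pm.span (relE m q) = relE m q" using pm.span_eq_iff subspace_relE by blast
      then have "a \<in> relE m q" using a by (simp only:)
      then show "\<exists>x\<in>E (Suc m) q. a + b - lin_ext bE x \<in> relE m q" using x by (intro bexI[of _ x]) simp_all
    qed
  qed (auto simp: BE_def ZE_def intro: pm.span_base)
  from has_dim_modulo_dim[OF R subspace_BE relE_BE this] dims(3)[of "Suc m" q] show ?thesis by simp
qed

text \<open>For \<open>q \<ge> 3\<close> this is the exactness of the cyclic cube; for
  \<open>q \<le> 1\<close> there are no chains in positive degree.\<close>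

lemma exact:
  assumes "q \<noteq> 2"
  shows "ZE (Suc m) q = BE (Suc m) q"
proof (rule subset_antisym[OF subsetI BE_ZE])
  fix z assume z: "z \<in> ZE (Suc m) q"
  show "z \<in> BE (Suc m) q"
  proof (cases "q \<ge> 3")
    case True
    from z have "z \<in> E (Suc m) q" "lin_ext bE z \<in> relE m q" by (auto simp: ZE_def)
    from E_exact[OF True this] obtain y where y: "y \<in> E (Suc (Suc m)) q" "z - lin_ext bE y \<in> relE (Suc m) q" by blast
    have "(z - lin_ext bE y) + lin_ext bE y \<in> BE (Suc m) q"
      using y relE_BE by (intro pm.subspace_add subspace_BE) (auto simp: BE_def intro: pm.span_base)
    then show ?thesis by simp
  next
    case False
    then have "E (Suc m) q = {0}" using assms by (intro E_zero) auto
    moreover have "z \<in> E (Suc m) q" using z ZE_E by blast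
    ultimately have "z = 0" by simp
    then show ?thesis using pm.subspace_0[OF subspace_BE] by simp
  qed
qed

text \<open>The alternating sum telescopes. The remainder is the dimension of the boundaries in
  degree \<open>m\<close>, which vanishes at \<open>m = q\<close>, where no tensor of weight
  \<open>q\<close> exists.\<close>

lemma euler_aux:
  assumes "q \<noteq> 2"
  shows "int (pm.dim (E 0 q)) - int (pm.dim (BE 0 q))
    = (\<Sum>i\<le>m. (- 1) ^ i * int (coinv_dim i q)) - (- 1) ^ m * (int (pm.dim (BE m q)) - int (pm.dim (relE m q)))"
proof (induction m)
  case 0
  show ?case using dims[of 0 q] by (simp add: coinv_dim_def)
next
  case (Suc m)
  have "int (pm.dim (E (Suc m) q)) + int (pm.dim (relE m q)) = int (pm.dim (BE (Suc m) q)) + int (pm.dim (BE m q))"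
    using rank_nullity[of m q] unfolding exact[OF assms, of m] by linarith
  moreover have "int (coinv_dim (Suc m) q) = int (pm.dim (E (Suc m) q)) - int (pm.dim (relE (Suc m) q))"
    using dims[of "Suc m" q] by (simp add: coinv_dim_def)
  ultimately have "int (coinv_dim (Suc m) q) = int (pm.dim (BE (Suc m) q)) + int (pm.dim (BE m q)) - int (pm.dim (relE m q)) - int (pm.dim (relE (Suc m) q))"
    by linarith
  then show ?case unfolding Suc.IH sum.atMost_Suc power_Suc by (simp only:) (simp add: algebra_simps)
qed

lemma dim_E_zero: "q \<le> m \<Longrightarrow> pm.dim (E m q) = 0"
  using E_zero pm.dim_span_eq_card_independent[OF pm.independent_empty] by simp

lemma coinv_dim_zero: "q \<le> m \<Longrightarrow> coinv_dim m q = 0"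
  by (simp add: coinv_dim_def dim_E_zero)

lemma euler:
  assumes "q \<noteq> 2"
  shows "int (pm.dim (ZE 0 q) - pm.dim (BE 0 q)) = (\<Sum>i<q. (- 1) ^ i * int (coinv_dim i q))"
proof -
  have "pm.dim (BE q q) = 0" "pm.dim (relE q q) = 0" using dims[of q q] dim_E_zero[of q q] by auto
  then have "int (pm.dim (E 0 q)) - int (pm.dim (BE 0 q)) = (\<Sum>i\<le>q. (- 1) ^ i * int (coinv_dim i q))"
    using euler_aux[OF assms, of q] by simp
  also have "\<dots> = (\<Sum>i<q. (- 1) ^ i * int (coinv_dim i q))"
    by (simp add: coinv_dim_zero flip: lessThan_Suc_atMost)
  finally show ?thesis using dims[of 0 q] by (simp add: ZE_def of_nat_diff)
qed

lemma HC_higher: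
  assumes "q \<noteq> 2 \<or> m \<noteq> 0"
  shows "has_dim_modulo (BE (Suc m) q) (ZE (Suc m) q) 0"
proof -
  have "pm.dim (ZE (Suc m) q) - pm.dim (BE (Suc m) q) = 0"
  proof (cases "q = 2")
    case True
    then have "pm.dim (E (Suc m) q) = 0" using assms by (intro dim_E_zero) simp
    then show ?thesis using dims(3)[of "Suc m" q] by simp
  next
    case False
    then show ?thesis by (simp add: exact)
  qed
  then show ?thesis using HC_has_dim[of "Suc m" q] by simp
qed

lemma HC_zero: "q \<noteq> 2 \<Longrightarrow> \<exists>d. has_dim_modulo (BE 0 q) (ZE 0 q) d \<and> int d = (\<Sum>i<q. (- 1) ^ i * int (coinv_dim i q))"
  using HC_has_dim euler by blast


section \<open>The exceptional class in weight two\<close>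

lemma Eset_1_2: "ws \<in> Eset 1 2 \<Longrightarrow> \<exists>k<n. \<exists>l<n. ws = [[k], [l]]"
proof -
  assume ws: "ws \<in> Eset 1 2"
  then obtain u v where uv: "ws = [u, v]" by (auto simp: Eset_def length_Suc_conv)
  then have "length u \<ge> 1" "length v \<ge> 1" "length u + length v = 2" using ws by (auto simp: Eset_def Suc_le_eq)
  then have "length u = Suc 0" "length v = Suc 0" by linarith+
  then obtain k l where "u = [k]" "v = [l]" by (auto simp: length_Suc_conv)
  then show ?thesis using ws uv by (auto simp: Eset_def)
qed

lemma Eset_0_2: "ws \<in> Eset 0 2 \<Longrightarrow> \<exists>k<n. \<exists>l<n. ws = [[k, l]]"
  by (auto simp: Eset_def length_Suc_conv numeral_2_eq_2)

text \<open>On two single letters the cyclic operator is the plain swap, of order two, and no factor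
  has room for \<open>\<omega>\<close>; the image of 1 - t is killed by 1 + t.\<close>

lemma relE_1_2:
  assumes "z \<in> relE 1 2"
  shows "z + lin_ext tE z = 0"
proof -
  have t: "lin_ext tE (lin_ext tE z) = z" if "z \<in> E 1 2" for z
    unfolding E_def
  proof (rule plinear_eq_on_supp[of "\<lambda>z. lin_ext tE (lin_ext tE z)" "\<lambda>z. z"])
    show "z \<in> supp_in (Eset 1 2)" using that by (simp add: E_def)
    fix ws assume "ws \<in> Eset 1 2"
    then obtain k l where "ws = [[k], [l]]" using Eset_1_2 by blast
    then show "lin_ext tE (lin_ext tE (Poly_Mapping.single ws 1)) = (Poly_Mapping.single ws 1 :: nat list list \<Rightarrow>\<^sub>0 'k)"
      by (simp add: tE_def)
  qed (rule plinear_comp[OF lin_ext_linear lin_ext_linear], rule plinear_id)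
  have e: "omega_gens 1 2 = {}"
  proof (rule ccontr)
    assume "omega_gens 1 2 \<noteq> {}"
    then obtain us x y vs where "us @ (x @ [0, 0] @ y) # vs \<in> Eset 1 2" by (auto simp: omega_gens_def)
    then obtain k l where "us @ (x @ [0, 0] @ y) # vs = [[k], [l]]" using Eset_1_2 by blast
    then have "x @ [0, 0] @ y \<in> set [[k], [l]]" by (metis in_set_conv_decomp)
    then show False by (auto simp: Cons_eq_append_conv append_eq_Cons_conv)
  qed
  have "z + lin_ext tE z \<in> {0}"
  proof (rule plinear_span_subset[OF plinear_add[OF plinear_id lin_ext_linear] _ pm.subspace_single_0 assms[unfolded relE_def e]])
    fix g assume "g \<in> {} \<union> (\<lambda>z. z - lin_ext tE z) ` E 1 2"
    then obtain y where "g = y - lin_ext tE y" "y \<in> E 1 2" by auto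
    then show "g + lin_ext tE g \<in> {0}" using t by simp
  qed
  then show ?thesis by simp
qed

lemma relE_0_2: "relE 0 2 \<subseteq> pm.span {omega_gen [] [] [] []}"
  unfolding relE_def
proof (rule pm.span_minimal[OF _ pm.subspace_span], rule Un_least)
  show "omega_gens 0 2 \<subseteq> pm.span {omega_gen [] [] [] []}"
  proof
    fix g assume "g \<in> omega_gens 0 2"
    then obtain us x y vs where g: "g = omega_gen us x y vs" "us @ (x @ [0, 0] @ y) # vs \<in> Eset 0 2" unfolding omega_gens_def by blast
    from Eset_0_2[OF g(2)] obtain k l where "us @ (x @ [0, 0] @ y) # vs = [[k, l]]" by blast
    then have "us = []" "vs = []" "x = []" "y = []" by (auto simp: Cons_eq_append_conv append_eq_Cons_conv)
    then show "g \<in> pm.span {omega_gen [] [] [] []}" using g(1) by (auto intro: pm.span_base)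
  qed
  have "z - lin_ext tE z \<in> {0}" if "z \<in> E 0 2" for z
  proof (rule E_linear_subset[of "\<lambda>z. z - lin_ext tE z", OF _ _ pm.subspace_single_0 that])
    fix ws assume "ws \<in> Eset 0 2"
    then obtain k l where "ws = [[k, l]]" using Eset_0_2 by blast
    then show "Poly_Mapping.single ws 1 - lin_ext tE (Poly_Mapping.single ws 1) \<in> {0 :: nat list list \<Rightarrow>\<^sub>0 'k}"
      by (simp add: tE_def)
  qed (intro plinear_minus lin_ext_linear plinear_id)
  then show "(\<lambda>z. z - lin_ext tE z) ` E 0 2 \<subseteq> pm.span {omega_gen [] [] [] []}" using pm.span_zero by auto
qed

text \<open>The class is \<open>\<omega>\<close> as a tensor of two letters. It is fixed by the
  swap, hence no relation, and it is a cycle because merging gives multiples of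
  \<open>\<omega>\<close>, which vanishes in B.\<close>

lemma HC_one_two: "has_dim_modulo (BE 1 2) (ZE 1 2) 1"
proof -
  define S where "S = (\<Sum>k<n. \<Sum>l<n. pscale (M k l) (Poly_Mapping.single [[k], [l]] (1::'k)))"
  define \<Omega> where "\<Omega> = omega_gen [] [] [] []"
  \<comment> \<open>Splits a word of two letters into two factors; composed with the differential it
    is minus 1 + t, so the kernel can be read off.\<close>
  define \<delta> where "\<delta> = lin_ext (\<lambda>ws. Poly_Mapping.single [[ws ! 0 ! 0], [ws ! 0 ! 1 :: nat]] (1::'k))"
  have pd: "plinear \<delta>" by (simp add: \<delta>_def lin_ext_linear)
  have BE: "BE 1 2 = relE 1 2"
  proof
    show "BE 1 2 \<subseteq> relE 1 2"
      unfolding BE_def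
      by (rule pm.span_minimal[OF _ subspace_relE]) (simp add: E_zero pm.subspace_0)
  qed (rule relE_BE)
  have tk: "lin_ext tE (Poly_Mapping.single [[k], [l]] 1) = (Poly_Mapping.single [[l], [k]] 1 :: nat list list \<Rightarrow>\<^sub>0 'k)" for k l
    by (simp add: tE_def)
  have tS: "lin_ext tE S = S"
  proof -
    have "lin_ext tE S = (\<Sum>k<n. \<Sum>l<n. pscale (M k l) (Poly_Mapping.single [[l], [k]] 1))"
      by (simp only: S_def pmp.linear_sum[OF lin_ext_linear] lin_ext_simps tk)
    also have "\<dots> = S" unfolding S_def by (subst sum.swap) (simp add: M_sym)
    finally show ?thesis .
  qed
  have bk: "lin_ext bE (Poly_Mapping.single [[k], [l]] 1) = (- Poly_Mapping.single [[k, l]] 1 - Poly_Mapping.single [[l, k]] 1 :: nat list list \<Rightarrow>\<^sub>0 'k)" for k l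
    by (simp add: bE_def bE'_def single_uminus)
  have SE: "S \<in> E 1 2"
    unfolding S_def by (intro pm.subspace_sum pm.subspace_scale subspace_E single_E) (auto simp: Eset_def)
  have \<Omega>: "\<Omega> = (\<Sum>k<n. \<Sum>l<n. pscale (M k l) (Poly_Mapping.single [[k, l]] 1))" by (simp add: \<Omega>_def omega_gen_def)
  have \<Omega>': "\<Omega> = (\<Sum>k<n. \<Sum>l<n. pscale (M k l) (Poly_Mapping.single [[l, k]] 1))"
    unfolding \<Omega> by (subst sum.swap) (simp add: M_sym)
  have "lin_ext bE S = - \<Omega> - \<Omega>"
  proof -
    have "lin_ext bE S = (\<Sum>k<n. \<Sum>l<n. pscale (M k l) (- Poly_Mapping.single [[k, l]] 1 - Poly_Mapping.single [[l, k]] 1))"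
      by (simp only: S_def pmp.linear_sum[OF lin_ext_linear] lin_ext_simps bk)
    also have "\<dots> = - \<Omega> - (\<Sum>k<n. \<Sum>l<n. pscale (M k l) (Poly_Mapping.single [[l, k]] 1))"
      unfolding \<Omega> by (simp only: pm.scale_right_diff_distrib pm.scale_minus_right sum_subtractf sum_negf)
    finally show ?thesis unfolding \<Omega>'[symmetric] .
  qed
  moreover have "\<Omega> \<in> relE 0 2"
    unfolding \<Omega>_def using n3 by (intro omega_gen_relE) (auto simp: Eset_def)
  ultimately have SZ: "S \<in> ZE 1 2"
    using SE by (simp add: ZE_def pm.subspace_diff pm.subspace_neg)
  have S0: "S \<noteq> 0"
  proof -
    obtain j where j: "j < n" "M 0 j \<noteq> 0" using row_nonzero[of 0] n3 by auto
    have "Poly_Mapping.lookup S [[0], [j]] = (\<Sum>k<n. \<Sum>l<n. if l = j then if k = 0 then M 0 j else 0 else 0)"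
      unfolding S_def by (simp add: lookup_sum lookup_single when_def) (intro sum.cong refl, auto)
    also have "\<dots> = M 0 j" using j(1) n3 by simp
    finally show ?thesis using j(2) by auto
  qed
  have \<delta>s: "\<delta> (Poly_Mapping.single [[k, l]] 1) = Poly_Mapping.single [[k], [l]] 1" for k l by (simp add: \<delta>_def)
  have \<delta>k: "\<delta> (lin_ext bE z) = 0 - (z + lin_ext tE z)" if "z \<in> E 1 2" for z
  proof (rule plinear_eq_on_supp[of "\<lambda>z. \<delta> (lin_ext bE z)" "\<lambda>z. 0 - (z + lin_ext tE z)"])
    show "z \<in> supp_in (Eset 1 2)" using that by (simp only: E_def)
    show "plinear (\<lambda>z. \<delta> (lin_ext bE z))" by (rule plinear_comp[OF pd lin_ext_linear])
    show "plinear (\<lambda>z. 0 - (z + lin_ext tE z))" by (rule plinear_minus[OF plinear_zero plinear_add[OF plinear_id lin_ext_linear]])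
    fix ws assume "ws \<in> Eset 1 2"
    then obtain k l where ws: "ws = [[k], [l]]" using Eset_1_2 by blast
    show "\<delta> (lin_ext bE (Poly_Mapping.single ws 1)) = 0 - (Poly_Mapping.single ws 1 + lin_ext tE (Poly_Mapping.single ws 1))"
      unfolding ws bk tk pmp.linear_diff[OF pd] pmp.linear_neg[OF pd] \<delta>s by simp
  qed
  have \<delta>\<Omega>: "\<delta> \<Omega> = S"
    unfolding \<Omega> S_def by (simp only: pmp.linear_sum[OF pd] pmp.linear_scale[OF pd] \<delta>s)
  show ?thesis
    unfolding has_dim_modulo_def
  proof (intro exI[of _ "{S}"] conjI allI impI)
    fix h assume "(\<Sum>s\<in>{S}. pscale (h s) s) \<in> BE 1 2"
    then have "pscale (h S) S \<in> relE 1 2" unfolding BE by simp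
    from relE_1_2[OF this] tS have "pscale (2 * h S) S = 0" by (simp flip: pm.scale_left_distrib)
    then show "\<forall>s\<in>{S}. h s = 0" using S0 by simp
  next
    show "ZE 1 2 \<subseteq> pm.span ({S} \<union> BE 1 2)"
    proof
      fix z assume "z \<in> ZE 1 2"
      then have z: "z \<in> E 1 2" "lin_ext bE z \<in> relE 0 2" by (auto simp: ZE_def)
      then obtain r where r: "lin_ext bE z = pscale r \<Omega>"
        using relE_0_2 unfolding pm.span_singleton \<Omega>_def by blast
      \<comment> \<open>Writing 2 z as (1 - t) z + (1 + t) z, the first part is a relation and the
        second a multiple of \<open>S\<close>.\<close>
      have "z + lin_ext tE z = pscale (- r) S"
        using \<delta>k[OF z(1)] unfolding r pmp.linear_scale[OF pd] \<delta>\<Omega> pm.scale_minus_left by simp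
      moreover have "z + z = (z - lin_ext tE z) + (z + lin_ext tE z)" by simp
      ultimately have zz: "z + z = (z - lin_ext tE z) + pscale (- r) S" by (simp only:)
      have "z - lin_ext tE z \<in> BE 1 2" unfolding BE by (rule tE_relE[OF z(1)])
      then have "pscale (1 / 2) ((z - lin_ext tE z) + pscale (- r) S) \<in> pm.span ({S} \<union> BE 1 2)"
        by (intro pm.span_scale[of "_ + _"] pm.span_add pm.span_scale[of S] pm.span_base) auto
      moreover have "pscale (1 / 2) (z + z) = z"
        by (simp add: pm.scale_right_distrib flip: pm.scale_left_distrib)
      ultimately show "z \<in> pm.span ({S} \<union> BE 1 2)" unfolding zz[symmetric] by simp
    qed
  qed (use SZ in simp_all)
qed

text \<open>The Euler characteristic is unchanged, so the extra class in degree one forces one more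
  class in degree zero; this is the summand z squared of the series.\<close>

lemma HC_zero_two: "\<exists>d. has_dim_modulo (BE 0 2) (ZE 0 2) d \<and> int d = 1 + (\<Sum>i<2. (- 1) ^ i * int (coinv_dim i 2))"
proof -
  have BE: "BE 1 2 = relE 1 2"
  proof
    show "BE 1 2 \<subseteq> relE 1 2"
      unfolding BE_def
      by (rule pm.span_minimal[OF _ subspace_relE]) (simp add: E_zero pm.subspace_0)
  qed (rule relE_BE)
  have "fin_dim (BE 1 2)" using fin_dim_subset[OF fin_dim_subset[OF fin_dim_E subspace_ZE ZE_E] subspace_BE BE_ZE] .
  from has_dim_modulo_dim[OF this subspace_ZE BE_ZE HC_one_two] have "pm.dim (ZE 1 2) = pm.dim (relE 1 2) + 1" unfolding BE .
  moreover have "pm.dim (E 1 2) + pm.dim (relE 0 2) = pm.dim (ZE 1 2) + pm.dim (BE 0 2)" using rank_nullity[of 0 2] by simp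
  moreover have "ZE 0 2 = E 0 2" by (simp add: ZE_def)
  ultimately have "int (pm.dim (ZE 0 2) - pm.dim (BE 0 2)) = 1 + (int (coinv_dim 0 2) - int (coinv_dim 1 2))"
    using dims[of 0 2] dims[of 1 2] by (simp add: coinv_dim_def of_nat_diff)
  then show ?thesis using HC_has_dim[of 0 2] by (intro exI conjI) (auto simp: numeral_2_eq_2)
qed

section \<open>Normal words\<close>

definition hilb :: "nat \<Rightarrow> nat" where "hilb p = pm.dim (T n p :: (nc_word \<Rightarrow>\<^sub>0 'k) set) - pm.dim (RS UNIV p :: (nc_word \<Rightarrow>\<^sub>0 'k) set)"

lemma fin_dim_T: "fin_dim (T n p)"
  unfolding fin_dim_def T_eq_span by (intro conjI pm.subspace_span exI[of _ "wmono ` words n p"]) simp_all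

lemma fin_dim_RS: "fin_dim (RS U p)" by (rule fin_dim_subset[OF fin_dim_T subspace_RS RS_T])

lemma hilb_has_dim: "has_dim_modulo (RS UNIV p) (T n p) (hilb p)"
proof -
  have "pm.dim (T n p :: (nc_word \<Rightarrow>\<^sub>0 'k) set) - pm.dim (RS UNIV p) = hilb p" by (simp add: hilb_def)
  then show ?thesis using has_dim_modulo_exists[OF fin_dim_T subspace_RS RS_T, of UNIV p] by simp
qed

lemma dim_T_RS: "pm.dim (T n p :: (nc_word \<Rightarrow>\<^sub>0 'k) set) = pm.dim (RS UNIV p) + hilb p"
  by (rule has_dim_modulo_dim[OF fin_dim_RS subspace_T RS_T hilb_has_dim])

lemma RS_Suc_iff: "x \<in> T n (Suc p) \<Longrightarrow> x \<in> RS {1..} (Suc p) \<longleftrightarrow> (\<forall>k<n. dec k x \<in> RS UNIV p)"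
proof -
  assume x: "x \<in> T n (Suc p)"
  have u: "{i. Suc i \<in> {1..}} = UNIV" by auto
  show ?thesis
  proof
    assume "x \<in> RS {1..} (Suc p)"
    from dec_RS[OF this] show "\<forall>k<n. dec k x \<in> RS UNIV p" unfolding u by auto
  next
    assume "\<forall>k<n. dec k x \<in> RS UNIV p"
    then show "x \<in> RS {1..} (Suc p)" by (intro T_letters_RS[OF x]) (simp add: u)
  qed
qed

text \<open>Without position 0, the quotient is the tensor product of the letters with the degree
  \<open>p\<close> part of B. It is filtered by the letters whose derivatives are already required
  to vanish in B, with \<open>n\<close> equal steps.\<close>

lemma dim_T_Suc: "pm.dim (T n (Suc p) :: (nc_word \<Rightarrow>\<^sub>0 'k) set) = pm.dim (RS {1..} (Suc p)) + n * hilb p"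
proof -
  define U :: "nat \<Rightarrow> (nc_word \<Rightarrow>\<^sub>0 'k) set" where "U j = {x \<in> T n (Suc p). \<forall>k<j. dec k x \<in> RS UNIV p}" for j
  have sU: "pm.subspace (U j)" for j
    unfolding U_def by (rule pm.subspaceI) (auto simp: pm.subspace_0 pm.subspace_add pm.subspace_scale)
  have UT: "U j \<subseteq> T n (Suc p)" for j by (auto simp: U_def)
  have UU: "U (Suc j) \<subseteq> U j" for j by (auto simp: U_def)
  have step: "pm.dim (U j) = pm.dim (U (Suc j)) + hilb p" if j: "j < n" for j
  proof (rule has_dim_modulo_dim[OF fin_dim_subset[OF fin_dim_T sU UT] sU UU])
    show "has_dim_modulo (U (Suc j)) (U j) (hilb p)"
    proof (rule has_dim_modulo_cong[OF hilb_has_dim plinear_times_left[of "wmono [j]"] subspace_T sU _ _ _ RS_T])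
      fix x :: "nc_word \<Rightarrow>\<^sub>0 'k" assume x: "x \<in> T n p"
      then show "wmono [j] * x \<in> U j" "wmono [j] * x \<in> U (Suc j) \<longleftrightarrow> x \<in> RS UNIV p"
        using T_mult_mono[OF j x] by (auto simp: U_def pm.subspace_0 less_Suc_eq)
    next
      fix y assume y: "y \<in> U j"
      then have yT: "y \<in> T n (Suc p)" using UT by blast
      have "y - wmono [j] * dec j y \<in> U (Suc j)"
        using y T_mult_mono[OF j dec_T[OF yT]] by (auto simp: U_def pm.subspace_0 less_Suc_eq intro!: pm.subspace_diff)
      then show "\<exists>x\<in>T n p. y - wmono [j] * x \<in> U (Suc j)" using dec_T[OF yT] by blast
    qed
  qed
  have "pm.dim (U 0) = pm.dim (U j) + j * hilb p" if "j \<le> n" for j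
    using that by (induction j) (use step in auto)
  moreover have "U 0 = T n (Suc p)" by (auto simp: U_def)
  moreover have "U n = RS {1..} (Suc p)" using RS_Suc_iff RS_T[of "{1..}" "Suc p"] by (auto simp: U_def)
  ultimately show ?thesis by (metis order_refl)
qed

text \<open>Position 0 adds the multiples \<open>\<omega> * x\<close>. Such a multiple is already a
  relation only if \<open>x\<close> is one, by cancelling a row, so the contribution is a full copy
  of B in degree \<open>p\<close>.\<close>

lemma dim_RS_Suc_Suc: "pm.dim (RS UNIV (Suc (Suc p))) = pm.dim (RS {1..} (Suc (Suc p)) :: (nc_word \<Rightarrow>\<^sub>0 'k) set) + hilb p"
proof (rule has_dim_modulo_dim[OF fin_dim_RS subspace_RS RS_mono[OF subset_UNIV]])
  show "has_dim_modulo (RS {1..} (Suc (Suc p))) (RS UNIV (Suc (Suc p))) (hilb p)"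
  proof (rule has_dim_modulo_cong[OF hilb_has_dim plinear_times_left[of \<omega>] subspace_T subspace_RS _ _ _ RS_T])
    fix x :: "nc_word \<Rightarrow>\<^sub>0 'k" assume x: "x \<in> T n p"
    show "\<omega> * x \<in> RS UNIV (Suc (Suc p))" 
    proof -
      have "(1 :: nc_word \<Rightarrow>\<^sub>0 'k) \<in> T n 0" unfolding T_0 by (auto intro: exI[of _ 1])
      from RS_gen_T[OF this x, of UNIV "Suc (Suc p)"] show ?thesis by simp
    qed
    have xT: "\<omega> * x \<in> T n (Suc (Suc p))" using T_mult[OF omega_T x] by simp
    show "\<omega> * x \<in> RS {1..} (Suc (Suc p)) \<longleftrightarrow> x \<in> RS UNIV p"
    proof
      assume "\<omega> * x \<in> RS {1..} (Suc (Suc p))"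
      then have "row 0 * x \<in> RS UNIV (Suc p)" using RS_Suc_iff[OF xT] n3 by auto
      from row_mult_cancel[OF x this] show "x \<in> RS UNIV p" using n3 by simp
    next
      assume "x \<in> RS UNIV p"
      moreover have "{i. Suc (Suc i) \<in> {1..}} = UNIV" by auto
      ultimately show "\<omega> * x \<in> RS {1..} (Suc (Suc p))" by (intro omega_mult_RS) simp
    qed
  next
    fix y assume y: "y \<in> RS UNIV (Suc (Suc p))"
    have "(UNIV :: nat set) = insert 0 {1..}" by (auto simp: Suc_le_eq)
    then obtain a b where "y = a + b" "a \<in> RS {0} (Suc (Suc p))" "b \<in> RS {1..} (Suc (Suc p))" using RS_insert y by metis
    moreover then obtain z where "z \<in> T n p" "a = \<omega> * z" using RS_single_0[of a "Suc (Suc p)"] by auto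
    ultimately show "\<exists>x\<in>T n p. y - \<omega> * x \<in> RS {1..} (Suc (Suc p))" by (intro bexI[of _ z]) simp_all
  qed
qed

lemma hilb_0: "hilb 0 = 1"
proof -
  have "T n 0 = pm.span {1 :: nc_word \<Rightarrow>\<^sub>0 'k}" by (auto simp: T_0 pm.span_singleton)
  then have "pm.dim (T n 0 :: (nc_word \<Rightarrow>\<^sub>0 'k) set) = 1" using pm.dim_span_eq_card_independent[of "{1 :: nc_word \<Rightarrow>\<^sub>0 'k}"] by simp
  moreover have "pm.dim {0 :: nc_word \<Rightarrow>\<^sub>0 'k} = 0"
    by (metis pm.dim_span_eq_card_independent pm.independent_empty pm.span_empty card.empty)
  ultimately show ?thesis by (simp add: hilb_def RS_small)
qed

lemma hilb_1: "hilb 1 = n"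
  using dim_T_Suc[of 0] dim_T_RS[of 1] hilb_0 by (simp add: RS_small)

text \<open>The two dimension counts say that 0 -> B(-2) -> V B(-1) -> B is exact with cokernel in
  degree zero, V being the span of the letters.\<close>

lemma hilb_rec: "hilb (Suc (Suc p)) + hilb p = n * hilb (Suc p)"
  using dim_T_Suc[of "Suc p"] dim_T_RS[of "Suc (Suc p)"] dim_RS_Suc_Suc[of p] by simp

text \<open>Normal words are any words whose classes form a basis of B in degree \<open>p\<close>;
  no monomial order is used.\<close>

lemma normal_words_exist:
  "\<exists>N\<subseteq>words n p. card N = hilb p \<and> supp_in (NCWord ` N) \<inter> RS UNIV p = {0} \<and>
     (\<forall>x\<in>T n p. \<exists>y\<in>supp_in (NCWord ` N). x - y \<in> RS UNIV p)"
proof -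
  let ?W = "wmono ` words n p :: (nc_word \<Rightarrow>\<^sub>0 'k) set"
  have ex: "\<exists>S\<subseteq>?W. (\<forall>h. (\<Sum>s\<in>S. pscale (h s) s) \<in> RS UNIV p \<longrightarrow> (\<forall>s\<in>S. h s = 0)) \<and> ?W \<subseteq> pm.span (S \<union> RS UNIV p)"
    by (rule basis_modulo_in_spanning_set[OF finite_imageI[OF finite_words] subspace_RS])
  obtain S where S: "S \<subseteq> ?W" "\<forall>h. (\<Sum>s\<in>S. pscale (h s) s) \<in> RS UNIV p \<longrightarrow> (\<forall>s\<in>S. h s = 0)" "?W \<subseteq> pm.span (S \<union> RS UNIV p)"
    using ex by (elim exE conjE)
  have fS: "finite S" by (rule finite_subset[OF S(1)]) simp
  define N where "N = {w \<in> words n p. wmono w \<in> S}"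
  have N: "N \<subseteq> words n p" "finite N" unfolding N_def by (auto intro: finite_subset[OF _ finite_words[of n p]])
  have wN: "wmono ` N = S" unfolding N_def using S(1) by auto
  have inj: "inj_on (wmono :: nat list \<Rightarrow> nc_word \<Rightarrow>\<^sub>0 'k) N"
    unfolding wmono_def inj_on_def by (metis lookup_single_eq lookup_single_not_eq one_neq_zero nc_word.inject)
  have sup: "supp_in (NCWord ` N) = pm.span S" unfolding wN[symmetric] supp_in_eq_span wmono_def by (simp add: image_image)
  have TS: "T n p \<subseteq> pm.span (S \<union> RS UNIV p)" unfolding T_eq_span by (rule pm.span_minimal[OF S(3) pm.subspace_span])
  have ST: "S \<subseteq> T n p" using S(1) wmono_in_T by blast
  have "has_dim_modulo (RS UNIV p) (T n p) (card S)"
    unfolding has_dim_modulo_def using fS S(2) TS ST by (intro exI[of _ S]) simp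
  from has_dim_modulo_dim[OF fin_dim_RS subspace_T RS_T this] dim_T_RS[of p] have "card S = hilb p" by simp
  then have "card N = hilb p" using card_image[OF inj] wN by simp
  moreover have "supp_in (NCWord ` N) \<inter> RS UNIV p = {0}"
  proof -
    have "x = 0" if x: "x \<in> pm.span S" "x \<in> RS UNIV p" for x
    proof -
      obtain h where h: "x = (\<Sum>s\<in>S. pscale (h s) s)" using x(1) unfolding pm.span_finite[OF fS] by blast
      then have "\<forall>s\<in>S. h s = 0" using S(2) x(2) by blast
      then show "x = 0" using h by simp
    qed
    then show ?thesis unfolding sup using pm.span_zero pm.subspace_0[OF subspace_RS] by blast
  qed
  moreover have "\<exists>y\<in>supp_in (NCWord ` N). x - y \<in> RS UNIV p" if "x \<in> T n p" for x
  proof -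
    have "x \<in> pm.span (S \<union> RS UNIV p)" using TS that by blast
    then obtain a b where "x = a + b" "a \<in> pm.span S" "b \<in> pm.span (RS UNIV p)" unfolding pm.span_Un by blast
    moreover have "pm.span (RS UNIV p) = RS UNIV p" using pm.span_eq_iff subspace_RS by blast
    ultimately show ?thesis unfolding sup by (intro bexI[of _ a]) simp_all
  qed
  ultimately show ?thesis using N(1) by blast
qed


definition NW :: "nat \<Rightarrow> nat list set"
  where "NW p = (SOME N. N \<subseteq> words n p \<and> card N = hilb p \<and> supp_in (NCWord ` N) \<inter> RS UNIV p = {0} \<and>
     (\<forall>x\<in>T n p. \<exists>y\<in>supp_in (NCWord ` N). x - y \<in> RS UNIV p))"

lemma NW: "NW p \<subseteq> words n p" "card (NW p) = hilb p" "supp_in (NCWord ` NW p) \<inter> RS UNIV p = {0}"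
  "x \<in> T n p \<Longrightarrow> \<exists>y\<in>supp_in (NCWord ` NW p). x - y \<in> RS UNIV p"
proof -
  have "NW p \<subseteq> words n p \<and> card (NW p) = hilb p \<and> supp_in (NCWord ` NW p) \<inter> RS UNIV p = {0} \<and>
     (\<forall>x\<in>T n p. \<exists>y\<in>supp_in (NCWord ` NW p). x - y \<in> RS UNIV p)"
    unfolding NW_def by (rule someI_ex) (use normal_words_exist[of p] in blast)
  then show "NW p \<subseteq> words n p" "card (NW p) = hilb p" "supp_in (NCWord ` NW p) \<inter> RS UNIV p = {0}"
    "x \<in> T n p \<Longrightarrow> \<exists>y\<in>supp_in (NCWord ` NW p). x - y \<in> RS UNIV p" by blast+
qed

lemma finite_NW: "finite (NW p)" by (rule finite_subset[OF NW(1) finite_words])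

abbreviation NF :: "nat \<Rightarrow> (nc_word \<Rightarrow>\<^sub>0 'k) set" where "NF p \<equiv> supp_in (NCWord ` NW p)"

lemma NF_T: "NF p \<subseteq> T n p" unfolding T_def by (rule supp_in_mono) (use NW(1) in blast)

lemma NF_unique: "y \<in> NF p \<Longrightarrow> y' \<in> NF p \<Longrightarrow> y - y' \<in> RS UNIV p \<Longrightarrow> y = y'"
proof -
  assume y: "y \<in> NF p" "y' \<in> NF p" "y - y' \<in> RS UNIV p"
  have "y - y' \<in> NF p" by (rule pm.subspace_diff[OF subspace_supp_in y(1,2)])
  then have "y - y' \<in> {0}" using NW(3)[of p] y(3) by blast
  then show ?thesis by simp
qed

text \<open>The linear projection onto combinations of normal words along the relations, fixed by a
  choice on words.\<close>

definition nf :: "(nc_word \<Rightarrow>\<^sub>0 'k) \<Rightarrow> (nc_word \<Rightarrow>\<^sub>0 'k)"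
  where "nf = lin_ext (\<lambda>w. SOME y. y \<in> NF (length (letters w)) \<and> wmono (letters w) - y \<in> RS UNIV (length (letters w)))"

lemma plinear_nf: "plinear nf" by (simp add: nf_def lin_ext_linear)

lemma nf_props:
  assumes "x \<in> T n p"
  shows "nf x \<in> NF p" "x - nf x \<in> RS UNIV p"
proof -
  have w: "nf (wmono w) \<in> NF p \<and> wmono w - nf (wmono w) \<in> RS UNIV p" if w: "w \<in> words n p" for w
  proof -
    have l: "length w = p" using w by (simp add: words_def)
    have e: "nf (wmono w) = (SOME y. y \<in> NF p \<and> wmono w - y \<in> RS UNIV p)" by (simp add: nf_def wmono_def l)
    show ?thesis unfolding e by (rule someI_ex) (use NW(4)[OF wmono_in_T[OF w]] in blast)
  qed
  show "nf x \<in> NF p" by (rule T_linear_subset[OF plinear_nf _ subspace_supp_in assms]) (use w in blast)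
  show "x - nf x \<in> RS UNIV p"
    by (rule T_linear_subset[OF plinear_minus[OF plinear_id plinear_nf] _ subspace_RS assms]) (use w in blast)
qed

lemma nf_NF: "y \<in> NF p \<Longrightarrow> nf y = y"
proof -
  assume y: "y \<in> NF p"
  then have "y \<in> T n p" using NF_T by blast
  note p = nf_props[OF this]
  from NF_unique[OF y p] show ?thesis by simp
qed

lemma nf_RS: "x \<in> RS UNIV p \<Longrightarrow> nf x = 0"
proof -
  assume x: "x \<in> RS UNIV p"
  then have "x \<in> T n p" using RS_T by blast
  note p = nf_props[OF this]
  have "x - (x - nf x) \<in> RS UNIV p" by (rule pm.subspace_diff[OF subspace_RS x p(2)])
  then show "nf x = 0" using NF_unique[OF p(1) pm.subspace_0[OF subspace_supp_in]] by simp
qed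

definition KS :: "nat \<Rightarrow> nat \<Rightarrow> nat list list set"
  where "KS j q = {ws. length ws = j \<and> (\<forall>w\<in>set ws. w \<noteq> [] \<and> w \<in> NW (length w)) \<and> sum_list (map length ws) = q}"

lemma KS_Eset: "KS (Suc m) q \<subseteq> Eset m q"
  using NW(1) by (fastforce simp: KS_def Eset_def words_def)

definition pnf :: "nat list list \<Rightarrow> (nc_word \<Rightarrow>\<^sub>0 'k)" where "pnf ws = prod_list (map (\<lambda>w. nf (wmono w)) ws)"

lemma pnf_simps [simp]: "pnf [] = 1" "pnf (w # ws) = nf (wmono w) * pnf ws" "pnf (us @ vs) = pnf us * pnf vs"
  by (simp_all add: pnf_def)

text \<open>\<open>Nf\<close> identifies the cyclic tensors modulo the relations with the coinvariants of the signed rotation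
  of tuples of normal words.\<close>

definition Nf :: "(nat list list \<Rightarrow>\<^sub>0 'k) \<Rightarrow> (nat list list \<Rightarrow>\<^sub>0 'k)"
  where "Nf = lin_ext (\<lambda>ws. gam (map length ws) (pnf ws))"

lemma plinear_Nf: "plinear Nf" by (simp add: Nf_def lin_ext_linear)

lemmas Nf_simps [simp] = pmp.linear_0[OF plinear_Nf] pmp.linear_add[OF plinear_Nf] pmp.linear_diff[OF plinear_Nf]
  pmp.linear_scale[OF plinear_Nf] pmp.linear_sum[OF plinear_Nf]

lemma Nf_single: "Nf (Poly_Mapping.single ws 1) = gam (map length ws) (pnf ws)"
  by (simp add: Nf_def)

lemma pnf_T: "(\<And>w. w \<in> set ws \<Longrightarrow> set w \<subseteq> {..<n}) \<Longrightarrow> pnf ws \<in> T n (sum_list (map length ws))"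
proof (induction ws)
  case Nil
  have "(1 :: nc_word \<Rightarrow>\<^sub>0 'k) \<in> T n 0" unfolding T_0 by (auto intro: exI[of _ 1])
  then show ?case by simp
next
  case (Cons w ws)
  have "wmono w \<in> T n (length w)" using Cons.prems by (intro wmono_in_T) (auto simp: words_def)
  then have "nf (wmono w) \<in> T n (length w)" using nf_props(1) NF_T by blast
  then show ?case using T_mult[OF _ Cons.IH] Cons.prems by simp
qed

lemma Nf_rel_ctx:
  assumes "us @ vs \<in> Eset m q"
  shows "gam (map length (us @ vs)) (wmono (concat us) * pnf vs) - Poly_Mapping.single (us @ vs) 1 \<in> relE m q"
  using assms
proof (induction vs arbitrary: us)
  case Nil
  then show ?case by (simp add: splitl_concat pm.subspace_0)
next
  case (Cons v vs)
  define j where "j = nf (wmono v) - wmono v"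
  have vw: "v \<in> words n (length v)" using Cons.prems by (auto simp: Eset_def words_def)
  have "- (wmono v - nf (wmono v)) \<in> RS UNIV (length v)" by (rule pm.subspace_neg[OF subspace_RS nf_props(2)[OF wmono_in_T[OF vw]]])
  then have j: "j \<in> RS UNIV (length v)" by (simp add: j_def)
  have W: "weights m q (map length us @ length v # map length vs)" using Cons.prems unfolding Eset_iff by simp
  have "pnf vs \<in> T n (sum_list (map length vs))" using Cons.prems by (intro pnf_T) (auto simp: Eset_def)
  moreover have "wmono (concat us) \<in> T n (sum_list (map length us))"
    using Cons.prems by (intro wmono_in_T) (auto simp: Eset_def words_def length_concat)
  ultimately have 1: "gam (map length (us @ v # vs)) (wmono (concat us) * j * pnf vs) \<in> relE m q"
    using gam_rel[OF W _ j] by simp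
  have 2: "gam (map length ((us @ [v]) @ vs)) (wmono (concat (us @ [v])) * pnf vs) - Poly_Mapping.single ((us @ [v]) @ vs) 1 \<in> relE m q"
    using Cons.prems by (intro Cons.IH) simp
  have "wmono (concat us) * pnf (v # vs) = wmono (concat us) * j * pnf vs + wmono (concat (us @ [v])) * pnf vs"
    by (simp add: j_def algebra_simps flip: wmono_mult)
  then have "gam (map length (us @ v # vs)) (wmono (concat us) * pnf (v # vs)) - Poly_Mapping.single (us @ v # vs) 1
    = gam (map length (us @ v # vs)) (wmono (concat us) * j * pnf vs)
     + (gam (map length ((us @ [v]) @ vs)) (wmono (concat (us @ [v])) * pnf vs) - Poly_Mapping.single ((us @ [v]) @ vs) 1)"
    by simp
  then show ?case using pm.subspace_add[OF subspace_relE 1 2] by (simp add: add_diff_eq)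
qed

lemma Nf_rel: "z \<in> E m q \<Longrightarrow> Nf z - z \<in> relE m q"
  by (rule E_linear_subset[of "\<lambda>z. Nf z - z", OF plinear_minus[OF plinear_Nf plinear_id] _ subspace_relE])
    (use Nf_rel_ctx[of "[]"] in \<open>auto simp: Nf_single wmono_Nil\<close>)

lemma pnf_expand:
  assumes "\<And>w. w \<in> set ws \<Longrightarrow> set w \<subseteq> {..<n}"
  shows "pnf ws \<in> pm.span {wmono (concat \<kappa>) | \<kappa>. map length \<kappa> = map length ws \<and> (\<forall>w\<in>set \<kappa>. w \<in> NW (length w))}"
  using assms
proof (induction ws)
  case Nil
  have "1 = (wmono (concat []) :: nc_word \<Rightarrow>\<^sub>0 'k)" by (simp add: wmono_Nil)
  then show ?case by (intro pm.span_base) (auto intro!: exI[of _ "[]"])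
next
  case (Cons w ws)
  let ?G = "\<lambda>ws. {wmono (concat \<kappa>) :: nc_word \<Rightarrow>\<^sub>0 'k | \<kappa>. map length \<kappa> = map length ws \<and> (\<forall>w\<in>set \<kappa>. w \<in> NW (length w))}"
  have IH: "pnf ws \<in> pm.span (?G ws)" using Cons by simp
  have "wmono w \<in> T n (length w)" using Cons.prems by (intro wmono_in_T) (auto simp: words_def)
  then have nf: "nf (wmono w) \<in> NF (length w)" by (rule nf_props(1))
  have 1: "wmono v * pnf ws \<in> pm.span (?G (w # ws))" if v: "v \<in> NW (length w)" for v
  proof (rule plinear_span_subset[OF plinear_times_left _ pm.subspace_span IH])
    fix g :: "nc_word \<Rightarrow>\<^sub>0 'k" assume "g \<in> ?G ws"
    then obtain \<kappa> where k: "g = wmono (concat \<kappa>)" "map length \<kappa> = map length ws" "\<forall>w\<in>set \<kappa>. w \<in> NW (length w)" by blast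
    have lv: "length v = length w" using v NW(1) by (auto simp: words_def)
    have "wmono v * g = wmono (concat (v # \<kappa>))" by (simp add: k(1) wmono_mult)
    then show "wmono v * g \<in> pm.span (?G (w # ws))"
      using k v lv by (intro pm.span_base) (auto intro!: exI[of _ "v # \<kappa>"])
  qed
  show ?case unfolding pnf_simps
    by (rule plinear_supp_subset[OF plinear_times_right _ pm.subspace_span nf]) (use 1 in \<open>auto simp: wmono_def\<close>)
qed

lemma Nf_KS: "z \<in> E m q \<Longrightarrow> Nf z \<in> supp_in (KS (Suc m) q)"
proof (rule E_linear_subset[OF plinear_Nf _ subspace_supp_in])
  fix ws assume ws: "ws \<in> Eset m q"
  have "pnf ws \<in> pm.span {wmono (concat \<kappa>) | \<kappa>. map length \<kappa> = map length ws \<and> (\<forall>w\<in>set \<kappa>. w \<in> NW (length w))}"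
    using ws by (intro pnf_expand) (auto simp: Eset_def)
  then show "Nf (Poly_Mapping.single ws 1) \<in> supp_in (KS (Suc m) q)" unfolding Nf_single
  proof (rule plinear_span_subset[OF plinear_gam _ subspace_supp_in, rotated])
    fix g :: "nc_word \<Rightarrow>\<^sub>0 'k"
    assume "g \<in> {wmono (concat \<kappa>) | \<kappa>. map length \<kappa> = map length ws \<and> (\<forall>w\<in>set \<kappa>. w \<in> NW (length w))}"
    then obtain \<kappa> where k: "g = wmono (concat \<kappa>)" "map length \<kappa> = map length ws" "\<forall>w\<in>set \<kappa>. w \<in> NW (length w)" by blast
    have "length \<kappa> = Suc m" using arg_cong[OF k(2), of length] ws by (simp add: Eset_def)
    moreover have "\<forall>w\<in>set \<kappa>. w \<noteq> []"
    proof
      fix w assume "w \<in> set \<kappa>"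
      then have "length w \<in> set (map length ws)" unfolding k(2)[symmetric] by simp
      then show "w \<noteq> []" using ws by (auto simp: Eset_def)
    qed
    moreover have "sum_list (map length \<kappa>) = q" using k(2) ws by (simp add: Eset_def)
    ultimately have "\<kappa> \<in> KS (Suc m) q" using k(3) by (simp add: KS_def)
    then show "gam (map length ws) g \<in> supp_in (KS (Suc m) q)"
      unfolding k(1) gam_wmono k(2)[symmetric] splitl_concat by (rule single_in_supp_in)
  qed
qed

lemma pnf_NW: "(\<And>w. w \<in> set ws \<Longrightarrow> w \<in> NW (length w)) \<Longrightarrow> pnf ws = wmono (concat ws)"
proof (induction ws)
  case (Cons w ws)
  have "wmono w \<in> NF (length w)" unfolding wmono_def by (rule single_in_supp_in) (use Cons.prems in simp)
  then show ?case using Cons by (simp add: nf_NF wmono_mult)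
qed (simp add: wmono_Nil)

lemma Nf_id: "z \<in> supp_in (KS (Suc m) q) \<Longrightarrow> Nf z = z"
proof (rule plinear_eq_on_supp[OF plinear_Nf plinear_id])
  fix ws assume "ws \<in> KS (Suc m) q"
  then have "pnf ws = wmono (concat ws)" by (intro pnf_NW) (auto simp: KS_def)
  then show "Nf (Poly_Mapping.single ws 1) = Poly_Mapping.single ws 1" by (simp add: Nf_single splitl_concat)
qed

text \<open>All words of an \<open>omega_gen\<close> have the same factor lengths, so the sum
  reassembles to one factor containing \<open>\<omega>\<close>, whose normal form is zero.\<close>

lemma Nf_omega_gen:
  assumes ws: "us @ (x @ [0, 0] @ y) # vs \<in> Eset m q"
  shows "Nf (omega_gen us x y vs) = 0"
proof -
  let ?p = "length x + 2 + length y"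
  let ?ps = "map length us @ ?p # map length vs"
  have "Nf (Poly_Mapping.single (us @ (x @ [k, l] @ y) # vs) 1) = gam ?ps (pnf us * nf (wmono (x @ [k, l] @ y)) * pnf vs)" for k l
    unfolding Nf_single by (simp add: mult.assoc)
  then have "Nf (omega_gen us x y vs) = (\<Sum>k<n. \<Sum>l<n. pscale (M k l) (gam ?ps (pnf us * nf (wmono (x @ [k, l] @ y)) * pnf vs)))"
    unfolding omega_gen_def by (simp only: Nf_simps)
  also have "\<dots> = gam ?ps (pnf us * nf (wmono x * \<omega> * wmono y) * pnf vs)"
    unfolding omega_pairs
    by (simp add: sum_distrib_left sum_distrib_right times_pscale_left times_pscale_right wmono_mult
        pmp.linear_sum[OF plinear_nf] pmp.linear_scale[OF plinear_nf] del: pscale_single)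
  also have "nf (wmono x * \<omega> * wmono y) = 0"
    using ws by (intro nf_RS[where p = ?p] RS_gen) (auto simp: Eset_def)
  finally show ?thesis by simp
qed

lemma Nf_tE:
  assumes "z \<in> E m q"
  shows "Nf (lin_ext tE z) = lin_ext tE (Nf z)"
  using assms unfolding E_def
proof (rule plinear_eq_on_supp[of "\<lambda>z. Nf (lin_ext tE z)" "\<lambda>z. lin_ext tE (Nf z)", rotated 2])
  fix ws assume ws: "ws \<in> Eset m q"
  then obtain us w where uw: "ws = us @ [w]" using Eset_last by blast
  let ?ps = "map length us" and ?p = "length w"
  let ?s = "(- 1 :: 'k) ^ ((?p + 1) * (\<Sum>r<m. ?ps ! r + 1))"
  have lu: "length us = m" using ws uw by (simp add: Eset_def)
  have W: "weights m q (?ps @ [?p])" using ws uw unfolding Eset_iff by simp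
  have wT: "wmono w \<in> T n ?p" and uT: "wmono (concat us) \<in> T n (sum_list ?ps)"
    using ws uw by (fastforce intro!: wmono_in_T simp: Eset_def words_def length_concat)+
  have "nf (wmono w) \<in> T n ?p" using nf_props(1)[OF wT] NF_T by blast
  moreover have "pnf us \<in> T n (sum_list ?ps)" using ws uw by (intro pnf_T) (auto simp: Eset_def)
  ultimately have "lin_ext tE (gam (?ps @ [?p]) (pnf us * nf (wmono w))) = pscale ?s (gam (?p # ?ps) (nf (wmono w) * pnf us))"
    by (intro tE_gam[OF W])
  then have r: "lin_ext tE (Nf (Poly_Mapping.single ws 1)) = pscale ?s (Nf (Poly_Mapping.single (w # us) 1))"
    unfolding Nf_single uw by simp
  have "(Poly_Mapping.single ws 1 :: nat list list \<Rightarrow>\<^sub>0 'k) = gam (?ps @ [?p]) (wmono (concat us) * wmono w)"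
    using splitl_concat[of "us @ [w]"] by (simp add: wmono_mult uw)
  then have "lin_ext tE (Poly_Mapping.single ws 1) = pscale ?s (gam (?p # ?ps) (wmono w * wmono (concat us)))"
    using tE_gam[OF W uT wT] by (simp only:)
  also have "gam (?p # ?ps) (wmono w * wmono (concat us)) = Poly_Mapping.single (w # us) 1"
    using splitl_concat[of "w # us"] by (simp add: wmono_mult)
  finally show "Nf (lin_ext tE (Poly_Mapping.single ws 1)) = lin_ext tE (Nf (Poly_Mapping.single ws 1))"
    unfolding r by (simp only: Nf_simps)
qed (rule plinear_comp[OF plinear_Nf lin_ext_linear], rule plinear_comp[OF lin_ext_linear plinear_Nf])

definition cyc_K :: "nat \<Rightarrow> nat \<Rightarrow> (nat list list \<Rightarrow>\<^sub>0 'k) set"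
  where "cyc_K j q = (\<lambda>y. y - lin_ext tE y) ` supp_in (KS j q)"

lemma subspace_cyc_K: "pm.subspace (cyc_K j q)"
  unfolding cyc_K_def by (rule pmp.linear_subspace_image[OF plinear_minus[OF plinear_id lin_ext_linear] subspace_supp_in])

lemma Nf_relE: "z \<in> relE m q \<Longrightarrow> Nf z \<in> cyc_K (Suc m) q"
  unfolding relE_def
proof (rule plinear_span_subset[OF plinear_Nf _ subspace_cyc_K])
  fix g :: "nat list list \<Rightarrow>\<^sub>0 'k" assume "g \<in> omega_gens m q \<union> (\<lambda>z. z - lin_ext tE z) ` E m q"
  then show "Nf g \<in> cyc_K (Suc m) q"
  proof
    assume "g \<in> omega_gens m q"
    then obtain us x y vs where "g = omega_gen us x y vs" "us @ (x @ [0, 0] @ y) # vs \<in> Eset m q"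
      unfolding omega_gens_def by blast
    then show ?thesis using Nf_omega_gen pm.subspace_0[OF subspace_cyc_K] by simp
  next
    assume "g \<in> (\<lambda>z. z - lin_ext tE z) ` E m q"
    then obtain z where z: "g = z - lin_ext tE z" "z \<in> E m q" by blast
    then have "Nf g = Nf z - lin_ext tE (Nf z)" by (simp add: Nf_tE)
    then show ?thesis unfolding cyc_K_def using Nf_KS[OF z(2)] by blast
  qed
qed

lemma supp_KS_E: "supp_in (KS (Suc m) q) \<subseteq> E m q"
  unfolding E_def by (rule supp_in_mono[OF KS_Eset])

text \<open>\<open>Nf\<close> and the inclusion are inverse modulo relations; after this the algebra
  B enters only through the number of normal words in each degree.\<close>

lemma coinv_dim_eq:
  assumes "has_dim_modulo (cyc_K (Suc m) q) (supp_in (KS (Suc m) q)) d"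
  shows "coinv_dim m q = d"
proof -
  have "has_dim_modulo (relE m q) (E m q) d"
  proof (rule has_dim_modulo_transfer[OF assms plinear_id plinear_Nf subspace_cyc_K subspace_relE])
    fix x :: "nat list list \<Rightarrow>\<^sub>0 'k" assume x: "x \<in> supp_in (KS (Suc m) q)"
    show "x \<in> E m q" using x supp_KS_E by blast
    show "Nf x - x \<in> cyc_K (Suc m) q" using Nf_id[OF x] pm.subspace_0[OF subspace_cyc_K] by simp
  next
    fix x :: "nat list list \<Rightarrow>\<^sub>0 'k" assume "x \<in> cyc_K (Suc m) q"
    then show "x \<in> relE m q" unfolding cyc_K_def using supp_KS_E tE_relE by blast
  next
    fix x :: "nat list list \<Rightarrow>\<^sub>0 'k" assume "x \<in> relE m q"
    then show "Nf x \<in> cyc_K (Suc m) q" by (rule Nf_relE)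
  next
    fix x :: "nat list list \<Rightarrow>\<^sub>0 'k" assume x: "x \<in> E m q"
    show "Nf x \<in> supp_in (KS (Suc m) q)" by (rule Nf_KS[OF x])
    show "x - Nf x \<in> relE m q" using pm.subspace_neg[OF subspace_relE Nf_rel[OF x]] by simp
  qed
  from has_dim_modulo_dim[OF fin_dim_subset[OF fin_dim_E subspace_relE relE_E] subspace_E relE_E this]
  show ?thesis by (simp add: coinv_dim_def)
qed

end

text \<open>\<open>P\<close> is idempotent on the coordinate space with kernel \<open>V\<close>, so
  a basis of its image is a basis modulo \<open>V\<close>, and the trace of an idempotent is its
  rank.\<close>

lemma rank_projection_eq_trace:
  fixes P :: "('x \<Rightarrow>\<^sub>0 'k::field_char_0) \<Rightarrow> ('x \<Rightarrow>\<^sub>0 'k)"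
  assumes K: "finite K" and P: "plinear P" and PK: "\<And>x. x \<in> supp_in K \<Longrightarrow> P x \<in> supp_in K"
    and V: "V \<subseteq> supp_in K" "\<And>x. x \<in> V \<Longrightarrow> P x = 0" and PV: "\<And>x. x \<in> supp_in K \<Longrightarrow> x - P x \<in> V"
  shows "\<exists>d. has_dim_modulo V (supp_in K) d \<and> of_nat d = (\<Sum>\<kappa>\<in>K. Poly_Mapping.lookup (P (Poly_Mapping.single \<kappa> 1)) \<kappa>)"
proof -
  let ?I = "P ` supp_in K"
  have idem: "P y = y" if y: "y \<in> ?I" for y
  proof -
    obtain x where x: "y = P x" "x \<in> supp_in K" using y by blast
    have "P (x - P x) = 0" using V(2) PV x(2) by blast
    then show ?thesis using x(1) by (simp add: pmp.linear_diff[OF P])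
  qed
  obtain S where S: "S \<subseteq> ?I" "pm.independent S" "?I \<subseteq> pm.span S" "card S = pm.dim ?I" by (rule pm.basis_exists)
  have SK: "S \<subseteq> supp_in K" using S(1) PK by blast
  have "fin_dim (supp_in K :: ('x \<Rightarrow>\<^sub>0 'k) set)"
    unfolding fin_dim_def supp_in_eq_span
    by (rule conjI[OF pm.subspace_span exI[of _ "(\<lambda>x. Poly_Mapping.single x 1) ` K"]]) (use K in simp)
  then have fS: "finite S" by (rule fin_dim_basis[OF _ S(2) SK])
  have P0: "P (\<Sum>s\<in>S. pscale (h s) s) = (\<Sum>s\<in>S. pscale (h s) s)" for h
  proof -
    have "P s = s" if "s \<in> S" for s using idem S(1) that by blast
    then show ?thesis unfolding pmp.linear_sum[OF P] pmp.linear_scale[OF P] by (intro sum.cong refl) (simp only:)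
  qed
  have "has_dim_modulo V (supp_in K) (card S)"
    unfolding has_dim_modulo_def
  proof (intro exI[of _ S] conjI allI impI)
    fix h assume "(\<Sum>s\<in>S. pscale (h s) s) \<in> V"
    from V(2)[OF this] have "(\<Sum>s\<in>S. pscale (h s) s) = 0" unfolding P0 .
    then show "\<forall>s\<in>S. h s = 0" using pm.independentD[OF S(2) fS] by blast
  next
    show "supp_in K \<subseteq> pm.span (S \<union> V)"
    proof
      fix x :: "'x \<Rightarrow>\<^sub>0 'k" assume x: "x \<in> supp_in K"
      have "P x \<in> pm.span (S \<union> V)" using S(3) x pm.span_mono[of S "S \<union> V"] by blast
      moreover have "x - P x \<in> pm.span (S \<union> V)" using PV[OF x] by (intro pm.span_base) blast
      ultimately have "P x + (x - P x) \<in> pm.span (S \<union> V)" by (rule pm.span_add)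
      then show "x \<in> pm.span (S \<union> V)" by simp
    qed
  qed (use fS SK in simp_all)
  moreover have "of_nat (card S) = (\<Sum>\<kappa>\<in>K. Poly_Mapping.lookup (P (Poly_Mapping.single \<kappa> 1)) \<kappa>)"
  proof -
    let ?e = "\<lambda>\<kappa>. Poly_Mapping.single \<kappa> (1::'k)"
    define f where "f \<kappa> = pm.representation S (P (?e \<kappa>))" for \<kappa>
    have Pe: "P (?e \<kappa>) = (\<Sum>s\<in>S. pscale (f \<kappa> s) s)" if "\<kappa> \<in> K" for \<kappa>
    proof -
      have "P (?e \<kappa>) \<in> ?I" using that by (intro imageI) simp
      then have "P (?e \<kappa>) \<in> pm.span S" using S(3) by blast
      from pm.sum_representation_eq[OF S(2) this fS order_refl] show ?thesis unfolding f_def by (rule sym)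
    qed
    have expand: "x = (\<Sum>\<kappa>\<in>K. pscale (Poly_Mapping.lookup x \<kappa>) (?e \<kappa>))" if x: "x \<in> supp_in K" for x
    proof (rule poly_mapping_eqI)
      fix \<kappa>
      have "Poly_Mapping.lookup (\<Sum>\<kappa>\<in>K. pscale (Poly_Mapping.lookup x \<kappa>) (?e \<kappa>)) \<kappa>
        = (\<Sum>\<kappa>'\<in>K. if \<kappa>' = \<kappa> then Poly_Mapping.lookup x \<kappa>' else 0)"
        unfolding lookup_sum by (intro sum.cong refl) (auto simp: lookup_single when_def)
      also have "\<dots> = Poly_Mapping.lookup x \<kappa>"
        using x K by (simp add: supp_in_def) (metis in_keys_iff subsetD)
      finally show "Poly_Mapping.lookup x \<kappa> = Poly_Mapping.lookup (\<Sum>\<kappa>\<in>K. pscale (Poly_Mapping.lookup x \<kappa>) (?e \<kappa>)) \<kappa>" by simp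
    qed
    \<comment> \<open>The coefficient of \<open>s\<close> in \<open>P s = s\<close>, computed by
      first expanding \<open>s\<close> in the coordinate basis. Summing over \<open>s\<close> and
      exchanging sums gives the trace.\<close>
    have one: "(\<Sum>\<kappa>\<in>K. Poly_Mapping.lookup s \<kappa> * f \<kappa> s) = 1" if s: "s \<in> S" for s
    proof -
      have sK: "s \<in> supp_in K" using SK s by blast
      have "P s = P (\<Sum>\<kappa>\<in>K. pscale (Poly_Mapping.lookup s \<kappa>) (?e \<kappa>))" using expand[OF sK] by (rule arg_cong)
      also have "\<dots> = (\<Sum>\<kappa>\<in>K. pscale (Poly_Mapping.lookup s \<kappa>) (P (?e \<kappa>)))"
        unfolding pmp.linear_sum[OF P] pmp.linear_scale[OF P] ..
      also have "P s = s" using idem S(1) s by blast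
      finally have "pm.representation S s s = pm.representation S (\<Sum>\<kappa>\<in>K. pscale (Poly_Mapping.lookup s \<kappa>) (P (?e \<kappa>))) s" by simp
      also have "\<dots> = (\<Sum>\<kappa>\<in>K. Poly_Mapping.lookup s \<kappa> * f \<kappa> s)"
      proof -
        have sp: "P (?e \<kappa>) \<in> pm.span S" if "\<kappa> \<in> K" for \<kappa>
        proof -
          have "P (?e \<kappa>) \<in> ?I" using that by (intro imageI) simp
          then show ?thesis using S(3) by blast
        qed
        have "pm.representation S (\<Sum>\<kappa>\<in>K. pscale (Poly_Mapping.lookup s \<kappa>) (P (?e \<kappa>))) s
          = (\<Sum>\<kappa>\<in>K. pm.representation S (pscale (Poly_Mapping.lookup s \<kappa>) (P (?e \<kappa>))) s)"
          by (subst pm.representation_sum[OF S(2)]) (intro pm.span_scale sp, assumption, rule refl)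
        also have "\<dots> = (\<Sum>\<kappa>\<in>K. Poly_Mapping.lookup s \<kappa> * f \<kappa> s)"
          unfolding f_def by (intro sum.cong refl) (simp add: pm.representation_scale[OF S(2) sp])
        finally show ?thesis .
      qed
      finally show ?thesis using pm.representation_basis[OF S(2) s] by simp
    qed
    have "(\<Sum>\<kappa>\<in>K. Poly_Mapping.lookup (P (?e \<kappa>)) \<kappa>) = (\<Sum>\<kappa>\<in>K. \<Sum>s\<in>S. Poly_Mapping.lookup s \<kappa> * f \<kappa> s)"
      by (intro sum.cong refl) (simp add: Pe lookup_sum mult.commute)
    also have "\<dots> = (\<Sum>s\<in>S. 1)" by (subst sum.swap) (simp add: one)
    finally show ?thesis by simp
  qed
  ultimately show ?thesis by (intro exI conjI)
qed

section \<open>Counting cyclic tuples of normal words\<close>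

lemma prod_lessThan_add: "(\<Prod>i<a + b. f i) = (\<Prod>i<a. f i) * (\<Prod>i<b. f (a + i :: nat) :: 'a::comm_monoid_mult)"
  by (induction b) (simp_all add: mult.assoc)

lemma prod_mod: "(\<Prod>i<k * g. h (i mod g)) = (\<Prod>i<g. h i :: 'a::comm_monoid_mult) ^ k"
proof (induction k)
  case (Suc k)
  have "(\<Prod>i<Suc k * g. h (i mod g)) = (\<Prod>i<k * g + g. h (i mod g))" by (simp add: add.commute)
  also have "\<dots> = (\<Prod>i<g. h i) ^ k * (\<Prod>i<g. h ((k * g + i) mod g))" unfolding prod_lessThan_add Suc.IH ..
  also have "(\<Prod>i<g. h ((k * g + i) mod g)) = (\<Prod>i<g. h i)" by (rule prod.cong) auto
  finally show ?case by (simp add: mult.commute)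
qed simp

lemma rotate_fixed_mult: "rotate r xs = xs \<Longrightarrow> rotate (k * r) xs = xs"
proof (induction k)
  case (Suc k)
  have "rotate (Suc k * r) xs = rotate r (rotate (k * r) xs)" unfolding rotate_rotate by simp
  then show ?case using Suc by simp
qed simp

lemma rotate_length_mult: "rotate (k * length xs) xs = xs"
  by (rule rotate_fixed_mult) simp

text \<open>The word \<open>b\<close> starts with \<open>a\<close>, and stripping it leaves a
  shorter word that commutes with \<open>a\<close>.\<close>

lemma commuting_power: "a @ b = b @ a \<Longrightarrow> length b = e * length a \<Longrightarrow> b = concat (replicate e a)"
proof (induction e arbitrary: b)
  case (Suc e)
  have "take (length a) b = a" using Suc.prems by (metis append_eq_append_conv_if append_take_drop_id le_add1 mult_Suc)
  then obtain b' where b: "b = a @ b'" by (metis append_take_drop_id)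
  have "a @ b' = b' @ a" using Suc.prems(1) unfolding b by simp
  moreover have "length b' = e * length a" using Suc.prems(2) b by simp
  ultimately show ?case using Suc.IH b by simp
qed simp

lemma concat_replicate_comm: "a @ concat (replicate e a) = concat (replicate e a) @ a"
  by (induction e) simp_all

lemma length_concat_replicate: "length (concat (replicate e a)) = e * length a"
  by (induction e) simp_all

lemma nth_concat_replicate: "i < e * length a \<Longrightarrow> concat (replicate e a) ! i = a ! (i mod length a)"
proof (induction e arbitrary: i)
  case (Suc e)
  show ?case
  proof (cases "i < length a")
    case False
    then have "i - length a < e * length a" using Suc.prems by simp
    from Suc.IH[OF this] False show ?thesis by (simp add: nth_append le_mod_geq)
  qed (simp add: nth_append)
qed simp

lemma rotate_fixed_gcd:
  assumes "rotate r xs = xs"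
  shows "rotate (gcd r (length xs)) xs = xs"
proof (cases "r = 0")
  case False
  then obtain x y where xy: "r * x = length xs * y + gcd r (length xs)" using bezout_nat by blast
  have "rotate (gcd r (length xs)) xs = rotate (gcd r (length xs)) (rotate (y * length xs) xs)" by (simp only: rotate_length_mult)
  also have "\<dots> = rotate (x * r) xs" unfolding rotate_rotate using xy by (simp add: ac_simps)
  also have "\<dots> = xs" by (rule rotate_fixed_mult[OF assms])
  finally show ?thesis .
qed simp

text \<open>A list fixed by the rotation by \<open>r\<close> is also fixed by the rotation by its
  length, hence by that through the gcd (Bezout). So it commutes with its prefix of length
  \<open>g\<close> and is a power of that prefix.\<close>

lemma rotate_fixed_iff:
  fixes xs :: "'a list"
  assumes l: "length xs = e * g" and g: "g = gcd r (length xs)" and e: "e \<ge> 1"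
  shows "rotate r xs = xs \<longleftrightarrow> (\<exists>a. length a = g \<and> xs = concat (replicate e a))"
proof
  assume "rotate r xs = xs"
  then have rg: "rotate g xs = xs" unfolding g by (rule rotate_fixed_gcd)
  obtain e' where e': "e = Suc e'" using e by (cases e) auto
  define a b where "a = take g xs" and "b = drop g xs"
  have la: "length a = g" and lb: "length b = e' * length a" using l e' by (simp_all add: a_def b_def)
  have xs: "xs = a @ b" by (simp add: a_def b_def)
  have "b @ a = a @ b" using rg rotate_append[of a b] unfolding xs la by simp
  then have "b = concat (replicate e' a)" using lb by (intro commuting_power) simp_all
  then show "\<exists>a. length a = g \<and> xs = concat (replicate e a)" using la xs e' by (intro exI[of _ a]) simp
next
  assume "\<exists>a. length a = g \<and> xs = concat (replicate e a)"
  then obtain a where a: "length a = g" "xs = concat (replicate e a)" by blast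
  obtain e' where e': "e = Suc e'" using e by (cases e) auto
  have "rotate g xs = xs" using rotate_append[of a "concat (replicate e' a)"] concat_replicate_comm[of a e'] a e' by simp
  then have "rotate (r div g * g) xs = xs" by (rule rotate_fixed_mult)
  moreover have "g dvd r" using g by simp
  ultimately show "rotate r xs = xs" by simp
qed

context quadric begin

lemma sum_list_rotate1: "sum_list (map length (rotate1 ws)) = sum_list (map length ws)"
  by (cases ws) simp_all

lemma KS_rotate: "ws \<in> KS j q \<Longrightarrow> rotate r ws \<in> KS j q"
proof (induction r)
  case (Suc r)
  then have "rotate r ws \<in> KS j q" by simp
  then show ?case by (simp add: KS_def sum_list_rotate1)
qed simp

lemma finite_KS: "finite (KS (Suc m) q)" by (rule finite_subset[OF KS_Eset finite_Eset])

text \<open>The sign collected when \<open>tE\<close>, applied \<open>r\<close> times, undoes the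
  rotation by \<open>r\<close>: one factor for each of the first \<open>r\<close> entries, counted
  cyclically.\<close>

definition ksg :: "nat \<Rightarrow> nat \<Rightarrow> nat list list \<Rightarrow> nat \<Rightarrow> 'k"
  where "ksg j q ws r = (\<Prod>i<r. sg j q ^ (length (ws ! (i mod j)) - 1))"

lemma funpow_plinear:
  fixes f :: "('x \<Rightarrow>\<^sub>0 'a::field) \<Rightarrow> ('x \<Rightarrow>\<^sub>0 'a)"
  assumes "plinear f"
  shows "plinear (f ^^ r)"
proof (induction r)
  case 0 then show ?case unfolding funpow.simps(1) id_def by (rule plinear_id)
next
  case (Suc r) then show ?case unfolding funpow.simps(2) comp_def by (rule plinear_comp[OF assms])
qed

abbreviation tL :: "(nat list list \<Rightarrow>\<^sub>0 'k) \<Rightarrow> (nat list list \<Rightarrow>\<^sub>0 'k)" where "tL \<equiv> lin_ext tE"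

lemma plinear_tL: "plinear tL" by (rule lin_ext_linear)

lemma tE_rotate:
  assumes ws: "ws \<in> KS (Suc m) q"
  shows "(tL ^^ r) (Poly_Mapping.single (rotate r ws) 1) = pscale (ksg (Suc m) q ws r) (Poly_Mapping.single ws 1)"
proof (induction r)
  case 0
  show ?case by (simp add: ksg_def)
next
  case (Suc r)
  have K: "rotate r ws \<in> KS (Suc m) q" by (rule KS_rotate[OF ws])
  have lw: "length ws = Suc m" using ws by (simp add: KS_def)
  then obtain w us where wu: "rotate r ws = w # us" by (cases "rotate r ws") auto
  have w: "w = ws ! (r mod Suc m)" using hd_rotate_conv_nth[of ws r] lw wu by force
  have "us @ [w] \<in> Eset m q" using K KS_Eset wu Eset_rotate by fastforce
  from tE_append[OF this] have t: "tL (Poly_Mapping.single (us @ [w]) 1) = pscale (sg (Suc m) q ^ (length w - 1)) (Poly_Mapping.single (rotate r ws) 1)"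
    by (simp add: wu)
  have "(tL ^^ Suc r) (Poly_Mapping.single (rotate (Suc r) ws) 1) = (tL ^^ r) (tL (Poly_Mapping.single (us @ [w]) 1))"
    by (simp only: funpow_Suc_right comp_apply rotate_Suc wu rotate1.simps)
  also have "\<dots> = pscale (sg (Suc m) q ^ (length w - 1)) (pscale (ksg (Suc m) q ws r) (Poly_Mapping.single ws 1))"
    unfolding t pmp.linear_scale[OF funpow_plinear[OF plinear_tL]] Suc.IH ..
  also have "\<dots> = pscale (ksg (Suc m) q ws (Suc r)) (Poly_Mapping.single ws 1)"
    unfolding w ksg_def by (simp add: mult.commute)
  finally show ?case .
qed

lemma lookup_tE_rotate:
  assumes ws: "ws \<in> KS (Suc m) q"
  shows "Poly_Mapping.lookup ((tL ^^ r) (Poly_Mapping.single ws 1)) ws = (if rotate r ws = ws then ksg (Suc m) q ws r else 0)"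
proof -
  \<comment> \<open>Rotation by \<open>m * r\<close> is the inverse of rotation by \<open>r\<close>
    on lists of length \<open>Suc m\<close>, so \<open>vs\<close> is the preimage of
    \<open>ws\<close>.\<close>
  define vs where "vs = rotate (m * r) ws"
  have lw: "length ws = Suc m" using ws by (simp add: KS_def)
  have "rotate r vs = rotate (r * length ws) ws" unfolding vs_def rotate_rotate lw by (simp add: mult.commute)
  then have rv: "rotate r vs = ws" by (simp only: rotate_length_mult)
  have vK: "vs \<in> KS (Suc m) q" unfolding vs_def by (rule KS_rotate[OF ws])
  have "vs = ws \<longleftrightarrow> rotate r ws = ws" using rv rotate_fixed_mult[of r ws m] by (auto simp: vs_def)
  then show ?thesis using tE_rotate[OF vK, of r] unfolding rv by (auto simp: lookup_single when_def)
qed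

lemma sum_length_pred: "(\<forall>w\<in>set ws. w \<noteq> []) \<Longrightarrow> (\<Sum>i<length ws. length (ws ! i) - 1) + length ws = sum_list (map length ws)"
proof (induction ws)
  case (Cons w ws)
  then show ?case by (cases w) (simp_all add: sum.lessThan_Suc_shift del: sum.lessThan_Suc)
qed simp

lemma prod_sg: "ws \<in> KS g d \<Longrightarrow> (\<Prod>i<g. s ^ (length (ws ! i) - 1)) = (s :: 'k) ^ (d - g)" "ws \<in> KS g d \<Longrightarrow> g \<le> d"
  using sum_length_pred[of ws] by (auto simp: KS_def simp flip: power_sum intro!: arg_cong[of _ _ "(^) s"])

lemma tL_KS: "x \<in> supp_in (KS (Suc m) q) \<Longrightarrow> tL x \<in> supp_in (KS (Suc m) q)"
proof (rule plinear_supp_subset[OF plinear_tL _ subspace_supp_in])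
  fix ws assume ws: "ws \<in> KS (Suc m) q"
  then have "ws \<in> Eset m q" using KS_Eset by blast
  then obtain us w where uw: "ws = us @ [w]" using Eset_last by blast
  have "w # us \<in> KS (Suc m) q" using ws by (auto simp: KS_def uw)
  then show "tL (Poly_Mapping.single ws 1) \<in> supp_in (KS (Suc m) q)" using tE_append[of us w m q] \<open>ws \<in> Eset m q\<close> by (simp add: uw)
qed

lemma funpow_tL_KS: "x \<in> supp_in (KS (Suc m) q) \<Longrightarrow> (tL ^^ r) x \<in> supp_in (KS (Suc m) q)"
  by (induction r) (simp_all add: tL_KS)

lemma tL_period: "x \<in> supp_in (KS (Suc m) q) \<Longrightarrow> (tL ^^ Suc m) x = x"
proof (rule plinear_eq_on_supp[of "tL ^^ Suc m" "\<lambda>x. x", OF funpow_plinear[OF plinear_tL] plinear_id])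
  fix ws assume ws: "ws \<in> KS (Suc m) q"
  have "length ws = Suc m" using ws by (simp add: KS_def)
  then have r: "rotate (Suc m) ws = ws" using rotate_length_mult[of 1 ws] by (simp only: nat_mult_1)
  have "ksg (Suc m) q ws (Suc m) = (\<Prod>i<Suc m. sg (Suc m) q ^ (length (ws ! i) - 1))"
    unfolding ksg_def by (rule prod.cong) auto
  also have "\<dots> = sg (Suc m) q ^ (q - Suc m)" by (rule prod_sg(1)[OF ws])
  also have "\<dots> = 1" by (rule sg_power[OF prod_sg(2)[OF ws]])
  finally show "(tL ^^ Suc m) (Poly_Mapping.single ws 1) = Poly_Mapping.single ws 1"
    using tE_rotate[OF ws, of "Suc m"] unfolding r by simp
qed

lemma cyc_K_power: "x \<in> supp_in (KS (Suc m) q) \<Longrightarrow> x - (tL ^^ r) x \<in> cyc_K (Suc m) q"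
proof (induction r)
  case 0
  then show ?case using pm.subspace_0[OF subspace_cyc_K] by simp
next
  case (Suc r)
  have "(tL ^^ r) x - tL ((tL ^^ r) x) \<in> cyc_K (Suc m) q"
    unfolding cyc_K_def by (rule imageI, rule funpow_tL_KS[OF Suc.prems])
  then have "(x - (tL ^^ r) x) + ((tL ^^ r) x - tL ((tL ^^ r) x)) \<in> cyc_K (Suc m) q"
    by (intro pm.subspace_add[OF subspace_cyc_K Suc.IH[OF Suc.prems]])
  then show ?case by simp
qed

text \<open>A signed Burnside count: the averaging projection over the cyclic group has the
  coinvariants as image, and only fixed tuples contribute to its trace.\<close>

lemma coinv_dim_trace:
  "of_nat (coinv_dim m q) * of_nat (Suc m) = (\<Sum>r<Suc m. \<Sum>ws | ws \<in> KS (Suc m) q \<and> rotate r ws = ws. ksg (Suc m) q ws r)"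
proof -
  let ?K = "KS (Suc m) q"
  define a where "a = inverse (of_nat (Suc m) :: 'k)"
  have a: "a * of_nat (Suc m) = 1" unfolding a_def by (rule left_inverse) (simp del: of_nat_Suc)
  define P where "P x = pscale a (\<Sum>r<Suc m. (tL ^^ r) x)" for x
  have P: "plinear P" unfolding P_def by (intro plinear_scale plinear_sum funpow_plinear plinear_tL)
  have "\<exists>d. has_dim_modulo (cyc_K (Suc m) q) (supp_in ?K) d \<and> of_nat d = (\<Sum>\<kappa>\<in>?K. Poly_Mapping.lookup (P (Poly_Mapping.single \<kappa> 1)) \<kappa>)"
  proof (rule rank_projection_eq_trace[OF finite_KS P])
    fix x :: "nat list list \<Rightarrow>\<^sub>0 'k" assume x: "x \<in> supp_in ?K"
    show "P x \<in> supp_in ?K" unfolding P_def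
      by (intro pm.subspace_scale pm.subspace_sum subspace_supp_in funpow_tL_KS x)
    have "pscale a (\<Sum>r<Suc m. x - (tL ^^ r) x) \<in> cyc_K (Suc m) q"
      by (intro pm.subspace_scale pm.subspace_sum subspace_cyc_K cyc_K_power x)
    moreover have "pscale a (\<Sum>r<Suc m. x) = x"
    proof -
      have "(\<Sum>r<N. x) = pscale (of_nat N) x" for N :: nat by (induction N) (simp_all add: pm.scale_left_distrib add.commute)
      then show ?thesis using a by (simp only: pm.scale_scale pm.scale_one)
    qed
    ultimately show "x - P x \<in> cyc_K (Suc m) q" unfolding P_def sum_subtractf pm.scale_right_diff_distrib by simp
  next
    show "cyc_K (Suc m) q \<subseteq> supp_in ?K" unfolding cyc_K_def by (auto intro!: pm.subspace_diff tL_KS)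
  next
    fix x :: "nat list list \<Rightarrow>\<^sub>0 'k" assume "x \<in> cyc_K (Suc m) q"
    then obtain y where y: "x = y - tL y" "y \<in> supp_in ?K" unfolding cyc_K_def by blast
    have "(\<Sum>r<Suc m. (tL ^^ r) x) = (\<Sum>r<Suc m. (tL ^^ r) y - (tL ^^ Suc r) y)"
      unfolding y(1) pmp.linear_diff[OF funpow_plinear[OF plinear_tL]] by (simp only: funpow_Suc_right comp_apply)
    also have "\<dots> = (tL ^^ 0) y - (tL ^^ Suc m) y" by (rule sum_lessThan_telescope')
    also have "\<dots> = 0" unfolding tL_period[OF y(2)] by simp
    finally show "P x = 0" unfolding P_def by simp
  qed
  then obtain d where d: "has_dim_modulo (cyc_K (Suc m) q) (supp_in ?K) d" "of_nat d = (\<Sum>\<kappa>\<in>?K. Poly_Mapping.lookup (P (Poly_Mapping.single \<kappa> 1)) \<kappa>)" by blast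
  have "of_nat d * of_nat (Suc m) = (\<Sum>\<kappa>\<in>?K. \<Sum>r<Suc m. if rotate r \<kappa> = \<kappa> then ksg (Suc m) q \<kappa> r else 0)"
    unfolding d(2) sum_distrib_right
  proof (rule sum.cong[OF refl])
    fix \<kappa> assume k: "\<kappa> \<in> ?K"
    have "Poly_Mapping.lookup (P (Poly_Mapping.single \<kappa> 1)) \<kappa> = a * (\<Sum>r<Suc m. if rotate r \<kappa> = \<kappa> then ksg (Suc m) q \<kappa> r else 0)"
      unfolding P_def lookup_pscale lookup_sum lookup_tE_rotate[OF k] ..
    then show "Poly_Mapping.lookup (P (Poly_Mapping.single \<kappa> 1)) \<kappa> * of_nat (Suc m) = (\<Sum>r<Suc m. if rotate r \<kappa> = \<kappa> then ksg (Suc m) q \<kappa> r else 0)"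
      using a by (simp only: mult.commute[of a] mult.assoc mult_1_right)
  qed
  also have "\<dots> = (\<Sum>r<Suc m. \<Sum>\<kappa>\<in>?K. if rotate r \<kappa> = \<kappa> then ksg (Suc m) q \<kappa> r else 0)" by (rule sum.swap)
  also have "\<dots> = (\<Sum>r<Suc m. \<Sum>ws | ws \<in> ?K \<and> rotate r ws = ws. ksg (Suc m) q ws r)"
    by (intro sum.cong refl sum.inter_filter[symmetric] finite_KS)
  finally show ?thesis unfolding coinv_dim_eq[OF d(1)] .
qed

lemma sum_list_concat_replicate: "sum_list (map length (concat (replicate e a))) = e * sum_list (map length a)"
  by (induction e) simp_all

lemma KS_concat_replicate: "e \<ge> 1 \<Longrightarrow> length a = g \<Longrightarrow> concat (replicate e a) \<in> KS (e * g) q \<longleftrightarrow> e dvd q \<and> a \<in> KS g (q div e)"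
proof -
  assume e: "e \<ge> 1" and a: "length a = g"
  have st: "set (concat (replicate e a)) = set a" using e by (induction e) auto
  have "e * sum_list (map length a) = q \<longleftrightarrow> e dvd q \<and> sum_list (map length a) = q div e" using e by auto
  then show ?thesis
    unfolding KS_def mem_Collect_eq st length_concat_replicate sum_list_concat_replicate a by blast
qed

text \<open>For even \<open>e\<close> the number \<open>k\<close> is odd and cannot affect the
  parity; for odd \<open>e\<close> both exponents are even. Hence the sign is the same for all
  rotations with a given gcd.\<close>

lemma sign_parity:
  fixes e g d k :: nat
  assumes "coprime k e" "g \<le> d"
  shows "((- 1 :: 'k) ^ (e * d + e * g + 1)) ^ (k * (d - g)) = (- 1) ^ ((e + 1) * (d + g))"
proof -
  have "even ((e * d + e * g + 1) * (k * (d - g))) \<longleftrightarrow> even ((e + 1) * (d + g))"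
  proof (cases "even e")
    case True
    then have "odd k" using assms(1) by (metis coprime_common_divisor odd_one)
    then show ?thesis using True assms(2) by auto
  next
    case False
    then show ?thesis using assms(2) by auto
  qed
  then show ?thesis unfolding power_mult[symmetric] by (simp only: minus_one_power_iff)
qed

text \<open>The fixed tuples are the \<open>e\<close>-fold powers of tuples of length
  \<open>g\<close> and weight \<open>q div e\<close>, and all of them carry the same sign.\<close>

lemma fixed_sum:
  assumes r: "r < j" and g: "g = gcd r j" and e: "e = j div g" and j: "j = Suc m"
  shows "(\<Sum>ws | ws \<in> KS j q \<and> rotate r ws = ws. ksg j q ws r)
    = (if e dvd q then (- 1) ^ ((e + 1) * (q div e + g)) * of_nat (card (KS g (q div e))) else 0)"
proof -
  have gj: "g dvd j" and g0: "g > 0" using g j by auto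
  have jeg: "j = e * g" using e gj by simp
  have "e \<noteq> 0"
  proof
    assume "e = 0"
    then have "j = 0" unfolding jeg by simp
    then show False using j by simp
  qed
  then have e1: "e \<ge> 1" by simp
  let ?F = "{ws. ws \<in> KS j q \<and> rotate r ws = ws}"
  let ?c = "\<lambda>a. concat (replicate e a)"
  have F: "?F = (if e dvd q then ?c ` KS g (q div e) else {})"
  proof (intro Set.set_eqI)
    fix ws
    have "ws \<in> ?F \<longleftrightarrow> (\<exists>a. length a = g \<and> ws = ?c a \<and> ws \<in> KS j q)"
    proof (cases "length ws = j")
      case True
      have "length ws = e * g" by (rule trans[OF True jeg])
      moreover have "g = gcd r (length ws)" unfolding True by (rule g)
      ultimately have "rotate r ws = ws \<longleftrightarrow> (\<exists>a. length a = g \<and> ws = ?c a)" by (rule rotate_fixed_iff[OF _ _ e1])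
      then show ?thesis by blast
    next
      case False
      then have "ws \<notin> KS j q" by (auto simp: KS_def)
      then show ?thesis by blast
    qed
    also have "\<dots> \<longleftrightarrow> (\<exists>a. length a = g \<and> ws = ?c a \<and> e dvd q \<and> a \<in> KS g (q div e))"
      unfolding jeg using KS_concat_replicate[OF e1, of _ g q] by (intro ex_cong1) blast
    also have "\<dots> \<longleftrightarrow> ws \<in> (if e dvd q then ?c ` KS g (q div e) else {})" by (auto simp: KS_def)
    finally show "ws \<in> ?F \<longleftrightarrow> ws \<in> (if e dvd q then ?c ` KS g (q div e) else {})" .
  qed
  show ?thesis
  proof (cases "e dvd q")
    case False
    then show ?thesis unfolding F by simp
  next
    case True
    define d where "d = q div e"
    have q: "q = e * d" using True d_def by simp
    have inj: "inj_on ?c (KS g d)"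
    proof (rule inj_onI)
      fix a b assume ab: "a \<in> KS g d" "b \<in> KS g d" "?c a = ?c b"
      obtain e' where "e = Suc e'" using e1 by (cases e) auto
      then have "take g (?c a) = a" "take g (?c b) = b" using ab(1,2) by (simp_all add: KS_def)
      then show "a = b" using ab(3) by metis
    qed
    have "ksg j q (?c a) r = (- 1) ^ ((e + 1) * (d + g))" if a: "a \<in> KS g d" for a
    proof -
      have la: "length a = g" using a by (simp add: KS_def)
      define k where "k = r div g"
      have rk: "r = k * g" using g by (simp add: k_def)
      have cop: "coprime k e" unfolding k_def e g using j by (intro div_gcd_coprime) auto
      have "ksg j q (?c a) r = (\<Prod>i<r. sg j q ^ (length (a ! (i mod g)) - 1))"
        unfolding ksg_def
      proof (rule prod.cong[OF refl])
        fix i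
        have "i mod j < e * length a" unfolding la jeg[symmetric] using j by simp
        from nth_concat_replicate[OF this] have "?c a ! (i mod j) = a ! (i mod g)" using gj la by (simp add: mod_mod_cancel)
        then show "sg j q ^ (length (?c a ! (i mod j)) - 1) = sg j q ^ (length (a ! (i mod g)) - 1)" by simp
      qed
      also have "\<dots> = (\<Prod>i<g. sg j q ^ (length (a ! i) - 1)) ^ k" unfolding rk by (rule prod_mod)
      also have "\<dots> = (sg j q ^ (d - g)) ^ k" by (simp only: prod_sg(1)[OF a])
      also have "\<dots> = ((- 1) ^ (e * d + e * g + 1)) ^ (k * (d - g))"
        unfolding power_mult[symmetric] sg_def q jeg by (simp only: ac_simps)
      also have "\<dots> = (- 1) ^ ((e + 1) * (d + g))" by (rule sign_parity[OF cop prod_sg(2)[OF a]])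
      finally show ?thesis .
    qed
    then have "(\<Sum>a\<in>KS g d. ksg j q (?c a) r) = of_nat (card (KS g d)) * (- 1) ^ ((e + 1) * (d + g))" by simp
    then show ?thesis unfolding F if_P[OF True] d_def[symmetric] sum.reindex[OF inj] by (simp add: mult.commute)
  qed
qed

text \<open>The common value of \<open>fixed_sum\<close> for rotations with gcd \<open>g\<close>, as
  an integer so that the dimension formula can leave the field.\<close>

definition orbit_term :: "nat \<Rightarrow> nat \<Rightarrow> nat \<Rightarrow> int"
  where "orbit_term q e g = (- 1) ^ ((e + 1) * (q div e + g)) * int (card (KS g (q div e)))"

lemma coinv_dim_formula:
  assumes j: "j = Suc m"
  shows "int (coinv_dim m q) * int j = (\<Sum>g | g dvd j. if (j div g) dvd q then int (totient (j div g)) * orbit_term q (j div g) g else 0)"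
proof -
  define H where "H g = (if (j div g) dvd q then orbit_term q (j div g) g else 0)" for g
  have "of_nat (coinv_dim m q) * of_nat j = (\<Sum>r<j. of_int (H (gcd r j)) :: 'k)"
    unfolding j coinv_dim_trace
  proof (rule sum.cong[OF refl])
    fix r assume "r \<in> {..<Suc m}"
    then show "(\<Sum>ws | ws \<in> KS (Suc m) q \<and> rotate r ws = ws. ksg (Suc m) q ws r) = of_int (H (gcd r (Suc m)))"
      using fixed_sum[of r j "gcd r j" "j div gcd r j" m q] unfolding H_def orbit_term_def j by simp
  qed
  then have "(of_int (int (coinv_dim m q) * int j) :: 'k) = of_int (\<Sum>r<j. H (gcd r j))" by simp
  then have "int (coinv_dim m q) * int j = (\<Sum>r<j. H (gcd r j))" by (simp only: of_int_eq_iff)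
  \<comment> \<open>Replaces the rotation by 0 with that by \<open>j\<close>, both having gcd
    \<open>j\<close>, to match the range in which Euler's function counts.\<close>
  also have "\<dots> = (\<Sum>r\<in>{0<..j}. H (gcd r j))"
  proof -
    have "{..<j} = insert 0 {0<..<j}" "{0<..j} = insert j {0<..<j}" using j by auto
    then show ?thesis by simp
  qed
  also have "\<dots> = (\<Sum>g | g dvd j. \<Sum>r | r \<in> {0<..j} \<and> gcd r j = g. H (gcd r j))"
    using j by (intro sum.group[symmetric]) (auto simp: finite_divisors_nat)
  also have "\<dots> = (\<Sum>g | g dvd j. int (totient (j div g)) * H g)"
  proof (rule sum.cong[OF refl])
    fix g assume "g \<in> {g. g dvd j}"
    then have "card {r \<in> {0<..j}. gcd r j = g} = totient (j div g)" using j by (intro card_gcd_eq_totient) auto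
    then show "(\<Sum>r | r \<in> {0<..j} \<and> gcd r j = g. H (gcd r j)) = int (totient (j div g)) * H g" by simp
  qed
  also have "\<dots> = (\<Sum>g | g dvd j. if (j div g) dvd q then int (totient (j div g)) * orbit_term q (j div g) g else 0)"
    by (rule sum.cong) (auto simp: H_def)
  finally show ?thesis .
qed

text \<open>The coefficient of degree \<open>d\<close> of log (1 + I), with I the Hilbert series of
  the augmentation ideal.\<close>

definition lam :: "nat \<Rightarrow> rat" where "lam d = (\<Sum>g=1..d. (- 1) ^ (g - 1) / of_nat g * of_nat (card (KS g d)))"

text \<open>The number of factors is \<open>j = e * g\<close>. Summing over pairs of
  \<open>e\<close> and \<open>g\<close> instead separates Euler's function from the logarithm, since
  \<open>1 / j\<close> and the sign both factor.\<close>

lemma euler_formula: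
  assumes q: "q > 0"
  shows "of_int (\<Sum>i<q. (- 1) ^ i * int (coinv_dim i q)) = (\<Sum>e | e dvd q. of_nat (totient e) / of_nat e * (- 1) ^ ((e + 1) * (q div e)) * lam (q div e))"
proof -
  let ?f = "\<lambda>j g. (- 1) ^ (j - 1) / of_nat j * (of_nat (totient (j div g)) * of_int (orbit_term q (j div g) g)) :: rat"
  let ?g = "\<lambda>e g. of_nat (totient e) / of_nat e * (- 1) ^ ((e + 1) * (q div e)) * ((- 1) ^ (g - 1) / of_nat g * of_nat (card (KS g (q div e)))) :: rat"
  have 1: "(- 1) ^ i * of_int (int (coinv_dim i q)) = (\<Sum>g | g dvd Suc i \<and> (Suc i div g) dvd q. ?f (Suc i) g)" for i
  proof -
    have "of_int (int (coinv_dim i q)) * (of_nat (Suc i) :: rat) = of_int (int (coinv_dim i q) * int (Suc i))" by simp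
    also have "\<dots> = (\<Sum>g | g dvd Suc i. if (Suc i div g) dvd q then of_nat (totient (Suc i div g)) * of_int (orbit_term q (Suc i div g) g) else 0)"
      unfolding coinv_dim_formula[OF refl] of_int_sum by (rule sum.cong) auto
    also have "\<dots> = (\<Sum>g | g dvd Suc i \<and> (Suc i div g) dvd q. of_nat (totient (Suc i div g)) * of_int (orbit_term q (Suc i div g) g))"
      by (subst sum.inter_filter[symmetric]) (simp_all add: finite_divisors_nat)
    finally have "of_int (int (coinv_dim i q)) = (\<Sum>g | g dvd Suc i \<and> (Suc i div g) dvd q. of_nat (totient (Suc i div g)) * of_int (orbit_term q (Suc i div g) g)) / (of_nat (Suc i) :: rat)"
      by (simp add: eq_divide_eq del: of_nat_Suc)
    then show ?thesis by (simp add: sum_distrib_left sum_divide_distrib del: of_nat_Suc)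
  qed
  have "(of_int (\<Sum>i<q. (- 1) ^ i * int (coinv_dim i q)) :: rat) = (\<Sum>i<q. (- 1) ^ i * of_int (int (coinv_dim i q)))" by simp
  also have "\<dots> = (\<Sum>i<q. \<Sum>g | g dvd Suc i \<and> (Suc i div g) dvd q. ?f (Suc i) g)" by (simp only: 1)
  also have "\<dots> = (\<Sum>j\<in>{1..q}. \<Sum>g | g dvd j \<and> (j div g) dvd q. ?f j g)"
    by (rule sum.reindex_bij_witness[of _ "\<lambda>j. j - 1" Suc]) auto
  also have "\<dots> = (\<Sum>(j, g)\<in>Sigma {1..q} (\<lambda>j. {g. g dvd j \<and> (j div g) dvd q}). ?f j g)"
    by (rule sum.Sigma) (auto intro: finite_subset[OF _ finite_divisors_nat])
  also have "\<dots> = (\<Sum>(e, g)\<in>Sigma {e. e dvd q} (\<lambda>e. {1..q div e}). ?g e g)"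
  proof (rule sum.reindex_bij_witness[of _ "\<lambda>(e, g). (e * g, g)" "\<lambda>(j, g). (j div g, g)"])
    fix x assume "x \<in> Sigma {1..q} (\<lambda>j. {g. g dvd j \<and> (j div g) dvd q})"
    then obtain j g where x: "x = (j, g)" and jg: "1 \<le> j" "j \<le> q" "g dvd j" "(j div g) dvd q" by auto
    define e where "e = j div g"
    have je: "j = e * g" using jg(3) by (simp add: e_def)
    have pos: "e > 0" "g > 0" using jg(1) je by (auto intro: gr0I)
    have "g \<le> q div e" using jg(2) pos je by (simp add: less_eq_div_iff_mult_less_eq mult.commute)
    then show "(case x of (j, g) \<Rightarrow> (j div g, g)) \<in> Sigma {e. e dvd q} (\<lambda>e. {1..q div e})"
      using x jg(4) pos by (simp add: e_def[symmetric])
    show "(case case x of (j, g) \<Rightarrow> (j div g, g) of (e, g) \<Rightarrow> (e * g, g)) = x" using x je by (simp add: e_def[symmetric])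
    \<comment> \<open>The alternating sign of degree \<open>e * g - 1\<close> and the sign of the
      fixed tuples combine into the sign of the substitution in \<open>hcfree\<close> and the sign
      of the logarithm.\<close>
    have "even (e * g - 1 + (e + 1) * (q div e + g)) \<longleftrightarrow> even ((e + 1) * (q div e) + (g - 1))"
      using pos by (cases "even e"; cases "even g") auto
    then have s: "(- 1 :: rat) ^ (e * g - 1) * (- 1) ^ ((e + 1) * (q div e + g)) = (- 1) ^ ((e + 1) * (q div e)) * (- 1) ^ (g - 1)"
      unfolding power_add[symmetric] by (simp only: minus_one_power_iff)
    have "?f j g = (- 1) ^ (e * g - 1) * (- 1) ^ ((e + 1) * (q div e + g)) * (of_nat (totient e) * of_nat (card (KS g (q div e)))) / (of_nat e * of_nat g)"
      by (simp add: e_def[symmetric] orbit_term_def) (simp add: je)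
    also have "\<dots> = ?g e g" unfolding s by simp
    finally show "(case case x of (j, g) \<Rightarrow> (j div g, g) of (e, g) \<Rightarrow> ?g e g) = (case x of (j, g) \<Rightarrow> ?f j g)"
      using x by (simp add: e_def[symmetric])
  next
    fix x assume "x \<in> Sigma {e. e dvd q} (\<lambda>e. {1..q div e})"
    then obtain e g where x: "x = (e, g)" and eg: "e dvd q" "1 \<le> g" "g \<le> q div e" by auto
    have e0: "e > 0" using eg(1) q by (auto intro: gr0I)
    have "e * g \<le> q" using eg(3) e0 by (simp add: less_eq_div_iff_mult_less_eq mult.commute)
    then show "(case x of (e, g) \<Rightarrow> (e * g, g)) \<in> Sigma {1..q} (\<lambda>j. {g. g dvd j \<and> (j div g) dvd q})"
      using x eg e0 by (simp add: Suc_le_eq)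
    show "(case case x of (e, g) \<Rightarrow> (e * g, g) of (j, g) \<Rightarrow> (j div g, g)) = x" using x eg(2) by simp
  qed
  also have "\<dots> = (\<Sum>e | e dvd q. \<Sum>g=1..q div e. ?g e g)"
    by (rule sum.Sigma[symmetric]) (use q in \<open>auto simp: finite_divisors_nat\<close>)
  also have "\<dots> = (\<Sum>e | e dvd q. of_nat (totient e) / of_nat e * (- 1) ^ ((e + 1) * (q div e)) * lam (q div e))"
    unfolding lam_def sum_distrib_left ..
  finally show ?thesis .
qed

definition hilbI :: "rat fps" where "hilbI = Abs_fps (\<lambda>p. if p = 0 then 0 else of_nat (hilb p))"

lemma KS_0: "KS 0 d = (if d = 0 then {[]} else {})"
  by (auto simp: KS_def)

lemma KS_Suc: "KS (Suc g) d = (\<Union>p\<in>{0..d}. (\<lambda>(w, ws). w # ws) ` ((if p = 0 then {} else NW p) \<times> KS g (d - p)))"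
proof (intro Set.set_eqI iffI)
  fix x assume x: "x \<in> KS (Suc g) d"
  then obtain w ws where w: "x = w # ws" by (cases x) (auto simp: KS_def)
  then have "length w \<in> {0..d}" "w \<in> (if length w = 0 then {} else NW (length w))" "ws \<in> KS g (d - length w)" using x by (auto simp: KS_def)
  then show "x \<in> (\<Union>p\<in>{0..d}. (\<lambda>(w, ws). w # ws) ` ((if p = 0 then {} else NW p) \<times> KS g (d - p)))" unfolding w by blast
next
  fix x assume "x \<in> (\<Union>p\<in>{0..d}. (\<lambda>(w, ws). w # ws) ` ((if p = 0 then {} else NW p) \<times> KS g (d - p)))"
  then obtain p w ws where "p \<le> d" "p \<noteq> 0" "w \<in> NW p" "ws \<in> KS g (d - p)" "x = w # ws" by (auto split: if_splits)
  moreover then have "length w = p" using NW(1)[of p] by (auto simp: words_def)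
  ultimately show "x \<in> KS (Suc g) d" by (auto simp: KS_def)
qed

lemma finite_KS': "finite (KS g d)"
  by (cases g) (simp_all add: KS_0 finite_KS)

text \<open>Tuples of nonempty normal words of total length \<open>d\<close> are counted by powers
  of I, by splitting off the first word.\<close>

lemma card_KS: "of_nat (card (KS g d)) = fps_nth (hilbI ^ g) d"
proof (induction g arbitrary: d)
  case 0
  show ?case by (simp add: KS_0)
next
  case (Suc g)
  let ?W = "\<lambda>p. if p = 0 then {} else NW p"
  let ?A = "\<lambda>p. (\<lambda>(w, ws). w # ws) ` (?W p \<times> KS g (d - p))"
  have "card (KS (Suc g) d) = (\<Sum>p\<in>{0..d}. card (?A p))"
    unfolding KS_Suc
  proof (rule card_UN_disjoint)
    show "\<forall>i\<in>{0..d}. finite (?A i)" by (simp add: finite_NW finite_KS')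
    have len: "length (hd x) = p" if "x \<in> ?A p" for x p using that NW(1)[of p] by (auto simp: words_def split: if_splits)
    show "\<forall>i\<in>{0..d}. \<forall>j\<in>{0..d}. i \<noteq> j \<longrightarrow> ?A i \<inter> ?A j = {}"
    proof (intro ballI impI equals0I)
      fix i j x assume "i \<noteq> j" "x \<in> ?A i \<inter> ?A j"
      then show False using len[of x i] len[of x j] by blast
    qed
  qed simp
  also have "\<dots> = (\<Sum>p\<in>{0..d}. card (?W p) * card (KS g (d - p)))"
    by (intro sum.cong refl) (subst card_image, auto simp: inj_on_def card_cartesian_product)
  finally have "(of_nat (card (KS (Suc g) d)) :: rat) = (\<Sum>p\<in>{0..d}. of_nat (card (?W p)) * of_nat (card (KS g (d - p))))" by simp
  also have "\<dots> = (\<Sum>p\<in>{0..d}. fps_nth hilbI p * fps_nth (hilbI ^ g) (d - p))"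
    unfolding Suc.IH by (intro sum.cong refl) (simp add: hilbI_def NW(2))
  finally show ?case by (simp add: fps_mult_nth)
qed

text \<open>The recursion \<open>hilb_rec\<close> together with its two initial values, written as
  an identity of power series.\<close>

lemma hilbI_eq: "(1 + hilbI) * (1 - (fps_const (of_nat n) * fps_X - fps_X\<^sup>2)) = 1"
proof -
  define H where "H = 1 + hilbI"
  have H: "fps_nth H p = of_nat (hilb p)" for p using hilb_0 by (simp add: H_def hilbI_def)
  have "H * (1 - (fps_const (of_nat n) * fps_X - fps_X\<^sup>2)) = H - fps_const (of_nat n) * (fps_X * H) + fps_X * (fps_X * H)"
    by (simp add: algebra_simps power2_eq_square)
  also have "\<dots> = 1"
  proof (rule fps_ext)
    fix k
    have nth: "fps_nth (H - fps_const (of_nat n) * (fps_X * H) + fps_X * (fps_X * H)) k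
      = of_nat (hilb k) - of_nat n * (if k = 0 then 0 else of_nat (hilb (k - 1))) + (if k = 0 then 0 else if k - 1 = 0 then 0 else of_nat (hilb (k - 2)))"
      unfolding fps_add_nth fps_sub_nth fps_mult_left_const_nth fps_X_mult_nth H
      by (simp add: numeral_2_eq_2)
    consider "k = 0" | "k = 1" | p where "k = Suc (Suc p)" by (metis One_nat_def not0_implies_Suc)
    then show "fps_nth (H - fps_const (of_nat n) * (fps_X * H) + fps_X * (fps_X * H)) k = fps_nth 1 k"
    proof cases
      case 1 then show ?thesis unfolding nth by (simp add: hilb_0)
    next
      case 2 then show ?thesis unfolding nth using hilb_1 by (simp add: hilb_0)
    next
      case (3 p)
      have "(of_nat (hilb (Suc (Suc p)) + hilb p) :: rat) = of_nat (n * hilb (Suc p))" by (simp only: hilb_rec)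
      then show ?thesis unfolding nth 3 by (simp add: H)
    qed
  qed
  finally show ?thesis unfolding H_def .
qed

end

section \<open>Logarithms and the series hcfree\<close>

lemma single_sum: "Poly_Mapping.single k (\<Sum>i\<in>I. f i) = (\<Sum>i\<in>I. Poly_Mapping.single k (f i))"
  by (induction I rule: infinite_finite_induct) (simp_all add: single_add)

text \<open>The logarithms of two inverse series cancel: by the product rule the derivative of their
  sum is zero, and so is its constant term.\<close>

lemma fps_ln_compose_inverse:
  fixes I p :: "rat fps"
  assumes eq: "(1 + I) * (1 - p) = 1" and I0: "fps_nth I 0 = 0" and p0: "fps_nth p 0 = 0"
  shows "(fps_ln 1 oo I) + (fps_ln 1 oo (- p)) = 0"
proof -
  have comp: "fps_deriv (fps_ln 1 oo b) = inverse (1 + b) * fps_deriv b" if b: "fps_nth b 0 = 0" for b :: "rat fps"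
  proof -
    have "inverse (1 + fps_X) oo b = inverse ((1 + fps_X) oo b)" using b by (intro fps_inverse_compose) simp_all
    also have "(1 + fps_X) oo b = 1 + b" using b by (simp add: fps_compose_add_distrib)
    finally show ?thesis using fps_compose_deriv[OF b, of "fps_ln 1"] by (simp add: fps_ln_deriv)
  qed
  have i1: "inverse (1 + I) = 1 - p" by (rule fps_inverse_unique[OF eq])
  have i2: "inverse (1 - p) = 1 + I" using eq by (intro fps_inverse_unique) (simp add: mult.commute)
  have "fps_deriv ((1 + I) * (1 - p)) = 0" unfolding eq by simp
  then have d: "(1 - p) * fps_deriv I - (1 + I) * fps_deriv p = 0" by (simp add: algebra_simps)
  have "fps_deriv ((fps_ln 1 oo I) + (fps_ln 1 oo (- p))) = 0"
    using comp[OF I0] comp[of "- p"] p0 d by (simp add: i1 i2)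
  then have "(fps_ln 1 oo I) + (fps_ln 1 oo (- p)) = fps_const (fps_nth ((fps_ln 1 oo I) + (fps_ln 1 oo (- p))) 0)"
    by (rule fps_deriv_eq_0_iff[THEN iffD1])
  also have "\<dots> = 0" by (simp add: fps_ln_def)
  finally show ?thesis .
qed

lemma fps_ln_1_nth: "fps_nth (fps_ln 1 :: rat fps) g = (if g = 0 then 0 else (- 1) ^ (g - 1) / of_nat g)"
  by (cases g) (simp_all add: fps_ln_def)

lemma log_coefficients:
  fixes I p :: "rat fps"
  assumes eq: "(1 + I) * (1 - p) = 1" and I0: "fps_nth I 0 = 0" and p0: "fps_nth p 0 = 0"
  shows "(\<Sum>g=1..d. (- 1) ^ (g - 1) / of_nat g * fps_nth (I ^ g) d) = (\<Sum>g=1..d. 1 / of_nat g * fps_nth (p ^ g) d)"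
proof -
  have c: "fps_nth (fps_ln 1 oo b) d = (\<Sum>g=1..d. (- 1) ^ (g - 1) / of_nat g * fps_nth (b ^ g) d)" for b :: "rat fps"
  proof -
    have "fps_nth (fps_ln 1 oo b) d = (\<Sum>g=0..d. (if g = 0 then 0 else (- 1) ^ (g - 1) / of_nat g) * fps_nth (b ^ g) d)"
      by (simp only: fps_compose_nth fps_ln_1_nth)
    also have "\<dots> = (\<Sum>g=1..d. (if g = 0 then 0 else (- 1) ^ (g - 1) / of_nat g) * fps_nth (b ^ g) d)"
      by (rule sum.mono_neutral_right) auto
    also have "\<dots> = (\<Sum>g=1..d. (- 1) ^ (g - 1) / of_nat g * fps_nth (b ^ g) d)" by (rule sum.cong) auto
    finally show ?thesis .
  qed
  have m: "fps_nth ((- p) ^ g) d = (- 1) ^ g * fps_nth (p ^ g) d" for g by (simp add: uminus_power_if)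
  have "(- 1) ^ (g - 1) / of_nat g * fps_nth ((- p) ^ g) d = - (1 / of_nat g * fps_nth (p ^ g) d)" if g: "g \<in> {1..d}" for g
  proof -
    obtain h where h: "g = Suc h" using g by (cases g) auto
    have "(- 1 :: rat) ^ h * (- 1) ^ h = 1" unfolding power_mult_distrib[symmetric] by simp
    then have s: "(- 1 :: rat) ^ (g - 1) * (- 1) ^ g = - 1" unfolding h by simp
    have "(- 1) ^ (g - 1) / of_nat g * fps_nth ((- p) ^ g) d = ((- 1) ^ (g - 1) * (- 1) ^ g) * (1 / of_nat g * fps_nth (p ^ g) d)"
      unfolding m by simp
    then show ?thesis unfolding s by simp
  qed
  then have "fps_nth (fps_ln 1 oo (- p)) d = - (\<Sum>g=1..d. 1 / of_nat g * fps_nth (p ^ g) d)"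
    unfolding c by (simp add: sum_negf)
  moreover have "fps_nth (fps_ln 1 oo I) d + fps_nth (fps_ln 1 oo (- p)) d = 0"
    using arg_cong[OF fps_ln_compose_inverse[OF assms], of "\<lambda>f. fps_nth f d"] by simp
  ultimately show ?thesis unfolding c by simp
qed

text \<open>The substitution of \<open>(-1)\<^sup>m\<^sup>+\<^sup>1 y\<^sup>m z\<^sup>m\<close> into a power series.\<close>

definition subst_hom :: "nat \<Rightarrow> rat fps \<Rightarrow> zy_series"
  where "subst_hom m f = Abs_fps (\<lambda>q. if m dvd q then Poly_Mapping.single (of_nat q) ((- 1) ^ ((m + 1) * (q div m)) * fps_nth f (q div m)) else 0)"

lemma subst_hom_1: "m \<ge> 1 \<Longrightarrow> subst_hom m 1 = 1"
  by (rule fps_ext) (auto simp: subst_hom_def elim!: dvdE)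

text \<open>The exponent of -1 and the group element are both additive in the degree, so the
  substitution is multiplicative.\<close>

lemma subst_hom_mult:
  assumes m: "m \<ge> 1"
  shows "subst_hom m (f * g) = subst_hom m f * subst_hom m g"
proof (rule fps_ext)
  fix q
  let ?a = "\<lambda>i. fps_nth (subst_hom m f) i * fps_nth (subst_hom m g) (q - i)"
  have "fps_nth (subst_hom m f * subst_hom m g) q = sum ?a {0..q}" by (simp add: fps_mult_nth)
  also have "\<dots> = fps_nth (subst_hom m (f * g)) q"
  proof (cases "m dvd q")
    case False
    have "?a i = 0" if "i \<in> {0..q}" for i
    proof -
      have "\<not> (m dvd i \<and> m dvd q - i)" using False that by (metis atLeastAtMost_iff dvd_diffD)
      then show ?thesis by (auto simp: subst_hom_def)
    qed
    then have "sum ?a {0..q} = 0" by (intro sum.neutral) blast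
    then show ?thesis using False by (simp add: subst_hom_def)
  next
    case True
    then obtain d where q: "q = m * d" by blast
    have "sum ?a {0..q} = sum ?a ((*) m ` {0..d})"
    proof (rule sum.mono_neutral_right)
      show "(*) m ` {0..d} \<subseteq> {0..q}" unfolding q by auto
      show "\<forall>i\<in>{0..q} - (*) m ` {0..d}. ?a i = 0"
      proof
        fix i assume i: "i \<in> {0..q} - (*) m ` {0..d}"
        have "\<not> m dvd i"
        proof
          assume "m dvd i"
          then obtain k where "i = m * k" by blast
          then show False using i m unfolding q by auto
        qed
        then show "?a i = 0" by (simp add: subst_hom_def)
      qed
    qed simp
    also have "\<dots> = (\<Sum>k=0..d. ?a (m * k))" using m by (subst sum.reindex) (auto simp: inj_on_def)
    also have "\<dots> = (\<Sum>k=0..d. Poly_Mapping.single (of_nat q) ((- 1) ^ ((m + 1) * d) * (fps_nth f k * fps_nth g (d - k))))"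
    proof (rule sum.cong[OF refl])
      fix k assume "k \<in> {0..d}"
      then have k: "k \<le> d" by simp
      have e: "q - m * k = m * (d - k)" unfolding q by (simp add: diff_mult_distrib2)
      have a: "(of_nat (m * k) + of_nat (m * (d - k)) :: bit) = of_nat q" 
      proof -
        have "m * k + m * (d - k) = q" unfolding q distrib_left[symmetric] using k by simp
        then show ?thesis unfolding of_nat_add[symmetric] by (simp only:)
      qed
      have s: "(- 1 :: rat) ^ ((m + 1) * k) * (- 1) ^ ((m + 1) * (d - k)) = (- 1) ^ ((m + 1) * d)"
        unfolding power_add[symmetric] distrib_left[symmetric] using k by simp
      have "?a (m * k) = Poly_Mapping.single (of_nat (m * k) + of_nat (m * (d - k)))
          (((- 1) ^ ((m + 1) * k) * fps_nth f k) * ((- 1) ^ ((m + 1) * (d - k)) * fps_nth g (d - k)))"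
        unfolding e subst_hom_def using m by (simp add: mult_single del: of_nat_mult)
      also have "((- 1 :: rat) ^ ((m + 1) * k) * fps_nth f k) * ((- 1) ^ ((m + 1) * (d - k)) * fps_nth g (d - k))
        = (- 1) ^ ((m + 1) * d) * (fps_nth f k * fps_nth g (d - k))" unfolding s[symmetric] by (simp only: ac_simps)
      finally show "?a (m * k) = Poly_Mapping.single (of_nat q) ((- 1) ^ ((m + 1) * d) * (fps_nth f k * fps_nth g (d - k)))" unfolding a .
    qed
    also have "\<dots> = Poly_Mapping.single (of_nat q) ((- 1) ^ ((m + 1) * d) * fps_nth (f * g) d)"
      unfolding fps_mult_nth sum_distrib_left by (rule single_sum[symmetric])
    also have "\<dots> = fps_nth (subst_hom m (f * g)) q" using m unfolding subst_hom_def q by simp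
    finally show ?thesis .
  qed
  finally show "fps_nth (subst_hom m (f * g)) q = fps_nth (subst_hom m f * subst_hom m g) q" by simp
qed

lemma subst_hom_power: "m \<ge> 1 \<Longrightarrow> subst_hom m (f ^ j) = subst_hom m f ^ j"
  by (induction j) (simp_all add: subst_hom_1 subst_hom_mult)

lemma hilbert_denominator_nth:
  "fps_nth (fps_const (of_nat n) * fps_X - fps_X\<^sup>2 :: rat fps) d = (if d = 1 then of_nat n else if d = 2 then - 1 else 0)"
  by simp

lemma series_nth:
  "fps_nth (of_nat n * zvar * yvar - zvar ^ 2) d
    = (if d = 1 then Poly_Mapping.single 1 (of_nat n) else if d = 2 then - Poly_Mapping.single 0 1 else 0)"
proof -
  have "of_nat n * zvar * yvar = fps_const (of_nat n * Poly_Mapping.single 1 1) * fps_X"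
    unfolding yvar_def zvar_def fps_of_nat[symmetric] fps_const_mult[symmetric] by (simp only: ac_simps)
  also have "of_nat n * Poly_Mapping.single (1::bit) (1::rat) = Poly_Mapping.single 1 (of_nat n)"
    by (simp add: mult_single flip: single_of_nat)
  finally show ?thesis by (simp add: zvar_def)
qed

lemma fps_nth_compose_X_power:
  fixes f :: "'a::comm_ring_1 fps"
  assumes m: "m \<ge> 1"
  shows "fps_nth (f oo fps_X ^ m) q = (if m dvd q then fps_nth f (q div m) else 0)"
proof -
  have "fps_nth (f oo fps_X ^ m) q = (\<Sum>i=0..q. if q = m * i then fps_nth f i else 0)"
    unfolding fps_compose_nth power_mult[symmetric] by (intro sum.cong refl) simp
  also have "\<dots> = (\<Sum>i=0..q. if i = q div m then if m dvd q then fps_nth f (q div m) else 0 else 0)"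
    using m by (intro sum.cong refl) auto
  also have "\<dots> = (if m dvd q then fps_nth f (q div m) else 0)" by simp
  finally show ?thesis .
qed

text \<open>As y squared is 1, the series n z y - z^2 is the one-variable series n t - t^2 at t = z
  y, and the substitution sends z y to (-1)^(m+1) y^m z^m.\<close>

lemma series_subst_eq:
  assumes m: "m \<ge> 1"
  shows "series_subst m (of_nat n * zvar * yvar - zvar ^ 2) = subst_hom m (fps_const (of_nat n) * fps_X - fps_X\<^sup>2)"
proof (rule fps_ext)
  fix q
  let ?X = "of_nat n * zvar * yvar - zvar ^ 2 :: zy_series"
  let ?p = "fps_const (of_nat n) * fps_X - fps_X\<^sup>2 :: rat fps"
  let ?f = "\<lambda>q. Poly_Mapping.single 0 (Poly_Mapping.lookup (fps_nth ?X q) 0)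
      + Poly_Mapping.single (of_nat m) ((- 1) ^ (m + 1) * Poly_Mapping.lookup (fps_nth ?X q) 1) :: bit \<Rightarrow>\<^sub>0 rat"
  have "?f d = Poly_Mapping.single (of_nat (m * d)) ((- 1) ^ ((m + 1) * d) * fps_nth ?p d)" for d
  proof -
    consider "d = 1" | "d = 2" | "d \<noteq> 1" "d \<noteq> 2" by blast
    then show ?thesis
    proof cases
      case 1
      then show ?thesis unfolding series_nth hilbert_denominator_nth by (simp add: lookup_single)
    next
      case 2
      have "(of_nat (m * 2) :: bit) = 0" unfolding of_nat_mult by simp
      moreover have "(- 1 :: rat) ^ ((m + 1) * 2) = 1" unfolding power_mult power2_eq_square[symmetric] by (simp add: power_mult_distrib[symmetric] power2_eq_square)
      ultimately show ?thesis using 2 unfolding series_nth hilbert_denominator_nth by (simp add: lookup_single lookup_one single_uminus del: of_nat_mult power_Suc)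
    next
      case 3
      then show ?thesis unfolding series_nth hilbert_denominator_nth by simp
    qed
  qed
  then have f: "?f = (\<lambda>d. Poly_Mapping.single (of_nat (m * d)) ((- 1) ^ ((m + 1) * d) * fps_nth ?p d))" by (rule ext)
  show "fps_nth (series_subst m ?X) q = fps_nth (subst_hom m ?p) q"
  proof (cases "m dvd q")
    case True
    then have "m * (q div m) = q" by simp
    then show ?thesis using True unfolding series_subst_def f fps_nth_compose_X_power[OF m] subst_hom_def fps_nth_Abs_fps by (simp only: if_True)
  next
    case False
    then show ?thesis unfolding series_subst_def f fps_nth_compose_X_power[OF m] subst_hom_def fps_nth_Abs_fps by (simp only: if_False)
  qed
qed

lemma hcfree_nth:
  assumes q: "q \<ge> 1"
  shows "fps_nth (hcfree (of_nat n * zvar * yvar - zvar ^ 2)) q = Poly_Mapping.single (of_nat q)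
    (\<Sum>m | m dvd q. of_nat (totient m) / of_nat m * (- 1) ^ ((m + 1) * (q div m)) *
       (\<Sum>g=1..q div m. 1 / of_nat g * fps_nth ((fps_const (of_nat n) * fps_X - fps_X\<^sup>2) ^ g) (q div m)))"
proof -
  let ?p = "fps_const (of_nat n) * fps_X - fps_X\<^sup>2 :: rat fps"
  let ?X = "of_nat n * zvar * yvar - zvar ^ 2 :: zy_series"
  let ?S = "\<lambda>m. \<Sum>g=1..q div m. 1 / of_nat g * fps_nth (?p ^ g) (q div m)"
  let ?c = "\<lambda>m. of_nat (totient m) / of_nat m :: rat"
  have p0: "fps_nth ?p 0 = 0" by simp
  have log: "fps_nth (series_log (1 - series_subst m ?X)) q
      = (if m dvd q then - Poly_Mapping.single (of_nat q) ((- 1) ^ ((m + 1) * (q div m)) * ?S m) else 0)" if m: "m \<ge> 1" for m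
  proof -
    have "fps_nth (series_log (1 - series_subst m ?X)) q
      = - (\<Sum>g=0..q. (if g = 0 then 0 else Poly_Mapping.single 0 (1 / of_nat g)) * fps_nth (subst_hom m (?p ^ g)) q)"
      unfolding series_log_def series_subst_eq[OF m] subst_hom_power[OF m] by (simp add: fps_compose_nth)
    also have "(\<Sum>g=0..q. (if g = 0 then 0 else Poly_Mapping.single 0 (1 / of_nat g)) * fps_nth (subst_hom m (?p ^ g)) q)
      = (if m dvd q then Poly_Mapping.single (of_nat q) ((- 1) ^ ((m + 1) * (q div m)) * ?S m) else 0)"
    proof (cases "m dvd q")
      case False
      then show ?thesis by (simp add: subst_hom_def)
    next
      case True
      let ?h = "\<lambda>g. Poly_Mapping.single (of_nat q :: bit) ((- 1) ^ ((m + 1) * (q div m)) * (1 / of_nat g * fps_nth (?p ^ g) (q div m)))"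
      have "(\<Sum>g=0..q. (if g = 0 then 0 else Poly_Mapping.single 0 (1 / of_nat g)) * fps_nth (subst_hom m (?p ^ g)) q) = (\<Sum>g=0..q. if g = 0 then 0 else ?h g)"
        using True by (intro sum.cong refl) (simp add: subst_hom_def mult_single mult_ac)
      \<comment> \<open>Powers beyond \<open>q div m\<close> contribute nothing, because the series
        has no constant term.\<close>
      also have "\<dots> = (\<Sum>g=1..q div m. if g = 0 then 0 else ?h g)"
      proof (rule sum.mono_neutral_right)
        show "\<forall>g\<in>{0..q} - {1..q div m}. (if g = 0 then 0 else ?h g) = 0"
          using startsby_zero_power_prefix[OF p0] by auto
        have "q div m \<le> q" by simp
        then show "{1..q div m} \<subseteq> {0..q}" by auto
      qed simp
      also have "\<dots> = (\<Sum>g=1..q div m. ?h g)" by (rule sum.cong) auto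
      also have "\<dots> = Poly_Mapping.single (of_nat q) ((- 1) ^ ((m + 1) * (q div m)) * ?S m)"
        unfolding sum_distrib_left by (rule single_sum[symmetric])
      finally show ?thesis using True by simp
    qed
    finally show ?thesis by auto
  qed
  have "fps_nth (hcfree ?X) q = - (\<Sum>m=1..q. fps_nth (rconst (?c m) * series_log (1 - series_subst m ?X)) q)"
    by (simp add: hcfree_def)
  also have "\<dots> = (\<Sum>m=1..q. if m dvd q then Poly_Mapping.single (of_nat q) (?c m * (- 1) ^ ((m + 1) * (q div m)) * ?S m) else 0)"
    unfolding sum_negf[symmetric]
  proof (rule sum.cong[OF refl])
    fix m assume "m \<in> {1..q}"
    then have m: "m \<ge> 1" by simp
    show "- fps_nth (rconst (?c m) * series_log (1 - series_subst m ?X)) q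
      = (if m dvd q then Poly_Mapping.single (of_nat q) (?c m * (- 1) ^ ((m + 1) * (q div m)) * ?S m) else 0)"
      unfolding rconst_def fps_mult_left_const_nth log[OF m] by (simp add: mult_single mult.assoc)
  qed
  also have "\<dots> = (\<Sum>m | m \<in> {1..q} \<and> m dvd q. Poly_Mapping.single (of_nat q) (?c m * (- 1) ^ ((m + 1) * (q div m)) * ?S m))"
    by (rule sum.inter_filter[symmetric]) simp
  also have "{m. m \<in> {1..q} \<and> m dvd q} = {m. m dvd q}" using q by (auto intro: dvd_imp_le gr0I simp: Suc_le_eq)
  finally show ?thesis unfolding single_sum .
qed

lemma hcfree_nth_0: "fps_nth (hcfree X) 0 = 0" by (simp add: hcfree_def)

section \<open>Genericity\<close>

lemma poly_eval_superset:
  assumes "finite S" "Poly_Mapping.keys P \<subseteq> S" "h 0 = 0"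
  shows "poly_eval h c P = (\<Sum>u\<in>S. h (Poly_Mapping.lookup P u) * (\<Prod>v\<in>Poly_Mapping.keys u. c v ^ Poly_Mapping.lookup u v))"
  unfolding poly_eval_def
  by (rule sum.mono_neutral_left) (use assms in \<open>auto simp: not_in_keys_iff_lookup_eq_zero\<close>)

text \<open>Indices may repeat, as each off-diagonal coefficient occurs at two places of the matrix;
  repetitions add up to exponents.\<close>

lemma monomial_eval:
  fixes c :: "'v \<Rightarrow> 'k::comm_ring_1"
  assumes "finite I"
  shows "(\<Prod>v\<in>Poly_Mapping.keys (\<Sum>i\<in>I. Poly_Mapping.single (a i) (1::nat)). c v ^ Poly_Mapping.lookup (\<Sum>i\<in>I. Poly_Mapping.single (a i) 1) v) = (\<Prod>i\<in>I. c (a i))"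
proof -
  let ?u = "\<Sum>i\<in>I. Poly_Mapping.single (a i) (1::nat)"
  have k: "Poly_Mapping.keys ?u \<subseteq> a ` I" using Poly_Mapping.keys_sum[of "\<lambda>i. Poly_Mapping.single (a i) (1::nat)" I] by auto
  have "(\<Prod>v\<in>Poly_Mapping.keys ?u. c v ^ Poly_Mapping.lookup ?u v) = (\<Prod>v\<in>a ` I. c v ^ Poly_Mapping.lookup ?u v)"
    by (rule prod.mono_neutral_left) (use assms k in \<open>auto simp: not_in_keys_iff_lookup_eq_zero\<close>)
  also have "\<dots> = (\<Prod>v\<in>a ` I. \<Prod>i\<in>I. if a i = v then c v else 1)"
    by (intro prod.cong refl) (auto simp: lookup_sum lookup_single when_def power_sum if_distrib intro!: prod.cong)
  also have "\<dots> = (\<Prod>i\<in>I. \<Prod>v\<in>a ` I. if a i = v then c v else 1)" by (rule prod.swap)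
  also have "\<dots> = (\<Prod>i\<in>I. c (a i))" using assms by (intro prod.cong refl) simp
  finally show ?thesis .
qed

definition form_index :: "nat \<Rightarrow> nat \<Rightarrow> nat \<times> nat" where "form_index i j = (min i j, max i j)"

definition form_mat :: "nat \<Rightarrow> (nat \<times> nat \<Rightarrow> 'k::comm_ring_1) \<Rightarrow> 'k mat"
  where "form_mat n c = mat n n (\<lambda>(i, j). c (form_index i j))"

definition disc_monom :: "nat \<Rightarrow> (nat \<Rightarrow> nat) \<Rightarrow> (nat \<times> nat) \<Rightarrow>\<^sub>0 nat"
  where "disc_monom n \<pi> = (\<Sum>i\<in>{0..<n}. Poly_Mapping.single (form_index i (\<pi> i)) 1)"

text \<open>The determinant of the generic symmetric matrix, over an arbitrary coefficient ring so
  as to serve both over the rationals and over the field. Different permutations may share a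
  monomial, for instance a permutation and its inverse, so the terms are added rather than listed by
  monomial.\<close>

definition disc_poly :: "nat \<Rightarrow> ((nat \<times> nat) \<Rightarrow>\<^sub>0 nat) \<Rightarrow>\<^sub>0 'r::comm_ring_1"
  where "disc_poly n = (\<Sum>\<pi> | \<pi> permutes {0..<n}. Poly_Mapping.single (disc_monom n \<pi>) (signof \<pi>))"

lemma disc_poly_eval:
  fixes h :: "'r::comm_ring_1 \<Rightarrow> 'k::comm_ring_1"
  assumes h0: "h 0 = 0" and hadd: "\<And>a b. h (a + b) = h a + h b" and hs: "\<And>\<pi>. h (signof \<pi>) = signof \<pi>"
  shows "poly_eval h c (disc_poly n) = det (form_mat n c)"
proof -
  let ?\<Pi> = "{\<pi>. \<pi> permutes {0..<n}}"
  let ?S = "disc_monom n ` ?\<Pi>"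
  have fin: "finite ?\<Pi>" by (simp add: finite_permutations)
  have hsum: "h (\<Sum>x\<in>A. f x) = (\<Sum>x\<in>A. h (f x))" for f :: "(nat \<Rightarrow> nat) \<Rightarrow> 'r" and A
    by (induction A rule: infinite_finite_induct) (simp_all add: h0 hadd)
  let ?mon = "\<lambda>u. \<Prod>v\<in>Poly_Mapping.keys u. c v ^ Poly_Mapping.lookup u v"
  have "Poly_Mapping.keys (disc_poly n :: _ \<Rightarrow>\<^sub>0 'r) \<subseteq> ?S"
    unfolding disc_poly_def using Poly_Mapping.keys_sum[of "\<lambda>\<pi>. Poly_Mapping.single (disc_monom n \<pi>) (signof \<pi> :: 'r)" ?\<Pi>] by (auto split: if_splits)
  then have "poly_eval h c (disc_poly n) = (\<Sum>u\<in>?S. h (Poly_Mapping.lookup (disc_poly n) u) * ?mon u)"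
    using fin by (intro poly_eval_superset) (simp_all add: h0)
  also have "\<dots> = (\<Sum>u\<in>?S. \<Sum>\<pi>\<in>?\<Pi>. if disc_monom n \<pi> = u then signof \<pi> * ?mon u else 0)"
    unfolding disc_poly_def lookup_sum hsum sum_distrib_right
    by (intro sum.cong refl) (auto simp: lookup_single when_def h0 hs)
  also have "\<dots> = (\<Sum>\<pi>\<in>?\<Pi>. \<Sum>u\<in>?S. if disc_monom n \<pi> = u then signof \<pi> * ?mon u else 0)" by (rule sum.swap)
  also have "\<dots> = (\<Sum>\<pi>\<in>?\<Pi>. signof \<pi> * ?mon (disc_monom n \<pi>))" using fin by (intro sum.cong refl) simp
  also have "\<dots> = (\<Sum>\<pi>\<in>?\<Pi>. signof \<pi> * (\<Prod>i=0..<n. c (form_index i (\<pi> i))))"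
    unfolding disc_monom_def by (simp only: monomial_eval finite_atLeastLessThan)
  also have "\<dots> = (\<Sum>\<pi>\<in>?\<Pi>. signof \<pi> * (\<Prod>i=0..<n. form_mat n c $$ (i, \<pi> i)))"
  proof (intro sum.cong refl arg_cong2[of _ _ _ _ "(*)"] prod.cong)
    fix \<pi> i assume "\<pi> \<in> ?\<Pi>" "i \<in> {0..<n}"
    then have "\<pi> i < n" "i < n" using permutes_in_image[of \<pi> "{0..<n}" i] by auto
    then show "c (form_index i (\<pi> i)) = form_mat n c $$ (i, \<pi> i)" by (simp add: form_mat_def)
  qed
  also have "\<dots> = det (form_mat n c)" by (rule det_def'[symmetric]) (simp add: form_mat_def)
  finally show ?thesis .
qed

lemma disc_poly_in: "disc_poly n \<in> polys_in (coeff_index n)"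
proof -
  have "Poly_Mapping.keys (disc_monom n \<pi>) \<subseteq> coeff_index n" if p: "\<pi> permutes {0..<n}" for \<pi>
  proof -
    have "Poly_Mapping.keys (disc_monom n \<pi>) \<subseteq> (\<lambda>i. form_index i (\<pi> i)) ` {0..<n}"
      unfolding disc_monom_def using Poly_Mapping.keys_sum[of "\<lambda>i. Poly_Mapping.single (form_index i (\<pi> i)) (1::nat)" "{0..<n}"] by auto
    also have "\<dots> \<subseteq> coeff_index n"
    proof (rule image_subsetI)
      fix i assume "i \<in> {0..<n}"
      then have "\<pi> i < n" "i < n" using permutes_in_image[OF p, of i] by auto
      then show "form_index i (\<pi> i) \<in> coeff_index n" by (simp add: form_index_def coeff_index_def min_le_iff_disj)
    qed
    finally show ?thesis .
  qed
  moreover have "Poly_Mapping.keys (disc_poly n :: _ \<Rightarrow>\<^sub>0 'r::comm_ring_1) \<subseteq> disc_monom n ` {\<pi>. \<pi> permutes {0..<n}}"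
    unfolding disc_poly_def using Poly_Mapping.keys_sum[of "\<lambda>\<pi>. Poly_Mapping.single (disc_monom n \<pi>) (signof \<pi> :: 'r)" "{\<pi>. \<pi> permutes {0..<n}}"]
    by (auto split: if_splits)
  ultimately show ?thesis unfolding polys_in_def by blast
qed

text \<open>The identity matrix, witnessing that the discriminant is not the zero polynomial and
  that the open set is nonempty; it is restricted so as to lie in
  \<open>affine_space\<close>.\<close>

definition unit_form :: "nat \<Rightarrow> nat \<times> nat \<Rightarrow> 'k::field_char_0"
  where "unit_form n = restrict (\<lambda>(i, j). if i = j then 1 else 0) (coeff_index n)"

lemma det_unit_form: "det (form_mat n (unit_form n :: _ \<Rightarrow> 'k::field_char_0)) = 1"
proof -
  have "form_mat n (unit_form n) = (1\<^sub>m n :: 'k mat)"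
    by (rule eq_matI) (auto simp: form_mat_def unit_form_def form_index_def coeff_index_def min_def max_def)
  then show ?thesis by simp
qed

lemma nondegenerate_det:
  fixes c :: "nat \<times> nat \<Rightarrow> 'k::field_char_0"
  assumes d: "det (form_mat n c) \<noteq> 0"
    and \<mu>: "\<And>k. k < n \<Longrightarrow> (\<Sum>l<n. c (min k l, max k l) * \<mu> l) = 0" and l: "l < n"
  shows "\<mu> l = 0"
proof (rule ccontr)
  assume "\<mu> l \<noteq> 0"
  have C: "form_mat n c \<in> carrier_mat n n" by (simp add: form_mat_def)
  have "vec n \<mu> \<noteq> 0\<^sub>v n" using \<open>\<mu> l \<noteq> 0\<close> l by (metis index_vec index_zero_vec(1))
  moreover have "form_mat n c *\<^sub>v vec n \<mu> = 0\<^sub>v n"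
  proof (rule eq_vecI)
    fix k assume "k < dim_vec (0\<^sub>v n :: 'k vec)"
    then have k: "k < n" by simp
    then show "(form_mat n c *\<^sub>v vec n \<mu>) $ k = 0\<^sub>v n $ k"
      using \<mu>[OF k] by (simp add: form_mat_def scalar_prod_def form_index_def atLeast0LessThan)
  qed (simp add: form_mat_def)
  ultimately show False using d det_0_iff_vec_prod_zero[OF C] by (metis vec_carrier)
qed

text \<open>The discriminant has coefficients in the prime field, so algebraically independent
  coefficients cannot be a zero of it; its non-vanishing is also a Zariski-open condition.\<close>

lemma generic_nondegenerate:
  fixes Q :: "(nat \<times> nat \<Rightarrow> 'k::field_char_0) \<Rightarrow> bool"
  assumes Q: "\<And>c. det (form_mat n c) \<noteq> 0 \<Longrightarrow> Q c"
  shows "holds_generically (coeff_index n) Q"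
proof -
  have signs: "of_rat (signof \<pi>) = (signof \<pi> :: 'k)" for \<pi> :: "nat \<Rightarrow> nat" by (simp add: sign_def)
  have er: "poly_eval of_rat c (disc_poly n) = det (form_mat n c)" for c :: "nat \<times> nat \<Rightarrow> 'k"
    by (rule disc_poly_eval) (simp_all add: of_rat_add signs)
  have ek: "poly_eval id c (disc_poly n) = det (form_mat n c)" for c :: "nat \<times> nat \<Rightarrow> 'k"
    by (rule disc_poly_eval) simp_all
  have nz: "disc_poly n \<noteq> (0 :: _ \<Rightarrow>\<^sub>0 rat)"
  proof
    assume "disc_poly n = (0 :: _ \<Rightarrow>\<^sub>0 rat)"
    then have "poly_eval of_rat (unit_form n :: _ \<Rightarrow> 'k) (disc_poly n) = 0" by (simp add: poly_eval_def)
    then show False using er[of "unit_form n"] by (simp add: det_unit_form)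
  qed
  show ?thesis
    unfolding holds_generically_def
  proof (intro conjI ballI impI)
    fix c :: "nat \<times> nat \<Rightarrow> 'k" assume "alg_indep_over_rat (coeff_index n) c"
    then have "poly_eval of_rat c (disc_poly n) \<noteq> 0" using nz disc_poly_in unfolding alg_indep_over_rat_def by blast
    then show "Q c" unfolding er by (rule Q)
  next
    let ?U = "{c \<in> affine_space (coeff_index n). \<exists>P\<in>{disc_poly n :: _ \<Rightarrow>\<^sub>0 'k}. poly_eval id c P \<noteq> 0}"
    have "zariski_open (coeff_index n) ?U"
      unfolding zariski_open_def by (intro exI[of _ "{disc_poly n}"]) (simp add: disc_poly_in)
    moreover have "unit_form n \<in> ?U"
      by (simp add: ek det_unit_form) (simp add: unit_form_def affine_space_def)
    moreover have "\<forall>c\<in>?U. Q c" using Q by (simp add: ek)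
    ultimately show "\<exists>U. zariski_open (coeff_index n) U \<and> U \<noteq> {} \<and> (\<forall>c\<in>U. Q c)" by blast
  qed
qed

section \<open>Assembling the three series\<close>

context quadric begin

text \<open>This replaces log (1 + I) by - log (1 - (n z - z^2)), the logarithm that occurs in
  \<open>hcfree\<close>.\<close>

lemma lam_eq: "lam d = (\<Sum>g=1..d. 1 / of_nat g * fps_nth ((fps_const (of_nat n) * fps_X - fps_X\<^sup>2) ^ g) d)"
  unfolding lam_def card_KS
  by (rule log_coefficients[OF hilbI_eq]) (simp_all add: hilbI_def)

lemma hcfree_coefficient:
  "fps_nth (hcfree (of_nat n * zvar * yvar - zvar ^ 2)) q
    = Poly_Mapping.single (of_nat q) (of_int (\<Sum>i<q. (- 1) ^ i * int (coinv_dim i q)))"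
proof (cases "q = 0")
  case True
  then show ?thesis by (simp add: hcfree_nth_0)
next
  case False
  then show ?thesis using hcfree_nth[of q n] euler_formula[of q] unfolding lam_eq by simp
qed

lemma zvar_square_nth: "fps_nth (zvar ^ 2) q = Poly_Mapping.single 0 (if q = 2 then 1 else 0)"
  by (simp add: zvar_def)

lemma HC_series_0: "HC_has_series B 0 (zvar ^ 2 + hcfree (of_nat n * zvar * yvar - zvar ^ 2))"
  unfolding HC_has_series_def
proof (intro allI)
  fix q \<epsilon>
  let ?X = "zvar ^ 2 + hcfree (of_nat n * zvar * yvar - zvar ^ 2)"
  define \<chi> where "\<chi> = (\<Sum>i<q. (- 1) ^ i * int (coinv_dim i q))"
  have X: "fps_nth ?X q = Poly_Mapping.single (of_nat q) (of_int (\<chi> + (if q = 2 then 1 else 0)))"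
  proof -
    \<comment> \<open>The extra class has weight two, which is even, so it lies in the sign degree
      shared by all of weight \<open>q\<close>.\<close>
    have "Poly_Mapping.single (0::bit) (if q = 2 then 1 else 0 :: rat) = Poly_Mapping.single (of_nat q) (if q = 2 then 1 else 0)"
      by auto
    then show ?thesis unfolding fps_add_nth hcfree_coefficient zvar_square_nth \<chi>_def[symmetric]
      by (simp add: add.commute flip: single_add)
  qed
  show "\<exists>d. HC_component_has_dim B 0 q \<epsilon> d \<and> Poly_Mapping.lookup (fps_nth ?X q) \<epsilon> = of_nat d"
  proof (cases "\<epsilon> = of_nat q")
    case True
    have "\<exists>d. has_dim_modulo (BE 0 q) (ZE 0 q) d \<and> int d = \<chi> + (if q = 2 then 1 else 0)"
    proof (cases "q = 2")
      case True
      then show ?thesis using HC_zero_two unfolding \<chi>_def by (simp add: add.commute)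
    next
      case False
      then show ?thesis using HC_zero[of q] unfolding \<chi>_def by simp
    qed
    then obtain d where d: "has_dim_modulo (BE 0 q) (ZE 0 q) d" "int d = \<chi> + (if q = 2 then 1 else 0)" by blast
    have "HC_component_has_dim B 0 q \<epsilon> d" using HC_component_transfer[OF d(1)] True by simp
    moreover have "Poly_Mapping.lookup (fps_nth ?X q) \<epsilon> = of_nat d"
      unfolding X d(2)[symmetric] True by simp
    ultimately show ?thesis by blast
  next
    case False
    then have "HC_component_has_dim B 0 q \<epsilon> 0" by (intro HC_component_other_sign) simp
    moreover have "Poly_Mapping.lookup (fps_nth ?X q) \<epsilon> = of_nat 0" using False unfolding X by (simp add: lookup_single)
    ultimately show ?thesis by blast
  qed
qed

lemma HC_series_1: "HC_has_series B 1 (yvar * zvar ^ 2)"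
  unfolding HC_has_series_def
proof (intro allI)
  fix q \<epsilon>
  have X: "fps_nth (yvar * zvar ^ 2) q = (if q = 2 then Poly_Mapping.single 1 1 else 0)"
    by (simp add: yvar_def zvar_def)
  define d :: nat where "d = (if q = 2 then 1 else 0)"
  show "\<exists>d. HC_component_has_dim B 1 q \<epsilon> d \<and> Poly_Mapping.lookup (fps_nth (yvar * zvar ^ 2) q) \<epsilon> = of_nat d"
  proof (cases "\<epsilon> = of_nat (1 + q)")
    case True
    have "has_dim_modulo (BE 1 q) (ZE 1 q) d"
      using HC_one_two HC_higher[of q 0] by (simp add: d_def)
    then have "HC_component_has_dim B 1 q \<epsilon> d" using HC_component_transfer True by blast
    moreover have "Poly_Mapping.lookup (fps_nth (yvar * zvar ^ 2) q) \<epsilon> = of_nat d"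
      using True unfolding X by (simp add: d_def lookup_single)
    ultimately show ?thesis by blast
  next
    case False
    then have "HC_component_has_dim B 1 q \<epsilon> 0" by (rule HC_component_other_sign)
    moreover have "Poly_Mapping.lookup (fps_nth (yvar * zvar ^ 2) q) \<epsilon> = of_nat 0"
      using False unfolding X by (auto simp: lookup_single when_def)
    ultimately show ?thesis by blast
  qed
qed

lemma HC_series_higher:
  assumes "m > 1"
  shows "HC_has_series B m 0"
  unfolding HC_has_series_def
proof (intro allI)
  fix q \<epsilon>
  obtain m' where m: "m = Suc m'" "m' \<noteq> 0" using assms by (cases m) auto
  have "HC_component_has_dim B m q \<epsilon> 0"
  proof (cases "\<epsilon> = of_nat (m + q)")
    case True
    then show ?thesis using HC_component_transfer[OF HC_higher] m by blast
  next
    case False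
    then show ?thesis by (rule HC_component_other_sign)
  qed
  then show "\<exists>d. HC_component_has_dim B m q \<epsilon> d \<and> Poly_Mapping.lookup (fps_nth 0 q) \<epsilon> = of_nat d"
    by (intro exI[of _ 0]) simp
qed

end

theorem proposition4p2:
  fixes n :: nat
  assumes "n \<ge> 3"
  shows "holds_generically (coeff_index n) (\<lambda>c :: nat \<times> nat \<Rightarrow> 'k::field_char_0.
    HC_has_series (quadric_algebra n c) 0
      (zvar ^ 2 + hcfree (of_nat n * zvar * yvar - zvar ^ 2)) \<and>
    HC_has_series (quadric_algebra n c) 1 (yvar * zvar ^ 2) \<and>
    (\<forall>m>1. HC_has_series (quadric_algebra n c) m 0))"
proof (rule generic_nondegenerate)
  fix c :: "nat \<times> nat \<Rightarrow> 'k"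
  assume "det (form_mat n c) \<noteq> 0"
  then interpret quadric n c
    by unfold_locales (use assms nondegenerate_det[of n c] in auto)
  show "HC_has_series (quadric_algebra n c) 0
      (zvar ^ 2 + hcfree (of_nat n * zvar * yvar - zvar ^ 2)) \<and>
    HC_has_series (quadric_algebra n c) 1 (yvar * zvar ^ 2) \<and>
    (\<forall>m>1. HC_has_series (quadric_algebra n c) m 0)"
    using HC_series_0 HC_series_1 HC_series_higher by blast
qed

end
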